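(* Let $n\ge 1$, $G=C_n$, and let $a,b$ be positive divisors of $n$. There are isomorphisms of $\underline{\mathbb{Z}}_{C_n}$-modules: (1) for all $i$, $\underline{\mathrm{Ext}}^{3-i}(\underline{\mathbb{Z}}/I_a,I_b)\cong\underline{\mathrm{Tor}}_i(\underline{\mathbb{Z}}/I_a,I_b)$, and this module is isomorphic to $\underline{\mathbb{Z}}/I_{(a,b)}$ if $i=2$, to $I_{(a,b)}/I_a$ if $i=0$, and to $0$ otherwise; (2) $\underline{\mathrm{Tor}}_i(I_a,I_b)$ is isomorphic to $\underline{\mathbb{Z}}/I_{(a,b)}$ if $i=1$, to $I_{[a,b]}$ if $i=0$, and to $0$ otherwise. In particular, $\underline{\mathbb{Z}}/I_a\,\Box\, I_b\cong I_{(a,b)}/I_a$ and $I_a\,\Box\, I_b\cong I_{[a,b]}$.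
   Context: For a finite group $G$, let $\mathcal{B}\mathbb{Z}_G$ be the category whose objects are finite $G$-sets and with morphisms $\mathcal{B}\mathbb{Z}_G(S,T)=\mathrm{Hom}_{\mathbb{Z}[G]}(\mathbb{Z}\langle S\rangle,\mathbb{Z}\langle T\rangle)$. A $\underline{\mathbb{Z}}$-module is an additive functor $M\colon \mathcal{B}\mathbb{Z}_G^{op}\to \mathcal{A}b$ (equivalently, a module over the constant Mackey functor $\underline{\mathbb{Z}}=\underline{\mathbb{Z}}_G$ in $G$-Mackey functors). For a map of $G$-sets $f\colon S\to T$, $f^*\colon M(T)\to M(S)$ is induced by the linearization of $f$ and $f_*\colon M(S)\to M(T)$ is induced by the fiber-sum map $\mathbb{Z}\langle T\rangle\to\mathbb{Z}\langle S\rangle$, $y\mapsto\sum_{x\in f^{-1}(y)}x$; for quotient maps of orbits these are the restriction and transfer maps. $\underline{\mathbb{Z}}$ itself is $S\mapsto \mathrm{Hom}_{\mathbb{Z}[G]}(\mathbb{Z}\langle S\rangle,\mathbb{Z})$: its value at every orbit $G/H$ is $\mathbb{Z}$ with generator $1_{G/H}$, restrictions are identities, and the transfer for $K\le H$ is multiplication by $[H:K]$. Kernels, cokernels and exactness are computed objectwise. Submodules of $\underline{\mathbb{Z}}$ are called ideals. The free modules are $F_X=\mathcal{B}\mathbb{Z}_G(-,X)$. The box product $\Box$ is Day convolution with respect to Cartesian product of $G$-sets, with unit $\underline{\mathbb{Z}}$; the internal hom is $\underline{\mathrm{Hom}}(M,N)(X)=\mathrm{Hom}(F_X\Box M,N)$.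 $\underline{\mathrm{Tor}}_i$ and $\underline{\mathrm{Ext}}^i$ are the derived functors of $\Box$ and $\underline{\mathrm{Hom}}$ (again $\underline{\mathbb{Z}}$-modules). For $G=C_n$ and $d\mid n$, let $\mathcal{F}_d$ be the family of all subgroups of $C_n$ whose order divides $\frac{n}{d}$, and let $I_d\subseteq\underline{\mathbb{Z}}$ be the ideal generated by the elements $1_{G/H}\in\underline{\mathbb{Z}}(G/H)$ for $H\in\mathcal{F}_d$. If $d\mid e$ then $I_e\subseteq I_d$. $(a,b)$ denotes the gcd and $[a,b]$ the lcm. *)

theory Defs
  imports "HOL-Algebra.Free_Abelian_Groups" "HOL-Algebra.Group_Action" "HOL-Algebra.Left_Coset"
begin

section \<open>Finite \<open>G\<close>-sets and the category \<open>BZ\<^sub>G\<close>\<close>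

text \<open>
  A finite \<open>G\<close>-set is a pair (underlying set, action).  To have a type of objects, underlying sets
  are finite sets of natural numbers; every finite \<open>G\<close>-set is isomorphic to one of this kind.
\<close>

type_synonym 'g gset = "nat set \<times> ('g \<Rightarrow> nat \<Rightarrow> nat)"

abbreviation pts :: "'g gset \<Rightarrow> nat set" where "pts \<equiv> fst"
abbreviation act :: "'g gset \<Rightarrow> 'g \<Rightarrow> nat \<Rightarrow> nat" where "act \<equiv> snd"

definition finite_gset :: "'g monoid \<Rightarrow> 'g gset \<Rightarrow> bool" where
  "finite_gset G S \<longleftrightarrow> group_action G (pts S) (act S) \<and> finite (pts S)"

text \<open>Cartesian product with the diagonal action; \<open>prod_encode\<close> brings the pairs back into \<open>nat\<close>.\<close>

definition gset_prod :: "'g monoid \<Rightarrow> 'g gset \<Rightarrow> 'g gset \<Rightarrow> 'g gset" where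
  "gset_prod G S T =
     (prod_encode ` (pts S \<times> pts T),
      \<lambda>g. \<lambda>p \<in> prod_encode ` (pts S \<times> pts T).
        case prod_decode p of (s, t) \<Rightarrow> prod_encode (act S g s, act T g t))"

definition is_orbit :: "'g monoid \<Rightarrow> 'g set \<Rightarrow> 'g gset \<Rightarrow> bool" where
  "is_orbit G H T \<longleftrightarrow> finite_gset G T \<and>
     (\<exists>f. bij_betw f (pts T) (lcosets\<^bsub>G\<^esub> H) \<and>
        (\<forall>g \<in> carrier G. \<forall>t \<in> pts T. f (act T g t) = g <#\<^bsub>G\<^esub> f t))"

text \<open>
  A \<open>\<int>[G]\<close>-linear map \<open>\<phi> : \<int>\<langle>S\<rangle> \<rightarrow> \<int>\<langle>T\<rangle>\<close> is written as its matrix: \<open>\<phi> s t\<close> is the coefficient of the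
  basis element \<open>t\<close> in the image of the basis element \<open>s\<close>.  Entries outside \<open>S \<times> T\<close> are \<open>0\<close>, so that
  equality of matrices is equality of linear maps; \<open>G\<close>-linearity is invariance of the matrix under
  the diagonal action.
\<close>

type_synonym mat = "nat \<Rightarrow> nat \<Rightarrow> int"

definition bz_hom :: "'g monoid \<Rightarrow> 'g gset \<Rightarrow> 'g gset \<Rightarrow> mat set" where
  "bz_hom G S T = {\<phi>. (\<forall>s t. \<not> (s \<in> pts S \<and> t \<in> pts T) \<longrightarrow> \<phi> s t = 0) \<and>
     (\<forall>g \<in> carrier G. \<forall>s \<in> pts S. \<forall>t \<in> pts T. \<phi> (act S g s) (act T g t) = \<phi> s t)}"

definition bz_add :: "mat \<Rightarrow> mat \<Rightarrow> mat" where
  "bz_add \<phi> \<psi> = (\<lambda>s t. \<phi> s t + \<psi> s t)"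

definition bz_zero :: mat where
  "bz_zero = (\<lambda>s t. 0)"

definition bz_id :: "'g gset \<Rightarrow> mat" where
  "bz_id S = (\<lambda>s t. if s = t \<and> s \<in> pts S then 1 else 0)"

text \<open>\<open>bz_comp T \<psi> \<phi>\<close> is \<open>\<psi> \<circ> \<phi>\<close> for \<open>\<phi> : \<int>\<langle>S\<rangle> \<rightarrow> \<int>\<langle>T\<rangle>\<close> and \<open>\<psi> : \<int>\<langle>T\<rangle> \<rightarrow> \<int>\<langle>U\<rangle>\<close>.\<close>

definition bz_comp :: "'g gset \<Rightarrow> mat \<Rightarrow> mat \<Rightarrow> mat" where
  "bz_comp T \<psi> \<phi> = (\<lambda>s u. \<Sum>t \<in> pts T. \<phi> s t * \<psi> t u)"

text \<open>
  The additive extension of the Cartesian product to morphisms, i.e. the tensor product of linear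
  maps under \<open>\<int>\<langle>S \<times> T\<rangle> = \<int>\<langle>S\<rangle> \<otimes> \<int>\<langle>T\<rangle>\<close>.
\<close>

definition bz_prod :: "'g gset \<Rightarrow> 'g gset \<Rightarrow> 'g gset \<Rightarrow> 'g gset \<Rightarrow> mat \<Rightarrow> mat \<Rightarrow> mat" where
  "bz_prod S T S' T' \<phi> \<psi> = (\<lambda>p q.
     if p \<in> prod_encode ` (pts S \<times> pts T) \<and> q \<in> prod_encode ` (pts S' \<times> pts T')
     then \<phi> (fst (prod_decode p)) (fst (prod_decode q)) * \<psi> (snd (prod_decode p)) (snd (prod_decode q))
     else 0)"

section \<open>Modules over the constant Mackey functor\<close>

text \<open>
  Abelian groups are multiplicatively written \<open>comm_group\<close>s.
  \<open>zmor M S T \<phi> : M(T) \<rightarrow> M(S)\<close> is the value of the contravariant functor at \<open>\<phi> : \<int>\<langle>S\<rangle> \<rightarrow> \<int>\<langle>T\<rangle>\<close>.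
  Only values at finite \<open>G\<close>-sets, and of maps only on carriers, matter.
\<close>

record ('g, 'm) zmod =
  zobj :: "'g gset \<Rightarrow> 'm monoid"
  zmor :: "'g gset \<Rightarrow> 'g gset \<Rightarrow> mat \<Rightarrow> 'm \<Rightarrow> 'm"

definition zmodule :: "'g monoid \<Rightarrow> ('g, 'm) zmod \<Rightarrow> bool" where
  "zmodule G M \<longleftrightarrow>
     (\<forall>S. finite_gset G S \<longrightarrow> comm_group (zobj M S)) \<and>
     (\<forall>S T. finite_gset G S \<longrightarrow> finite_gset G T \<longrightarrow>
        (\<forall>\<phi> \<in> bz_hom G S T. zmor M S T \<phi> \<in> hom (zobj M T) (zobj M S))) \<and>
     (\<forall>S. finite_gset G S \<longrightarrow> (\<forall>x \<in> carrier (zobj M S). zmor M S S (bz_id S) x = x)) \<and>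
     (\<forall>S T U. finite_gset G S \<longrightarrow> finite_gset G T \<longrightarrow> finite_gset G U \<longrightarrow>
        (\<forall>\<phi> \<in> bz_hom G S T. \<forall>\<psi> \<in> bz_hom G T U. \<forall>x \<in> carrier (zobj M U).
           zmor M S U (bz_comp T \<psi> \<phi>) x = zmor M S T \<phi> (zmor M T U \<psi> x))) \<and>
     (\<forall>S T. finite_gset G S \<longrightarrow> finite_gset G T \<longrightarrow>
        (\<forall>\<phi> \<in> bz_hom G S T. \<forall>\<psi> \<in> bz_hom G S T. \<forall>x \<in> carrier (zobj M T).
           zmor M S T (bz_add \<phi> \<psi>) x = zmor M S T \<phi> x \<otimes>\<^bsub>zobj M S\<^esub> zmor M S T \<psi> x))"

type_synonym ('g, 'm, 'n) zmap = "'g gset \<Rightarrow> 'm \<Rightarrow> 'n"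

definition zmod_hom :: "'g monoid \<Rightarrow> ('g, 'm) zmod \<Rightarrow> ('g, 'n) zmod \<Rightarrow> ('g, 'm, 'n) zmap \<Rightarrow> bool" where
  "zmod_hom G M N \<eta> \<longleftrightarrow>
     (\<forall>S. finite_gset G S \<longrightarrow> \<eta> S \<in> hom (zobj M S) (zobj N S)) \<and>
     (\<forall>S T. finite_gset G S \<longrightarrow> finite_gset G T \<longrightarrow>
        (\<forall>\<phi> \<in> bz_hom G S T. \<forall>x \<in> carrier (zobj M T).
           \<eta> S (zmor M S T \<phi> x) = zmor N S T \<phi> (\<eta> T x)))"

definition zmod_iso :: "'g monoid \<Rightarrow> ('g, 'm) zmod \<Rightarrow> ('g, 'n) zmod \<Rightarrow> bool" where
  "zmod_iso G M N \<longleftrightarrow> zmodule G M \<and> zmodule G N \<and>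
     (\<exists>\<eta>. zmod_hom G M N \<eta> \<and>
        (\<forall>S. finite_gset G S \<longrightarrow> bij_betw (\<eta> S) (carrier (zobj M S)) (carrier (zobj N S))))"

definition zmod_zero :: "('g, 'm) zmod" where
  "zmod_zero = \<lparr>zobj = \<lambda>S. singleton_group undefined, zmor = \<lambda>S T \<phi> x. undefined\<rparr>"

subsection \<open>Submodules, quotients, homology\<close>

definition submodule_family :: "'g monoid \<Rightarrow> ('g, 'm) zmod \<Rightarrow> ('g gset \<Rightarrow> 'm set) \<Rightarrow> bool" where
  "submodule_family G M J \<longleftrightarrow>
     (\<forall>S. finite_gset G S \<longrightarrow> subgroup (J S) (zobj M S)) \<and>
     (\<forall>S T. finite_gset G S \<longrightarrow> finite_gset G T \<longrightarrow>
        (\<forall>\<phi> \<in> bz_hom G S T. \<forall>x \<in> J T. zmor M S T \<phi> x \<in> J S))"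

definition submod :: "('g, 'm) zmod \<Rightarrow> ('g gset \<Rightarrow> 'm set) \<Rightarrow> ('g, 'm) zmod" where
  "submod M J = \<lparr>zobj = \<lambda>S. (zobj M S)\<lparr>carrier := J S\<rparr>, zmor = zmor M\<rparr>"

text \<open>
  The map on cosets induced by \<open>f\<close>, with values in \<open>H Mod N\<close>.  If \<open>f\<close> maps the subgroup of the
  source into \<open>N\<close>, the union is the coset of \<open>f c\<close> for any \<open>c \<in> C\<close>.
\<close>

definition coset_map :: "'b monoid \<Rightarrow> 'b set \<Rightarrow> ('a \<Rightarrow> 'b) \<Rightarrow> 'a set \<Rightarrow> 'b set" where
  "coset_map H N f C = (\<Union>c \<in> C. N #>\<^bsub>H\<^esub> f c)"

definition quot :: "('g, 'm) zmod \<Rightarrow> ('g gset \<Rightarrow> 'm set) \<Rightarrow> ('g, 'm set) zmod" where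
  "quot M J = \<lparr>zobj = \<lambda>S. zobj M S Mod J S,
               zmor = \<lambda>S T \<phi>. coset_map (zobj M S) (J S) (zmor M S T \<phi>)\<rparr>"

definition zker :: "('g, 'm) zmod \<Rightarrow> ('g, 'n) zmod \<Rightarrow> ('g, 'm, 'n) zmap \<Rightarrow> 'g gset \<Rightarrow> 'm set" where
  "zker M N \<eta> S = kernel (zobj M S) (zobj N S) (\<eta> S)"

definition zimg :: "('g, 'm) zmod \<Rightarrow> ('g, 'm, 'n) zmap \<Rightarrow> 'g gset \<Rightarrow> 'n set" where
  "zimg M \<eta> S = \<eta> S ` carrier (zobj M S)"

text \<open>Homology at \<open>B\<close> of \<open>A \<rightarrow> B \<rightarrow> C\<close>.\<close>

definition homology ::
  "('g, 'a) zmod \<Rightarrow> ('g, 'b) zmod \<Rightarrow> ('g, 'c) zmod \<Rightarrow> ('g, 'a, 'b) zmap \<Rightarrow> ('g, 'b, 'c) zmap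
    \<Rightarrow> ('g, 'b set) zmod" where
  "homology A B C f h = quot (submod B (zker B C h)) (zimg A f)"

subsection \<open>The constant module and the free modules\<close>

text \<open>An element of \<open>Hom\<^bsub>\<int>[G]\<^esub>(\<int>\<langle>S\<rangle>, \<int>)\<close> is given by its values on the basis \<open>S\<close>.\<close>

definition Zconst :: "'g monoid \<Rightarrow> ('g, nat \<Rightarrow> int) zmod" where
  "Zconst G =
     \<lparr>zobj = \<lambda>S. \<lparr>carrier = {u. (\<forall>s. s \<notin> pts S \<longrightarrow> u s = 0) \<and>
                            (\<forall>g \<in> carrier G. \<forall>s \<in> pts S. u (act S g s) = u s)},
                  monoid.mult = \<lambda>u v s. u s + v s, one = \<lambda>s. 0\<rparr>,
      zmor = \<lambda>S T \<phi> u s. \<Sum>t \<in> pts T. \<phi> s t * u t\<rparr>"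

definition Zgen :: "'g gset \<Rightarrow> nat \<Rightarrow> int" where
  "Zgen T = (\<lambda>t. if t \<in> pts T then 1 else 0)"

text \<open>The free module \<open>F\<^sub>X = BZ\<^sub>G(-, X)\<close> and its functoriality in \<open>X\<close>.\<close>

definition rep :: "'g monoid \<Rightarrow> 'g gset \<Rightarrow> ('g, mat) zmod" where
  "rep G X =
     \<lparr>zobj = \<lambda>S. \<lparr>carrier = bz_hom G S X, monoid.mult = bz_add, one = bz_zero\<rparr>,
      zmor = \<lambda>S T \<phi> \<psi>. bz_comp T \<psi> \<phi>\<rparr>"

definition rep_map :: "'g gset \<Rightarrow> mat \<Rightarrow> ('g, mat, mat) zmap" where
  "rep_map X \<theta> = (\<lambda>U \<psi>. bz_comp X \<theta> \<psi>)"

text \<open>The direct sum of the \<open>F\<^bsub>X j\<^esub>\<close> for \<open>j \<in> J\<close>.\<close>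

definition free_mod :: "'g monoid \<Rightarrow> 'j set \<Rightarrow> ('j \<Rightarrow> 'g gset) \<Rightarrow> ('g, 'j \<Rightarrow> mat) zmod" where
  "free_mod G J X =
     \<lparr>zobj = \<lambda>S. \<lparr>carrier = {u. (\<forall>j \<in> J. u j \<in> bz_hom G S (X j)) \<and>
                            (\<forall>j. j \<notin> J \<longrightarrow> u j = bz_zero) \<and> finite {j. u j \<noteq> bz_zero}},
                  monoid.mult = \<lambda>u v j. bz_add (u j) (v j), one = \<lambda>j. bz_zero\<rparr>,
      zmor = \<lambda>S T \<phi> u j. bz_comp T (u j) \<phi>\<rparr>"

section \<open>Box product and internal hom\<close>

text \<open>
  Day convolution is the coend \<open>\<integral>\<^sup>X\<^sup>,\<^sup>Y BZ\<^sub>G(S, X \<times> Y) \<otimes> M(X) \<otimes> N(Y)\<close>.  It is presented as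
  the free abelian group on the tuples \<open>(X, Y, \<phi>, m, n)\<close> modulo additivity in each of \<open>\<phi>\<close>, \<open>m\<close>, \<open>n\<close>
  and the coend relation for morphisms \<open>f : \<int>\<langle>X\<rangle> \<rightarrow> \<int>\<langle>X'\<rangle>\<close> and \<open>h : \<int>\<langle>Y\<rangle> \<rightarrow> \<int>\<langle>Y'\<rangle>\<close>.
\<close>

type_synonym ('g, 'm, 'n) boxgen = "'g gset \<times> 'g gset \<times> mat \<times> 'm \<times> 'n"

definition box_gens ::
  "'g monoid \<Rightarrow> ('g, 'm) zmod \<Rightarrow> ('g, 'n) zmod \<Rightarrow> 'g gset \<Rightarrow> ('g, 'm, 'n) boxgen set" where
  "box_gens G M N S = {(X, Y, \<phi>, m, n). finite_gset G X \<and> finite_gset G Y \<and>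
     \<phi> \<in> bz_hom G S (gset_prod G X Y) \<and> m \<in> carrier (zobj M X) \<and> n \<in> carrier (zobj N Y)}"

definition box_pre ::
  "'g monoid \<Rightarrow> ('g, 'm) zmod \<Rightarrow> ('g, 'n) zmod \<Rightarrow> ('g, ('g, 'm, 'n) boxgen \<Rightarrow>\<^sub>0 int) zmod" where
  "box_pre G M N =
     \<lparr>zobj = \<lambda>S. free_Abelian_group (box_gens G M N S),
      zmor = \<lambda>S T \<theta>. frag_extend (\<lambda>(X, Y, \<phi>, m, n). frag_of (X, Y, bz_comp T \<phi> \<theta>, m, n))\<rparr>"

definition box_rels ::
  "'g monoid \<Rightarrow> ('g, 'm) zmod \<Rightarrow> ('g, 'n) zmod \<Rightarrow> 'g gset \<Rightarrow> (('g, 'm, 'n) boxgen \<Rightarrow>\<^sub>0 int) set" where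
  "box_rels G M N S =
     {frag_of (X, Y, bz_add \<phi> \<psi>, m, n) - frag_of (X, Y, \<phi>, m, n) - frag_of (X, Y, \<psi>, m, n)
       | X Y \<phi> \<psi> m n. finite_gset G X \<and> finite_gset G Y \<and>
          \<phi> \<in> bz_hom G S (gset_prod G X Y) \<and> \<psi> \<in> bz_hom G S (gset_prod G X Y) \<and>
          m \<in> carrier (zobj M X) \<and> n \<in> carrier (zobj N Y)} \<union>
     {frag_of (X, Y, \<phi>, m \<otimes>\<^bsub>zobj M X\<^esub> m', n) - frag_of (X, Y, \<phi>, m, n) - frag_of (X, Y, \<phi>, m', n)
       | X Y \<phi> m m' n. finite_gset G X \<and> finite_gset G Y \<and>
          \<phi> \<in> bz_hom G S (gset_prod G X Y) \<and>
          m \<in> carrier (zobj M X) \<and> m' \<in> carrier (zobj M X) \<and> n \<in> carrier (zobj N Y)} \<union>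
     {frag_of (X, Y, \<phi>, m, n \<otimes>\<^bsub>zobj N Y\<^esub> n') - frag_of (X, Y, \<phi>, m, n) - frag_of (X, Y, \<phi>, m, n')
       | X Y \<phi> m n n'. finite_gset G X \<and> finite_gset G Y \<and>
          \<phi> \<in> bz_hom G S (gset_prod G X Y) \<and>
          m \<in> carrier (zobj M X) \<and> n \<in> carrier (zobj N Y) \<and> n' \<in> carrier (zobj N Y)} \<union>
     {frag_of (X', Y', bz_comp (gset_prod G X Y) (bz_prod X Y X' Y' f h) \<phi>, m, n)
        - frag_of (X, Y, \<phi>, zmor M X X' f m, zmor N Y Y' h n)
       | X Y X' Y' f h \<phi> m n. finite_gset G X \<and> finite_gset G Y \<and>
          finite_gset G X' \<and> finite_gset G Y' \<and>
          f \<in> bz_hom G X X' \<and> h \<in> bz_hom G Y Y' \<and> \<phi> \<in> bz_hom G S (gset_prod G X Y) \<and>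
          m \<in> carrier (zobj M X') \<and> n \<in> carrier (zobj N Y')}"

definition box_ker ::
  "'g monoid \<Rightarrow> ('g, 'm) zmod \<Rightarrow> ('g, 'n) zmod \<Rightarrow> 'g gset \<Rightarrow> (('g, 'm, 'n) boxgen \<Rightarrow>\<^sub>0 int) set" where
  "box_ker G M N S = generate (zobj (box_pre G M N) S) (box_rels G M N S)"

definition box ::
  "'g monoid \<Rightarrow> ('g, 'm) zmod \<Rightarrow> ('g, 'n) zmod \<Rightarrow> ('g, (('g, 'm, 'n) boxgen \<Rightarrow>\<^sub>0 int) set) zmod" where
  "box G M N = quot (box_pre G M N) (box_ker G M N)"

text \<open>\<open>box_map G M' N f\<close> is \<open>f \<box> N : M \<box> N \<rightarrow> M' \<box> N\<close> for \<open>f : M \<rightarrow> M'\<close>.\<close>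

definition box_map ::
  "'g monoid \<Rightarrow> ('g, 'b) zmod \<Rightarrow> ('g, 'n) zmod \<Rightarrow> ('g, 'm, 'b) zmap
    \<Rightarrow> ('g, (('g, 'm, 'n) boxgen \<Rightarrow>\<^sub>0 int) set, (('g, 'b, 'n) boxgen \<Rightarrow>\<^sub>0 int) set) zmap" where
  "box_map G M' N f = (\<lambda>S. coset_map (zobj (box_pre G M' N) S) (box_ker G M' N S)
     (frag_extend (\<lambda>(X, Y, \<phi>, m, n). frag_of (X, Y, \<phi>, f X m, n))))"

text \<open>\<open>box_map' G M N' f\<close> is \<open>M \<box> f : M \<box> N \<rightarrow> M \<box> N'\<close> for \<open>f : N \<rightarrow> N'\<close>.\<close>

definition box_map' ::
  "'g monoid \<Rightarrow> ('g, 'm) zmod \<Rightarrow> ('g, 'b) zmod \<Rightarrow> ('g, 'n, 'b) zmap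
    \<Rightarrow> ('g, (('g, 'm, 'n) boxgen \<Rightarrow>\<^sub>0 int) set, (('g, 'm, 'b) boxgen \<Rightarrow>\<^sub>0 int) set) zmap" where
  "box_map' G M N' f = (\<lambda>S. coset_map (zobj (box_pre G M N') S) (box_ker G M N' S)
     (frag_extend (\<lambda>(X, Y, \<phi>, m, n). frag_of (X, Y, \<phi>, m, f Y n))))"

text \<open>
  The abelian group \<open>Hom(M, N)\<close>.  Natural transformations are made extensional, so that equality in
  the carrier is equality on all \<open>M(S)\<close>.
\<close>

definition hom_group :: "'g monoid \<Rightarrow> ('g, 'm) zmod \<Rightarrow> ('g, 'n) zmod \<Rightarrow> ('g, 'm, 'n) zmap monoid" where
  "hom_group G M N =
     \<lparr>carrier = {\<eta> \<in> (\<Pi>\<^sub>E S \<in> Collect (finite_gset G). carrier (zobj M S) \<rightarrow>\<^sub>E carrier (zobj N S)).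
                   zmod_hom G M N \<eta>},
      monoid.mult = \<lambda>\<eta> \<theta>. \<lambda>S \<in> Collect (finite_gset G). \<lambda>x \<in> carrier (zobj M S).
                      \<eta> S x \<otimes>\<^bsub>zobj N S\<^esub> \<theta> S x,
      one = \<lambda>S \<in> Collect (finite_gset G). \<lambda>x \<in> carrier (zobj M S). \<one>\<^bsub>zobj N S\<^esub>\<rparr>"

text \<open>Precomposition \<open>Hom(M', N) \<rightarrow> Hom(M, N)\<close> with \<open>f : M \<rightarrow> M'\<close>.\<close>

definition precomp ::
  "'g monoid \<Rightarrow> ('g, 'm) zmod \<Rightarrow> ('g, 'm, 'b) zmap \<Rightarrow> ('g, 'b, 'n) zmap \<Rightarrow> ('g, 'm, 'n) zmap" where
  "precomp G M f \<eta> = (\<lambda>S \<in> Collect (finite_gset G). \<lambda>x \<in> carrier (zobj M S). \<eta> S (f S x))"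

text \<open>The internal hom \<open>X \<mapsto> Hom(F\<^sub>X \<box> M, N)\<close>.\<close>

type_synonym ('g, 'm, 'n) ihom_el = "('g, (('g, mat, 'm) boxgen \<Rightarrow>\<^sub>0 int) set, 'n) zmap"

definition ihom ::
  "'g monoid \<Rightarrow> ('g, 'm) zmod \<Rightarrow> ('g, 'n) zmod \<Rightarrow> ('g, ('g, 'm, 'n) ihom_el) zmod" where
  "ihom G M N =
     \<lparr>zobj = \<lambda>X. hom_group G (box G (rep G X) M) N,
      zmor = \<lambda>X Y \<theta>. precomp G (box G (rep G X) M) (box_map G (rep G Y) M (rep_map X \<theta>))\<rparr>"

text \<open>\<open>ihom_map G M M' f : ihom(M', N) \<rightarrow> ihom(M, N)\<close> for \<open>f : M \<rightarrow> M'\<close>.\<close>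

definition ihom_map ::
  "'g monoid \<Rightarrow> ('g, 'm) zmod \<Rightarrow> ('g, 'b) zmod \<Rightarrow> ('g, 'm, 'b) zmap
    \<Rightarrow> ('g, ('g, 'b, 'n) ihom_el, ('g, 'm, 'n) ihom_el) zmap" where
  "ihom_map G M M' f = (\<lambda>X. precomp G (box G (rep G X) M) (box_map' G (rep G X) M' f))"

section \<open>Derived functors\<close>

text \<open>
  A resolution of \<open>M\<close> is \<open>\<dots> \<rightarrow> P 2 \<rightarrow> P 1 \<rightarrow> P 0 \<rightarrow> M \<rightarrow> 0\<close>, extended by \<open>P i = 0\<close> for \<open>i < 0\<close>, where
  \<open>d i : P i \<rightarrow> P (i - 1)\<close>.  The summands are indexed by subsets of \<open>'m list\<close>: this type is infinite
  and at least as large as \<open>'m\<close>, and there are only finitely many transitive \<open>G\<close>-sets up to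
  isomorphism, so every module with values in \<open>'m\<close> has such a resolution when \<open>G\<close> is finite.
\<close>

type_synonym ('g, 'm) resolution =
  "(int \<Rightarrow> ('g, 'm list \<Rightarrow> mat) zmod) \<times> (int \<Rightarrow> ('g, 'm list \<Rightarrow> mat, 'm list \<Rightarrow> mat) zmap)
    \<times> ('g, 'm list \<Rightarrow> mat, 'm) zmap"

definition free_resolution :: "'g monoid \<Rightarrow> ('g, 'm) zmod \<Rightarrow> ('g, 'm) resolution \<Rightarrow> bool" where
  "free_resolution G M = (\<lambda>(P, d, e).
     (\<forall>i. \<exists>J X. (\<forall>j \<in> J. finite_gset G (X j)) \<and> P i = free_mod G J X) \<and>
     (\<forall>i < 0. \<forall>S. finite_gset G S \<longrightarrow> trivial_group (zobj (P i) S)) \<and>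
     (\<forall>i. zmod_hom G (P i) (P (i - 1)) (d i)) \<and>
     zmod_hom G (P 0) M e \<and>
     (\<forall>S. finite_gset G S \<longrightarrow>
        zimg (P 0) e S = carrier (zobj M S) \<and>
        zimg (P 1) (d 1) S = zker (P 0) M e S \<and>
        (\<forall>i \<ge> 1. zimg (P (i + 1)) (d (i + 1)) S = zker (P i) (P (i - 1)) (d i) S)))"

definition the_resolution :: "'g monoid \<Rightarrow> ('g, 'm) zmod \<Rightarrow> ('g, 'm) resolution" where
  "the_resolution G M = (SOME r. free_resolution G M r)"

text \<open>
  \<open>Tor\<^sub>i(M, N) = H\<^sub>i(P \<box> N)\<close> and \<open>Ext\<^sup>i(M, N) = H\<^sup>i(ihom(P, N))\<close> for a free resolution \<open>P\<close> of \<open>M\<close>,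
  for all integers \<open>i\<close>.
\<close>

definition Tor ::
  "'g monoid \<Rightarrow> int \<Rightarrow> ('g, 'm) zmod \<Rightarrow> ('g, 'n) zmod
    \<Rightarrow> ('g, (('g, 'm list \<Rightarrow> mat, 'n) boxgen \<Rightarrow>\<^sub>0 int) set set) zmod" where
  "Tor G i M N = (case the_resolution G M of (P, d, e) \<Rightarrow>
     homology (box G (P (i + 1)) N) (box G (P i) N) (box G (P (i - 1)) N)
       (box_map G (P i) N (d (i + 1)))
       (box_map G (P (i - 1)) N (d i)))"

definition Ext ::
  "'g monoid \<Rightarrow> int \<Rightarrow> ('g, 'm) zmod \<Rightarrow> ('g, 'n) zmod
    \<Rightarrow> ('g, ('g, 'm list \<Rightarrow> mat, 'n) ihom_el set) zmod" where
  "Ext G i M N = (case the_resolution G M of (P, d, e) \<Rightarrow>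
     homology (ihom G (P (i - 1)) N) (ihom G (P i) N) (ihom G (P (i + 1)) N)
       (ihom_map G (P i) (P (i - 1)) (d i))
       (ihom_map G (P (i + 1)) (P i) (d (i + 1))))"

section \<open>The ideals \<open>I\<^sub>d\<close> for cyclic groups\<close>

abbreviation Cyc :: "nat \<Rightarrow> int monoid" where
  "Cyc n \<equiv> integer_mod_group n"

definition Fam :: "nat \<Rightarrow> nat \<Rightarrow> int set set" where
  "Fam n d = {H. subgroup H (Cyc n) \<and> card H dvd n div d}"

definition ideal_fam :: "nat \<Rightarrow> nat \<Rightarrow> int gset \<Rightarrow> (nat \<Rightarrow> int) set" where
  "ideal_fam n d S = \<Inter> {J S | J. submodule_family (Cyc n) (Zconst (Cyc n)) J \<and>
     (\<forall>H \<in> Fam n d. \<forall>T. is_orbit (Cyc n) H T \<longrightarrow> Zgen T \<in> J T)}"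

definition Imod :: "nat \<Rightarrow> nat \<Rightarrow> (int, nat \<Rightarrow> int) zmod" where
  "Imod n d = submod (Zconst (Cyc n)) (ideal_fam n d)"

definition ZmodI :: "nat \<Rightarrow> nat \<Rightarrow> (int, (nat \<Rightarrow> int) set) zmod" where
  "ZmodI n d = quot (Zconst (Cyc n)) (ideal_fam n d)"

text \<open>\<open>I\<^sub>d / I\<^sub>e\<close> for \<open>d dvd e\<close>.\<close>

definition ImodI :: "nat \<Rightarrow> nat \<Rightarrow> nat \<Rightarrow> (int, (nat \<Rightarrow> int) set) zmod" where
  "ImodI n d e = quot (Imod n d) (ideal_fam n e)"

end

theory Submission
  imports Defs
begin

text \<open>
  The homology of \<open>P \<box> N\<close> and of \<open>Hom(P, N)\<close> does not depend on the free resolution \<open>P\<close>, and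
  \<open>F\<^sub>X \<box> N\<close> and \<open>Hom(F\<^sub>X, N)\<close> are both the shifted module \<open>N(X \<times> -)\<close>, because \<open>\<int>\<langle>X\<rangle>\<close> is self-dual.
  For \<open>X = \<int>/a\<close> the module \<open>\<int>/I\<^sub>a\<close> has the resolution \<open>0 \<rightarrow> F\<^sub>1 \<rightarrow> F\<^sub>X \<rightarrow> F\<^sub>X \<rightarrow> F\<^sub>1\<close> by norm, \<open>1 - \<sigma>\<close> and
  augmentation, and dropping the last term resolves \<open>I\<^sub>a\<close>.  Dualizing reverses the first complex and
  replaces the generator \<open>\<sigma>\<close> by its inverse, which is where the duality between Ext and Tor comes from.

  What remains is the homology of \<open>N \<rightarrow> N(X \<times> -) \<rightarrow> N(X \<times> -) \<rightarrow> N\<close> for \<open>N = I\<^sub>b\<close>.  An invariant function \<open>u\<close>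
  on a \<open>G\<close>-set lies in \<open>I\<^sub>d\<close> iff \<open>d\<close> divides \<open>l(s) u(s)\<close> for every point \<open>s\<close>, where \<open>l(s)\<close> is the length of the
  orbit of \<open>s\<close>.  So the complex is exact where trace meets difference, the trace has image \<open>I\<^bsub>[a,b]\<^esub>\<close>, the
  cokernel \<open>I\<^sub>b / I\<^bsub>[a,b]\<^esub>\<close> is \<open>I\<^bsub>(a,b)\<^esub> / I\<^sub>a\<close> since \<open>I\<^sub>a + I\<^sub>b = I\<^bsub>(a,b)\<^esub>\<close>, and multiplication by \<open>b / (a,b)\<close>
  identifies \<open>\<int>/I\<^bsub>(a,b)\<^esub>\<close> with the invariants modulo those pulled back from \<open>N\<close>.
\<close>

text \<open>\<open>Tor\<close> and \<open>Ext\<close> start from a resolution picked by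
  \<open>SOME\<close>, so nothing can be computed before the comparison theorem. One explicit
  resolution then does two jobs: it shows that the picked object is a resolution at all, and it
  evaluates the result. The box product is a quotient of a free abelian group, so its right
  exactness, which identifies degree 0, has to be proved from the presentation. Modules live on all
  finite G-sets, and a matrix may mix orbits. Hence ideals are described pointwise through orbit
  lengths, and every auxiliary function must be chosen in terms of invariant data, or it would not
  be invariant itself. The number b/(a,b) comes from the one-point set: a constant c on Z/a lies in
  I_b there iff b divides a c, that is, iff b/(a,b) divides c. Over an orbit of length l the
  condition is b | lcm(a,l) c, which admits more values of c; the surplus is accounted for by
  functions pulled back from I_b, and Bezout provides the decomposition.\<close>

abbreviation el :: "('g, 'm) zmod \<Rightarrow> 'g gset \<Rightarrow> 'm set" where
  "el M S \<equiv> carrier (zobj M S)"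

abbreviation gset :: "'g monoid \<Rightarrow> 'g gset \<Rightarrow> bool" where
  "gset \<equiv> finite_gset"

section \<open>Finite G-sets and integer matrices\<close>

text \<open>\<open>G\<close>-sets are pairs, and the simplifier would split quantifiers over them.\<close>

declare split_paired_All [simp del] split_paired_Ex [simp del]

lemma finite_gset_group: "gset G S \<Longrightarrow> group G"
  by (auto simp: finite_gset_def group_action_def group_hom_def)

lemma finite_gset_finite: "gset G S \<Longrightarrow> finite (pts S)"
  by (auto simp: finite_gset_def)

lemma act_closed: "gset G S \<Longrightarrow> g \<in> carrier G \<Longrightarrow> s \<in> pts S \<Longrightarrow> act S g s \<in> pts S"
  unfolding finite_gset_def by (meson group_action.element_image)

lemma act_one: "gset G S \<Longrightarrow> s \<in> pts S \<Longrightarrow> act S \<one>\<^bsub>G\<^esub> s = s"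
  unfolding finite_gset_def by (metis group_action.id_eq_one restrict_apply')

lemma act_mult:
  "gset G S \<Longrightarrow> g \<in> carrier G \<Longrightarrow> h \<in> carrier G \<Longrightarrow> s \<in> pts S
    \<Longrightarrow> act S (g \<otimes>\<^bsub>G\<^esub> h) s = act S g (act S h s)"
  unfolding finite_gset_def by (metis group_action.composition_rule)

lemma act_bij: "gset G S \<Longrightarrow> g \<in> carrier G \<Longrightarrow> bij_betw (act S g) (pts S) (pts S)"
  unfolding finite_gset_def bij_betw_def
  by (metis group_action.inj_prop group_action.surj_prop)

text \<open>Asks only for the elementwise action laws: that each group element acts by a bijection
  follows by letting its inverse act.\<close>

lemma finite_gsetI:
  assumes "group G" "finite (pts S)"
    and ext: "\<And>g. g \<in> carrier G \<Longrightarrow> act S g \<in> extensional (pts S)"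
    and closed: "\<And>g s. g \<in> carrier G \<Longrightarrow> s \<in> pts S \<Longrightarrow> act S g s \<in> pts S"
    and one: "\<And>s. s \<in> pts S \<Longrightarrow> act S \<one>\<^bsub>G\<^esub> s = s"
    and mult: "\<And>g h s. g \<in> carrier G \<Longrightarrow> h \<in> carrier G \<Longrightarrow> s \<in> pts S
      \<Longrightarrow> act S (g \<otimes>\<^bsub>G\<^esub> h) s = act S g (act S h s)"
  shows "gset G S"
proof -
  interpret G: group G by fact
  have bij: "act S g \<in> Bij (pts S)" if "g \<in> carrier G" for g
  proof -
    have "bij_betw (act S g) (pts S) (pts S)"
      by (rule bij_betwI[where g="act S (inv\<^bsub>G\<^esub> g)"])
        (use that closed mult[of "inv\<^bsub>G\<^esub> g" g, symmetric] mult[of g "inv\<^bsub>G\<^esub> g", symmetric] one in auto)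
    then show ?thesis using ext that by (simp add: Bij_def)
  qed
  have "act S \<in> hom G (BijGroup (pts S))"
  proof (rule homI)
    fix g h assume gh: "g \<in> carrier G" "h \<in> carrier G"
    have "act S (g \<otimes>\<^bsub>G\<^esub> h) = compose (pts S) (act S g) (act S h)"
      by (rule extensionalityI[where A="pts S"]) (use gh mult ext in \<open>auto simp: compose_def\<close>)
    then show "act S (g \<otimes>\<^bsub>G\<^esub> h) = act S g \<otimes>\<^bsub>BijGroup (pts S)\<^esub> act S h"
      using bij gh by (simp add: BijGroup_def)
  qed (use bij in \<open>simp add: BijGroup_def\<close>)
  then show ?thesis
    using assms(1,2) group_BijGroup
    by (auto simp: finite_gset_def group_action_def group_hom_def group_hom_axioms_def)
qed

lemma pts_gset_prod [simp]: "pts (gset_prod G S T) = prod_encode ` (pts S \<times> pts T)"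
  by (simp add: gset_prod_def)

lemma act_gset_prod:
  "s \<in> pts S \<Longrightarrow> t \<in> pts T \<Longrightarrow>
    act (gset_prod G S T) g (prod_encode (s, t)) = prod_encode (act S g s, act T g t)"
  by (simp add: gset_prod_def)

lemma prod_encode_in_iff [simp]: "prod_encode (s, t) \<in> prod_encode ` (A \<times> B) \<longleftrightarrow> s \<in> A \<and> t \<in> B"
  by (auto simp: prod_encode_eq)

lemma finite_gset_prod:
  assumes "gset G S" "gset G T"
  shows "gset G (gset_prod G S T)"
proof (rule finite_gsetI)
  show "group G" using assms finite_gset_group by blast
  then interpret group G .
  show "finite (pts (gset_prod G S T))" using assms[THEN finite_gset_finite] by auto
  show "act (gset_prod G S T) g \<in> extensional (pts (gset_prod G S T))" for g
    by (simp add: gset_prod_def)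
qed (use assms in \<open>auto simp: act_gset_prod act_closed act_one act_mult\<close>)

lemma sum_prod_encode:
  "(\<Sum>p \<in> prod_encode ` (A \<times> B). F p) = (\<Sum>s \<in> A. \<Sum>t \<in> B. F (prod_encode (s, t)))"
  by (simp add: sum.reindex inj_prod_encode sum.cartesian_product case_prod_unfold)

section \<open>Equivariant integer matrices as morphisms\<close>

lemma bz_homI:
  assumes "\<And>s t. \<not> (s \<in> pts S \<and> t \<in> pts T) \<Longrightarrow> \<phi> s t = 0"
    and "\<And>g s t. g \<in> carrier G \<Longrightarrow> s \<in> pts S \<Longrightarrow> t \<in> pts T \<Longrightarrow> \<phi> (act S g s) (act T g t) = \<phi> s t"
  shows "\<phi> \<in> bz_hom G S T"
  using assms unfolding bz_hom_def by blast

lemma bz_hom_zero: "\<phi> \<in> bz_hom G S T \<Longrightarrow> \<not> (s \<in> pts S \<and> t \<in> pts T) \<Longrightarrow> \<phi> s t = 0"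
  unfolding bz_hom_def by blast

lemma bz_hom_out:
  "\<phi> \<in> bz_hom G S T \<Longrightarrow> s \<notin> pts S \<Longrightarrow> \<phi> s t = 0"
  "\<phi> \<in> bz_hom G S T \<Longrightarrow> t \<notin> pts T \<Longrightarrow> \<phi> s t = 0"
  unfolding bz_hom_def by blast+

lemma bz_hom_inv:
  "\<phi> \<in> bz_hom G S T \<Longrightarrow> g \<in> carrier G \<Longrightarrow> s \<in> pts S \<Longrightarrow> t \<in> pts T
    \<Longrightarrow> \<phi> (act S g s) (act T g t) = \<phi> s t"
  unfolding bz_hom_def by blast

lemma bz_hom_eqI:
  assumes "\<phi> \<in> bz_hom G S T" "\<psi> \<in> bz_hom G S T"
    and "\<And>s t. s \<in> pts S \<Longrightarrow> t \<in> pts T \<Longrightarrow> \<phi> s t = \<psi> s t"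
  shows "\<phi> = \<psi>"
  by (intro ext) (metis assms bz_hom_zero)

lemma bz_zero_in [simp]: "bz_zero \<in> bz_hom G S T"
  by (simp add: bz_hom_def bz_zero_def)

lemma bz_add_in [simp]: "\<phi> \<in> bz_hom G S T \<Longrightarrow> \<psi> \<in> bz_hom G S T \<Longrightarrow> bz_add \<phi> \<psi> \<in> bz_hom G S T"
  by (auto simp: bz_hom_def bz_add_def)

definition bz_neg :: "mat \<Rightarrow> mat" where
  "bz_neg \<phi> = (\<lambda>s t. - \<phi> s t)"

lemma bz_neg_in [simp]: "\<phi> \<in> bz_hom G S T \<Longrightarrow> bz_neg \<phi> \<in> bz_hom G S T"
  by (auto simp: bz_hom_def bz_neg_def)

lemma bz_add_simps [simp]:
  "bz_add \<phi> bz_zero = \<phi>" "bz_add bz_zero \<phi> = \<phi>"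
  "bz_add \<phi> (bz_neg \<phi>) = bz_zero" "bz_add (bz_neg \<phi>) \<phi> = bz_zero"
  by (auto simp: bz_add_def bz_zero_def bz_neg_def)

lemma bz_add_assoc: "bz_add (bz_add \<phi> \<psi>) \<chi> = bz_add \<phi> (bz_add \<psi> \<chi>)"
  by (simp add: bz_add_def add.assoc)

lemma bz_add_comm: "bz_add \<phi> \<psi> = bz_add \<psi> \<phi>"
  by (simp add: bz_add_def add.commute)

lemma bz_id_in [simp]: assumes "gset G S" shows "bz_id S \<in> bz_hom G S S"
proof (rule bz_homI)
  fix g s t assume "g \<in> carrier G" "s \<in> pts S" "t \<in> pts S"
  then show "bz_id S (act S g s) (act S g t) = bz_id S s t"
    using act_bij[OF assms, of g] act_closed[OF assms, of g]
    by (auto simp: bz_id_def bij_betw_def inj_on_def)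
qed (auto simp: bz_id_def)

lemma sum_act:
  assumes "gset G T" "g \<in> carrier G"
  shows "(\<Sum>t \<in> pts T. F (act T g t)) = (\<Sum>t \<in> pts T. F t)"
  by (rule sum.reindex_bij_betw[OF act_bij[OF assms]])

lemma bz_comp_in [simp]:
  assumes T: "gset G T" and \<phi>: "\<phi> \<in> bz_hom G S T" and \<psi>: "\<psi> \<in> bz_hom G T U"
  shows "bz_comp T \<psi> \<phi> \<in> bz_hom G S U"
proof (rule bz_homI)
  fix g s u assume *: "g \<in> carrier G" "s \<in> pts S" "u \<in> pts U"
  have "bz_comp T \<psi> \<phi> (act S g s) (act U g u) =
      (\<Sum>t \<in> pts T. \<phi> (act S g s) (act T g t) * \<psi> (act T g t) (act U g u))"
    unfolding bz_comp_def using sum_act[OF T *(1), symmetric] .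
  also have "\<dots> = bz_comp T \<psi> \<phi> s u"
    unfolding bz_comp_def using * bz_hom_inv[OF \<phi>] bz_hom_inv[OF \<psi>] by (intro sum.cong) auto
  finally show "bz_comp T \<psi> \<phi> (act S g s) (act U g u) = bz_comp T \<psi> \<phi> s u" .
qed (auto simp: bz_comp_def bz_hom_out[OF \<phi>] bz_hom_out[OF \<psi>])

lemma bz_comp_assoc: "bz_comp U \<chi> (bz_comp T \<psi> \<phi>) = bz_comp T (bz_comp U \<chi> \<psi>) \<phi>"
  unfolding bz_comp_def
  by (intro ext) (simp add: sum_distrib_left sum_distrib_right mult.assoc, rule sum.swap)

lemma bz_comp_id_right [simp]:
  assumes "gset G S" "\<phi> \<in> bz_hom G S T" shows "bz_comp S \<phi> (bz_id S) = \<phi>"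
proof (intro ext)
  fix s t show "bz_comp S \<phi> (bz_id S) s t = \<phi> s t"
    using finite_gset_finite[OF assms(1)] bz_hom_out[OF assms(2)]
    by (cases "s \<in> pts S") (auto simp: bz_comp_def bz_id_def if_distrib[of "\<lambda>x. x * _"] cong: if_cong)
qed

lemma bz_comp_id_left [simp]:
  assumes "gset G T" "\<phi> \<in> bz_hom G S T" shows "bz_comp T (bz_id T) \<phi> = \<phi>"
proof (intro ext)
  fix s t
  have "bz_comp T (bz_id T) \<phi> s t = (\<Sum>t' \<in> pts T. if t' = t then \<phi> s t' else 0)"
    unfolding bz_comp_def by (intro sum.cong) (auto simp: bz_id_def)
  then show "bz_comp T (bz_id T) \<phi> s t = \<phi> s t"
    using finite_gset_finite[OF assms(1)] bz_hom_out[OF assms(2)]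
    by (cases "t \<in> pts T") auto
qed

lemma bz_comp_add_left [simp]: "bz_comp T (bz_add \<psi> \<psi>') \<phi> = bz_add (bz_comp T \<psi> \<phi>) (bz_comp T \<psi>' \<phi>)"
  by (auto simp: bz_comp_def bz_add_def algebra_simps sum.distrib)

lemma bz_comp_add_right [simp]: "bz_comp T \<psi> (bz_add \<phi> \<phi>') = bz_add (bz_comp T \<psi> \<phi>) (bz_comp T \<psi> \<phi>')"
  by (auto simp: bz_comp_def bz_add_def algebra_simps sum.distrib)

lemma bz_comp_zero [simp]: "bz_comp T bz_zero \<phi> = bz_zero" "bz_comp T \<psi> bz_zero = bz_zero"
  by (auto simp: bz_comp_def bz_zero_def)

section \<open>Tensor products and duals of matrices\<close>

lemma bz_prod_apply [simp]:
  "bz_prod S T S' T' \<phi> \<psi> (prod_encode (s, t)) (prod_encode (s', t')) =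
    (if s \<in> pts S \<and> t \<in> pts T \<and> s' \<in> pts S' \<and> t' \<in> pts T' then \<phi> s s' * \<psi> t t' else 0)"
  by (simp add: bz_prod_def)

lemma bz_prod_out: "\<not> (p \<in> prod_encode ` (pts S \<times> pts T) \<and> q \<in> prod_encode ` (pts S' \<times> pts T'))
    \<Longrightarrow> bz_prod S T S' T' \<phi> \<psi> p q = 0"
  by (auto simp: bz_prod_def)

lemma bz_prod_in [simp]:
  assumes "gset G S" "gset G T" "gset G S'" "gset G T'"
    "\<phi> \<in> bz_hom G S S'" "\<psi> \<in> bz_hom G T T'"
  shows "bz_prod S T S' T' \<phi> \<psi> \<in> bz_hom G (gset_prod G S T) (gset_prod G S' T')"
proof (rule bz_homI)
  fix g p q assume "g \<in> carrier G" "p \<in> pts (gset_prod G S T)" "q \<in> pts (gset_prod G S' T')"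
  then show "bz_prod S T S' T' \<phi> \<psi> (act (gset_prod G S T) g p) (act (gset_prod G S' T') g q)
      = bz_prod S T S' T' \<phi> \<psi> p q"
    using assms by (auto simp: act_gset_prod act_closed bz_hom_inv)
qed (auto simp: bz_prod_def)

lemma bz_prod_comp:
  assumes "\<phi> \<in> bz_hom G S S'" "\<phi>' \<in> bz_hom G S' S''" "\<psi> \<in> bz_hom G T T'" "\<psi>' \<in> bz_hom G T' T''"
  shows "bz_comp (gset_prod G S' T') (bz_prod S' T' S'' T'' \<phi>' \<psi>') (bz_prod S T S' T' \<phi> \<psi>) =
    bz_prod S T S'' T'' (bz_comp S' \<phi>' \<phi>) (bz_comp T' \<psi>' \<psi>)"
proof (intro ext)
  fix p q
  show "bz_comp (gset_prod G S' T') (bz_prod S' T' S'' T'' \<phi>' \<psi>') (bz_prod S T S' T' \<phi> \<psi>) p q =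
    bz_prod S T S'' T'' (bz_comp S' \<phi>' \<phi>) (bz_comp T' \<psi>' \<psi>) p q"
  proof (cases "p \<in> prod_encode ` (pts S \<times> pts T) \<and> q \<in> prod_encode ` (pts S'' \<times> pts T'')")
    case True
    then obtain s t s'' t'' where "p = prod_encode (s, t)" "q = prod_encode (s'', t'')"
      "s \<in> pts S" "t \<in> pts T" "s'' \<in> pts S''" "t'' \<in> pts T''" by blast
    then show ?thesis
      by (simp add: bz_comp_def sum_prod_encode sum_product mult_ac)
  next
    case False
    then show ?thesis by (auto simp: bz_comp_def bz_prod_out)
  qed
qed

lemma bz_prod_id [simp]: "bz_prod S T S T (bz_id S) (bz_id T) = bz_id (gset_prod G S T)"
proof (intro ext)
  fix p q show "bz_prod S T S T (bz_id S) (bz_id T) p q = bz_id (gset_prod G S T) p q"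
    by (cases "p \<in> prod_encode ` (pts S \<times> pts T) \<and> q \<in> prod_encode ` (pts S \<times> pts T)")
      (auto simp: bz_id_def bz_prod_out split: if_splits)
qed

lemma bz_prod_add:
  "bz_prod S T S' T' (bz_add \<phi> \<phi>') \<psi> = bz_add (bz_prod S T S' T' \<phi> \<psi>) (bz_prod S T S' T' \<phi>' \<psi>)"
  "bz_prod S T S' T' \<phi> (bz_add \<psi> \<psi>') = bz_add (bz_prod S T S' T' \<phi> \<psi>) (bz_prod S T S' T' \<phi> \<psi>')"
  by (intro ext; simp add: bz_prod_def bz_add_def algebra_simps)+

text \<open>The dual map: a permutation module is its own dual through its basis, and invariance
  under the diagonal action is symmetric in the two indices, so duality stays inside the
  category.\<close>

definition bz_transpose :: "mat \<Rightarrow> mat" where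
  "bz_transpose \<phi> = (\<lambda>s t. \<phi> t s)"

lemma bz_transpose_in [simp]: "\<phi> \<in> bz_hom G S T \<Longrightarrow> bz_transpose \<phi> \<in> bz_hom G T S"
  by (auto simp: bz_hom_def bz_transpose_def)

section \<open>Modules over the constant Mackey functor\<close>

lemma zm_comm_group: "zmodule G M \<Longrightarrow> gset G S \<Longrightarrow> comm_group (zobj M S)"
  by (simp add: zmodule_def)

lemma zm_group: "zmodule G M \<Longrightarrow> gset G S \<Longrightarrow> group (zobj M S)"
  using zm_comm_group comm_group_def by blast

lemma zm_hom:
  "zmodule G M \<Longrightarrow> gset G S \<Longrightarrow> gset G T \<Longrightarrow> \<phi> \<in> bz_hom G S T
    \<Longrightarrow> zmor M S T \<phi> \<in> hom (zobj M T) (zobj M S)"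
  by (simp add: zmodule_def)

lemma zm_closed:
  "zmodule G M \<Longrightarrow> gset G S \<Longrightarrow> gset G T \<Longrightarrow> \<phi> \<in> bz_hom G S T
    \<Longrightarrow> x \<in> el M T \<Longrightarrow> zmor M S T \<phi> x \<in> el M S"
  by (rule hom_in_carrier[OF zm_hom])

lemma zm_m_closed: "zmodule G M \<Longrightarrow> gset G S \<Longrightarrow> x \<in> el M S \<Longrightarrow> y \<in> el M S \<Longrightarrow> x \<otimes>\<^bsub>zobj M S\<^esub> y \<in> el M S"
  using zm_group[of G M S] by (simp add: group.is_monoid monoid.m_closed)

lemma zm_mult:
  "zmodule G M \<Longrightarrow> gset G S \<Longrightarrow> gset G T \<Longrightarrow> \<phi> \<in> bz_hom G S T
    \<Longrightarrow> x \<in> el M T \<Longrightarrow> y \<in> el M T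
    \<Longrightarrow> zmor M S T \<phi> (x \<otimes>\<^bsub>zobj M T\<^esub> y) = zmor M S T \<phi> x \<otimes>\<^bsub>zobj M S\<^esub> zmor M S T \<phi> y"
  by (rule hom_mult[OF zm_hom])

lemma zm_one:
  "zmodule G M \<Longrightarrow> gset G S \<Longrightarrow> gset G T \<Longrightarrow> \<phi> \<in> bz_hom G S T
    \<Longrightarrow> zmor M S T \<phi> \<one>\<^bsub>zobj M T\<^esub> = \<one>\<^bsub>zobj M S\<^esub>"
  by (rule hom_one[OF zm_hom zm_group zm_group])

lemma zm_id: "zmodule G M \<Longrightarrow> gset G S \<Longrightarrow> x \<in> el M S \<Longrightarrow> zmor M S S (bz_id S) x = x"
  by (simp add: zmodule_def)

lemma zm_comp:
  "zmodule G M \<Longrightarrow> gset G S \<Longrightarrow> gset G T \<Longrightarrow> gset G U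
    \<Longrightarrow> \<phi> \<in> bz_hom G S T \<Longrightarrow> \<psi> \<in> bz_hom G T U \<Longrightarrow> x \<in> el M U
    \<Longrightarrow> zmor M S U (bz_comp T \<psi> \<phi>) x = zmor M S T \<phi> (zmor M T U \<psi> x)"
  unfolding zmodule_def by blast

lemma zm_add:
  "zmodule G M \<Longrightarrow> gset G S \<Longrightarrow> gset G T
    \<Longrightarrow> \<phi> \<in> bz_hom G S T \<Longrightarrow> \<psi> \<in> bz_hom G S T \<Longrightarrow> x \<in> el M T
    \<Longrightarrow> zmor M S T (bz_add \<phi> \<psi>) x = zmor M S T \<phi> x \<otimes>\<^bsub>zobj M S\<^esub> zmor M S T \<psi> x"
  unfolding zmodule_def by blast

text \<open>The way in which additive functors are shown to preserve zero: from 0 = 0 + 0 the value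
  v satisfies v = v + v.\<close>

lemma (in group) idem_imp_one: "x \<in> carrier G \<Longrightarrow> x = x \<otimes> x \<Longrightarrow> x = \<one>"
  by (metis l_cancel_one')

lemma zm_zero:
  assumes "zmodule G M" "gset G S" "gset G T" "x \<in> el M T"
  shows "zmor M S T bz_zero x = \<one>\<^bsub>zobj M S\<^esub>"
  using zm_add[OF assms(1-3) bz_zero_in bz_zero_in assms(4)]
    group.idem_imp_one[OF zm_group[OF assms(1,2)] zm_closed[OF assms(1-3) bz_zero_in assms(4)]]
  by simp

lemma zmod_homD:
  assumes "zmod_hom G M N \<eta>" "gset G S"
  shows "\<eta> S \<in> hom (zobj M S) (zobj N S)"
    and "x \<in> el M S \<Longrightarrow> \<eta> S x \<in> el N S"
    and "x \<in> el M S \<Longrightarrow> y \<in> el M S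
      \<Longrightarrow> \<eta> S (x \<otimes>\<^bsub>zobj M S\<^esub> y) = \<eta> S x \<otimes>\<^bsub>zobj N S\<^esub> \<eta> S y"
    and "gset G T \<Longrightarrow> \<phi> \<in> bz_hom G S T \<Longrightarrow> z \<in> el M T
      \<Longrightarrow> \<eta> S (zmor M S T \<phi> z) = zmor N S T \<phi> (\<eta> T z)"
  using assms unfolding zmod_hom_def hom_def by blast+

lemma zmod_hom_one:
  assumes "zmod_hom G M N \<eta>" "zmodule G M" "zmodule G N" "gset G S"
  shows "\<eta> S \<one>\<^bsub>zobj M S\<^esub> = \<one>\<^bsub>zobj N S\<^esub>"
  by (rule hom_one[OF zmod_homD(1)[OF assms(1,4)] zm_group[OF assms(2,4)] zm_group[OF assms(3,4)]])

lemma zmod_hom_inv: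
  assumes "zmod_hom G M N \<eta>" "zmodule G M" "zmodule G N" "gset G S" "x \<in> el M S"
  shows "\<eta> S (inv\<^bsub>zobj M S\<^esub> x) = inv\<^bsub>zobj N S\<^esub> (\<eta> S x)"
  by (rule group_hom.hom_inv[OF group_hom.intro[OF zm_group[OF assms(2,4)] zm_group[OF assms(3,4)]
        group_hom_axioms.intro[OF zmod_homD(1)[OF assms(1,4)]]] assms(5)])

lemma zmod_homI:
  assumes "\<And>S x. gset G S \<Longrightarrow> x \<in> el M S \<Longrightarrow> \<eta> S x \<in> el N S"
    and "\<And>S x y. gset G S \<Longrightarrow> x \<in> el M S \<Longrightarrow> y \<in> el M S
      \<Longrightarrow> \<eta> S (x \<otimes>\<^bsub>zobj M S\<^esub> y) = \<eta> S x \<otimes>\<^bsub>zobj N S\<^esub> \<eta> S y"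
    and "\<And>S T \<phi> z. gset G S \<Longrightarrow> gset G T \<Longrightarrow> \<phi> \<in> bz_hom G S T \<Longrightarrow> z \<in> el M T
      \<Longrightarrow> \<eta> S (zmor M S T \<phi> z) = zmor N S T \<phi> (\<eta> T z)"
  shows "zmod_hom G M N \<eta>"
  using assms unfolding zmod_hom_def hom_def by auto

lemma zmod_hom_comp:
  assumes "zmod_hom G L M \<eta>" "zmod_hom G M N \<theta>"
  shows "zmod_hom G L N (\<lambda>S x. \<theta> S (\<eta> S x))"
  by (rule zmod_homI) (simp_all add: zmod_homD[OF assms(1)] zmod_homD[OF assms(2)])

lemma zmod_hom_id: "zmod_hom G M M (\<lambda>S x. x)"
  by (rule zmod_homI) auto

lemma zmod_hom_mult:
  assumes M: "zmodule G M" and N: "zmodule G N" and "zmod_hom G M N \<eta>" "zmod_hom G M N \<theta>"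
  shows "zmod_hom G M N (\<lambda>S x. \<eta> S x \<otimes>\<^bsub>zobj N S\<^esub> \<theta> S x)"
proof (rule zmod_homI)
  note D = zmod_homD[OF assms(3)] zmod_homD[OF assms(4)]
  fix S x y assume S: "gset G S" and x: "x \<in> el M S"
  interpret comm_group "zobj N S" by (rule zm_comm_group[OF N S])
  show "\<eta> S x \<otimes>\<^bsub>zobj N S\<^esub> \<theta> S x \<in> el N S" using D[OF S] x by simp
  assume y: "y \<in> el M S"
  show "\<eta> S (x \<otimes>\<^bsub>zobj M S\<^esub> y) \<otimes>\<^bsub>zobj N S\<^esub> \<theta> S (x \<otimes>\<^bsub>zobj M S\<^esub> y) =
    \<eta> S x \<otimes>\<^bsub>zobj N S\<^esub> \<theta> S x \<otimes>\<^bsub>zobj N S\<^esub> (\<eta> S y \<otimes>\<^bsub>zobj N S\<^esub> \<theta> S y)"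
    using D[OF S] x y by (simp add: m_ac)
next
  note D = zmod_homD[OF assms(3)] zmod_homD[OF assms(4)]
  fix S T \<phi> z assume S: "gset G S" and T: "gset G T"
    and \<phi>: "\<phi> \<in> bz_hom G S T" and z: "z \<in> el M T"
  then show "\<eta> S (zmor M S T \<phi> z) \<otimes>\<^bsub>zobj N S\<^esub> \<theta> S (zmor M S T \<phi> z)
      = zmor N S T \<phi> (\<eta> T z \<otimes>\<^bsub>zobj N T\<^esub> \<theta> T z)"
    using D[OF S] D[OF T] by (simp add: zm_mult[OF N S T \<phi>])
qed

lemma zm_inv:
  assumes "zmodule G M" "gset G S" "gset G T" "\<phi> \<in> bz_hom G S T" "x \<in> el M T"
  shows "zmor M S T \<phi> (inv\<^bsub>zobj M T\<^esub> x) = inv\<^bsub>zobj M S\<^esub> (zmor M S T \<phi> x)"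
  by (rule group_hom.hom_inv[OF group_hom.intro[OF zm_group[OF assms(1,3)] zm_group[OF assms(1,2)]
        group_hom_axioms.intro[OF zm_hom[OF assms(1-4)]]] assms(5)])

lemma zmod_hom_minus:
  assumes M: "zmodule G M" and N: "zmodule G N" and \<eta>: "zmod_hom G M N \<eta>"
  shows "zmod_hom G M N (\<lambda>S x. inv\<^bsub>zobj N S\<^esub> (\<eta> S x))"
proof (rule zmod_homI)
  fix S x y assume S: "gset G S" and x: "x \<in> el M S"
  interpret comm_group "zobj N S" by (rule zm_comm_group[OF N S])
  show "inv\<^bsub>zobj N S\<^esub> (\<eta> S x) \<in> el N S" using zmod_homD[OF \<eta> S] x by simp
  assume y: "y \<in> el M S"
  show "inv\<^bsub>zobj N S\<^esub> (\<eta> S (x \<otimes>\<^bsub>zobj M S\<^esub> y)) =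
    inv\<^bsub>zobj N S\<^esub> (\<eta> S x) \<otimes>\<^bsub>zobj N S\<^esub> inv\<^bsub>zobj N S\<^esub> (\<eta> S y)"
    using zmod_homD[OF \<eta> S] x y by (simp add: inv_mult)
next
  fix S T \<phi> z assume S: "gset G S" and T: "gset G T"
    and \<phi>: "\<phi> \<in> bz_hom G S T" and z: "z \<in> el M T"
  then show "inv\<^bsub>zobj N S\<^esub> (\<eta> S (zmor M S T \<phi> z)) = zmor N S T \<phi> (inv\<^bsub>zobj N T\<^esub> (\<eta> T z))"
    using zmod_homD[OF \<eta> S] zmod_homD[OF \<eta> T] by (simp add: zm_inv[OF N S T \<phi>])
qed

lemma zmod_hom_const_one:
  assumes "zmodule G N" shows "zmod_hom G M N (\<lambda>S x. \<one>\<^bsub>zobj N S\<^esub>)"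
proof (rule zmod_homI)
  fix S assume S: "gset G S"
  interpret comm_group "zobj N S" by (rule zm_comm_group[OF assms S])
  show "\<one>\<^bsub>zobj N S\<^esub> \<in> el N S" "\<one>\<^bsub>zobj N S\<^esub> = \<one>\<^bsub>zobj N S\<^esub> \<otimes>\<^bsub>zobj N S\<^esub> \<one>\<^bsub>zobj N S\<^esub>"
    by auto
qed (simp add: zm_one[OF assms])

subsection \<open>Isomorphisms\<close>

lemma zmod_isoI:
  assumes "zmodule G M" "zmodule G N" "zmod_hom G M N \<eta>"
    and "\<And>S. gset G S \<Longrightarrow> inj_on (\<eta> S) (el M S)"
    and "\<And>S y. gset G S \<Longrightarrow> y \<in> el N S \<Longrightarrow> \<exists>x \<in> el M S. \<eta> S x = y"
  shows "zmod_iso G M N"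
proof -
  have "bij_betw (\<eta> S) (el M S) (el N S)" if "gset G S" for S
  proof -
    have "\<eta> S ` el M S = el N S"
      using assms(5)[OF that] zmod_homD(2)[OF assms(3) that] by blast
    then show ?thesis using assms(4)[OF that] unfolding bij_betw_def by blast
  qed
  with assms show ?thesis unfolding zmod_iso_def by blast
qed

lemma zmod_iso_trans: assumes "zmod_iso G L M" "zmod_iso G M N" shows "zmod_iso G L N"
proof -
  from assms obtain \<eta> \<theta> where *: "zmod_hom G L M \<eta>" "zmod_hom G M N \<theta>"
    "\<And>S. gset G S \<Longrightarrow> bij_betw (\<eta> S) (el L S) (el M S)"
    "\<And>S. gset G S \<Longrightarrow> bij_betw (\<theta> S) (el M S) (el N S)"
    unfolding zmod_iso_def by blast
  have "bij_betw (\<lambda>x. \<theta> S (\<eta> S x)) (el L S) (el N S)" if "gset G S" for S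
    using bij_betw_trans[OF *(3,4)[OF that]] by (simp add: comp_def)
  with zmod_hom_comp[OF *(1,2)] assms show ?thesis unfolding zmod_iso_def by blast
qed

text \<open>The inverses are taken separately at each G-set; they are additive and natural because
  each component of \<eta> is injective and turns both sides into the same element.\<close>

lemma zmod_iso_sym: assumes "zmod_iso G M N" shows "zmod_iso G N M"
proof -
  from assms obtain \<eta> where \<eta>: "zmod_hom G M N \<eta>" and M: "zmodule G M" and N: "zmodule G N"
    and bij: "\<And>S. gset G S \<Longrightarrow> bij_betw (\<eta> S) (el M S) (el N S)"
    unfolding zmod_iso_def by blast
  define \<theta> where "\<theta> = (\<lambda>S. inv_into (el M S) (\<eta> S))"
  have \<theta>_in: "\<theta> S y \<in> el M S" and \<eta>\<theta>: "\<eta> S (\<theta> S y) = y"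
    if "gset G S" "y \<in> el N S" for S y
    using bij[OF that(1)] that(2) unfolding \<theta>_def bij_betw_def
    by (auto simp: inv_into_into f_inv_into_f)
  have inj: "x = x'" if "gset G S" "\<eta> S x = \<eta> S x'" "x \<in> el M S" "x' \<in> el M S" for S x x'
    using bij[OF that(1)] that unfolding bij_betw_def inj_on_def by blast
  have "zmod_hom G N M \<theta>"
  proof (rule zmod_homI)
    fix S x y assume S: "gset G S" and x: "x \<in> el N S" and y: "y \<in> el N S"
    have "x \<otimes>\<^bsub>zobj N S\<^esub> y \<in> el N S" "\<theta> S x \<otimes>\<^bsub>zobj M S\<^esub> \<theta> S y \<in> el M S"
      using zm_group[OF N S] zm_group[OF M S] \<theta>_in[OF S] x y by (simp_all add: group.is_monoid monoid.m_closed)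
    then show "\<theta> S (x \<otimes>\<^bsub>zobj N S\<^esub> y) = \<theta> S x \<otimes>\<^bsub>zobj M S\<^esub> \<theta> S y"
      using S x y by (intro inj) (simp_all add: \<eta>\<theta> \<theta>_in zmod_homD[OF \<eta>])
  next
    fix S T \<phi> z assume *: "gset G S" "gset G T" "\<phi> \<in> bz_hom G S T" "z \<in> el N T"
    show "\<theta> S (zmor N S T \<phi> z) = zmor M S T \<phi> (\<theta> T z)"
      by (rule inj[OF *(1)])
        (use * in \<open>simp_all add: \<eta>\<theta> \<theta>_in zmod_homD(4)[OF \<eta> *(1)] zm_closed[OF N *(1)] zm_closed[OF M *(1)]\<close>)
  qed (simp add: \<theta>_in)
  then show ?thesis
    proof (rule zmod_isoI[OF N M])
    fix S assume S: "gset G S"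
    show "inj_on (\<theta> S) (el N S)" by (rule inj_onI) (metis \<eta>\<theta>[OF S])
    fix x assume "x \<in> el M S"
    then show "\<exists>y \<in> el N S. \<theta> S y = x"
      using inj[OF S] \<eta>\<theta>[OF S] \<theta>_in[OF S] zmod_homD(2)[OF \<eta> S] by metis
  qed
qed

subsection \<open>Submodules and quotients\<close>

lemma submodule_familyD:
  assumes "submodule_family G M J" "gset G S"
  shows "subgroup (J S) (zobj M S)"
    and "gset G T \<Longrightarrow> \<phi> \<in> bz_hom G S T \<Longrightarrow> x \<in> J T \<Longrightarrow> zmor M S T \<phi> x \<in> J S"
    and "x \<in> J S \<Longrightarrow> x \<in> el M S"
  using assms unfolding submodule_family_def by (blast dest: subgroup.mem_carrier)+

lemma zobj_submod: "zobj (submod M J) S = (zobj M S)\<lparr>carrier := J S\<rparr>"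
  by (simp add: submod_def)

lemma submod_simps [simp]:
  "el (submod M J) S = J S"
  "monoid.mult (zobj (submod M J) S) = monoid.mult (zobj M S)"
  "one (zobj (submod M J) S) = one (zobj M S)"
  "zmor (submod M J) = zmor M"
  by (simp_all add: submod_def)

lemma zmodule_submod:
  assumes M: "zmodule G M" and J: "submodule_family G M J"
  shows "zmodule G (submod M J)"
proof -
  note JD = submodule_familyD[OF J]
  have grp: "comm_group (zobj (submod M J) S)" if S: "gset G S" for S
  proof (rule group.group_comm_groupI)
    interpret comm_group "zobj M S" by (rule zm_comm_group[OF M S])
    show "group (zobj (submod M J) S)"
      unfolding zobj_submod by (rule subgroup.subgroup_is_group[OF JD(1)[OF S] is_group])
    show "x \<otimes>\<^bsub>zobj (submod M J) S\<^esub> y = y \<otimes>\<^bsub>zobj (submod M J) S\<^esub> x"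
      if "x \<in> el (submod M J) S" "y \<in> el (submod M J) S" for x y
      using that JD(3)[OF S] by (simp add: m_comm)
  qed
  show ?thesis
    unfolding zmodule_def
    using grp zm_mult[OF M] zm_id[OF M] zm_comp[OF M] zm_add[OF M]
    by (auto simp: hom_def JD)
qed

lemma subgroup_submod:
  assumes "submodule_family G M J" "submodule_family G M K" "\<And>S x. gset G S \<Longrightarrow> x \<in> K S \<Longrightarrow> x \<in> J S"
    and M: "zmodule G M"
  shows "submodule_family G (submod M J) K"
proof -
  have "subgroup (K S) (zobj (submod M J) S)" if S: "gset G S" for S
    using group.subgroup_incl[OF zm_group[OF M S]] submodule_familyD(1)[OF assms(1) S]
      submodule_familyD(1)[OF assms(2) S] assms(3)[OF S]
    by (metis subsetI zobj_submod)
  then show ?thesis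
    using submodule_familyD(2)[OF assms(2)] by (simp add: submodule_family_def)
qed

text \<open>All sets in the union coincide: f (j x) = f j f x differs from f x by an element of K.
  Through this equation every induced map on quotients is computed on representatives.\<close>

lemma coset_map_eq:
  assumes A: "comm_group A" and B: "comm_group B" and J: "subgroup J A" and K: "subgroup K B"
    and f: "f \<in> hom A B" and fJ: "\<And>x. x \<in> J \<Longrightarrow> f x \<in> K" and x: "x \<in> carrier A"
  shows "coset_map B K f (J #>\<^bsub>A\<^esub> x) = K #>\<^bsub>B\<^esub> f x"
proof -
  interpret A: comm_group A by fact
  interpret B: comm_group B by fact
  interpret J: subgroup J A by fact
  interpret K: subgroup K B by fact
  have eq: "K #>\<^bsub>B\<^esub> f (j \<otimes>\<^bsub>A\<^esub> x) = K #>\<^bsub>B\<^esub> f x" if "j \<in> J" for j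
  proof -
    have "f j \<in> K" "f x \<in> carrier B" "f (j \<otimes>\<^bsub>A\<^esub> x) = f j \<otimes>\<^bsub>B\<^esub> f x"
      using that fJ f x by (auto simp: hom_in_carrier hom_mult)
    then show ?thesis
      by (metis B.coset_mult_assoc K.mem_carrier K.rcos_const[OF B.is_group] K.subset)
  qed
  have "coset_map B K f (J #>\<^bsub>A\<^esub> x) = (\<Union>j \<in> J. K #>\<^bsub>B\<^esub> f (j \<otimes>\<^bsub>A\<^esub> x))"
    by (simp add: coset_map_def r_coset_def[of A J x])
  also have "\<dots> = (\<Union>j \<in> J. K #>\<^bsub>B\<^esub> f x)" using eq by simp
  also have "\<dots> = K #>\<^bsub>B\<^esub> f x" using J.one_closed by blast
  finally show ?thesis .
qed

lemma zobj_quot: "zobj (quot M J) S = zobj M S Mod J S"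
  by (simp add: quot_def)

lemma quot_simps [simp]:
  "monoid.mult (zobj (quot M J) S) = set_mult (zobj M S)"
  "one (zobj (quot M J) S) = J S"
  "zmor (quot M J) S T \<phi> = coset_map (zobj M S) (J S) (zmor M S T \<phi>)"
  by (simp_all add: quot_def)

lemma carrier_quot: "el (quot M J) S = (\<lambda>x. J S #>\<^bsub>zobj M S\<^esub> x) ` el M S"
  by (simp add: quot_def carrier_FactGroup)

lemma quot_mult:
  assumes M: "zmodule G M" and J: "submodule_family G M J" and S: "gset G S"
    and "x \<in> el M S" "y \<in> el M S"
  shows "(J S #>\<^bsub>zobj M S\<^esub> x) <#>\<^bsub>zobj M S\<^esub> (J S #>\<^bsub>zobj M S\<^esub> y) = J S #>\<^bsub>zobj M S\<^esub> (x \<otimes>\<^bsub>zobj M S\<^esub> y)"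
proof -
  interpret comm_group "zobj M S" by (rule zm_comm_group[OF M S])
  have "J S \<lhd> zobj M S" using submodule_familyD(1)[OF J S] normal_iff_subgroup by blast
  then show ?thesis using assms by (simp add: normal.rcos_sum)
qed

lemma quot_mor:
  assumes M: "zmodule G M" and J: "submodule_family G M J" and S: "gset G S" and T: "gset G T"
    and \<phi>: "\<phi> \<in> bz_hom G S T" and x: "x \<in> el M T"
  shows "coset_map (zobj M S) (J S) (zmor M S T \<phi>) (J T #>\<^bsub>zobj M T\<^esub> x) = J S #>\<^bsub>zobj M S\<^esub> (zmor M S T \<phi> x)"
  by (rule coset_map_eq[OF zm_comm_group[OF M T] zm_comm_group[OF M S] submodule_familyD(1)[OF J T]
        submodule_familyD(1)[OF J S] zm_hom[OF M S T \<phi>] submodule_familyD(2)[OF J S T \<phi>] x])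

lemma zmodule_quot:
  assumes M: "zmodule G M" and J: "submodule_family G M J"
  shows "zmodule G (quot M J)"
proof -
  have grp: "comm_group (zobj (quot M J) S)" if S: "gset G S" for S
    unfolding zobj_quot
    by (rule comm_group.abelian_FactGroup[OF zm_comm_group[OF M S] submodule_familyD(1)[OF J S]])
  have mult: "zmor M S T \<phi> x \<otimes>\<^bsub>zobj M S\<^esub> zmor M S T \<phi> y \<in> el M S"
    if "gset G S" "gset G T" "\<phi> \<in> bz_hom G S T" "x \<in> el M T" "y \<in> el M T"
    for S T \<phi> x y
    using that zm_closed[OF M] zm_group[OF M] by (simp add: group.is_monoid monoid.m_closed)
  show ?thesis
    unfolding zmodule_def
  proof (intro conjI allI impI ballI)
    fix S T \<phi> assume *: "gset G S" "gset G T" "\<phi> \<in> bz_hom G S T"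
    show "zmor (quot M J) S T \<phi> \<in> hom (zobj (quot M J) T) (zobj (quot M J) S)"
      by (rule homI)
        (use * in \<open>auto simp: carrier_quot quot_mult[OF M J] quot_mor[OF M J] zm_mult[OF M] zm_closed[OF M] zm_m_closed[OF M]\<close>)
  next
    fix S x assume "gset G S" "x \<in> el (quot M J) S"
    then show "zmor (quot M J) S S (bz_id S) x = x"
      by (auto simp: carrier_quot quot_mor[OF M J] zm_id[OF M])
  next
    fix S T U \<phi> \<psi> x assume "gset G S" "gset G T" "gset G U"
      "\<phi> \<in> bz_hom G S T" "\<psi> \<in> bz_hom G T U" "x \<in> el (quot M J) U"
    then show "zmor (quot M J) S U (bz_comp T \<psi> \<phi>) x = zmor (quot M J) S T \<phi> (zmor (quot M J) T U \<psi> x)"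
      by (auto simp: carrier_quot quot_mor[OF M J] zm_comp[OF M] zm_closed[OF M])
  next
    fix S T \<phi> \<psi> x assume "gset G S" "gset G T"
      "\<phi> \<in> bz_hom G S T" "\<psi> \<in> bz_hom G S T" "x \<in> el (quot M J) T"
    then show "zmor (quot M J) S T (bz_add \<phi> \<psi>) x =
       zmor (quot M J) S T \<phi> x \<otimes>\<^bsub>zobj (quot M J) S\<^esub> zmor (quot M J) S T \<psi> x"
      by (auto simp: carrier_quot quot_mor[OF M J] quot_mult[OF M J] zm_add[OF M] zm_closed[OF M])
  qed (rule grp)
qed

lemma (in comm_group) rcos_eq_iff:
  assumes "subgroup H G" "x \<in> carrier G" "y \<in> carrier G"
  shows "H #> x = H #> y \<longleftrightarrow> x \<otimes> inv y \<in> H"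
proof -
  have "H #> x = H #> y \<longleftrightarrow> x \<in> H #> y"
    using assms by (metis repr_independence rcos_self subgroup.subset)
  also have "\<dots> \<longleftrightarrow> x \<otimes> inv y \<in> H"
    using assms by (metis subgroup.rcos_module is_group)
  finally show ?thesis .
qed

text \<open>J being the full preimage of K gives injectivity, and reaching every element up to K
  gives surjectivity. Since \<eta> has to be onto only modulo K, the second isomorphism theorem is
  covered as well as the first.\<close>

lemma quot_iso:
  assumes M: "zmodule G M" and N: "zmodule G N"
    and J: "submodule_family G M J" and K: "submodule_family G N K"
    and \<eta>: "zmod_hom G M N \<eta>"
    and mem: "\<And>S x. gset G S \<Longrightarrow> x \<in> el M S \<Longrightarrow> \<eta> S x \<in> K S \<longleftrightarrow> x \<in> J S"
    and surj: "\<And>S y. gset G S \<Longrightarrow> y \<in> el N S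
      \<Longrightarrow> \<exists>x \<in> el M S. \<exists>k \<in> K S. y = k \<otimes>\<^bsub>zobj N S\<^esub> \<eta> S x"
  shows "zmod_iso G (quot M J) (quot N K)"
proof -
  let ?\<theta> = "\<lambda>S. coset_map (zobj N S) (K S) (\<eta> S)"
  have \<theta>: "?\<theta> S (J S #>\<^bsub>zobj M S\<^esub> x) = K S #>\<^bsub>zobj N S\<^esub> \<eta> S x"
    if "gset G S" "x \<in> el M S" for S x
  proof (rule coset_map_eq[OF zm_comm_group[OF M that(1)] zm_comm_group[OF N that(1)]
        submodule_familyD(1)[OF J that(1)] submodule_familyD(1)[OF K that(1)] zmod_homD(1)[OF \<eta> that(1)] _ that(2)])
    show "\<eta> S y \<in> K S" if "y \<in> J S" for y
      using mem submodule_familyD(3)[OF J] that \<open>gset G S\<close> by blast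
  qed
  show ?thesis
  proof (rule zmod_isoI[OF zmodule_quot[OF M J] zmodule_quot[OF N K]])
    show "zmod_hom G (quot M J) (quot N K) ?\<theta>"
      by (rule zmod_homI)
        (auto simp: carrier_quot \<theta> quot_mult[OF M J] quot_mult[OF N K] quot_mor[OF M J] quot_mor[OF N K]
          zmod_homD[OF \<eta>] zm_closed[OF M] zm_m_closed[OF M])
  next
    fix S assume S: "gset G S"
    interpret A: comm_group "zobj M S" by (rule zm_comm_group[OF M S])
    interpret B: comm_group "zobj N S" by (rule zm_comm_group[OF N S])
    show "inj_on (?\<theta> S) (el (quot M J) S)"
    proof (rule inj_onI)
      fix X Y assume "X \<in> el (quot M J) S" "Y \<in> el (quot M J) S"
        and eq: "?\<theta> S X = ?\<theta> S Y"
      then obtain x y where x: "x \<in> el M S" "X = J S #>\<^bsub>zobj M S\<^esub> x"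
        and y: "y \<in> el M S" "Y = J S #>\<^bsub>zobj M S\<^esub> y"
        by (auto simp: carrier_quot)
      have "\<eta> S x \<otimes>\<^bsub>zobj N S\<^esub> inv\<^bsub>zobj N S\<^esub> \<eta> S y \<in> K S"
        using eq x y S submodule_familyD(1)[OF K S]
        by (simp add: \<theta> B.rcos_eq_iff zmod_homD[OF \<eta>])
      then have "\<eta> S (x \<otimes>\<^bsub>zobj M S\<^esub> inv\<^bsub>zobj M S\<^esub> y) \<in> K S"
        using x y S by (simp add: zmod_homD[OF \<eta>] zmod_hom_inv[OF \<eta> M N])
      then show "X = Y"
        using x y S submodule_familyD(1)[OF J S] by (simp add: mem A.rcos_eq_iff)
    qed
    fix Y assume "Y \<in> el (quot N K) S"
    then obtain y where y: "y \<in> el N S" "Y = K S #>\<^bsub>zobj N S\<^esub> y" by (auto simp: carrier_quot)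
    with surj[OF S] obtain x k where xk: "x \<in> el M S" "k \<in> K S" "y = k \<otimes>\<^bsub>zobj N S\<^esub> \<eta> S x" by blast
    have "Y = K S #>\<^bsub>zobj N S\<^esub> \<eta> S x"
      unfolding y(2) xk(3) using xk(1,2) zmod_homD(2)[OF \<eta> S] submodule_familyD[OF K S]
      by (metis B.coset_mult_assoc B.is_group subgroup.rcos_const subgroup.subset)
    then show "\<exists>X \<in> el (quot M J) S. ?\<theta> S X = Y"
      using xk(1) \<theta>[OF S xk(1)] by (auto simp: carrier_quot)
  qed
qed

lemma submodule_family_trivial:
  assumes "zmodule G M" shows "submodule_family G M (\<lambda>S. {\<one>\<^bsub>zobj M S\<^esub>})"
  using assms by (auto simp: submodule_family_def zm_one intro: group.triv_subgroup zm_group)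

lemma quot_trivial_iso:
  assumes M: "zmodule G M" shows "zmod_iso G M (quot M (\<lambda>S. {\<one>\<^bsub>zobj M S\<^esub>}))"
proof -
  note triv = submodule_family_trivial[OF M]
  have coset: "{\<one>\<^bsub>zobj M S\<^esub>} #>\<^bsub>zobj M S\<^esub> x = {x}" if "gset G S" "x \<in> el M S" for S x
    using zm_group[OF M that(1)] that(2) by (auto simp: r_coset_def group.is_monoid monoid.l_one)
  show ?thesis
  proof (rule zmod_isoI[OF M zmodule_quot[OF M triv], where \<eta>="\<lambda>S x. {\<one>\<^bsub>zobj M S\<^esub>} #>\<^bsub>zobj M S\<^esub> x"])
    show "zmod_hom G M (quot M (\<lambda>S. {\<one>\<^bsub>zobj M S\<^esub>})) (\<lambda>S x. {\<one>\<^bsub>zobj M S\<^esub>} #>\<^bsub>zobj M S\<^esub> x)"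
      by (rule zmod_homI) (simp_all add: carrier_quot quot_mult[OF M triv] quot_mor[OF M triv])
    fix S assume "gset G S"
    then show "inj_on (\<lambda>x. {\<one>\<^bsub>zobj M S\<^esub>} #>\<^bsub>zobj M S\<^esub> x) (el M S)"
      by (auto simp: inj_on_def coset)
  qed (auto simp: carrier_quot)
qed

text \<open>First isomorphism theorem, obtained by dividing the target by its trivial
  submodule.\<close>

lemma quot_iso_target:
  assumes M: "zmodule G M" and N: "zmodule G N" and J: "submodule_family G M J" and \<eta>: "zmod_hom G M N \<eta>"
    and mem: "\<And>S x. gset G S \<Longrightarrow> x \<in> el M S \<Longrightarrow> \<eta> S x = \<one>\<^bsub>zobj N S\<^esub> \<longleftrightarrow> x \<in> J S"
    and surj: "\<And>S y. gset G S \<Longrightarrow> y \<in> el N S \<Longrightarrow> \<exists>x \<in> el M S. y = \<eta> S x"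
  shows "zmod_iso G (quot M J) N"
proof -
  have "zmod_iso G (quot M J) (quot N (\<lambda>S. {\<one>\<^bsub>zobj N S\<^esub>}))"
  proof (rule quot_iso[OF M N J submodule_family_trivial[OF N] \<eta>])
    fix S y assume S: "gset G S" and y: "y \<in> el N S"
    with surj[OF S] obtain x where x: "x \<in> el M S" "y = \<eta> S x" by blast
    have "y = \<one>\<^bsub>zobj N S\<^esub> \<otimes>\<^bsub>zobj N S\<^esub> \<eta> S x"
      using zm_group[OF N S] y x(2) by (simp add: group.is_monoid monoid.l_one)
    with x(1) show "\<exists>x \<in> el M S. \<exists>k \<in> {\<one>\<^bsub>zobj N S\<^esub>}. y = k \<otimes>\<^bsub>zobj N S\<^esub> \<eta> S x" by blast
  qed (use mem in auto)
  then show ?thesis using zmod_iso_trans zmod_iso_sym quot_trivial_iso[OF N] by blast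
qed

lemma trivial_quot_iso_zero:
  assumes M: "zmodule G M" and J: "submodule_family G M J"
    and all: "\<And>S x. gset G S \<Longrightarrow> x \<in> el M S \<Longrightarrow> x \<in> J S"
  shows "zmod_iso G (quot M J) zmod_zero"
\<comment> \<open>The zero module has \<open>undefined\<close> as its only element, so the map into
  it is forced.\<close>
proof (rule quot_iso_target[OF M _ J, where \<eta>="\<lambda>S x. undefined"])
  show "zmodule G zmod_zero"
    by (auto simp: zmodule_def zmod_zero_def singleton_group_def hom_def
      intro!: group.group_comm_groupI groupI)
  show "zmod_hom G M zmod_zero (\<lambda>S x. undefined)"
    by (rule zmod_homI) (auto simp: zmod_zero_def singleton_group_def)
  fix S y assume S: "gset G S"
  show "\<exists>x \<in> el M S. y = undefined" if "y \<in> el zmod_zero S"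
    using that zm_group[OF M S] group.is_monoid monoid.one_closed
    by (auto simp: zmod_zero_def singleton_group_def)
qed (use all in \<open>auto simp: zmod_zero_def singleton_group_def\<close>)

subsection \<open>Homology\<close>

lemma zker_iff: "x \<in> zker M N \<eta> S \<longleftrightarrow> x \<in> el M S \<and> \<eta> S x = \<one>\<^bsub>zobj N S\<^esub>"
  by (simp add: zker_def kernel_def)

lemma zimg_iff: "y \<in> zimg M \<eta> S \<longleftrightarrow> (\<exists>x \<in> el M S. y = \<eta> S x)"
  by (auto simp: zimg_def)

lemma submodule_family_zker:
  assumes M: "zmodule G M" and N: "zmodule G N" and \<eta>: "zmod_hom G M N \<eta>"
  shows "submodule_family G M (zker M N \<eta>)"
  unfolding submodule_family_def
proof (intro conjI allI impI ballI)
  fix S assume S: "gset G S"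
  show "subgroup (zker M N \<eta> S) (zobj M S)"
    unfolding zker_def
    by (rule group_hom.subgroup_kernel[OF group_hom.intro[OF zm_group[OF M S] zm_group[OF N S]
        group_hom_axioms.intro[OF zmod_homD(1)[OF \<eta> S]]]])
qed (auto simp: zker_iff zm_closed[OF M] zmod_homD[OF \<eta>] zm_one[OF N])

lemma submodule_family_zimg:
  assumes M: "zmodule G M" and N: "zmodule G N" and \<eta>: "zmod_hom G M N \<eta>"
  shows "submodule_family G N (zimg M \<eta>)"
  unfolding submodule_family_def
proof (intro conjI allI impI ballI)
  fix S assume S: "gset G S"
  show "subgroup (zimg M \<eta> S) (zobj N S)"
    unfolding zimg_def
    by (rule group_hom.img_is_subgroup[OF group_hom.intro[OF zm_group[OF M S] zm_group[OF N S]
        group_hom_axioms.intro[OF zmod_homD(1)[OF \<eta> S]]]])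
next
  fix S T \<phi> y assume *: "gset G S" "gset G T" "\<phi> \<in> bz_hom G S T" and "y \<in> zimg M \<eta> T"
  then obtain x where x: "x \<in> el M T" "y = \<eta> T x" by (auto simp: zimg_iff)
  show "zmor N S T \<phi> y \<in> zimg M \<eta> S"
    unfolding zimg_iff x(2) using zmod_homD(4)[OF \<eta> *(1,2,3) x(1), symmetric] zm_closed[OF M * x(1)] by blast
qed

text \<open>The term \<open>homology\<close> is formed without any side condition; these are the
  conditions under which the image is a submodule of the kernel and the quotient is a
  module.\<close>

definition zseq ::
  "'g monoid \<Rightarrow> ('g, 'a) zmod \<Rightarrow> ('g, 'b) zmod \<Rightarrow> ('g, 'c) zmod \<Rightarrow> ('g, 'a, 'b) zmap \<Rightarrow> ('g, 'b, 'c) zmap \<Rightarrow> bool"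
  where "zseq G A B C \<alpha> \<beta> \<longleftrightarrow> zmodule G A \<and> zmodule G B \<and> zmodule G C \<and> zmod_hom G A B \<alpha> \<and> zmod_hom G B C \<beta> \<and>
    (\<forall>S. gset G S \<longrightarrow> (\<forall>x \<in> el A S. \<beta> S (\<alpha> S x) = \<one>\<^bsub>zobj C S\<^esub>))"

lemma zseqD:
  assumes "zseq G A B C \<alpha> \<beta>"
  shows "zmodule G A" "zmodule G B" "zmodule G C" "zmod_hom G A B \<alpha>" "zmod_hom G B C \<beta>"
    and "\<And>S x. gset G S \<Longrightarrow> x \<in> el A S \<Longrightarrow> \<beta> S (\<alpha> S x) = \<one>\<^bsub>zobj C S\<^esub>"
    and "submodule_family G B (zker B C \<beta>)" "zmodule G (submod B (zker B C \<beta>))"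
    and "submodule_family G (submod B (zker B C \<beta>)) (zimg A \<alpha>)"
proof -
  show *: "zmodule G A" "zmodule G B" "zmodule G C" "zmod_hom G A B \<alpha>" "zmod_hom G B C \<beta>"
    "\<And>S x. gset G S \<Longrightarrow> x \<in> el A S \<Longrightarrow> \<beta> S (\<alpha> S x) = \<one>\<^bsub>zobj C S\<^esub>"
    using assms unfolding zseq_def by blast+
  show ker: "submodule_family G B (zker B C \<beta>)" by (rule submodule_family_zker[OF *(2,3,5)])
  show "zmodule G (submod B (zker B C \<beta>))" by (rule zmodule_submod[OF *(2) ker])
  show "submodule_family G (submod B (zker B C \<beta>)) (zimg A \<alpha>)"
    by (rule subgroup_submod[OF ker submodule_family_zimg[OF *(1,2,4)] _ *(2)])
      (auto simp: zimg_iff zker_iff * zmod_homD[OF *(4)])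
qed

lemma homology_zero:
  assumes "zseq G A B C \<alpha> \<beta>"
    and "\<And>S x. gset G S \<Longrightarrow> x \<in> el B S \<Longrightarrow> \<beta> S x = \<one>\<^bsub>zobj C S\<^esub> \<Longrightarrow> \<exists>z \<in> el A S. x = \<alpha> S z"
  shows "zmod_iso G (homology A B C \<alpha> \<beta>) zmod_zero"
  unfolding homology_def
  by (rule trivial_quot_iso_zero[OF zseqD(8,9)[OF assms(1)]])
    (use assms(2) in \<open>auto simp: zker_iff zimg_iff\<close>)

text \<open>The two maps are given at the middle term only. It is enough that they send cycles to
  cycles and boundaries to boundaries and are mutually inverse on cycles up to boundaries.\<close>

lemma homology_iso:
  assumes s: "zseq G A B C \<alpha> \<beta>" and s': "zseq G A' B' C' \<alpha>' \<beta>'"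
    and f: "zmod_hom G B B' f" and g: "zmod_hom G B' B g"
    and f_ker: "\<And>S x. gset G S \<Longrightarrow> x \<in> el B S \<Longrightarrow> \<beta> S x = \<one>\<^bsub>zobj C S\<^esub> \<Longrightarrow> \<beta>' S (f S x) = \<one>\<^bsub>zobj C' S\<^esub>"
    and g_ker: "\<And>S x. gset G S \<Longrightarrow> x \<in> el B' S \<Longrightarrow> \<beta>' S x = \<one>\<^bsub>zobj C' S\<^esub> \<Longrightarrow> \<beta> S (g S x) = \<one>\<^bsub>zobj C S\<^esub>"
    and f_img: "\<And>S x. gset G S \<Longrightarrow> x \<in> el A S \<Longrightarrow> \<exists>y \<in> el A' S. f S (\<alpha> S x) = \<alpha>' S y"
    and g_img: "\<And>S x. gset G S \<Longrightarrow> x \<in> el A' S \<Longrightarrow> \<exists>y \<in> el A S. g S (\<alpha>' S x) = \<alpha> S y"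
    and gf: "\<And>S x. gset G S \<Longrightarrow> x \<in> el B S \<Longrightarrow> \<beta> S x = \<one>\<^bsub>zobj C S\<^esub>
      \<Longrightarrow> \<exists>y \<in> el A S. g S (f S x) = x \<otimes>\<^bsub>zobj B S\<^esub> \<alpha> S y"
    and fg: "\<And>S x. gset G S \<Longrightarrow> x \<in> el B' S \<Longrightarrow> \<beta>' S x = \<one>\<^bsub>zobj C' S\<^esub>
      \<Longrightarrow> \<exists>y \<in> el A' S. f S (g S x) = x \<otimes>\<^bsub>zobj B' S\<^esub> \<alpha>' S y"
  shows "zmod_iso G (homology A B C \<alpha> \<beta>) (homology A' B' C' \<alpha>' \<beta>')"
  unfolding homology_def
proof (rule quot_iso[OF zseqD(8)[OF s] zseqD(8)[OF s'] zseqD(9)[OF s] zseqD(9)[OF s'], where \<eta>=f])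
  note D = zseqD[OF s] and D' = zseqD[OF s']
  show "zmod_hom G (submod B (zker B C \<beta>)) (submod B' (zker B' C' \<beta>')) f"
    by (rule zmod_homI) (auto simp: zker_iff zmod_homD[OF f] f_ker)
  fix S x assume S: "gset G S"
  interpret A: comm_group "zobj A S" by (rule zm_comm_group[OF D(1) S])
  interpret B: comm_group "zobj B S" by (rule zm_comm_group[OF D(2) S])
  interpret A': comm_group "zobj A' S" by (rule zm_comm_group[OF D'(1) S])
  interpret B': comm_group "zobj B' S" by (rule zm_comm_group[OF D'(2) S])
  {
    assume "x \<in> el (submod B (zker B C \<beta>)) S"
    then have x: "x \<in> el B S" "\<beta> S x = \<one>\<^bsub>zobj C S\<^esub>" by (auto simp: zker_iff)
    show "f S x \<in> zimg A' \<alpha>' S \<longleftrightarrow> x \<in> zimg A \<alpha> S"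
    proof
      assume "f S x \<in> zimg A' \<alpha>' S"
      then obtain y where y: "y \<in> el A' S" "f S x = \<alpha>' S y" by (auto simp: zimg_iff)
      obtain z where z: "z \<in> el A S" "g S (\<alpha>' S y) = \<alpha> S z" using g_img[OF S y(1)] by blast
      obtain w where w: "w \<in> el A S" "g S (f S x) = x \<otimes>\<^bsub>zobj B S\<^esub> \<alpha> S w" using gf[OF S x] by blast
      have cl: "\<alpha> S w \<in> el B S" "\<alpha> S z \<in> el B S" using w z zmod_homD(2)[OF D(4) S] by auto
      \<comment> \<open>Two expressions for g (f x) are compared: x + \<alpha> w, because gf is the
        identity up to boundaries, and \<alpha> z, because f x is a boundary and g preserves
        boundaries.\<close>
      have "x = \<alpha> S z \<otimes>\<^bsub>zobj B S\<^esub> inv\<^bsub>zobj B S\<^esub> \<alpha> S w"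
        using w(2) z(2) y(2) x(1) cl by (metis B.inv_solve_right)
      also have "\<dots> = \<alpha> S (z \<otimes>\<^bsub>zobj A S\<^esub> inv\<^bsub>zobj A S\<^esub> w)"
        using w z S by (simp add: zmod_homD[OF D(4)] zmod_hom_inv[OF D(4) D(1,2)])
      finally show "x \<in> zimg A \<alpha> S" using w z by (auto simp: zimg_iff)
    qed (auto simp: zimg_iff dest: f_img[OF S])
  next
    assume "x \<in> el (submod B' (zker B' C' \<beta>')) S"
    then have x: "x \<in> el B' S" "\<beta>' S x = \<one>\<^bsub>zobj C' S\<^esub>" by (auto simp: zker_iff)
    obtain y where y: "y \<in> el A' S" "f S (g S x) = x \<otimes>\<^bsub>zobj B' S\<^esub> \<alpha>' S y" using fg[OF S x] by blast
    have gx: "g S x \<in> zker B C \<beta> S" using x g_ker[OF S] zmod_homD(2)[OF g S] by (auto simp: zker_iff)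
    have fgx: "f S (g S x) \<in> el B' S" using x zmod_homD(2)[OF g S] zmod_homD(2)[OF f S] by auto
    have cl: "\<alpha>' S y \<in> el B' S" using y zmod_homD(2)[OF D'(4) S] by auto
    have "x = inv\<^bsub>zobj B' S\<^esub> \<alpha>' S y \<otimes>\<^bsub>zobj B' S\<^esub> f S (g S x)"
      using y(2) x(1) cl fgx by (metis B'.inv_closed B'.inv_solve_right B'.m_comm)
    also have "inv\<^bsub>zobj B' S\<^esub> \<alpha>' S y = \<alpha>' S (inv\<^bsub>zobj A' S\<^esub> y)"
      using y S by (simp add: zmod_hom_inv[OF D'(4) D'(1,2)])
    finally have "x = \<alpha>' S (inv\<^bsub>zobj A' S\<^esub> y) \<otimes>\<^bsub>zobj B' S\<^esub> f S (g S x)" .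
    moreover have "\<alpha>' S (inv\<^bsub>zobj A' S\<^esub> y) \<in> zimg A' \<alpha>' S" using y by (auto simp: zimg_iff)
    ultimately show "\<exists>z \<in> el (submod B (zker B C \<beta>)) S. \<exists>k \<in> zimg A' \<alpha>' S.
        x = k \<otimes>\<^bsub>zobj (submod B' (zker B' C' \<beta>')) S\<^esub> f S z"
      using gx by auto
  }
qed

text \<open>On a cycle the summand t (\<beta> x) of the homotopy vanishes and the summand \<alpha>
  (s x) is a boundary, which is what \<open>homology_iso\<close> asks for.\<close>

lemma homology_homotopy_equiv:
  assumes z: "zseq G A B C \<alpha> \<beta>" and z': "zseq G A' B' C' \<alpha>' \<beta>'"
    and fA: "zmod_hom G A A' fA" and fB: "zmod_hom G B B' fB" and fC: "zmod_hom G C C' fC"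
    and gA: "zmod_hom G A' A gA" and gB: "zmod_hom G B' B gB" and gC: "zmod_hom G C' C gC"
    and f_sq: "\<And>S x. gset G S \<Longrightarrow> x \<in> el A S \<Longrightarrow> fB S (\<alpha> S x) = \<alpha>' S (fA S x)"
      "\<And>S x. gset G S \<Longrightarrow> x \<in> el B S \<Longrightarrow> \<beta>' S (fB S x) = fC S (\<beta> S x)"
    and g_sq: "\<And>S x. gset G S \<Longrightarrow> x \<in> el A' S \<Longrightarrow> gB S (\<alpha>' S x) = \<alpha> S (gA S x)"
      "\<And>S x. gset G S \<Longrightarrow> x \<in> el B' S \<Longrightarrow> \<beta> S (gB S x) = gC S (\<beta>' S x)"
    and s: "zmod_hom G B A s" and t: "zmod_hom G C B t" and s': "zmod_hom G B' A' s'" and t': "zmod_hom G C' B' t'"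
    and h: "\<And>S x. gset G S \<Longrightarrow> x \<in> el B S \<Longrightarrow>
      gB S (fB S x) = x \<otimes>\<^bsub>zobj B S\<^esub> (\<alpha> S (s S x) \<otimes>\<^bsub>zobj B S\<^esub> t S (\<beta> S x))"
    and h': "\<And>S x. gset G S \<Longrightarrow> x \<in> el B' S \<Longrightarrow>
      fB S (gB S x) = x \<otimes>\<^bsub>zobj B' S\<^esub> (\<alpha>' S (s' S x) \<otimes>\<^bsub>zobj B' S\<^esub> t' S (\<beta>' S x))"
  shows "zmod_iso G (homology A B C \<alpha> \<beta>) (homology A' B' C' \<alpha>' \<beta>')"
proof (rule homology_iso[OF z z' fB gB])
  note m = zseqD(1-5)[OF z] and m' = zseqD(1-5)[OF z']
  fix S assume S: "gset G S"
  show "\<beta>' S (fB S x) = \<one>\<^bsub>zobj C' S\<^esub>" if "x \<in> el B S" "\<beta> S x = \<one>\<^bsub>zobj C S\<^esub>" for x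
    unfolding f_sq(2)[OF S that(1)] that(2) by (rule zmod_hom_one[OF fC m(3) m'(3) S])
  show "\<beta> S (gB S x) = \<one>\<^bsub>zobj C S\<^esub>" if "x \<in> el B' S" "\<beta>' S x = \<one>\<^bsub>zobj C' S\<^esub>" for x
    unfolding g_sq(2)[OF S that(1)] that(2) by (rule zmod_hom_one[OF gC m'(3) m(3) S])
  show "\<exists>y \<in> el A' S. fB S (\<alpha> S x) = \<alpha>' S y" if x: "x \<in> el A S" for x
    by (rule bexI[OF _ zmod_homD(2)[OF fA S x]], rule f_sq(1)[OF S x])
  show "\<exists>y \<in> el A S. gB S (\<alpha>' S x) = \<alpha> S y" if x: "x \<in> el A' S" for x
    by (rule bexI[OF _ zmod_homD(2)[OF gA S x]], rule g_sq(1)[OF S x])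
  show "\<exists>y \<in> el A S. gB S (fB S x) = x \<otimes>\<^bsub>zobj B S\<^esub> \<alpha> S y" if x: "x \<in> el B S" and c: "\<beta> S x = \<one>\<^bsub>zobj C S\<^esub>" for x
  proof (rule bexI[OF _ zmod_homD(2)[OF s S x]])
    interpret comm_group "zobj B S" by (rule zm_comm_group[OF m(2) S])
    show "gB S (fB S x) = x \<otimes>\<^bsub>zobj B S\<^esub> \<alpha> S (s S x)"
      unfolding h[OF S x] c zmod_hom_one[OF t m(3,2) S] r_one[OF zmod_homD(2)[OF m(4) S zmod_homD(2)[OF s S x]]] ..
  qed
  show "\<exists>y \<in> el A' S. fB S (gB S x) = x \<otimes>\<^bsub>zobj B' S\<^esub> \<alpha>' S y" if x: "x \<in> el B' S" and c: "\<beta>' S x = \<one>\<^bsub>zobj C' S\<^esub>" for x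
  proof (rule bexI[OF _ zmod_homD(2)[OF s' S x]])
    interpret comm_group "zobj B' S" by (rule zm_comm_group[OF m'(2) S])
    show "fB S (gB S x) = x \<otimes>\<^bsub>zobj B' S\<^esub> \<alpha>' S (s' S x)"
      unfolding h'[OF S x] c zmod_hom_one[OF t' m'(3,2) S] r_one[OF zmod_homD(2)[OF m'(4) S zmod_homD(2)[OF s' S x]]] ..
  qed
qed

section \<open>The box product\<close>

text \<open>The induction principle for free abelian groups closes under subtraction, so both
  homomorphisms are first shown to respect differences.\<close>

lemma free_hom_eq:
  assumes L: "group L" and h: "h \<in> hom (free_Abelian_group A) L" and k: "k \<in> hom (free_Abelian_group A) L"
    and eq: "\<And>x. x \<in> A \<Longrightarrow> h (frag_of x) = k (frag_of x)" and x: "x \<in> carrier (free_Abelian_group A)"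
  shows "h x = k x"
proof -
  interpret L: group L by fact
  have one: "f 0 = \<one>\<^bsub>L\<^esub>" if "f \<in> hom (free_Abelian_group A) L" for f
    using hom_one[OF that group_free_Abelian_group L] by simp
  have diff: "f (x - y) = f x \<otimes>\<^bsub>L\<^esub> inv\<^bsub>L\<^esub> f y"
    if f: "f \<in> hom (free_Abelian_group A) L" and "Poly_Mapping.keys x \<subseteq> A" "Poly_Mapping.keys y \<subseteq> A" for f x y
  proof -
    have "f (x - y) \<otimes>\<^bsub>L\<^esub> f y = f x"
      using hom_mult[OF f, of "x - y" y] that keys_diff[of x y] by force
    moreover have "f (x - y) \<in> carrier L" "f y \<in> carrier L" "f x \<in> carrier L"
      using hom_in_carrier[OF f] that(2,3) keys_diff[of x y] by auto
    ultimately show ?thesis using L.inv_solve_right by metis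
  qed
  from x have "Poly_Mapping.keys x \<subseteq> A" by simp
  then show ?thesis
    by (induction rule: free_Abelian_group_induct[consumes 1]) (auto simp: one[OF h] one[OF k] diff[OF h] diff[OF k] eq)
qed

section \<open>The presentation of the box product and its universal property\<close>

lemma box_gens_iff [simp]:
  "(X, Y, \<phi>, m, n) \<in> box_gens G M N S \<longleftrightarrow> gset G X \<and> gset G Y \<and>
     \<phi> \<in> bz_hom G S (gset_prod G X Y) \<and> m \<in> el M X \<and> n \<in> el N Y"
  by (simp add: box_gens_def)

lemma zobj_box: "zobj (box G M N) S = free_Abelian_group (box_gens G M N S) Mod box_ker G M N S"
  by (simp add: box_def zobj_quot box_pre_def)

abbreviation box_cl ::
  "'g monoid \<Rightarrow> ('g, 'm) zmod \<Rightarrow> ('g, 'n) zmod \<Rightarrow> 'g gset \<Rightarrow> ('g, 'm, 'n) boxgen \<Rightarrow> (('g, 'm, 'n) boxgen \<Rightarrow>\<^sub>0 int) set"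
  where "box_cl G M N S x \<equiv> box_ker G M N S #>\<^bsub>free_Abelian_group (box_gens G M N S)\<^esub> frag_of x"

text \<open>The relations of the presentation are differences in a free group. Recast as relations
  between generators there are only two shapes, a three-term one for additivity in each variable and
  a two-term one for the coend, so later arguments treat two cases instead of four.\<close>

inductive box_rel3 ::
  "'g monoid \<Rightarrow> ('g, 'm) zmod \<Rightarrow> ('g, 'n) zmod \<Rightarrow> 'g gset
    \<Rightarrow> ('g, 'm, 'n) boxgen \<Rightarrow> ('g, 'm, 'n) boxgen \<Rightarrow> ('g, 'm, 'n) boxgen \<Rightarrow> bool"
  for G M N S where
  "gset G X \<Longrightarrow> gset G Y \<Longrightarrow> \<phi> \<in> bz_hom G S (gset_prod G X Y) \<Longrightarrow> \<psi> \<in> bz_hom G S (gset_prod G X Y) \<Longrightarrow> m \<in> el M X \<Longrightarrow> n \<in> el N Y \<Longrightarrow>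
    box_rel3 G M N S (X, Y, bz_add \<phi> \<psi>, m, n) (X, Y, \<phi>, m, n) (X, Y, \<psi>, m, n)"
| "gset G X \<Longrightarrow> gset G Y \<Longrightarrow> \<phi> \<in> bz_hom G S (gset_prod G X Y) \<Longrightarrow> m \<in> el M X \<Longrightarrow> m' \<in> el M X \<Longrightarrow> n \<in> el N Y \<Longrightarrow>
    box_rel3 G M N S (X, Y, \<phi>, m \<otimes>\<^bsub>zobj M X\<^esub> m', n) (X, Y, \<phi>, m, n) (X, Y, \<phi>, m', n)"
| "gset G X \<Longrightarrow> gset G Y \<Longrightarrow> \<phi> \<in> bz_hom G S (gset_prod G X Y) \<Longrightarrow> m \<in> el M X \<Longrightarrow> n \<in> el N Y \<Longrightarrow> n' \<in> el N Y \<Longrightarrow>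
    box_rel3 G M N S (X, Y, \<phi>, m, n \<otimes>\<^bsub>zobj N Y\<^esub> n') (X, Y, \<phi>, m, n) (X, Y, \<phi>, m, n')"

inductive box_rel2 ::
  "'g monoid \<Rightarrow> ('g, 'm) zmod \<Rightarrow> ('g, 'n) zmod \<Rightarrow> 'g gset \<Rightarrow> ('g, 'm, 'n) boxgen \<Rightarrow> ('g, 'm, 'n) boxgen \<Rightarrow> bool"
  for G M N S where
  "gset G X \<Longrightarrow> gset G Y \<Longrightarrow> \<phi> \<in> bz_hom G S (gset_prod G X Y) \<Longrightarrow> gset G X' \<Longrightarrow> gset G Y' \<Longrightarrow>
    f \<in> bz_hom G X X' \<Longrightarrow> h \<in> bz_hom G Y Y' \<Longrightarrow> m \<in> el M X' \<Longrightarrow> n \<in> el N Y' \<Longrightarrow>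
    box_rel2 G M N S (X', Y', bz_comp (gset_prod G X Y) (bz_prod X Y X' Y' f h) \<phi>, m, n)
      (X, Y, \<phi>, zmor M X X' f m, zmor N Y Y' h n)"

lemma box_relsE:
  assumes "r \<in> box_rels G M N S"
  obtains x y z where "box_rel3 G M N S x y z" "r = frag_of x - frag_of y - frag_of z"
    | x y where "box_rel2 G M N S x y" "r = frag_of x - frag_of y"
  using assms unfolding box_rels_def
  by (elim UnE CollectE exE conjE)
    (rule that(1)[OF box_rel3.intros(1)] that(1)[OF box_rel3.intros(2)] that(1)[OF box_rel3.intros(3)] that(2)[OF box_rel2.intros]; assumption)+

lemma box_rels_rel3: "box_rel3 G M N S x y z \<Longrightarrow> frag_of x - frag_of y - frag_of z \<in> box_rels G M N S"
  unfolding box_rels_def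
  apply (erule box_rel3.cases; hypsubst)
    apply (rule UnI1, rule UnI1, rule UnI1, rule CollectI, intro exI conjI, rule refl; assumption)
   apply (rule UnI1, rule UnI1, rule UnI2, rule CollectI, intro exI conjI, rule refl; assumption)
  apply (rule UnI1, rule UnI2, rule CollectI, intro exI conjI, rule refl; assumption)
  done

lemma box_rels_rel2: "box_rel2 G M N S x y \<Longrightarrow> frag_of x - frag_of y \<in> box_rels G M N S"
  unfolding box_rels_def
  by (erule box_rel2.cases, hypsubst) (rule UnI2, rule CollectI, intro exI conjI, rule refl; assumption)

text \<open>The compatibility under which a function on generators descends to a homomorphism out of
  the box product; the analogue of a balanced bilinear map for a tensor product.\<close>

definition box_balanced ::
  "'g monoid \<Rightarrow> ('g, 'm) zmod \<Rightarrow> ('g, 'n) zmod \<Rightarrow> 'g gset \<Rightarrow> 'l monoid \<Rightarrow> (('g, 'm, 'n) boxgen \<Rightarrow> 'l) \<Rightarrow> bool"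
  where "box_balanced G M N S L \<beta> \<longleftrightarrow> (\<forall>x \<in> box_gens G M N S. \<beta> x \<in> carrier L) \<and>
    (\<forall>x y z. box_rel3 G M N S x y z \<longrightarrow> \<beta> x = \<beta> y \<otimes>\<^bsub>L\<^esub> \<beta> z) \<and> (\<forall>x y. box_rel2 G M N S x y \<longrightarrow> \<beta> x = \<beta> y)"

lemma box_balanced_rel:
  assumes "box_balanced G M N S L \<beta>"
  shows "x \<in> box_gens G M N S \<Longrightarrow> \<beta> x \<in> carrier L"
    and "box_rel3 G M N S x y z \<Longrightarrow> \<beta> x = \<beta> y \<otimes>\<^bsub>L\<^esub> \<beta> z" and "box_rel2 G M N S x y \<Longrightarrow> \<beta> x = \<beta> y"
  using assms unfolding box_balanced_def by blast+

lemma box_balancedD: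
  assumes "box_balanced G M N S L \<beta>" "gset G X" "gset G Y" "\<phi> \<in> bz_hom G S (gset_prod G X Y)"
  shows "m \<in> el M X \<Longrightarrow> n \<in> el N Y \<Longrightarrow> \<beta> (X, Y, \<phi>, m, n) \<in> carrier L"
    and "\<psi> \<in> bz_hom G S (gset_prod G X Y) \<Longrightarrow> m \<in> el M X \<Longrightarrow> n \<in> el N Y \<Longrightarrow>
      \<beta> (X, Y, bz_add \<phi> \<psi>, m, n) = \<beta> (X, Y, \<phi>, m, n) \<otimes>\<^bsub>L\<^esub> \<beta> (X, Y, \<psi>, m, n)"
    and "m \<in> el M X \<Longrightarrow> m' \<in> el M X \<Longrightarrow> n \<in> el N Y \<Longrightarrow>
       \<beta> (X, Y, \<phi>, m \<otimes>\<^bsub>zobj M X\<^esub> m', n) = \<beta> (X, Y, \<phi>, m, n) \<otimes>\<^bsub>L\<^esub> \<beta> (X, Y, \<phi>, m', n)"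
    and "m \<in> el M X \<Longrightarrow> n \<in> el N Y \<Longrightarrow> n' \<in> el N Y \<Longrightarrow>
       \<beta> (X, Y, \<phi>, m, n \<otimes>\<^bsub>zobj N Y\<^esub> n') = \<beta> (X, Y, \<phi>, m, n) \<otimes>\<^bsub>L\<^esub> \<beta> (X, Y, \<phi>, m, n')"
    and "gset G X' \<Longrightarrow> gset G Y' \<Longrightarrow> f \<in> bz_hom G X X' \<Longrightarrow> h \<in> bz_hom G Y Y' \<Longrightarrow>
       m' \<in> el M X' \<Longrightarrow> n' \<in> el N Y' \<Longrightarrow>
       \<beta> (X', Y', bz_comp (gset_prod G X Y) (bz_prod X Y X' Y' f h) \<phi>, m', n')
         = \<beta> (X, Y, \<phi>, zmor M X X' f m', zmor N Y Y' h n')"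
proof -
  note R = box_balanced_rel[OF assms(1)]
  show "m \<in> el M X \<Longrightarrow> n \<in> el N Y \<Longrightarrow> \<beta> (X, Y, \<phi>, m, n) \<in> carrier L" using R(1) assms(2-4) by simp
qed (rule box_balanced_rel(2)[OF assms(1) box_rel3.intros(1)[OF assms(2-4)]] box_balanced_rel(2)[OF assms(1) box_rel3.intros(2)[OF assms(2-4)]]
    box_balanced_rel(2)[OF assms(1) box_rel3.intros(3)[OF assms(2-4)]] box_balanced_rel(3)[OF assms(1) box_rel2.intros[OF assms(2-4)]]; assumption)+

lemma box_balancedI:
  assumes "\<And>X Y \<phi> m n. gset G X \<Longrightarrow> gset G Y \<Longrightarrow> \<phi> \<in> bz_hom G S (gset_prod G X Y) \<Longrightarrow>
       m \<in> el M X \<Longrightarrow> n \<in> el N Y \<Longrightarrow> \<beta> (X, Y, \<phi>, m, n) \<in> carrier L"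
    "\<And>X Y \<phi> \<psi> m n. gset G X \<Longrightarrow> gset G Y \<Longrightarrow>
       \<phi> \<in> bz_hom G S (gset_prod G X Y) \<Longrightarrow> \<psi> \<in> bz_hom G S (gset_prod G X Y) \<Longrightarrow>
       m \<in> el M X \<Longrightarrow> n \<in> el N Y \<Longrightarrow>
       \<beta> (X, Y, bz_add \<phi> \<psi>, m, n) = \<beta> (X, Y, \<phi>, m, n) \<otimes>\<^bsub>L\<^esub> \<beta> (X, Y, \<psi>, m, n)"
    "\<And>X Y \<phi> m m' n. gset G X \<Longrightarrow> gset G Y \<Longrightarrow> \<phi> \<in> bz_hom G S (gset_prod G X Y) \<Longrightarrow>
       m \<in> el M X \<Longrightarrow> m' \<in> el M X \<Longrightarrow> n \<in> el N Y \<Longrightarrow>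
       \<beta> (X, Y, \<phi>, m \<otimes>\<^bsub>zobj M X\<^esub> m', n) = \<beta> (X, Y, \<phi>, m, n) \<otimes>\<^bsub>L\<^esub> \<beta> (X, Y, \<phi>, m', n)"
    "\<And>X Y \<phi> m n n'. gset G X \<Longrightarrow> gset G Y \<Longrightarrow> \<phi> \<in> bz_hom G S (gset_prod G X Y) \<Longrightarrow>
       m \<in> el M X \<Longrightarrow> n \<in> el N Y \<Longrightarrow> n' \<in> el N Y \<Longrightarrow>
       \<beta> (X, Y, \<phi>, m, n \<otimes>\<^bsub>zobj N Y\<^esub> n') = \<beta> (X, Y, \<phi>, m, n) \<otimes>\<^bsub>L\<^esub> \<beta> (X, Y, \<phi>, m, n')"
    "\<And>X Y X' Y' f h \<phi> m n. gset G X \<Longrightarrow> gset G Y \<Longrightarrow> gset G X' \<Longrightarrow> gset G Y' \<Longrightarrow>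
       f \<in> bz_hom G X X' \<Longrightarrow> h \<in> bz_hom G Y Y' \<Longrightarrow> \<phi> \<in> bz_hom G S (gset_prod G X Y) \<Longrightarrow>
       m \<in> el M X' \<Longrightarrow> n \<in> el N Y' \<Longrightarrow>
       \<beta> (X', Y', bz_comp (gset_prod G X Y) (bz_prod X Y X' Y' f h) \<phi>, m, n)
         = \<beta> (X, Y, \<phi>, zmor M X X' f m, zmor N Y Y' h n)"
  shows "box_balanced G M N S L \<beta>"
  unfolding box_balanced_def
proof (intro conjI ballI allI impI)
  fix x assume "x \<in> box_gens G M N S"
  then show "\<beta> x \<in> carrier L" by (cases x) (simp add: assms(1))
next
  fix x y z assume "box_rel3 G M N S x y z"
  then show "\<beta> x = \<beta> y \<otimes>\<^bsub>L\<^esub> \<beta> z" by cases (simp_all add: assms(2-4))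
next
  fix x y assume "box_rel2 G M N S x y"
  then show "\<beta> x = \<beta> y" by cases (simp add: assms(5))
qed

context
  fixes G :: "'g monoid" and M :: "('g, 'm) zmod" and N :: "('g, 'n) zmod"
  assumes M: "zmodule G M" and N: "zmodule G N"
begin

lemma box_rel3_gens: "box_rel3 G M N S x y z \<Longrightarrow> x \<in> box_gens G M N S \<and> y \<in> box_gens G M N S \<and> z \<in> box_gens G M N S"
  by (erule box_rel3.cases) (simp_all add: zm_m_closed[OF M] zm_m_closed[OF N])

lemma box_rel2_gens: "box_rel2 G M N S x y \<Longrightarrow> x \<in> box_gens G M N S \<and> y \<in> box_gens G M N S"
  by (erule box_rel2.cases)
    (simp add: zm_closed[OF M] zm_closed[OF N] bz_comp_in[OF finite_gset_prod] bz_prod_in)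

lemma free_diff: "x \<in> carrier (free_Abelian_group A) \<Longrightarrow> y \<in> carrier (free_Abelian_group A) \<Longrightarrow> x - y \<in> carrier (free_Abelian_group A)"
  using keys_diff[of x y] by auto

lemma box_rels_subset: "box_rels G M N S \<subseteq> carrier (free_Abelian_group (box_gens G M N S))"
proof
  fix r assume "r \<in> box_rels G M N S"
  then show "r \<in> carrier (free_Abelian_group (box_gens G M N S))"
  proof (cases rule: box_relsE)
    case (1 x y z)
    then show ?thesis using box_rel3_gens[OF 1(1)] by (simp only: 1(2)) (intro free_diff; simp)
  next
    case (2 x y)
    then show ?thesis using box_rel2_gens[OF 2(1)] by (simp only: 2(2)) (intro free_diff; simp)
  qed
qed

lemma box_ker_subgroup:
  assumes S: "gset G S" shows "subgroup (box_ker G M N S) (free_Abelian_group (box_gens G M N S))"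
  unfolding box_ker_def
  using group.generate_is_subgroup[OF group_free_Abelian_group box_rels_subset] by (simp add: box_pre_def)

lemma box_ker_normal:
  assumes S: "gset G S" shows "box_ker G M N S \<lhd> free_Abelian_group (box_gens G M N S)"
  using box_ker_subgroup[OF S] comm_group.normal_iff_subgroup[OF abelian_free_Abelian_group] by blast

lemma box_rels_ker: "box_rels G M N S \<subseteq> box_ker G M N S"
  unfolding box_ker_def by (auto intro: generate.incl)

lemma box_comm_group:
  assumes S: "gset G S" shows "comm_group (zobj (box G M N) S)"
  unfolding zobj_box by (rule comm_group.abelian_FactGroup[OF abelian_free_Abelian_group box_ker_subgroup[OF S]])

lemma box_proj_hom:
  assumes S: "gset G S"
  shows "(\<lambda>x. box_ker G M N S #>\<^bsub>free_Abelian_group (box_gens G M N S)\<^esub> x)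
    \<in> hom (free_Abelian_group (box_gens G M N S)) (zobj (box G M N) S)"
  unfolding zobj_box by (rule normal.r_coset_hom_Mod[OF box_ker_normal[OF S]])

lemma box_cl_closed:
  assumes S: "gset G S" and "x \<in> box_gens G M N S"
  shows "box_cl G M N S x \<in> el (box G M N) S"
  using hom_in_carrier[OF box_proj_hom[OF S], of "frag_of x"] assms(2) by simp

text \<open>The classes of generators generate the quotient. Nearly all identities about box
  products below are checked through this principle.\<close>

lemma box_hom_eq:
  assumes S: "gset G S" and L: "group L"
    and h: "h \<in> hom (zobj (box G M N) S) L" and k: "k \<in> hom (zobj (box G M N) S) L"
    and eq: "\<And>x. x \<in> box_gens G M N S \<Longrightarrow> h (box_cl G M N S x) = k (box_cl G M N S x)"
    and x: "x \<in> el (box G M N) S"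
  shows "h x = k x"
proof -
  let ?F = "free_Abelian_group (box_gens G M N S)"
  from x obtain y where y: "y \<in> carrier ?F" "x = box_ker G M N S #>\<^bsub>?F\<^esub> y"
    by (auto simp: zobj_box carrier_FactGroup)
  have "h (box_ker G M N S #>\<^bsub>?F\<^esub> y) = k (box_ker G M N S #>\<^bsub>?F\<^esub> y)"
    by (rule free_hom_eq[OF L, where h="\<lambda>y. h (box_ker G M N S #>\<^bsub>?F\<^esub> y)" and k="\<lambda>y. k (box_ker G M N S #>\<^bsub>?F\<^esub> y)"])
      (use hom_compose[OF box_proj_hom[OF S] h] hom_compose[OF box_proj_hom[OF S] k] y eq in \<open>auto simp: comp_def\<close>)
  then show ?thesis using y by simp
qed

lemma box_cl_rel2:
  assumes S: "gset G S" and "x \<in> box_gens G M N S" "y \<in> box_gens G M N S"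
    and r: "frag_of x - frag_of y \<in> box_rels G M N S"
  shows "box_cl G M N S x = box_cl G M N S y"
proof -
  have "frag_of x \<otimes>\<^bsub>free_Abelian_group (box_gens G M N S)\<^esub> inv\<^bsub>free_Abelian_group (box_gens G M N S)\<^esub> frag_of y
      \<in> box_ker G M N S"
    using assms subsetD[OF box_rels_ker r] by simp
  then show ?thesis
    using comm_group.rcos_eq_iff[OF abelian_free_Abelian_group box_ker_subgroup[OF S]] assms(2,3) by simp
qed

lemma box_cl_rel3:
  assumes S: "gset G S" and "x \<in> box_gens G M N S" "y \<in> box_gens G M N S" "z \<in> box_gens G M N S"
    and r: "frag_of x - frag_of y - frag_of z \<in> box_rels G M N S"
  shows "box_cl G M N S x = box_cl G M N S y \<otimes>\<^bsub>zobj (box G M N) S\<^esub> box_cl G M N S z"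
proof -
  let ?F = "free_Abelian_group (box_gens G M N S)"
  have yz: "frag_of y + frag_of z \<in> carrier ?F"
    using assms(3,4) keys_add[of "frag_of y" "frag_of z"] by auto
  then have "frag_of x \<otimes>\<^bsub>?F\<^esub> inv\<^bsub>?F\<^esub> (frag_of y + frag_of z) \<in> box_ker G M N S"
    using subsetD[OF box_rels_ker r] by (simp add: diff_diff_eq del: minus_add_distrib)
  then have "box_cl G M N S x = box_ker G M N S #>\<^bsub>?F\<^esub> (frag_of y + frag_of z)"
    using comm_group.rcos_eq_iff[OF abelian_free_Abelian_group box_ker_subgroup[OF S]] assms(2) yz
    by (simp del: minus_add_distrib)
  also have "\<dots> = box_cl G M N S y \<otimes>\<^bsub>zobj (box G M N) S\<^esub> box_cl G M N S z"
    using hom_mult[OF box_proj_hom[OF S], of "frag_of y" "frag_of z"] assms(3,4) by simp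
  finally show ?thesis .
qed

lemma box_cl_balanced:
  assumes S: "gset G S" shows "box_balanced G M N S (zobj (box G M N) S) (box_cl G M N S)"
  unfolding box_balanced_def
proof (intro conjI ballI allI impI)
  show "box_cl G M N S x \<in> el (box G M N) S" if "x \<in> box_gens G M N S" for x by (rule box_cl_closed[OF S that])
  show "box_cl G M N S x = box_cl G M N S y \<otimes>\<^bsub>zobj (box G M N) S\<^esub> box_cl G M N S z" if "box_rel3 G M N S x y z" for x y z
    using box_rel3_gens[OF that] by (intro box_cl_rel3[OF S _ _ _ box_rels_rel3[OF that]]) simp_all
  show "box_cl G M N S x = box_cl G M N S y" if "box_rel2 G M N S x y" for x y
    using box_rel2_gens[OF that] by (intro box_cl_rel2[OF S _ _ box_rels_rel2[OF that]]) simp_all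
qed

text \<open>Universal property: extend \<beta> to the free abelian group, observe that balancedness
  kills the relations, and pass to the quotient.\<close>

lemma box_lift:
  assumes S: "gset G S" and L: "comm_group L" and \<beta>: "box_balanced G M N S L \<beta>"
  obtains h where "h \<in> hom (zobj (box G M N) S) L"
    and "\<And>x. x \<in> box_gens G M N S \<Longrightarrow> h (box_cl G M N S x) = \<beta> x"
proof -
  let ?A = "box_gens G M N S"
  let ?F = "free_Abelian_group ?A"
  interpret L: comm_group L by fact
  interpret F: comm_group ?F by (rule abelian_free_Abelian_group)
  have "\<beta> ` ?A \<subseteq> carrier L" using box_balanced_rel(1)[OF \<beta>] by blast
  then obtain h where h: "h \<in> hom ?F L" and h_frag: "\<And>x. x \<in> ?A \<Longrightarrow> h (frag_of x) = \<beta> x"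
    using L.free_Abelian_group_universal by metis
  interpret h: group_hom ?F L h
    by (rule group_hom.intro[OF F.is_group L.is_group group_hom_axioms.intro[OF h]])
  have h_diff: "h (x - y) = h x \<otimes>\<^bsub>L\<^esub> inv\<^bsub>L\<^esub> h y" if "x \<in> carrier ?F" "y \<in> carrier ?F" for x y
    using that h.hom_mult[of x "inv\<^bsub>?F\<^esub> y"] F.inv_closed[of y] by (simp add: h.hom_inv[symmetric])
  have r3: "h (frag_of x - frag_of y - frag_of z) = \<one>\<^bsub>L\<^esub>"
    if "x \<in> ?A" "y \<in> ?A" "z \<in> ?A" "\<beta> x = \<beta> y \<otimes>\<^bsub>L\<^esub> \<beta> z" for x y z
  proof -
    have fr: "frag_of x \<in> carrier ?F" "frag_of y \<in> carrier ?F" "frag_of z \<in> carrier ?F" using that by auto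
    have c: "\<beta> y \<in> carrier L" "\<beta> z \<in> carrier L" using box_balanced_rel(1)[OF \<beta>] that(2,3) by blast+
    have "h (frag_of x - frag_of y - frag_of z) = (\<beta> y \<otimes>\<^bsub>L\<^esub> \<beta> z) \<otimes>\<^bsub>L\<^esub> inv\<^bsub>L\<^esub> \<beta> y \<otimes>\<^bsub>L\<^esub> inv\<^bsub>L\<^esub> \<beta> z"
      using h_diff[OF free_diff[OF fr(1,2)] fr(3)] h_diff[OF fr(1,2)] h_frag that by simp
    also have "\<dots> = \<one>\<^bsub>L\<^esub>" using c by (metis L.inv_mult L.m_assoc L.m_closed L.r_inv L.inv_closed)
    finally show ?thesis .
  qed
  have r2: "h (frag_of x - frag_of y) = \<one>\<^bsub>L\<^esub>" if "x \<in> ?A" "y \<in> ?A" "\<beta> x = \<beta> y" for x y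
  proof -
    have fr: "frag_of x \<in> carrier ?F" "frag_of y \<in> carrier ?F" using that by auto
    have c: "\<beta> y \<in> carrier L" using box_balanced_rel(1)[OF \<beta>] that(2) by blast
    show ?thesis using h_diff[OF fr] h_frag that c by simp
  qed
  have rels: "h r = \<one>\<^bsub>L\<^esub>" if "r \<in> box_rels G M N S" for r
    using that
  proof (cases rule: box_relsE)
    case (1 x y z)
    then show ?thesis using r3[of x y z] box_rel3_gens[OF 1(1)] box_balanced_rel(2)[OF \<beta> 1(1)] by simp
  next
    case (2 x y)
    then show ?thesis using r2[of x y] box_rel2_gens[OF 2(1)] box_balanced_rel(3)[OF \<beta> 2(1)] by simp
  qed
  \<comment> \<open>The kernel of \<open>h\<close> is a subgroup, so it contains everything
    generated by the relations once it contains the relations.\<close>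
  have "box_ker G M N S \<subseteq> kernel ?F L h"
  proof -
    have "box_rels G M N S \<subseteq> kernel ?F L h"
      using rels box_rels_subset unfolding kernel_def by blast
    then show ?thesis
      unfolding box_ker_def box_pre_def
      using F.generate_subgroup_incl[OF _ h.subgroup_kernel] by simp
  qed
  then have ker: "h x = \<one>\<^bsub>L\<^esub>" if "x \<in> box_ker G M N S" for x using that by (auto simp: kernel_def)
  have "h x = h y"
    if xy: "x \<in> carrier ?F" "y \<in> carrier ?F" "box_ker G M N S #>\<^bsub>?F\<^esub> x = box_ker G M N S #>\<^bsub>?F\<^esub> y" for x y
  proof -
    have "x - y \<in> box_ker G M N S"
      using F.rcos_eq_iff[OF box_ker_subgroup[OF S] xy(1,2)] xy by simp
    then have "h x \<otimes>\<^bsub>L\<^esub> inv\<^bsub>L\<^esub> h y = \<one>\<^bsub>L\<^esub>" using ker h_diff[OF xy(1,2)] by simp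
    moreover have "h x \<in> carrier L" "h y \<in> carrier L" using h.hom_closed xy(1,2) by auto
    ultimately show ?thesis by (metis L.inv_closed L.inv_equality L.inv_inv)
  qed
  then obtain k where "k \<in> hom (?F Mod box_ker G M N S) L"
    "\<And>x. x \<in> carrier ?F \<Longrightarrow> k (box_ker G M N S #>\<^bsub>?F\<^esub> x) = h x"
    using FactGroup_universal[OF h box_ker_normal[OF S]] by metis
  then show thesis using that[of k] h_frag by (simp add: zobj_box)
qed

end

subsection \<open>Maps out of box products induced by maps of generators\<close>

text \<open>The maps between box products are defined as a concrete \<open>coset_map\<close>,
  whereas \<open>box_lift\<close> yields an abstract homomorphism. Showing that both agree on
  classes transfers well-definedness to the concrete map.\<close>

lemma box_coset_map:
  assumes M: "zmodule G M" and N: "zmodule G N" and M': "zmodule G M'" and N': "zmodule G N'"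
    and S: "gset G S" and T: "gset G T"
    and r: "\<And>x. x \<in> box_gens G M N T \<Longrightarrow> r x \<in> box_gens G M' N' S"
    and bal: "box_balanced G M N T (zobj (box G M' N') S) (\<lambda>x. box_cl G M' N' S (r x))"
  defines "\<rho> \<equiv> coset_map (free_Abelian_group (box_gens G M' N' S)) (box_ker G M' N' S) (frag_extend (\<lambda>x. frag_of (r x)))"
  shows "\<rho> \<in> hom (zobj (box G M N) T) (zobj (box G M' N') S)"
    and "\<And>x. x \<in> box_gens G M N T \<Longrightarrow> \<rho> (box_cl G M N T x) = box_cl G M' N' S (r x)"
proof -
  let ?F = "free_Abelian_group (box_gens G M N T)" and ?F' = "free_Abelian_group (box_gens G M' N' S)"
  let ?K = "box_ker G M N T" and ?K' = "box_ker G M' N' S"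
  let ?e = "frag_extend (\<lambda>x. frag_of (r x))"
  interpret F: comm_group ?F by (rule abelian_free_Abelian_group)
  interpret F': comm_group ?F' by (rule abelian_free_Abelian_group)
  interpret B': comm_group "zobj (box G M' N') S" by (rule box_comm_group[OF M' N' S])
  obtain h where h: "h \<in> hom (zobj (box G M N) T) (zobj (box G M' N') S)"
    and h_cl: "\<And>x. x \<in> box_gens G M N T \<Longrightarrow> h (box_cl G M N T x) = box_cl G M' N' S (r x)"
    using box_lift[OF M N T box_comm_group[OF M' N' S] bal] by metis
  have e: "?e \<in> hom ?F ?F'"
  proof (rule homI)
    fix x assume "x \<in> carrier ?F"
    then have "Poly_Mapping.keys (?e x) \<subseteq> (\<Union>y \<in> Poly_Mapping.keys x. Poly_Mapping.keys (frag_of (r y)))"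
      by (intro keys_frag_extend)
    with \<open>x \<in> carrier ?F\<close> r show "?e x \<in> carrier ?F'" by fastforce
  qed (simp add: frag_extend_add)
  have eq: "?K' #>\<^bsub>?F'\<^esub> ?e x = h (?K #>\<^bsub>?F\<^esub> x)" if "x \<in> carrier ?F" for x
    by (rule free_hom_eq[OF B'.is_group, where h="\<lambda>x. ?K' #>\<^bsub>?F'\<^esub> ?e x" and k="\<lambda>x. h (?K #>\<^bsub>?F\<^esub> x)"])
      (use hom_compose[OF e box_proj_hom[OF M' N' S]] hom_compose[OF box_proj_hom[OF M N T] h] that h_cl
        in \<open>auto simp: comp_def\<close>)
  \<comment> \<open>Deduced from the existence of \<open>h\<close>: an element of \<open>?K\<close>
    has trivial class, \<open>h\<close> preserves this, and the class of \<open>?e x\<close> is that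
    image. The relations need not be inspected again.\<close>
  have eK: "?e x \<in> ?K'" if "x \<in> ?K" for x
  proof -
    have x: "x \<in> carrier ?F" using that box_ker_subgroup[OF M N T] by (rule subgroup.mem_carrier[rotated])
    have "?K' #>\<^bsub>?F'\<^esub> ?e x = h (?K #>\<^bsub>?F\<^esub> x)" by (rule eq[OF x])
    also have "?K #>\<^bsub>?F\<^esub> x = ?K" using subgroup.rcos_const[OF box_ker_subgroup[OF M N T] F.is_group that] .
    also have "h ?K = \<one>\<^bsub>zobj (box G M' N') S\<^esub>"
      using hom_one[OF h comm_group.axioms(2)[OF box_comm_group[OF M N T]] B'.is_group] by (simp add: zobj_box)
    also have "\<dots> = ?K'" by (simp add: zobj_box)
    finally have "?K' #>\<^bsub>?F'\<^esub> ?e x = ?K'" .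
    then show ?thesis
      using F'.rcos_self[OF hom_in_carrier[OF e x] box_ker_subgroup[OF M' N' S]] by simp
  qed
  have \<rho>: "\<rho> (?K #>\<^bsub>?F\<^esub> x) = h (?K #>\<^bsub>?F\<^esub> x)" if "x \<in> carrier ?F" for x
    unfolding \<rho>_def
    using coset_map_eq[OF abelian_free_Abelian_group abelian_free_Abelian_group box_ker_subgroup[OF M N T]
        box_ker_subgroup[OF M' N' S] e eK that] eq[OF that] by simp
  then have "\<rho> X = h X" if "X \<in> el (box G M N) T" for X
    using that by (auto simp: zobj_box carrier_FactGroup)
  then show "\<rho> \<in> hom (zobj (box G M N) T) (zobj (box G M' N') S)"
    using h B'.is_group comm_group.axioms(2)[OF box_comm_group[OF M N T]]
    by (auto simp: hom_def Pi_iff group.is_monoid monoid.m_closed)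
  show "\<rho> (box_cl G M N T x) = box_cl G M' N' S (r x)" if "x \<in> box_gens G M N T" for x
    using \<rho>[of "frag_of x"] h_cl[OF that] that by simp
qed

lemma box_mor:
  assumes M: "zmodule G M" and N: "zmodule G N" and S: "gset G S" and T: "gset G T"
    and \<theta>: "\<theta> \<in> bz_hom G S T"
  shows "zmor (box G M N) S T \<theta> \<in> hom (zobj (box G M N) T) (zobj (box G M N) S)"
    and "(X, Y, \<phi>, m, n) \<in> box_gens G M N T \<Longrightarrow>
      zmor (box G M N) S T \<theta> (box_cl G M N T (X, Y, \<phi>, m, n)) = box_cl G M N S (X, Y, bz_comp T \<phi> \<theta>, m, n)"
proof -
  define r :: "('a, 'b, 'c) boxgen \<Rightarrow> ('a, 'b, 'c) boxgen" where "r = (\<lambda>(X, Y, \<phi>, m, n). (X, Y, bz_comp T \<phi> \<theta>, m, n))"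
  have mor: "zmor (box G M N) S T \<theta> = coset_map (free_Abelian_group (box_gens G M N S)) (box_ker G M N S) (frag_extend (\<lambda>x. frag_of (r x)))"
    by (simp add: box_def box_pre_def r_def case_prod_unfold)
  have r: "r x \<in> box_gens G M N S" if "x \<in> box_gens G M N T" for x
    using that T \<theta> by (cases x) (auto simp: r_def intro: bz_comp_in)
  note B = box_balancedD[OF box_cl_balanced[OF M N S]]
  have cl: "bz_comp T \<phi> \<theta> \<in> bz_hom G S Z" if "\<phi> \<in> bz_hom G T Z" for \<phi> Z
    using bz_comp_in[OF T \<theta> that] .
  have bal: "box_balanced G M N T (zobj (box G M N) S) (\<lambda>x. box_cl G M N S (r x))"
    by (rule box_balancedI) (simp_all add: r_def B cl bz_comp_assoc[symmetric])
  show "zmor (box G M N) S T \<theta> \<in> hom (zobj (box G M N) T) (zobj (box G M N) S)"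
    unfolding mor by (rule box_coset_map[OF M N M N S T r bal])
  show "zmor (box G M N) S T \<theta> (box_cl G M N T (X, Y, \<phi>, m, n)) = box_cl G M N S (X, Y, bz_comp T \<phi> \<theta>, m, n)"
    if "(X, Y, \<phi>, m, n) \<in> box_gens G M N T"
    unfolding mor using box_coset_map(2)[where r=r, OF M N M N S T _ bal that] r by (simp add: r_def)
qed

lemma box_zmodule:
  assumes M: "zmodule G M" and N: "zmodule G N"
  shows "zmodule G (box G M N)"
  unfolding zmodule_def
proof (intro conjI allI impI ballI)
  fix S :: "'a gset" assume "gset G S"
  then show "comm_group (zobj (box G M N) S)" by (rule box_comm_group[OF M N])
next
  fix S T \<phi> assume "gset G S" "gset G T" "\<phi> \<in> bz_hom G S T"
  then show "zmor (box G M N) S T \<phi> \<in> hom (zobj (box G M N) T) (zobj (box G M N) S)" by (rule box_mor[OF M N])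
next
  fix S x assume S: "gset G S" and x: "x \<in> el (box G M N) S"
  note grp = comm_group.axioms(2)[OF box_comm_group[OF M N S]]
  show "zmor (box G M N) S S (bz_id S) x = x"
  proof (rule box_hom_eq[OF M N S grp box_mor(1)[OF M N S S bz_id_in[OF S]] _ _ x, where k="\<lambda>x. x"])
    show "(\<lambda>x. x) \<in> hom (zobj (box G M N) S) (zobj (box G M N) S)" by (simp add: hom_def)
    fix x assume x: "x \<in> box_gens G M N S"
    obtain X Y \<phi> m n where x_eq: "x = (X, Y, \<phi>, m, n)" by (cases x)
    show "zmor (box G M N) S S (bz_id S) (box_cl G M N S x) = box_cl G M N S x"
      using x unfolding x_eq by (simp add: box_mor(2)[OF M N S S bz_id_in[OF S]] bz_comp_id_right[OF S, of \<phi> "gset_prod G X Y"])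
  qed
next
  fix S T U \<phi> \<psi> x assume S: "gset G S" and T: "gset G T" and U: "gset G U"
    and \<phi>: "\<phi> \<in> bz_hom G S T" and \<psi>: "\<psi> \<in> bz_hom G T U" and x: "x \<in> el (box G M N) U"
  note grp = comm_group.axioms(2)[OF box_comm_group[OF M N S]]
  show "zmor (box G M N) S U (bz_comp T \<psi> \<phi>) x = zmor (box G M N) S T \<phi> (zmor (box G M N) T U \<psi> x)"
  proof (rule box_hom_eq[OF M N U grp box_mor(1)[OF M N S U bz_comp_in[OF T \<phi> \<psi>]] _ _ x])
    show "(\<lambda>x. zmor (box G M N) S T \<phi> (zmor (box G M N) T U \<psi> x)) \<in> hom (zobj (box G M N) U) (zobj (box G M N) S)"
      using hom_compose[OF box_mor(1)[OF M N T U \<psi>] box_mor(1)[OF M N S T \<phi>]] by (simp add: comp_def)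
    fix x assume x: "x \<in> box_gens G M N U"
    obtain X Y \<chi> m n where x_eq: "x = (X, Y, \<chi>, m, n)" by (cases x)
    show "zmor (box G M N) S U (bz_comp T \<psi> \<phi>) (box_cl G M N U x) =
        zmor (box G M N) S T \<phi> (zmor (box G M N) T U \<psi> (box_cl G M N U x))"
      using bz_comp_in[OF T \<phi> \<psi>] bz_comp_in[OF U \<psi>] x unfolding x_eq
      by (simp add: box_mor(2)[OF M N] S T U \<phi> \<psi> bz_comp_assoc)
  qed
next
  fix S T \<phi> \<psi> x assume S: "gset G S" and T: "gset G T"
    and \<phi>: "\<phi> \<in> bz_hom G S T" and \<psi>: "\<psi> \<in> bz_hom G S T" and x: "x \<in> el (box G M N) T"
  interpret B: comm_group "zobj (box G M N) S" by (rule box_comm_group[OF M N S])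
  note H = box_mor(1)[OF M N S T \<phi>] box_mor(1)[OF M N S T \<psi>]
  show "zmor (box G M N) S T (bz_add \<phi> \<psi>) x = zmor (box G M N) S T \<phi> x \<otimes>\<^bsub>zobj (box G M N) S\<^esub> zmor (box G M N) S T \<psi> x"
  proof (rule box_hom_eq[OF M N T B.is_group box_mor(1)[OF M N S T bz_add_in[OF \<phi> \<psi>]] _ _ x])
    show "(\<lambda>x. zmor (box G M N) S T \<phi> x \<otimes>\<^bsub>zobj (box G M N) S\<^esub> zmor (box G M N) S T \<psi> x)
        \<in> hom (zobj (box G M N) T) (zobj (box G M N) S)"
      by (rule homI) (simp_all add: hom_in_carrier[OF H(1)] hom_in_carrier[OF H(2)] hom_mult[OF H(1)] hom_mult[OF H(2)] B.m_ac)
    fix x assume x: "x \<in> box_gens G M N T"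
    obtain X Y \<chi> m n where x_eq: "x = (X, Y, \<chi>, m, n)" by (cases x)
    show "zmor (box G M N) S T (bz_add \<phi> \<psi>) (box_cl G M N T x) =
        zmor (box G M N) S T \<phi> (box_cl G M N T x) \<otimes>\<^bsub>zobj (box G M N) S\<^esub> zmor (box G M N) S T \<psi> (box_cl G M N T x)"
      using bz_comp_in[OF T \<phi>] bz_comp_in[OF T \<psi>] x unfolding x_eq
      by (simp add: box_mor(2)[OF M N S T] \<phi> \<psi> box_balancedD(2)[OF box_cl_balanced[OF M N S]])
  qed
qed

lemma zmod_hom_box_eq:
  assumes "zmodule G M" "zmodule G N" "zmodule G L" "zmod_hom G (box G M N) L \<eta>" "zmod_hom G (box G M N) L \<theta>"
    and S: "gset G S" and x: "x \<in> el (box G M N) S"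
    and eq: "\<And>X Y \<phi> m n. gset G X \<Longrightarrow> gset G Y \<Longrightarrow> \<phi> \<in> bz_hom G S (gset_prod G X Y) \<Longrightarrow>
       m \<in> el M X \<Longrightarrow> n \<in> el N Y \<Longrightarrow>
       \<eta> S (box_cl G M N S (X, Y, \<phi>, m, n)) = \<theta> S (box_cl G M N S (X, Y, \<phi>, m, n))"
  shows "\<eta> S x = \<theta> S x"
proof (rule box_hom_eq[OF assms(1,2) S zm_group[OF assms(3) S] zmod_homD(1)[OF assms(4) S] zmod_homD(1)[OF assms(5) S] _ x])
  fix y assume "y \<in> box_gens G M N S"
  then show "\<eta> S (box_cl G M N S y) = \<theta> S (box_cl G M N S y)"
    using eq by (cases y) auto
qed

text \<open>The components come one by one from \<open>box_lift\<close>; naturality in S has to be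
  verified on generators only.\<close>

lemma zmod_hom_from_box:
  assumes M: "zmodule G M" and N: "zmodule G N" and L: "zmodule G L"
    and bal: "\<And>S. gset G S \<Longrightarrow> box_balanced G M N S (zobj L S) (\<beta> S)"
    and nat: "\<And>S T \<theta> X Y \<phi> m n. gset G S \<Longrightarrow> gset G T \<Longrightarrow> \<theta> \<in> bz_hom G S T \<Longrightarrow>
      gset G X \<Longrightarrow> gset G Y \<Longrightarrow> \<phi> \<in> bz_hom G T (gset_prod G X Y) \<Longrightarrow>
       m \<in> el M X \<Longrightarrow> n \<in> el N Y \<Longrightarrow>
       \<beta> S (X, Y, bz_comp T \<phi> \<theta>, m, n) = zmor L S T \<theta> (\<beta> T (X, Y, \<phi>, m, n))"
  obtains \<eta> where "zmod_hom G (box G M N) L \<eta>"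
    "\<And>S x. gset G S \<Longrightarrow> x \<in> box_gens G M N S \<Longrightarrow> \<eta> S (box_cl G M N S x) = \<beta> S x"
proof -
  have "\<exists>h. gset G S \<longrightarrow> h \<in> hom (zobj (box G M N) S) (zobj L S) \<and>
      (\<forall>x \<in> box_gens G M N S. h (box_cl G M N S x) = \<beta> S x)" for S
    using box_lift[OF M N _ zm_comm_group[OF L] bal] by metis
  then obtain \<eta> where \<eta>: "\<And>S. gset G S \<Longrightarrow> \<eta> S \<in> hom (zobj (box G M N) S) (zobj L S)"
      "\<And>S x. gset G S \<Longrightarrow> x \<in> box_gens G M N S \<Longrightarrow> \<eta> S (box_cl G M N S x) = \<beta> S x"
    by metis
  have "zmod_hom G (box G M N) L \<eta>"
    unfolding zmod_hom_def
  proof (intro conjI allI impI ballI \<eta>(1))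
    fix S T \<theta> x assume S: "gset G S" and T: "gset G T" and \<theta>: "\<theta> \<in> bz_hom G S T"
      and x: "x \<in> el (box G M N) T"
    show "\<eta> S (zmor (box G M N) S T \<theta> x) = zmor L S T \<theta> (\<eta> T x)"
    proof (rule box_hom_eq[OF M N T zm_group[OF L S] _ _ _ x])
      show "(\<lambda>x. \<eta> S (zmor (box G M N) S T \<theta> x)) \<in> hom (zobj (box G M N) T) (zobj L S)"
        using hom_compose[OF box_mor(1)[OF M N S T \<theta>] \<eta>(1)[OF S]] by (simp add: comp_def)
      show "(\<lambda>x. zmor L S T \<theta> (\<eta> T x)) \<in> hom (zobj (box G M N) T) (zobj L S)"
        using hom_compose[OF \<eta>(1)[OF T] zm_hom[OF L S T \<theta>]] by (simp add: comp_def)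
      fix x assume x: "x \<in> box_gens G M N T"
      obtain X Y \<phi> m n where x_eq: "x = (X, Y, \<phi>, m, n)" by (cases x)
      show "\<eta> S (zmor (box G M N) S T \<theta> (box_cl G M N T x)) = zmor L S T \<theta> (\<eta> T (box_cl G M N T x))"
        using x bz_comp_in[OF T \<theta>] unfolding x_eq
        by (simp add: box_mor(2)[OF M N S T \<theta>] \<eta>(2) S T nat[OF S T \<theta>])
    qed
  qed
  then show thesis using \<eta>(2) that by blast
qed

subsection \<open>Functoriality\<close>

text \<open>Functoriality in both variables at once. \<open>box_map\<close> and
  \<open>box_map'\<close> are the instances with the identity in the other variable, and
  \<open>B\<close> is given by an equation so that their definitions fit it literally.\<close>

lemma box_bimap:
  assumes M: "zmodule G M" and N: "zmodule G N" and M': "zmodule G M'" and N': "zmodule G N'"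
    and f: "zmod_hom G M M' f" and h: "zmod_hom G N N' h"
    and B: "B = (\<lambda>S. coset_map (zobj (box_pre G M' N') S) (box_ker G M' N' S)
      (frag_extend (\<lambda>(X, Y, \<phi>, m, n). frag_of (X, Y, \<phi>, f X m, h Y n))))"
  shows "zmod_hom G (box G M N) (box G M' N') B"
    and "gset G S \<Longrightarrow> (X, Y, \<phi>, m, n) \<in> box_gens G M N S \<Longrightarrow>
      B S (box_cl G M N S (X, Y, \<phi>, m, n)) = box_cl G M' N' S (X, Y, \<phi>, f X m, h Y n)"
proof -
  define r :: "('a, 'b, 'c) boxgen \<Rightarrow> ('a, 'd, 'e) boxgen" where "r = (\<lambda>(X, Y, \<phi>, m, n). (X, Y, \<phi>, f X m, h Y n))"
  have mor: "B S = coset_map (free_Abelian_group (box_gens G M' N' S)) (box_ker G M' N' S) (frag_extend (\<lambda>x. frag_of (r x)))" for S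
    by (simp add: B box_pre_def r_def case_prod_unfold)
  have r: "r x \<in> box_gens G M' N' S" if "x \<in> box_gens G M N S" for x S
    using that by (cases x) (auto simp: r_def zmod_homD[OF f] zmod_homD[OF h])
  have bal: "box_balanced G M N S (zobj (box G M' N') S) (\<lambda>x. box_cl G M' N' S (r x))" if S: "gset G S" for S
    using box_balancedD[OF box_cl_balanced[OF M' N' S]]
    by (intro box_balancedI) (simp_all add: r_def zmod_homD[OF f] zmod_homD[OF h])
  have C1: "B S \<in> hom (zobj (box G M N) S) (zobj (box G M' N') S)" if S: "gset G S" for S
    unfolding mor by (rule box_coset_map(1)[OF M N M' N' S S r bal[OF S]])
  have C2: "B S (box_cl G M N S x) = box_cl G M' N' S (r x)" if S: "gset G S" and "x \<in> box_gens G M N S" for S x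
    unfolding mor by (rule box_coset_map(2)[OF M N M' N' S S r bal[OF S] that(2)])
  show cl: "B S (box_cl G M N S (X, Y, \<phi>, m, n)) = box_cl G M' N' S (X, Y, \<phi>, f X m, h Y n)"
    if "gset G S" "(X, Y, \<phi>, m, n) \<in> box_gens G M N S" for S X Y \<phi> m n
    using C2[OF that] by (simp add: r_def)
  show "zmod_hom G (box G M N) (box G M' N') B"
    unfolding zmod_hom_def
  proof (intro conjI allI impI ballI)
    fix S T \<theta> x assume S: "gset G S" and T: "gset G T" and \<theta>: "\<theta> \<in> bz_hom G S T"
      and x: "x \<in> el (box G M N) T"
    show "B S (zmor (box G M N) S T \<theta> x) = zmor (box G M' N') S T \<theta> (B T x)"
    proof (rule box_hom_eq[OF M N T comm_group.axioms(2)[OF box_comm_group[OF M' N' S]] _ _ _ x])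
      show "(\<lambda>x. B S (zmor (box G M N) S T \<theta> x)) \<in> hom (zobj (box G M N) T) (zobj (box G M' N') S)"
        using hom_compose[OF box_mor(1)[OF M N S T \<theta>] C1[OF S]] by (simp add: comp_def)
      show "(\<lambda>x. zmor (box G M' N') S T \<theta> (B T x)) \<in> hom (zobj (box G M N) T) (zobj (box G M' N') S)"
        using hom_compose[OF C1[OF T] box_mor(1)[OF M' N' S T \<theta>]] by (simp add: comp_def)
      fix x assume x: "x \<in> box_gens G M N T"
      obtain X Y \<phi> m n where x_eq: "x = (X, Y, \<phi>, m, n)" by (cases x)
      show "B S (zmor (box G M N) S T \<theta> (box_cl G M N T x)) = zmor (box G M' N') S T \<theta> (B T (box_cl G M N T x))"
        using x bz_comp_in[OF T \<theta>] unfolding x_eq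
        by (simp add: box_mor(2)[OF M N S T \<theta>] box_mor(2)[OF M' N' S T \<theta>] cl S T zmod_homD(2)[OF f] zmod_homD(2)[OF h])
    qed
  qed (rule C1)
qed

lemma box_map:
  assumes M: "zmodule G M" and M': "zmodule G M'" and N: "zmodule G N" and f: "zmod_hom G M M' f"
  shows "zmod_hom G (box G M N) (box G M' N) (box_map G M' N f)"
    and "gset G S \<Longrightarrow> (X, Y, \<phi>, m, n) \<in> box_gens G M N S \<Longrightarrow>
      box_map G M' N f S (box_cl G M N S (X, Y, \<phi>, m, n)) = box_cl G M' N S (X, Y, \<phi>, f X m, n)"
  by (rule box_bimap[where f = f and h = "\<lambda>Y n. n", OF M N M' N f zmod_hom_id box_map_def])+

lemma box_map':
  assumes M: "zmodule G M" and N: "zmodule G N" and N': "zmodule G N'" and f: "zmod_hom G N N' f"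
  shows "zmod_hom G (box G M N) (box G M N') (box_map' G M N' f)"
    and "gset G S \<Longrightarrow> (X, Y, \<phi>, m, n) \<in> box_gens G M N S \<Longrightarrow>
      box_map' G M N' f S (box_cl G M N S (X, Y, \<phi>, m, n)) = box_cl G M N' S (X, Y, \<phi>, m, f Y n)"
  by (rule box_bimap[where f = "\<lambda>X m. m" and h = f, OF M N M N' zmod_hom_id f box_map'_def])+

text \<open>Composition, sums and identities are what carrying a chain homotopy through the functor
  requires. The fourth rule is a congruence: maps of modules matter only on carriers, so equal maps
  need not be equal as functions.\<close>

lemma box_map_functor:
  assumes M: "zmodule G M" and N: "zmodule G N" and M': "zmodule G M'" and f: "zmod_hom G M M' f"
    and S: "gset G S" and x: "x \<in> el (box G M N) S"
  shows "zmodule G M'' \<Longrightarrow> zmod_hom G M' M'' g1 \<Longrightarrow>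
      box_map G M'' N g1 S (box_map G M' N f S x) = box_map G M'' N (\<lambda>S x. g1 S (f S x)) S x"
    and "zmod_hom G M M' g2 \<Longrightarrow> zmod_hom G M M' h2 \<Longrightarrow>
      (\<And>S x. gset G S \<Longrightarrow> x \<in> el M S \<Longrightarrow> h2 S x = f S x \<otimes>\<^bsub>zobj M' S\<^esub> g2 S x) \<Longrightarrow>
      box_map G M' N h2 S x = box_map G M' N f S x \<otimes>\<^bsub>zobj (box G M' N) S\<^esub> box_map G M' N g2 S x"
    and "zmod_hom G M M h3 \<Longrightarrow> (\<And>S x. gset G S \<Longrightarrow> x \<in> el M S \<Longrightarrow> h3 S x = x) \<Longrightarrow> box_map G M N h3 S x = x"
    and "zmod_hom G M M' h4 \<Longrightarrow> (\<And>S x. gset G S \<Longrightarrow> x \<in> el M S \<Longrightarrow> h4 S x = f S x) \<Longrightarrow>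
      box_map G M' N h4 S x = box_map G M' N f S x"
proof -
  note B = box_zmodule[OF _ N]
  show "box_map G M'' N g1 S (box_map G M' N f S x) = box_map G M'' N (\<lambda>S x. g1 S (f S x)) S x"
    if M'': "zmodule G M''" and g: "zmod_hom G M' M'' g1"
    by (rule zmod_hom_box_eq[OF M N B[OF M''] zmod_hom_comp[OF box_map(1)[OF M M' N f] box_map(1)[OF M' M'' N g]]
            box_map(1)[OF M M'' N zmod_hom_comp[OF f g]] S x])
      (simp add: box_map(2)[OF M M' N f S] box_map(2)[OF M' M'' N g S] box_map(2)[OF M M'' N zmod_hom_comp[OF f g] S] zmod_homD(2)[OF f])
  show "box_map G M' N h2 S x = box_map G M' N f S x \<otimes>\<^bsub>zobj (box G M' N) S\<^esub> box_map G M' N g2 S x"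
    if g: "zmod_hom G M M' g2" and h: "zmod_hom G M M' h2"
      and eq: "\<And>S x. gset G S \<Longrightarrow> x \<in> el M S \<Longrightarrow> h2 S x = f S x \<otimes>\<^bsub>zobj M' S\<^esub> g2 S x"
    by (rule zmod_hom_box_eq[OF M N B[OF M'] box_map(1)[OF M M' N h]
            zmod_hom_mult[OF B[OF M] B[OF M'] box_map(1)[OF M M' N f] box_map(1)[OF M M' N g]] S x])
      (simp add: box_map(2)[OF M M' N f S] box_map(2)[OF M M' N g S] box_map(2)[OF M M' N h S]
        zmod_homD(2)[OF f] zmod_homD(2)[OF g] eq box_balancedD(3)[OF box_cl_balanced[OF M' N S]])
  show "box_map G M N h3 S x = x"
    if h: "zmod_hom G M M h3" and eq: "\<And>S x. gset G S \<Longrightarrow> x \<in> el M S \<Longrightarrow> h3 S x = x"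
    by (rule zmod_hom_box_eq[OF M N B[OF M] box_map(1)[OF M M N h] zmod_hom_id S x])
      (simp add: box_map(2)[OF M M N h S] eq)
  show "box_map G M' N h4 S x = box_map G M' N f S x"
    if h: "zmod_hom G M M' h4" and eq: "\<And>S x. gset G S \<Longrightarrow> x \<in> el M S \<Longrightarrow> h4 S x = f S x"
    by (rule zmod_hom_box_eq[OF M N B[OF M'] box_map(1)[OF M M' N h] box_map(1)[OF M M' N f] S x])
      (simp add: box_map(2)[OF M M' N h S] box_map(2)[OF M M' N f S] eq)
qed

lemma box_map'_functor:
  assumes M: "zmodule G M" and N: "zmodule G N" and N': "zmodule G N'" and f: "zmod_hom G N N' f"
    and S: "gset G S" and x: "x \<in> el (box G M N) S"
  shows "zmodule G N'' \<Longrightarrow> zmod_hom G N' N'' g1 \<Longrightarrow>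
      box_map' G M N'' g1 S (box_map' G M N' f S x) = box_map' G M N'' (\<lambda>S x. g1 S (f S x)) S x"
    and "zmod_hom G N N' g2 \<Longrightarrow> zmod_hom G N N' h2 \<Longrightarrow>
      (\<And>S x. gset G S \<Longrightarrow> x \<in> el N S \<Longrightarrow> h2 S x = f S x \<otimes>\<^bsub>zobj N' S\<^esub> g2 S x) \<Longrightarrow>
      box_map' G M N' h2 S x = box_map' G M N' f S x \<otimes>\<^bsub>zobj (box G M N') S\<^esub> box_map' G M N' g2 S x"
    and "zmod_hom G N N h3 \<Longrightarrow> (\<And>S x. gset G S \<Longrightarrow> x \<in> el N S \<Longrightarrow> h3 S x = x) \<Longrightarrow> box_map' G M N h3 S x = x"
    and "zmod_hom G N N' h4 \<Longrightarrow> (\<And>S x. gset G S \<Longrightarrow> x \<in> el N S \<Longrightarrow> h4 S x = f S x) \<Longrightarrow>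
      box_map' G M N' h4 S x = box_map' G M N' f S x"
proof -
  note B = box_zmodule[OF M]
  show "box_map' G M N'' g1 S (box_map' G M N' f S x) = box_map' G M N'' (\<lambda>S x. g1 S (f S x)) S x"
    if N'': "zmodule G N''" and g: "zmod_hom G N' N'' g1"
    by (rule zmod_hom_box_eq[OF M N B[OF N''] zmod_hom_comp[OF box_map'(1)[OF M N N' f] box_map'(1)[OF M N' N'' g]]
            box_map'(1)[OF M N N'' zmod_hom_comp[OF f g]] S x])
      (simp add: box_map'(2)[OF M N N' f S] box_map'(2)[OF M N' N'' g S] box_map'(2)[OF M N N'' zmod_hom_comp[OF f g] S] zmod_homD(2)[OF f])
  show "box_map' G M N' h2 S x = box_map' G M N' f S x \<otimes>\<^bsub>zobj (box G M N') S\<^esub> box_map' G M N' g2 S x"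
    if g: "zmod_hom G N N' g2" and h: "zmod_hom G N N' h2"
      and eq: "\<And>S x. gset G S \<Longrightarrow> x \<in> el N S \<Longrightarrow> h2 S x = f S x \<otimes>\<^bsub>zobj N' S\<^esub> g2 S x"
    by (rule zmod_hom_box_eq[OF M N B[OF N'] box_map'(1)[OF M N N' h]
            zmod_hom_mult[OF B[OF N] B[OF N'] box_map'(1)[OF M N N' f] box_map'(1)[OF M N N' g]] S x])
      (simp add: box_map'(2)[OF M N N' f S] box_map'(2)[OF M N N' g S] box_map'(2)[OF M N N' h S]
        zmod_homD(2)[OF f] zmod_homD(2)[OF g] eq box_balancedD(4)[OF box_cl_balanced[OF M N' S]])
  show "box_map' G M N h3 S x = x"
    if h: "zmod_hom G N N h3" and eq: "\<And>S x. gset G S \<Longrightarrow> x \<in> el N S \<Longrightarrow> h3 S x = x"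
    by (rule zmod_hom_box_eq[OF M N B[OF N] box_map'(1)[OF M N N h] zmod_hom_id S x])
      (simp add: box_map'(2)[OF M N N h S] eq)
  show "box_map' G M N' h4 S x = box_map' G M N' f S x"
    if h: "zmod_hom G N N' h4" and eq: "\<And>S x. gset G S \<Longrightarrow> x \<in> el N S \<Longrightarrow> h4 S x = f S x"
    by (rule zmod_hom_box_eq[OF M N B[OF N'] box_map'(1)[OF M N N' h] box_map'(1)[OF M N N' f] S x])
      (simp add: box_map'(2)[OF M N N' h S] box_map'(2)[OF M N N' f S] eq)
qed

section \<open>Free modules and free resolutions\<close>

lemma free_mod_simps [simp]:
  "el (free_mod G J X) S = {u. (\<forall>j \<in> J. u j \<in> bz_hom G S (X j)) \<and>
     (\<forall>j. j \<notin> J \<longrightarrow> u j = bz_zero) \<and> finite {j. u j \<noteq> bz_zero}}"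
  "x \<otimes>\<^bsub>zobj (free_mod G J X) S\<^esub> y = (\<lambda>j. bz_add (x j) (y j))"
  "\<one>\<^bsub>zobj (free_mod G J X) S\<^esub> = (\<lambda>j. bz_zero)"
  "zmor (free_mod G J X) S T \<phi> x = (\<lambda>j. bz_comp T (x j) \<phi>)"
  by (simp_all add: free_mod_def)

lemma free_modD:
  assumes "u \<in> el (free_mod G J X) S"
  shows "j \<in> J \<Longrightarrow> u j \<in> bz_hom G S (X j)" "j \<notin> J \<Longrightarrow> u j = bz_zero" "finite {j. u j \<noteq> bz_zero}"
  using assms by auto

lemma zmodule_free_mod: "zmodule G (free_mod G J X)"
  unfolding zmodule_def
proof (intro conjI allI impI ballI)
  fix S :: "'a gset" assume S: "gset G S"
  show "comm_group (zobj (free_mod G J X) S)"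
  proof (rule group.group_comm_groupI[OF groupI])
    fix x y assume x: "x \<in> el (free_mod G J X) S" and y: "y \<in> el (free_mod G J X) S"
    have "finite ({j. x j \<noteq> bz_zero} \<union> {j. y j \<noteq> bz_zero})" using x y by simp
    then have "finite {j. bz_add (x j) (y j) \<noteq> bz_zero}"
      by (rule finite_subset[rotated]) (rule subsetI, rule ccontr, simp)
    then show "x \<otimes>\<^bsub>zobj (free_mod G J X) S\<^esub> y \<in> el (free_mod G J X) S"
      using x y by simp
  next
    fix x assume x: "x \<in> el (free_mod G J X) S"
    have neg0: "bz_neg \<phi> = bz_zero \<longleftrightarrow> \<phi> = bz_zero" for \<phi>
      by (simp add: bz_neg_def bz_zero_def fun_eq_iff)
    show "\<exists>y \<in> el (free_mod G J X) S. y \<otimes>\<^bsub>zobj (free_mod G J X) S\<^esub> x = \<one>\<^bsub>zobj (free_mod G J X) S\<^esub>"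
      by (rule bexI[of _ "\<lambda>j. bz_neg (x j)"]) (use x in \<open>simp_all add: neg0\<close>)
  qed (simp_all add: bz_add_assoc, simp add: bz_add_comm)
next
  fix S T \<phi> assume S: "gset G S" and T: "gset G T" and \<phi>: "\<phi> \<in> bz_hom G S T"
  show "zmor (free_mod G J X) S T \<phi> \<in> hom (zobj (free_mod G J X) T) (zobj (free_mod G J X) S)"
  proof (rule homI)
    fix x assume x: "x \<in> el (free_mod G J X) T"
    then have "finite {j. x j \<noteq> bz_zero}" by simp
    then have "finite {j. bz_comp T (x j) \<phi> \<noteq> bz_zero}"
      by (rule finite_subset[rotated]) (rule subsetI, rule ccontr, simp)
    then show "zmor (free_mod G J X) S T \<phi> x \<in> el (free_mod G J X) S"
      using x bz_comp_in[OF T \<phi>] by simp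
  qed simp
next
  fix S x assume S: "gset G S" and x: "x \<in> el (free_mod G J X) S"
  have "bz_comp S (x j) (bz_id S) = x j" for j
    using bz_comp_id_right[OF S free_modD(1)[OF x]] free_modD(2)[OF x] by (cases "j \<in> J") simp_all
  then show "zmor (free_mod G J X) S S (bz_id S) x = x" by simp
qed (simp_all add: bz_comp_assoc)

text \<open>The universal element of the j-th summand in the sense of Yoneda.\<close>

definition free_gen :: "('j \<Rightarrow> 'g gset) \<Rightarrow> 'j \<Rightarrow> 'j \<Rightarrow> mat" where
  "free_gen X j = (\<lambda>i. if i = j then bz_id (X j) else bz_zero)"

lemma free_gen_in:
  assumes "j \<in> J" "gset G (X j)" shows "free_gen X j \<in> el (free_mod G J X) (X j)"
proof -
  have "finite {i. free_gen X j i \<noteq> bz_zero}"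
    by (rule finite_subset[of _ "{j}"]) (auto simp: free_gen_def)
  then show ?thesis using assms by (auto simp: free_gen_def)
qed

text \<open>Yoneda for direct sums: an element has finite support and is a sum of pullbacks of
  universal elements. The induction runs over a finite set containing the support.\<close>

lemma free_hom_ext:
  assumes N: "zmodule G N" and f: "zmod_hom G (free_mod G J X) N f" and g: "zmod_hom G (free_mod G J X) N g"
    and X: "\<And>j. j \<in> J \<Longrightarrow> gset G (X j)"
    and eq: "\<And>j. j \<in> J \<Longrightarrow> f (X j) (free_gen X j) = g (X j) (free_gen X j)"
    and S: "gset G S" and u: "u \<in> el (free_mod G J X) S"
  shows "f S u = g S u"
proof -
  note F = zmodule_free_mod[of G J X]
  have "f S u = g S u" if "finite A" "u \<in> el (free_mod G J X) S" "{j. u j \<noteq> bz_zero} \<subseteq> A" for A u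
    using that
  proof (induction A arbitrary: u rule: finite_induct)
    case empty
    then have "u = \<one>\<^bsub>zobj (free_mod G J X) S\<^esub>" by auto
    then show ?case using zmod_hom_one[OF f F N S] zmod_hom_one[OF g F N S] by simp
  next
    case (insert j A)
    show ?case
    proof (cases "j \<in> J")
      case False
      then have "{i. u i \<noteq> bz_zero} \<subseteq> A" using insert.prems free_modD(2)[OF insert.prems(1), of j] by auto
      then show ?thesis using insert.IH insert.prems by blast
    next
      case True
      \<comment> \<open>One component is split off; it is the pullback of the universal element
        along \<open>u j\<close>, so its image is known from the image of the generator.\<close>
      let ?v = "u(j := bz_zero)" and ?w = "zmor (free_mod G J X) S (X j) (u j) (free_gen X j)"
      have uj: "u j \<in> bz_hom G S (X j)" using insert.prems(1) True by simp
      have "finite {i. ?v i \<noteq> bz_zero}" by (rule finite_subset[OF _ free_modD(3)[OF insert.prems(1)]]) auto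
      then have v: "?v \<in> el (free_mod G J X) S" using insert.prems(1) by auto
      have w: "?w \<in> el (free_mod G J X) S"
        using zm_closed[OF F S X[OF True] uj free_gen_in[where X=X, OF True X[OF True]]] .
      have "{i. ?v i \<noteq> bz_zero} \<subseteq> A" using insert.prems(2) by auto
      then have IH: "f S ?v = g S ?v" using insert.IH[OF v] by blast
      have u_eq: "u = ?v \<otimes>\<^bsub>zobj (free_mod G J X) S\<^esub> ?w"
        using bz_comp_id_left[OF X[OF True] uj] by (auto simp: free_gen_def)
      have "f S ?w = g S ?w"
        using zmod_homD(4)[OF f S X[OF True] uj free_gen_in[where X=X, OF True X[OF True]]]
          zmod_homD(4)[OF g S X[OF True] uj free_gen_in[where X=X, OF True X[OF True]]] eq[OF True] by simp
      then have "f S (?v \<otimes>\<^bsub>zobj (free_mod G J X) S\<^esub> ?w) = g S (?v \<otimes>\<^bsub>zobj (free_mod G J X) S\<^esub> ?w)"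
        using IH zmod_homD(3)[OF f S v w] zmod_homD(3)[OF g S v w] by simp
      then show ?thesis using u_eq by metis
    qed
  qed
  from this[OF free_modD(3)[OF u] u subset_refl] show ?thesis .
qed

text \<open>The homomorphism with prescribed values c on the universal elements. The product runs
  over the support, which keeps it finite.\<close>

definition free_lin :: "('g, 'm) zmod \<Rightarrow> ('j \<Rightarrow> 'g gset) \<Rightarrow> ('j \<Rightarrow> 'm) \<Rightarrow> ('g, 'j \<Rightarrow> mat, 'm) zmap" where
  "free_lin M X c S u = finprod (zobj M S) (\<lambda>j. zmor M S (X j) (u j) (c j)) {j. u j \<noteq> bz_zero}"

lemma (in comm_monoid) finprod_hom_image:
  assumes H: "comm_monoid H" and h: "h \<in> hom G H" "h \<one> = \<one>\<^bsub>H\<^esub>" and "finite A" "f \<in> A \<rightarrow> carrier G"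
  shows "h (finprod G f A) = finprod H (\<lambda>x. h (f x)) A"
proof -
  interpret H: comm_monoid H by fact
  show ?thesis using assms(4,5)
proof (induction A rule: finite_induct)
  case empty
  then show ?case using h by simp
next
  case (insert x A)
  have "(\<lambda>x. h (f x)) \<in> insert x A \<rightarrow> carrier H" using insert.prems hom_in_carrier[OF h(1)] by auto
  then show ?case using insert hom_mult[OF h(1)] by (simp add: Pi_iff)
qed
qed

lemma free_lin:
  assumes M: "zmodule G M" and X: "\<And>j. j \<in> J \<Longrightarrow> gset G (X j)" and c: "\<And>j. j \<in> J \<Longrightarrow> c j \<in> el M (X j)"
  shows "zmod_hom G (free_mod G J X) M (free_lin M X c)"
    and "j \<in> J \<Longrightarrow> free_lin M X c (X j) (free_gen X j) = c j"
proof -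
  have cl: "zmor M S (X j) (u j) (c j) \<in> el M S"
    if "gset G S" "u \<in> el (free_mod G J X) S" "j \<in> J" for S u j
    using zm_closed[OF M that(1) X[OF that(3)] _ c[OF that(3)]] that(2,3) by simp
  have supp: "j \<in> J" if "u \<in> el (free_mod G J X) S" "u j \<noteq> bz_zero" for u S j
    using that by auto
  \<comment> \<open>Zero components contribute neutral factors, so any finite index set containing
    the support gives the same value. This allows x, y and x + y to be compared over one common
    index set.\<close>
  have lin_eq: "free_lin M X c S u = finprod (zobj M S) (\<lambda>j. zmor M S (X j) (u j) (c j)) A"
    if S: "gset G S" and u: "u \<in> el (free_mod G J X) S"
      and A: "finite A" "A \<subseteq> J" "{j. u j \<noteq> bz_zero} \<subseteq> A" for S u A
  proof -
    interpret comm_group "zobj M S" by (rule zm_comm_group[OF M S])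
    show ?thesis
      unfolding free_lin_def
    proof (rule finprod_mono_neutral_cong_left[OF A(1,3)])
      fix j assume "j \<in> A - {j. u j \<noteq> bz_zero}"
      then have "u j = bz_zero" "j \<in> J" using A(2) by auto
      then show "zmor M S (X j) (u j) (c j) = \<one>\<^bsub>zobj M S\<^esub>"
        using zm_zero[OF M S X c] by simp
    qed (use cl[OF S u] A(2) in auto)
  qed
  show "zmod_hom G (free_mod G J X) M (free_lin M X c)"
  proof (rule zmod_homI)
    fix S x assume S: "gset G S" and x: "x \<in> el (free_mod G J X) S"
    interpret comm_group "zobj M S" by (rule zm_comm_group[OF M S])
    show "free_lin M X c S x \<in> el M S"
      unfolding free_lin_def by (rule finprod_closed) (use cl[OF S x] supp[OF x] in auto)
  next
    fix S x y assume S: "gset G S" and x: "x \<in> el (free_mod G J X) S"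
      and y: "y \<in> el (free_mod G J X) S"
    interpret comm_group "zobj M S" by (rule zm_comm_group[OF M S])
    let ?A = "{j. x j \<noteq> bz_zero} \<union> {j. y j \<noteq> bz_zero}"
    have A: "finite ?A" "?A \<subseteq> J" using free_modD(3)[OF x] free_modD(3)[OF y] supp[OF x] supp[OF y] by auto
    have xy: "x \<otimes>\<^bsub>zobj (free_mod G J X) S\<^esub> y \<in> el (free_mod G J X) S"
      using zm_group[OF zmodule_free_mod S] x y by (meson group.is_monoid monoid.m_closed)
    have supp_xy: "{j. (x \<otimes>\<^bsub>zobj (free_mod G J X) S\<^esub> y) j \<noteq> bz_zero} \<subseteq> ?A" by auto
    have "free_lin M X c S (x \<otimes>\<^bsub>zobj (free_mod G J X) S\<^esub> y)
        = finprod (zobj M S) (\<lambda>j. zmor M S (X j) (bz_add (x j) (y j)) (c j)) ?A"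
      using lin_eq[OF S xy A supp_xy] by simp
    also have "\<dots> = finprod (zobj M S) (\<lambda>j. zmor M S (X j) (x j) (c j) \<otimes>\<^bsub>zobj M S\<^esub> zmor M S (X j) (y j) (c j)) ?A"
    proof (rule finprod_cong')
      fix j assume "j \<in> ?A"
      then have j: "j \<in> J" using A(2) by blast
      show "zmor M S (X j) (bz_add (x j) (y j)) (c j) = zmor M S (X j) (x j) (c j) \<otimes>\<^bsub>zobj M S\<^esub> zmor M S (X j) (y j) (c j)"
        by (rule zm_add[OF M S X[OF j] _ _ c[OF j]]) (use j x y in simp_all)
    qed (use cl[OF S x] cl[OF S y] A(2) in auto)
    also have "\<dots> = free_lin M X c S x \<otimes>\<^bsub>zobj M S\<^esub> free_lin M X c S y"
    proof -
      have "(\<lambda>j. zmor M S (X j) (x j) (c j)) \<in> ?A \<rightarrow> el M S"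
        "(\<lambda>j. zmor M S (X j) (y j) (c j)) \<in> ?A \<rightarrow> el M S"
        using cl[OF S x] cl[OF S y] A(2) by blast+
      then show ?thesis
        using lin_eq[OF S x A] lin_eq[OF S y A] finprod_multf by simp
    qed
    finally show "free_lin M X c S (x \<otimes>\<^bsub>zobj (free_mod G J X) S\<^esub> y) = free_lin M X c S x \<otimes>\<^bsub>zobj M S\<^esub> free_lin M X c S y" .
  next
    fix S T \<phi> u assume S: "gset G S" and T: "gset G T" and \<phi>: "\<phi> \<in> bz_hom G S T"
      and u: "u \<in> el (free_mod G J X) T"
    interpret A: comm_group "zobj M S" by (rule zm_comm_group[OF M S])
    interpret B: comm_group "zobj M T" by (rule zm_comm_group[OF M T])
    let ?A = "{j. u j \<noteq> bz_zero}"
    have A: "finite ?A" "?A \<subseteq> J" using free_modD(3)[OF u] supp[OF u] by auto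
    have u': "zmor (free_mod G J X) S T \<phi> u \<in> el (free_mod G J X) S"
      by (rule zm_closed[OF zmodule_free_mod S T \<phi> u])
    have supp': "{j. zmor (free_mod G J X) S T \<phi> u j \<noteq> bz_zero} \<subseteq> ?A" by auto
    have "free_lin M X c S (zmor (free_mod G J X) S T \<phi> u)
        = finprod (zobj M S) (\<lambda>j. zmor M S (X j) (bz_comp T (u j) \<phi>) (c j)) ?A"
      using lin_eq[OF S u' A supp'] by simp
    also have "\<dots> = finprod (zobj M S) (\<lambda>j. zmor M S T \<phi> (zmor M T (X j) (u j) (c j))) ?A"
    proof (rule A.finprod_cong')
      fix j assume "j \<in> ?A"
      then have j: "j \<in> J" using A(2) by blast
      show "zmor M S (X j) (bz_comp T (u j) \<phi>) (c j) = zmor M S T \<phi> (zmor M T (X j) (u j) (c j))"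
        by (rule zm_comp[OF M S T X[OF j] \<phi> _ c[OF j]]) (use j u in simp)
    qed (use cl[OF T u] A(2) zm_closed[OF M S T \<phi>] in auto)
    also have "\<dots> = zmor M S T \<phi> (free_lin M X c T u)"
      unfolding free_lin_def
      by (rule B.finprod_hom_image[OF A.comm_monoid_axioms zm_hom[OF M S T \<phi>] zm_one[OF M S T \<phi>] A(1), symmetric])
        (use cl[OF T u] A(2) in auto)
    finally show "free_lin M X c S (zmor (free_mod G J X) S T \<phi> u) = zmor M S T \<phi> (free_lin M X c T u)" .
  qed
  assume j: "j \<in> J"
  interpret comm_group "zobj M (X j)" by (rule zm_comm_group[OF M X[OF j]])
  have "free_lin M X c (X j) (free_gen X j) = finprod (zobj M (X j)) (\<lambda>i. zmor M (X j) (X i) (free_gen X j i) (c i)) {j}"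
    by (rule lin_eq[OF X[OF j] free_gen_in[where X=X, OF j X[OF j]]]) (use j in \<open>auto simp: free_gen_def\<close>)
  also have "\<dots> = c j"
    using c[OF j] zm_id[OF M X[OF j] c[OF j]] by (simp add: free_gen_def)
  finally show "free_lin M X c (X j) (free_gen X j) = c j" .
qed

definition is_free :: "'g monoid \<Rightarrow> ('g, 'j \<Rightarrow> mat) zmod \<Rightarrow> bool" where
  "is_free G P \<longleftrightarrow> (\<exists>J X. (\<forall>j \<in> J. gset G (X j)) \<and> P = free_mod G J X)"

lemma is_free_zmodule: "is_free G P \<Longrightarrow> zmodule G P"
  unfolding is_free_def using zmodule_free_mod by blast

text \<open>Projectivity of free modules: choose preimages for the images of the universal elements
  and extend. Only the values of f are required to lie in the image of b, which is the form in which
  exactness supplies the hypothesis.\<close>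

lemma free_lift:
  assumes P: "is_free G P" and A: "zmodule G A" and B: "zmodule G B"
    and f: "zmod_hom G P B f" and b: "zmod_hom G A B b"
    and img: "\<And>S x. gset G S \<Longrightarrow> x \<in> el P S \<Longrightarrow> f S x \<in> zimg A b S"
  shows "\<exists>f'. zmod_hom G P A f' \<and> (\<forall>S x. gset G S \<longrightarrow> x \<in> el P S \<longrightarrow> b S (f' S x) = f S x)"
proof -
  from P obtain J X where X: "\<And>j. j \<in> J \<Longrightarrow> gset G (X j)" and P_eq: "P = free_mod G J X"
    unfolding is_free_def by blast
  have "\<exists>c. j \<in> J \<longrightarrow> c \<in> el A (X j) \<and> b (X j) c = f (X j) (free_gen X j)" for j
  proof (cases "j \<in> J")
    case True
    have "free_gen X j \<in> el P (X j)"
      unfolding P_eq by (rule free_gen_in[where X=X, OF True X[OF True]])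
    from img[OF X[OF True] this] show ?thesis unfolding zimg_iff by metis
  qed simp
  then obtain c where c: "\<And>j. j \<in> J \<Longrightarrow> c j \<in> el A (X j)"
    and bc: "\<And>j. j \<in> J \<Longrightarrow> b (X j) (c j) = f (X j) (free_gen X j)" by metis
  note L = free_lin[where J=J and X=X and c=c, OF A X c]
  have "b S (free_lin A X c S x) = f S x" if "gset G S" "x \<in> el P S" for S x
    by (rule free_hom_ext[OF B zmod_hom_comp[OF L(1) b] f[unfolded P_eq] X _ that(1) that(2)[unfolded P_eq]])
      (simp_all add: L(2) bc)
  then show ?thesis using L(1) P_eq by blast
qed

subsection \<open>The comparison theorem\<close>

lemma free_resolutionD:
  assumes "free_resolution G M (P, d, e)"
  shows "is_free G (P i)" "zmodule G (P i)"
    and "i < 0 \<Longrightarrow> gset G S \<Longrightarrow> x \<in> el (P i) S \<Longrightarrow> x = \<one>\<^bsub>zobj (P i) S\<^esub>"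
    and "zmod_hom G (P i) (P (i - 1)) (d i)" "zmod_hom G (P 0) M e"
    and "gset G S \<Longrightarrow> zimg (P 0) e S = el M S"
    and "gset G S \<Longrightarrow> zimg (P 1) (d 1) S = zker (P 0) M e S"
    and "gset G S \<Longrightarrow> i \<ge> 1 \<Longrightarrow> zimg (P (i + 1)) (d (i + 1)) S = zker (P i) (P (i - 1)) (d i) S"
proof -
  note R = assms[unfolded free_resolution_def, simplified prod.case]
  note R1 = R[THEN conjunct1] and R2 = R[THEN conjunct2, THEN conjunct1]
    and R3 = R[THEN conjunct2, THEN conjunct2, THEN conjunct1]
    and R4 = R[THEN conjunct2, THEN conjunct2, THEN conjunct2, THEN conjunct1]
    and R5 = R[THEN conjunct2, THEN conjunct2, THEN conjunct2, THEN conjunct2, THEN spec, THEN mp]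
  show *: "is_free G (P i)" unfolding is_free_def by (rule R1[THEN spec])
  show "zmodule G (P i)" by (rule is_free_zmodule[OF *])
  show "x = \<one>\<^bsub>zobj (P i) S\<^esub>" if "i < 0" "gset G S" "x \<in> el (P i) S"
    using R2 that by (simp add: trivial_group_def)
  show "zmod_hom G (P i) (P (i - 1)) (d i)" by (rule R3[THEN spec])
  show "zmod_hom G (P 0) M e" by (rule R4)
  assume S: "gset G S"
  show "zimg (P 0) e S = el M S" by (rule R5[OF S, THEN conjunct1])
  show "zimg (P 1) (d 1) S = zker (P 0) M e S" by (rule R5[OF S, THEN conjunct2, THEN conjunct1])
  show "zimg (P (i + 1)) (d (i + 1)) S = zker (P i) (P (i - 1)) (d i) S" if "i \<ge> 1"
    by (rule R5[OF S, THEN conjunct2, THEN conjunct2, THEN spec, THEN mp, OF that])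
qed

text \<open>In positive degrees this is half of exactness; in the remaining degrees the target is a
  trivial group.\<close>

lemma free_resolution_dd:
  assumes R: "free_resolution G M (P, d, e)" and S: "gset G S" and x: "x \<in> el (P (i + 1)) S"
  shows "d i S (d (i + 1) S x) = \<one>\<^bsub>zobj (P (i - 1)) S\<^esub>"
proof (cases "i \<ge> 1")
  case True
  have "d (i + 1) S x \<in> zker (P i) (P (i - 1)) (d i) S"
    unfolding free_resolutionD(8)[OF R S True, symmetric] zimg_def by (rule imageI[OF x])
  then show ?thesis unfolding zker_iff by (rule conjunct2)
next
  case False
  have "d (i + 1) S x \<in> el (P i) S"
    using zmod_homD(2)[OF free_resolutionD(4)[OF R, of "i + 1"] S x] by simp
  then have "d i S (d (i + 1) S x) \<in> el (P (i - 1)) S"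
    using zmod_homD(2)[OF free_resolutionD(4)[OF R] S] by blast
  then show ?thesis using free_resolutionD(3)[OF R _ S] False by simp
qed

text \<open>For \<open>k = 0\<close> the cycles are the kernel of the augmentation, so exactness reads the same in all degrees.\<close>

definition res_cycle :: "'g monoid \<Rightarrow> ('g, 'm) zmod \<Rightarrow> ('g, 'm) resolution \<Rightarrow> nat \<Rightarrow> 'g gset \<Rightarrow> ('m list \<Rightarrow> mat) set" where
  "res_cycle G M = (\<lambda>(P, d, e) k S. if k = 0 then zker (P 0) M e S else zker (P (int k)) (P (int k - 1)) (d (int k)) S)"

lemma res_cycle_exact:
  assumes R: "free_resolution G M (P, d, e)" and S: "gset G S"
  shows "zimg (P (int (Suc k))) (d (int (Suc k))) S = res_cycle G M (P, d, e) k S"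
proof (cases k)
  case 0
  then show ?thesis using free_resolutionD(7)[OF R S] by (simp add: res_cycle_def)
next
  case (Suc m)
  have "int (Suc k) = int k + 1" by simp
  then show ?thesis using free_resolutionD(8)[OF R S, of "int k"] Suc by (simp add: res_cycle_def)
qed

text \<open>Dependent choice over the degree. The invariant carried along is that the map already
  built sends cycles to cycles, since by exactness this is what makes the next lift exist.\<close>

lemma comparison:
  assumes R: "free_resolution G M (P, d, e)" and R': "free_resolution G M (Q, d', e')" and M: "zmodule G M"
  shows "\<exists>f. (\<forall>i. zmod_hom G (P i) (Q i) (f i)) \<and>
    (\<forall>S x. gset G S \<longrightarrow> x \<in> el (P 0) S \<longrightarrow> e' S (f 0 S x) = e S x) \<and>
    (\<forall>i S x. gset G S \<longrightarrow> x \<in> el (P i) S \<longrightarrow> d' i S (f i S x) = f (i - 1) S (d i S x))"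
proof -
  note D = free_resolutionD[OF R] and D' = free_resolutionD[OF R']
  define Inv where "Inv k f \<longleftrightarrow> zmod_hom G (P (int k)) (Q (int k)) f \<and>
     (k = 0 \<longrightarrow> (\<forall>S x. gset G S \<longrightarrow> x \<in> el (P 0) S \<longrightarrow> e' S (f S x) = e S x)) \<and>
     (\<forall>S x. gset G S \<longrightarrow> x \<in> res_cycle G M (P, d, e) k S \<longrightarrow> f S x \<in> res_cycle G M (Q, d', e') k S)" for k f
  define Step where "Step k f f' \<longleftrightarrow> (\<forall>S x. gset G S \<longrightarrow> x \<in> el (P (int (Suc k))) S \<longrightarrow>
     d' (int (Suc k)) S (f' S x) = f S (d (int (Suc k)) S x))" for k f f'
  have "\<exists>f. Inv 0 f"
  proof -
    have "\<exists>f. zmod_hom G (P 0) (Q 0) f \<and> (\<forall>S x. gset G S \<longrightarrow> x \<in> el (P 0) S \<longrightarrow> e' S (f S x) = e S x)"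
      by (rule free_lift[OF D(1) D'(2) M D(5) D'(5)]) (simp add: D'(6) zmod_homD(2)[OF D(5)])
    then obtain f where f: "zmod_hom G (P 0) (Q 0) f"
      "\<And>S x. gset G S \<Longrightarrow> x \<in> el (P 0) S \<Longrightarrow> e' S (f S x) = e S x" by blast
    have "Inv 0 f" unfolding Inv_def res_cycle_def using f zmod_homD(2)[OF f(1)] by (simp add: zker_iff)
    then show ?thesis by blast
  qed
  moreover have "\<exists>f'. Inv (Suc k) f' \<and> Step k f f'" if I: "Inv k f" for k f
  proof -
    let ?k = "int (Suc k)"
    have hP: "zmod_hom G (P ?k) (P (int k)) (d ?k)" and hQ: "zmod_hom G (Q ?k) (Q (int k)) (d' ?k)"
      using D(4)[of ?k] D'(4)[of ?k] by simp_all
    have f: "zmod_hom G (P (int k)) (Q (int k)) f" using I unfolding Inv_def by blast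
    have "\<exists>f'. zmod_hom G (P ?k) (Q ?k) f' \<and> (\<forall>S x. gset G S \<longrightarrow> x \<in> el (P ?k) S \<longrightarrow> d' ?k S (f' S x) = f S (d ?k S x))"
    proof (rule free_lift[OF D(1) D'(2) D'(2) zmod_hom_comp[OF hP f] hQ])
      fix S x assume S: "gset G S" and x: "x \<in> el (P ?k) S"
      have "d ?k S x \<in> res_cycle G M (P, d, e) k S"
        unfolding res_cycle_exact[OF R S, of k, symmetric] zimg_def by (rule imageI[OF x])
      then show "f S (d ?k S x) \<in> zimg (Q ?k) (d' ?k) S"
        unfolding res_cycle_exact[OF R' S] using I S unfolding Inv_def by blast
    qed
    then obtain f' where f': "zmod_hom G (P ?k) (Q ?k) f'"
      "\<And>S x. gset G S \<Longrightarrow> x \<in> el (P ?k) S \<Longrightarrow> d' ?k S (f' S x) = f S (d ?k S x)" by blast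
    have "Inv (Suc k) f'"
      unfolding Inv_def res_cycle_def
      using f' zmod_homD(2)[OF f'(1)] zmod_hom_one[OF f D(2) D'(2)] by (simp add: zker_iff)
    moreover have "Step k f f'" unfolding Step_def using f'(2) by blast
    ultimately show ?thesis by blast
  qed
  ultimately have "\<exists>F. \<forall>k. Inv k (F k) \<and> Step k (F k) (F (Suc k))"
    by (rule dependent_nat_choice)
  then obtain F where F: "\<And>k. Inv k (F k)" "\<And>k. Step k (F k) (F (Suc k))" by blast
  \<comment> \<open>Resolutions are indexed by all integers; below degree 0 the modules are trivial
    and the constant map fills the gap.\<close>
  define f where "f i = (if i < 0 then (\<lambda>S x. \<one>\<^bsub>zobj (Q i) S\<^esub>) else F (nat i))" for i
  have f_hom: "zmod_hom G (P i) (Q i) (f i)" for i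
  proof (cases "i < 0")
    case True then show ?thesis using zmod_hom_const_one[OF D'(2)] by (simp add: f_def)
  next
    case False then show ?thesis using F(1)[of "nat i"] by (simp add: f_def Inv_def)
  qed
  have "d' i S (f i S x) = f (i - 1) S (d i S x)" if S: "gset G S" and x: "x \<in> el (P i) S" for i S x
  proof (cases "i \<le> 0")
    case True
    \<comment> \<open>Both sides lie in a module of negative degree, hence in a trivial
      group.\<close>
    have cl: "d' i S (f i S x) \<in> el (Q (i - 1)) S" "f (i - 1) S (d i S x) \<in> el (Q (i - 1)) S"
      using zmod_homD(2)[OF D'(4) S zmod_homD(2)[OF f_hom S x]] zmod_homD(2)[OF f_hom S zmod_homD(2)[OF D(4) S x]] by auto
    have neg: "i - 1 < 0" using True by simp
    show ?thesis by (rule trans[OF D'(3)[OF neg S cl(1)] D'(3)[OF neg S cl(2), symmetric]])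
  next
    case False
    define k where "k = nat (i - 1)"
    have i: "i = int (Suc k)" "i - 1 = int k" using False by (simp_all add: k_def)
    have "f i = F (Suc k)" "f (i - 1) = F k" unfolding f_def i(2) unfolding i(1) by (simp_all del: of_nat_Suc)
    then show ?thesis using F(2)[of k] S x unfolding Step_def i(1) by simp
  qed
  moreover have "e' S (f 0 S x) = e S x" if "gset G S" "x \<in> el (P 0) S" for S x
    using F(1)[of 0] that by (simp add: Inv_def f_def)
  ultimately show ?thesis using f_hom by blast
qed

text \<open>A chain map over the zero map is null-homotopic. The invariant says that the homotopy
  built so far already satisfies d' s = h on cycles; then h - s d has cycles as values in the next
  degree and can be lifted.\<close>

lemma null_homotopic:
  assumes R: "free_resolution G M (P, d, e)" and R': "free_resolution G M (Q, d', e')" and M: "zmodule G M"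
    and h: "\<And>i. zmod_hom G (P i) (Q i) (h i)"
    and h_e: "\<And>S x. gset G S \<Longrightarrow> x \<in> el (P 0) S \<Longrightarrow> e' S (h 0 S x) = \<one>\<^bsub>zobj M S\<^esub>"
    and h_d: "\<And>i S x. gset G S \<Longrightarrow> x \<in> el (P i) S \<Longrightarrow> d' i S (h i S x) = h (i - 1) S (d i S x)"
  shows "\<exists>s. (\<forall>i. zmod_hom G (P i) (Q (i + 1)) (s i)) \<and>
    (\<forall>i S x. gset G S \<longrightarrow> x \<in> el (P i) S \<longrightarrow>
       h i S x = d' (i + 1) S (s i S x) \<otimes>\<^bsub>zobj (Q i) S\<^esub> s (i - 1) S (d i S x))"
proof -
  note D = free_resolutionD[OF R] and D' = free_resolutionD[OF R']
  define Inv where "Inv k s \<longleftrightarrow> zmod_hom G (P (int k)) (Q (int (Suc k))) s \<and>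
     (k = 0 \<longrightarrow> (\<forall>S x. gset G S \<longrightarrow> x \<in> el (P 0) S \<longrightarrow> d' 1 S (s S x) = h 0 S x)) \<and>
     (\<forall>S x. gset G S \<longrightarrow> x \<in> res_cycle G M (P, d, e) k S \<longrightarrow> d' (int (Suc k)) S (s S x) = h (int k) S x)" for k s
  define Step where "Step k s s' \<longleftrightarrow> (\<forall>S x. gset G S \<longrightarrow> x \<in> el (P (int (Suc k))) S \<longrightarrow>
     h (int (Suc k)) S x = d' (int (Suc (Suc k))) S (s' S x) \<otimes>\<^bsub>zobj (Q (int (Suc k))) S\<^esub> s S (d (int (Suc k)) S x))" for k s s'
  have "\<exists>s. Inv 0 s"
  proof -
    have d1: "zmod_hom G (Q 1) (Q 0) (d' 1)" using D'(4)[of 1] by simp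
    have "\<exists>s. zmod_hom G (P 0) (Q 1) s \<and> (\<forall>S x. gset G S \<longrightarrow> x \<in> el (P 0) S \<longrightarrow> d' 1 S (s S x) = h 0 S x)"
      by (rule free_lift[OF D(1) D'(2) D'(2) h d1]) (simp add: D'(7) zker_iff h_e zmod_homD(2)[OF h])
    then obtain s where s: "zmod_hom G (P 0) (Q 1) s"
      "\<And>S x. gset G S \<Longrightarrow> x \<in> el (P 0) S \<Longrightarrow> d' 1 S (s S x) = h 0 S x" by blast
    have "Inv 0 s" unfolding Inv_def res_cycle_def using s by (simp add: zker_iff)
    then show ?thesis by blast
  qed
  moreover have "\<exists>s'. Inv (Suc k) s' \<and> Step k s s'" if I: "Inv k s" for k s
  proof -
    let ?k = "int (Suc k)" and ?k2 = "int (Suc (Suc k))"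
    have dP: "zmod_hom G (P ?k) (P (int k)) (d ?k)" and dQ: "zmod_hom G (Q ?k2) (Q ?k) (d' ?k2)"
      and dQ1: "zmod_hom G (Q ?k) (Q (int k)) (d' ?k)"
      using D(4)[of ?k] D'(4)[of ?k2] D'(4)[of ?k] by simp_all
    have s: "zmod_hom G (P (int k)) (Q ?k) s" using I unfolding Inv_def by blast
    let ?t = "\<lambda>S x. s S (d ?k S x)"
    \<comment> \<open>The part of h that the previous stage of the homotopy does not account for;
      its lift along the next differential is the new stage.\<close>
    let ?r = "\<lambda>S x. h ?k S x \<otimes>\<^bsub>zobj (Q ?k) S\<^esub> inv\<^bsub>zobj (Q ?k) S\<^esub> ?t S x"
    have t: "zmod_hom G (P ?k) (Q ?k) ?t" by (rule zmod_hom_comp[OF dP s])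
    have r: "zmod_hom G (P ?k) (Q ?k) ?r"
      by (rule zmod_hom_mult[OF D(2) D'(2) h zmod_hom_minus[OF D(2) D'(2) t]])
    have "\<exists>s'. zmod_hom G (P ?k) (Q ?k2) s' \<and> (\<forall>S x. gset G S \<longrightarrow> x \<in> el (P ?k) S \<longrightarrow> d' ?k2 S (s' S x) = ?r S x)"
    proof (rule free_lift[OF D(1) D'(2) D'(2) r dQ])
      fix S x assume S: "gset G S" and x: "x \<in> el (P ?k) S"
      interpret Q: comm_group "zobj (Q ?k) S" by (rule zm_comm_group[OF D'(2) S])
      interpret Q0: comm_group "zobj (Q (int k)) S" by (rule zm_comm_group[OF D'(2) S])
      have "d ?k S x \<in> res_cycle G M (P, d, e) k S"
        unfolding res_cycle_exact[OF R S, of k, symmetric] zimg_def by (rule imageI[OF x])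
      then have ds: "d' ?k S (?t S x) = h (int k) S (d ?k S x)"
        using I S unfolding Inv_def by blast
      have dh: "d' ?k S (h ?k S x) = h (int k) S (d ?k S x)" using h_d[OF S x] by simp
      have c: "h ?k S x \<in> el (Q ?k) S" "?t S x \<in> el (Q ?k) S"
        "h (int k) S (d ?k S x) \<in> el (Q (int k)) S"
        using zmod_homD(2)[OF h S x] zmod_homD(2)[OF t S x] zmod_homD(2)[OF h S zmod_homD(2)[OF dP S x]] by auto
      have "d' ?k S (?r S x) = \<one>\<^bsub>zobj (Q (int k)) S\<^esub>"
        using c by (simp add: zmod_homD(3)[OF dQ1 S] zmod_hom_inv[OF dQ1 D'(2) D'(2) S] ds dh del: of_nat_Suc)
      moreover have "?r S x \<in> el (Q ?k) S" using c by (simp del: of_nat_Suc)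
      moreover have k1: "?k - 1 = int k" by simp
      ultimately have "?r S x \<in> res_cycle G M (Q, d', e') (Suc k) S"
        by (simp add: res_cycle_def zker_iff k1 del: of_nat_Suc)
      then show "?r S x \<in> zimg (Q ?k2) (d' ?k2) S" unfolding res_cycle_exact[OF R' S] .
    qed
    then obtain s' where s': "zmod_hom G (P ?k) (Q ?k2) s'"
      "\<And>S x. gset G S \<Longrightarrow> x \<in> el (P ?k) S \<Longrightarrow> d' ?k2 S (s' S x) = ?r S x" by blast
    \<comment> \<open>On a cycle the correction \<open>?t\<close> is trivial, so the invariant
      passes to the next degree.\<close>
    have "d' ?k2 S (s' S x) = h ?k S x" if S: "gset G S" and x: "x \<in> res_cycle G M (P, d, e) (Suc k) S" for S x
    proof -
      interpret Q: comm_group "zobj (Q ?k) S" by (rule zm_comm_group[OF D'(2) S])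
      have x': "x \<in> el (P ?k) S" "d ?k S x = \<one>\<^bsub>zobj (P (int k)) S\<^esub>"
        using x by (simp_all add: res_cycle_def zker_iff)
      show ?thesis
        unfolding s'(2)[OF S x'(1)] x'(2) zmod_hom_one[OF s D(2) D'(2) S] Q.inv_one
        by (rule Q.r_one[OF zmod_homD(2)[OF h S x'(1)]])
    qed
    then have "Inv (Suc k) s'" unfolding Inv_def using s'(1) by simp
    moreover have "Step k s s'" unfolding Step_def
    proof (intro allI impI)
      fix S x assume S: "gset G S" and x: "x \<in> el (P ?k) S"
      interpret Q: comm_group "zobj (Q ?k) S" by (rule zm_comm_group[OF D'(2) S])
      have "h ?k S x \<in> el (Q ?k) S" "?t S x \<in> el (Q ?k) S"
        using zmod_homD(2)[OF h S x] zmod_homD(2)[OF t S x] by auto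
      then show "h ?k S x = d' ?k2 S (s' S x) \<otimes>\<^bsub>zobj (Q ?k) S\<^esub> ?t S x"
        unfolding s'(2)[OF S x] by (simp add: Q.m_assoc del: of_nat_Suc)
    qed
    ultimately show ?thesis by blast
  qed
  ultimately have "\<exists>F. \<forall>k. Inv k (F k) \<and> Step k (F k) (F (Suc k))"
    by (rule dependent_nat_choice)
  then obtain F where F: "\<And>k. Inv k (F k)" "\<And>k. Step k (F k) (F (Suc k))" by blast
  define s where "s i = (if i < 0 then (\<lambda>S x. \<one>\<^bsub>zobj (Q (i + 1)) S\<^esub>) else F (nat i))" for i
  have s_hom: "zmod_hom G (P i) (Q (i + 1)) (s i)" for i
  proof (cases "i < 0")
    case True then show ?thesis using zmod_hom_const_one[OF D'(2)] by (simp add: s_def)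
  next
    case False
    then have "int (Suc (nat i)) = i + 1" by simp
    then show ?thesis using F(1)[of "nat i"] False unfolding Inv_def s_def by (simp add: add.commute)
  qed
  have "h i S x = d' (i + 1) S (s i S x) \<otimes>\<^bsub>zobj (Q i) S\<^esub> s (i - 1) S (d i S x)"
    if S: "gset G S" and x: "x \<in> el (P i) S" for i S x
  proof -
    interpret Q: comm_group "zobj (Q i) S" by (rule zm_comm_group[OF D'(2) S])
    have c: "h i S x \<in> el (Q i) S" "d' (i + 1) S (s i S x) \<in> el (Q i) S"
      using zmod_homD(2)[OF h S x] zmod_homD(2)[OF D'(4)[of "i + 1"] S zmod_homD(2)[OF s_hom S x]] by simp_all
    consider "i < 0" | "i = 0" | "i > 0" by linarith
    then show ?thesis
    proof cases
      case 1
      have "s (i - 1) S (d i S x) \<in> el (Q i) S"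
        using zmod_homD(2)[OF s_hom[of "i - 1"] S zmod_homD(2)[OF D(4) S x]] by simp
      then show ?thesis using D'(3)[OF 1 S] c Q.m_closed Q.one_closed Q.l_one by metis
    next
      case 2
      have "s (i - 1) S (d i S x) = \<one>\<^bsub>zobj (Q i) S\<^esub>" using 2 by (simp add: s_def)
      moreover have "d' 1 S (F 0 S x) = h 0 S x" using F(1)[of 0] S x 2 unfolding Inv_def by blast
      moreover have "h i S x \<otimes>\<^bsub>zobj (Q i) S\<^esub> \<one>\<^bsub>zobj (Q i) S\<^esub> = h i S x" using c by simp
      ultimately show ?thesis using 2 by (simp add: s_def)
    next
      case 3
      define k where "k = nat (i - 1)"
      have i: "i = int (Suc k)" "i - 1 = int k" "i + 1 = int (Suc (Suc k))" using 3 by (simp_all add: k_def)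
      have "s i = F (Suc k)" "s (i - 1) = F k" unfolding s_def i(2) unfolding i(1) by (simp_all del: of_nat_Suc)
      then show ?thesis using F(2)[of k] S x unfolding Step_def i(3) i(1) by simp
    qed
  qed
  then show ?thesis using s_hom by blast
qed

text \<open>Both g f and the identity lie over the identity of M, so their difference lies over zero
  and is null-homotopic.\<close>

lemma comparison_homotopy:
  assumes R: "free_resolution G M (P, d, e)" and R': "free_resolution G M (Q, d', e')" and M: "zmodule G M"
    and f1: "\<And>i. zmod_hom G (P i) (Q i) (f i)"
    and f2: "\<And>S x. gset G S \<Longrightarrow> x \<in> el (P 0) S \<Longrightarrow> e' S (f 0 S x) = e S x"
    and f3: "\<And>i S x. gset G S \<Longrightarrow> x \<in> el (P i) S \<Longrightarrow> d' i S (f i S x) = f (i - 1) S (d i S x)"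
    and g1: "\<And>i. zmod_hom G (Q i) (P i) (g i)"
    and g2: "\<And>S x. gset G S \<Longrightarrow> x \<in> el (Q 0) S \<Longrightarrow> e S (g 0 S x) = e' S x"
    and g3: "\<And>i S x. gset G S \<Longrightarrow> x \<in> el (Q i) S \<Longrightarrow> d i S (g i S x) = g (i - 1) S (d' i S x)"
  shows "\<exists>s. (\<forall>i. zmod_hom G (P i) (P (i + 1)) (s i)) \<and>
    (\<forall>i S x. gset G S \<longrightarrow> x \<in> el (P i) S \<longrightarrow>
       g i S (f i S x) = x \<otimes>\<^bsub>zobj (P i) S\<^esub> (d (i + 1) S (s i S x) \<otimes>\<^bsub>zobj (P i) S\<^esub> s (i - 1) S (d i S x)))"
proof -
  note D = free_resolutionD[OF R] and D' = free_resolutionD[OF R']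
  define h where "h i S x = g i S (f i S x) \<otimes>\<^bsub>zobj (P i) S\<^esub> inv\<^bsub>zobj (P i) S\<^esub> x" for i S x
  have h_hom: "zmod_hom G (P i) (P i) (h i)" for i
    unfolding h_def
    by (rule zmod_hom_mult[OF D(2) D(2) zmod_hom_comp[OF f1 g1] zmod_hom_minus[OF D(2) D(2) zmod_hom_id]])
  have "\<exists>s. (\<forall>i. zmod_hom G (P i) (P (i + 1)) (s i)) \<and>
    (\<forall>i S x. gset G S \<longrightarrow> x \<in> el (P i) S \<longrightarrow>
       h i S x = d (i + 1) S (s i S x) \<otimes>\<^bsub>zobj (P i) S\<^esub> s (i - 1) S (d i S x))"
  proof (rule null_homotopic[OF R R M h_hom])
    fix S x assume S: "gset G S" and x: "x \<in> el (P 0) S"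
    interpret comm_group "zobj M S" by (rule zm_comm_group[OF M S])
    have fx: "f 0 S x \<in> el (Q 0) S" and gfx: "g 0 S (f 0 S x) \<in> el (P 0) S"
      using zmod_homD(2)[OF f1 S x] zmod_homD(2)[OF g1 S zmod_homD(2)[OF f1 S x]] by auto
    have "inv\<^bsub>zobj (P 0) S\<^esub> x \<in> el (P 0) S" using group.inv_closed[OF zm_group[OF D(2) S] x] .
    then show "e S (h 0 S x) = \<one>\<^bsub>zobj M S\<^esub>"
      using zmod_homD(2)[OF D(5) S x] gfx x
      by (simp add: h_def zmod_homD(3)[OF D(5) S] zmod_hom_inv[OF D(5) D(2) M S] g2[OF S fx] f2[OF S x])
  next
    fix i S x assume S: "gset G S" and x: "x \<in> el (P i) S"
    have fx: "f i S x \<in> el (Q i) S" and gfx: "g i S (f i S x) \<in> el (P i) S"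
      using zmod_homD(2)[OF f1 S x] zmod_homD(2)[OF g1 S zmod_homD(2)[OF f1 S x]] by auto
    have "inv\<^bsub>zobj (P i) S\<^esub> x \<in> el (P i) S" using group.inv_closed[OF zm_group[OF D(2) S] x] .
    then show "d i S (h i S x) = h (i - 1) S (d i S x)"
      using gfx x
      by (simp add: h_def zmod_homD(3)[OF D(4) S] zmod_hom_inv[OF D(4) D(2) D(2) S] g3[OF S fx] f3[OF S x])
  qed
  then obtain s where s: "\<And>i. zmod_hom G (P i) (P (i + 1)) (s i)"
    "\<And>i S x. gset G S \<Longrightarrow> x \<in> el (P i) S \<Longrightarrow>
       h i S x = d (i + 1) S (s i S x) \<otimes>\<^bsub>zobj (P i) S\<^esub> s (i - 1) S (d i S x)" by blast
  have "g i S (f i S x) = x \<otimes>\<^bsub>zobj (P i) S\<^esub> (d (i + 1) S (s i S x) \<otimes>\<^bsub>zobj (P i) S\<^esub> s (i - 1) S (d i S x))"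
    if S: "gset G S" and x: "x \<in> el (P i) S" for i S x
  proof -
    interpret comm_group "zobj (P i) S" by (rule zm_comm_group[OF D(2) S])
    have "g i S (f i S x) \<in> el (P i) S" using zmod_homD(2)[OF g1 S zmod_homD(2)[OF f1 S x]] .
    then show ?thesis unfolding s(2)[OF S x, symmetric] h_def using x m_lcomm[of x _ "inv\<^bsub>zobj (P i) S\<^esub> x"] by simp
  qed
  then show ?thesis using s(1) by blast
qed

text \<open>One half of a homotopy equivalence. The asymmetric form lets the same lemmas be applied
  a second time with the two complexes exchanged.\<close>

definition homotopy_retract ::
  "'g monoid \<Rightarrow> (int \<Rightarrow> ('g, 'p) zmod) \<Rightarrow> (int \<Rightarrow> ('g, 'q) zmod) \<Rightarrow> (int \<Rightarrow> ('g, 'p, 'p) zmap) \<Rightarrow> (int \<Rightarrow> ('g, 'q, 'q) zmap)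
    \<Rightarrow> (int \<Rightarrow> ('g, 'p, 'q) zmap) \<Rightarrow> (int \<Rightarrow> ('g, 'q, 'p) zmap) \<Rightarrow> (int \<Rightarrow> ('g, 'p, 'p) zmap) \<Rightarrow> bool" where
  "homotopy_retract G P Q d d' f g s \<longleftrightarrow>
    (\<forall>i. zmod_hom G (P i) (Q i) (f i)) \<and> (\<forall>i. zmod_hom G (P i) (P (i + 1)) (s i)) \<and>
    (\<forall>i S x. gset G S \<longrightarrow> x \<in> el (P i) S \<longrightarrow> d' i S (f i S x) = f (i - 1) S (d i S x)) \<and>
    (\<forall>i S x. gset G S \<longrightarrow> x \<in> el (P i) S \<longrightarrow>
       g i S (f i S x) = x \<otimes>\<^bsub>zobj (P i) S\<^esub> (d (i + 1) S (s i S x) \<otimes>\<^bsub>zobj (P i) S\<^esub> s (i - 1) S (d i S x)))"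

lemma homotopy_retractD:
  assumes "homotopy_retract G P Q d d' f g s"
  shows "zmod_hom G (P i) (Q i) (f i)" and "zmod_hom G (P i) (P (i + 1)) (s i)"
    and "gset G S \<Longrightarrow> x \<in> el (P i) S \<Longrightarrow> d' i S (f i S x) = f (i - 1) S (d i S x)"
    and "gset G S \<Longrightarrow> x \<in> el (P i) S \<Longrightarrow>
       g i S (f i S x) = x \<otimes>\<^bsub>zobj (P i) S\<^esub> (d (i + 1) S (s i S x) \<otimes>\<^bsub>zobj (P i) S\<^esub> s (i - 1) S (d i S x))"
  using assms unfolding homotopy_retract_def by simp_all

lemma resolution_homotopy_equiv:
  assumes R: "free_resolution G M (P, d, e)" and R': "free_resolution G M (Q, d', e')" and M: "zmodule G M"
  obtains f g s t where "homotopy_retract G P Q d d' f g s" "homotopy_retract G Q P d' d g f t"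
proof -
  obtain f where f: "\<And>i. zmod_hom G (P i) (Q i) (f i)"
    "\<And>S x. gset G S \<Longrightarrow> x \<in> el (P 0) S \<Longrightarrow> e' S (f 0 S x) = e S x"
    "\<And>i S x. gset G S \<Longrightarrow> x \<in> el (P i) S \<Longrightarrow> d' i S (f i S x) = f (i - 1) S (d i S x)"
    using comparison[OF R R' M] by blast
  obtain g where g: "\<And>i. zmod_hom G (Q i) (P i) (g i)"
    "\<And>S x. gset G S \<Longrightarrow> x \<in> el (Q 0) S \<Longrightarrow> e S (g 0 S x) = e' S x"
    "\<And>i S x. gset G S \<Longrightarrow> x \<in> el (Q i) S \<Longrightarrow> d i S (g i S x) = g (i - 1) S (d' i S x)"
    using comparison[OF R' R M] by blast
  obtain s where s: "(\<forall>i. zmod_hom G (P i) (P (i + 1)) (s i)) \<and>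
    (\<forall>i S x. gset G S \<longrightarrow> x \<in> el (P i) S \<longrightarrow>
       g i S (f i S x) = x \<otimes>\<^bsub>zobj (P i) S\<^esub> (d (i + 1) S (s i S x) \<otimes>\<^bsub>zobj (P i) S\<^esub> s (i - 1) S (d i S x)))"
    using comparison_homotopy[of G M P d e Q d' e' f g, OF R R' M f g] by (rule exE)
  obtain t where t: "(\<forall>i. zmod_hom G (Q i) (Q (i + 1)) (t i)) \<and>
    (\<forall>i S x. gset G S \<longrightarrow> x \<in> el (Q i) S \<longrightarrow>
       f i S (g i S x) = x \<otimes>\<^bsub>zobj (Q i) S\<^esub> (d' (i + 1) S (t i S x) \<otimes>\<^bsub>zobj (Q i) S\<^esub> t (i - 1) S (d' i S x)))"
    using comparison_homotopy[of G M Q d' e' P d e g f, OF R' R M g f] by (rule exE)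
  have "homotopy_retract G P Q d d' f g s" unfolding homotopy_retract_def using s f(1,3) by simp
  moreover have "homotopy_retract G Q P d' d g f t" unfolding homotopy_retract_def using t g(1,3) by simp
  ultimately show thesis by (rule that)
qed

section \<open>The internal hom\<close>

lemma zmodule_rep: "zmodule G (rep G X)"
  unfolding zmodule_def
proof (intro conjI allI impI ballI)
  fix S :: "'a gset" assume S: "gset G S"
  show "comm_group (zobj (rep G X) S)"
  proof (rule group.group_comm_groupI[OF groupI])
    fix x assume "x \<in> el (rep G X) S"
    then show "\<exists>y \<in> el (rep G X) S. y \<otimes>\<^bsub>zobj (rep G X) S\<^esub> x = \<one>\<^bsub>zobj (rep G X) S\<^esub>"
      by (intro bexI[of _ "bz_neg x"]) (simp_all add: rep_def)
  qed (simp_all add: rep_def bz_add_assoc, simp add: bz_add_comm)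
next
  fix S T \<phi> assume S: "gset G S" and T: "gset G T" and \<phi>: "\<phi> \<in> bz_hom G S T"
  show "zmor (rep G X) S T \<phi> \<in> hom (zobj (rep G X) T) (zobj (rep G X) S)"
    by (rule homI) (use bz_comp_in[OF T \<phi>] in \<open>simp_all add: rep_def\<close>)
next
  fix S x assume S: "gset G S" and x: "x \<in> el (rep G X) S"
  then show "zmor (rep G X) S S (bz_id S) x = x"
    using bz_comp_id_right[OF S, of x X] by (simp add: rep_def)
qed (simp_all add: rep_def bz_comp_assoc)

lemma rep_simps [simp]:
  "el (rep G X) S = bz_hom G S X"
  "monoid.mult (zobj (rep G X) S) = bz_add"
  "one (zobj (rep G X) S) = bz_zero"
  "zmor (rep G X) S T \<phi> \<psi> = bz_comp T \<psi> \<phi>"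
  by (simp_all add: rep_def)

lemma zmod_hom_rep_map:
  assumes X: "gset G X" and \<theta>: "\<theta> \<in> bz_hom G X Y"
  shows "zmod_hom G (rep G X) (rep G Y) (rep_map X \<theta>)"
  by (rule zmod_homI) (use bz_comp_in[OF X _ \<theta>] in \<open>simp_all add: rep_map_def bz_comp_assoc\<close>)

text \<open>Elements of \<open>hom_group\<close> are extensional, so a transformation given by a
  formula must be cut off outside the carriers before it counts as an element.\<close>

abbreviation zext :: "'g monoid \<Rightarrow> ('g, 'm) zmod \<Rightarrow> ('g, 'm, 'n) zmap \<Rightarrow> ('g, 'm, 'n) zmap" where
  "zext G M \<eta> \<equiv> (\<lambda>S \<in> Collect (gset G). \<lambda>x \<in> el M S. \<eta> S x)"

lemma zext_apply: "gset G S \<Longrightarrow> x \<in> el M S \<Longrightarrow> zext G M \<eta> S x = \<eta> S x"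
  by simp

lemma zmod_hom_cong:
  assumes M: "zmodule G M" and \<eta>: "zmod_hom G M N \<eta>"
    and eq: "\<And>S x. gset G S \<Longrightarrow> x \<in> el M S \<Longrightarrow> \<theta> S x = \<eta> S x"
  shows "zmod_hom G M N \<theta>"
proof (rule zmod_homI)
  fix S x y assume "gset G S" "x \<in> el M S" "y \<in> el M S"
  moreover from this have "x \<otimes>\<^bsub>zobj M S\<^esub> y \<in> el M S"
    using zm_group[OF M] by (simp add: group.is_monoid monoid.m_closed)
  ultimately show "\<theta> S (x \<otimes>\<^bsub>zobj M S\<^esub> y) = \<theta> S x \<otimes>\<^bsub>zobj N S\<^esub> \<theta> S y"
    by (simp add: eq zmod_homD[OF \<eta>])
qed (simp_all add: eq zmod_homD[OF \<eta>] zm_closed[OF M])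

section \<open>Groups of natural transformations and precomposition\<close>

lemma hom_group_hom: "\<eta> \<in> carrier (hom_group G M N) \<Longrightarrow> zmod_hom G M N \<eta>"
  by (simp add: hom_group_def)

lemma zext_in:
  assumes M: "zmodule G M" and \<eta>: "zmod_hom G M N \<eta>"
  shows "zext G M \<eta> \<in> carrier (hom_group G M N)"
proof -
  have "zmod_hom G M N (zext G M \<eta>)" by (rule zmod_hom_cong[OF M \<eta>]) simp
  moreover have "zext G M \<eta> \<in> (\<Pi>\<^sub>E S \<in> Collect (gset G). el M S \<rightarrow>\<^sub>E el N S)"
    using zmod_homD(2)[OF \<eta>] by (intro restrict_PiE_iff[THEN iffD2] ballI) simp
  ultimately show ?thesis by (simp add: hom_group_def)
qed

lemma hom_group_eqI:
  assumes "\<eta> \<in> carrier (hom_group G M N)" "\<theta> \<in> carrier (hom_group G M N)"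
    and "\<And>S x. gset G S \<Longrightarrow> x \<in> el M S \<Longrightarrow> \<eta> S x = \<theta> S x"
  shows "\<eta> = \<theta>"
proof -
  have PiE: "\<eta> \<in> (\<Pi>\<^sub>E S \<in> Collect (gset G). el M S \<rightarrow>\<^sub>E el N S)"
    "\<theta> \<in> (\<Pi>\<^sub>E S \<in> Collect (gset G). el M S \<rightarrow>\<^sub>E el N S)"
    using assms(1,2) by (simp_all add: hom_group_def)
  show ?thesis
  proof (rule PiE_ext[OF PiE])
    fix S assume "S \<in> Collect (gset G)"
    then have S: "gset G S" by simp
    show "\<eta> S = \<theta> S"
      by (rule PiE_ext[of "\<eta> S" "el M S" "\<lambda>_. el N S" "\<theta> S"])
        (use PiE_mem[OF PiE(1)] PiE_mem[OF PiE(2)] S assms(3)[OF S] in simp_all)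
  qed
qed

lemma hom_group_simps:
  "\<eta> \<otimes>\<^bsub>hom_group G M N\<^esub> \<theta> = zext G M (\<lambda>S x. \<eta> S x \<otimes>\<^bsub>zobj N S\<^esub> \<theta> S x)"
  "\<one>\<^bsub>hom_group G M N\<^esub> = zext G M (\<lambda>S x. \<one>\<^bsub>zobj N S\<^esub>)"
  by (simp_all add: hom_group_def)

lemma hom_group_apply:
  "gset G S \<Longrightarrow> x \<in> el M S \<Longrightarrow> (\<eta> \<otimes>\<^bsub>hom_group G M N\<^esub> \<theta>) S x = \<eta> S x \<otimes>\<^bsub>zobj N S\<^esub> \<theta> S x"
  "gset G S \<Longrightarrow> x \<in> el M S \<Longrightarrow> \<one>\<^bsub>hom_group G M N\<^esub> S x = \<one>\<^bsub>zobj N S\<^esub>"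
  by (simp_all add: hom_group_simps)

lemma hom_group_comm_group:
  assumes M: "zmodule G M" and N: "zmodule G N"
  shows "comm_group (hom_group G M N)"
proof -
  have m: "\<eta> \<otimes>\<^bsub>hom_group G M N\<^esub> \<theta> \<in> carrier (hom_group G M N)"
    if "\<eta> \<in> carrier (hom_group G M N)" "\<theta> \<in> carrier (hom_group G M N)" for \<eta> \<theta>
    unfolding hom_group_simps by (rule zext_in[OF M zmod_hom_mult[OF M N that[THEN hom_group_hom]]])
  have o: "\<one>\<^bsub>hom_group G M N\<^esub> \<in> carrier (hom_group G M N)"
    unfolding hom_group_simps by (rule zext_in[OF M zmod_hom_const_one[OF N]])
  have cl: "\<eta> S x \<in> el N S"
    if "\<eta> \<in> carrier (hom_group G M N)" "gset G S" "x \<in> el M S" for \<eta> S x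
    by (rule zmod_homD(2)[OF hom_group_hom[OF that(1)] that(2,3)])
  note ap = hom_group_apply
  show ?thesis
  proof (rule group.group_comm_groupI[OF groupI])
    fix x y z assume h: "x \<in> carrier (hom_group G M N)" "y \<in> carrier (hom_group G M N)" "z \<in> carrier (hom_group G M N)"
    show "x \<otimes>\<^bsub>hom_group G M N\<^esub> y \<otimes>\<^bsub>hom_group G M N\<^esub> z = x \<otimes>\<^bsub>hom_group G M N\<^esub> (y \<otimes>\<^bsub>hom_group G M N\<^esub> z)"
    proof (rule hom_group_eqI[OF m[OF m[OF h(1,2)] h(3)] m[OF h(1) m[OF h(2,3)]]])
      fix S t assume St: "gset G S" "t \<in> el M S"
      interpret comm_group "zobj N S" by (rule zm_comm_group[OF N St(1)])
      show "(x \<otimes>\<^bsub>hom_group G M N\<^esub> y \<otimes>\<^bsub>hom_group G M N\<^esub> z) S t = (x \<otimes>\<^bsub>hom_group G M N\<^esub> (y \<otimes>\<^bsub>hom_group G M N\<^esub> z)) S t"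
        unfolding ap[OF St] by (rule m_assoc[OF h(1-3)[THEN cl, OF St]])
    qed
  next
    fix x assume h: "x \<in> carrier (hom_group G M N)"
    show "\<one>\<^bsub>hom_group G M N\<^esub> \<otimes>\<^bsub>hom_group G M N\<^esub> x = x"
    proof (rule hom_group_eqI[OF m[OF o h] h])
      fix S t assume St: "gset G S" "t \<in> el M S"
      interpret comm_group "zobj N S" by (rule zm_comm_group[OF N St(1)])
      show "(\<one>\<^bsub>hom_group G M N\<^esub> \<otimes>\<^bsub>hom_group G M N\<^esub> x) S t = x S t"
        unfolding ap[OF St] by (rule l_one[OF cl[OF h St]])
    qed
    let ?y = "zext G M (\<lambda>S t. inv\<^bsub>zobj N S\<^esub> x S t)"
    have y: "?y \<in> carrier (hom_group G M N)"
      by (rule zext_in[OF M zmod_hom_minus[OF M N hom_group_hom[OF h]]])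
    show "\<exists>y \<in> carrier (hom_group G M N). y \<otimes>\<^bsub>hom_group G M N\<^esub> x = \<one>\<^bsub>hom_group G M N\<^esub>"
    proof (rule bexI[OF _ y], rule hom_group_eqI[OF m[OF y h] o])
      fix S t assume St: "gset G S" "t \<in> el M S"
      interpret comm_group "zobj N S" by (rule zm_comm_group[OF N St(1)])
      show "(?y \<otimes>\<^bsub>hom_group G M N\<^esub> x) S t = \<one>\<^bsub>hom_group G M N\<^esub> S t"
        unfolding ap[OF St] zext_apply[OF St] by (rule l_inv[OF cl[OF h St]])
    qed
  next
    fix x y assume h: "x \<in> carrier (hom_group G M N)" "y \<in> carrier (hom_group G M N)"
    show "x \<otimes>\<^bsub>hom_group G M N\<^esub> y = y \<otimes>\<^bsub>hom_group G M N\<^esub> x"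
    proof (rule hom_group_eqI[OF m[OF h] m[OF h(2,1)]])
      fix S t assume St: "gset G S" "t \<in> el M S"
      interpret comm_group "zobj N S" by (rule zm_comm_group[OF N St(1)])
      show "(x \<otimes>\<^bsub>hom_group G M N\<^esub> y) S t = (y \<otimes>\<^bsub>hom_group G M N\<^esub> x) S t"
        unfolding ap[OF St] by (rule m_comm[OF h[THEN cl, OF St]])
    qed
  qed (rule m o; assumption)+
qed

lemma precomp_in:
  assumes A: "zmodule G A" and f: "zmod_hom G A B f" and \<eta>: "\<eta> \<in> carrier (hom_group G B N)"
  shows "precomp G A f \<eta> \<in> carrier (hom_group G A N)"
  unfolding precomp_def by (rule zext_in[OF A zmod_hom_comp[OF f hom_group_hom[OF \<eta>]]])

lemma precomp_apply: "gset G S \<Longrightarrow> x \<in> el A S \<Longrightarrow> precomp G A f \<eta> S x = \<eta> S (f S x)"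
  by (simp add: precomp_def)

lemma precomp_hom:
  assumes A: "zmodule G A" and B: "zmodule G B" and N: "zmodule G N" and f: "zmod_hom G A B f"
  shows "precomp G A f \<in> hom (hom_group G B N) (hom_group G A N)"
proof (rule homI)
  fix x y assume x: "x \<in> carrier (hom_group G B N)" and y: "y \<in> carrier (hom_group G B N)"
  interpret HB: comm_group "hom_group G B N" by (rule hom_group_comm_group[OF B N])
  interpret HA: comm_group "hom_group G A N" by (rule hom_group_comm_group[OF A N])
  show "precomp G A f (x \<otimes>\<^bsub>hom_group G B N\<^esub> y) = precomp G A f x \<otimes>\<^bsub>hom_group G A N\<^esub> precomp G A f y"
  proof (rule hom_group_eqI[OF precomp_in[OF A f HB.m_closed[OF x y]] HA.m_closed[OF precomp_in[OF A f x] precomp_in[OF A f y]]])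
    fix S t assume St: "gset G S" "t \<in> el A S"
    show "precomp G A f (x \<otimes>\<^bsub>hom_group G B N\<^esub> y) S t = (precomp G A f x \<otimes>\<^bsub>hom_group G A N\<^esub> precomp G A f y) S t"
      unfolding hom_group_apply[OF St] precomp_apply[OF St]
      by (rule hom_group_apply[OF St(1) zmod_homD(2)[OF f St]])
  qed
qed (rule precomp_in[OF A f])

lemma precomp_eq:
  assumes A: "zmodule G A" and B: "zmodule G B" and C: "zmodule G C" and f: "zmod_hom G A B f" and g: "zmod_hom G A C g"
    and \<eta>: "\<eta> \<in> carrier (hom_group G B N)" and \<theta>: "\<theta> \<in> carrier (hom_group G C N)"
    and eq: "\<And>S x. gset G S \<Longrightarrow> x \<in> el A S \<Longrightarrow> \<eta> S (f S x) = \<theta> S (g S x)"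
  shows "precomp G A f \<eta> = precomp G A g \<theta>"
  by (rule hom_group_eqI[OF precomp_in[OF A f \<eta>] precomp_in[OF A g \<theta>]]) (simp add: precomp_apply eq)

lemma ihom_simps:
  "zobj (ihom G M N) X = hom_group G (box G (rep G X) M) N"
  "zmor (ihom G M N) X Y \<theta> = precomp G (box G (rep G X) M) (box_map G (rep G Y) M (rep_map X \<theta>))"
  by (simp_all add: ihom_def)

text \<open>The module axioms in X are the functor laws of \<open>box_map\<close> applied to the
  representable modules, turned around by precomposition.\<close>

lemma zmodule_ihom:
  assumes M: "zmodule G M" and N: "zmodule G N"
  shows "zmodule G (ihom G M N)"
proof -
  note B = box_zmodule[OF zmodule_rep M]
  have bm: "zmod_hom G (box G (rep G X) M) (box G (rep G Y) M) (box_map G (rep G Y) M (rep_map X \<theta>))"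
    if "gset G X" "\<theta> \<in> bz_hom G X Y" for X Y \<theta>
    by (rule box_map(1)[OF zmodule_rep zmodule_rep M zmod_hom_rep_map[OF that]])
  show ?thesis
    unfolding zmodule_def ihom_simps
  proof (intro conjI allI impI ballI)
    fix S :: "'a gset" assume "gset G S"
    show "comm_group (hom_group G (box G (rep G S) M) N)" by (rule hom_group_comm_group[OF B N])
  next
    fix S T \<phi> assume S: "gset G S" and T: "gset G T" and \<phi>: "\<phi> \<in> bz_hom G S T"
    show "precomp G (box G (rep G S) M) (box_map G (rep G T) M (rep_map S \<phi>))
        \<in> hom (hom_group G (box G (rep G T) M) N) (hom_group G (box G (rep G S) M) N)"
      by (rule precomp_hom[OF B B N bm[OF S \<phi>]])
  next
    fix S x assume S: "gset G S" and x: "x \<in> carrier (hom_group G (box G (rep G S) M) N)"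
    show "precomp G (box G (rep G S) M) (box_map G (rep G S) M (rep_map S (bz_id S))) x = x"
    proof (rule hom_group_eqI[OF precomp_in[OF B bm[OF S bz_id_in[OF S]] x] x])
      fix T t assume Tt: "gset G T" "t \<in> el (box G (rep G S) M) T"
      have "box_map G (rep G S) M (rep_map S (bz_id S)) T t = t"
        by (rule box_map_functor(3)[OF zmodule_rep M zmodule_rep zmod_hom_id Tt zmod_hom_rep_map[OF S bz_id_in[OF S]]])
          (simp add: rep_map_def bz_comp_id_left[OF S])
      then show "precomp G (box G (rep G S) M) (box_map G (rep G S) M (rep_map S (bz_id S))) x T t = x T t"
        by (simp add: precomp_apply[OF Tt])
    qed
  next
    fix S T U \<phi> \<psi> x assume S: "gset G S" and T: "gset G T" and U: "gset G U"
      and \<phi>: "\<phi> \<in> bz_hom G S T" and \<psi>: "\<psi> \<in> bz_hom G T U" and x: "x \<in> carrier (hom_group G (box G (rep G U) M) N)"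
    note cmp = bz_comp_in[OF T \<phi> \<psi>]
    show "precomp G (box G (rep G S) M) (box_map G (rep G U) M (rep_map S (bz_comp T \<psi> \<phi>))) x =
      precomp G (box G (rep G S) M) (box_map G (rep G T) M (rep_map S \<phi>))
        (precomp G (box G (rep G T) M) (box_map G (rep G U) M (rep_map T \<psi>)) x)"
    proof (rule precomp_eq[OF B B B bm[OF S cmp] bm[OF S \<phi>] x precomp_in[OF B bm[OF T \<psi>] x]])
      fix V t assume Vt: "gset G V" "t \<in> el (box G (rep G S) M) V"
      have "box_map G (rep G U) M (rep_map T \<psi>) V (box_map G (rep G T) M (rep_map S \<phi>) V t) = box_map G (rep G U) M (rep_map S (bz_comp T \<psi> \<phi>)) V t"
        unfolding box_map_functor(1)[OF zmodule_rep M zmodule_rep zmod_hom_rep_map[OF S \<phi>] Vt zmodule_rep zmod_hom_rep_map[OF T \<psi>]]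
        by (rule box_map_functor(4)[OF zmodule_rep M zmodule_rep zmod_hom_rep_map[OF S cmp] Vt
              zmod_hom_comp[OF zmod_hom_rep_map[OF S \<phi>] zmod_hom_rep_map[OF T \<psi>]]])
          (simp add: rep_map_def bz_comp_assoc)
      then show "x V (box_map G (rep G U) M (rep_map S (bz_comp T \<psi> \<phi>)) V t) =
          precomp G (box G (rep G T) M) (box_map G (rep G U) M (rep_map T \<psi>)) x V (box_map G (rep G T) M (rep_map S \<phi>) V t)"
        by (simp add: precomp_apply[OF Vt(1) zmod_homD(2)[OF bm[OF S \<phi>] Vt]])
    qed
  next
    fix S T \<phi> \<psi> x assume S: "gset G S" and T: "gset G T"
      and \<phi>: "\<phi> \<in> bz_hom G S T" and \<psi>: "\<psi> \<in> bz_hom G S T" and x: "x \<in> carrier (hom_group G (box G (rep G T) M) N)"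
    interpret HA: comm_group "hom_group G (box G (rep G S) M) N" by (rule hom_group_comm_group[OF B N])
    note add = bz_add_in[OF \<phi> \<psi>]
    show "precomp G (box G (rep G S) M) (box_map G (rep G T) M (rep_map S (bz_add \<phi> \<psi>))) x =
      precomp G (box G (rep G S) M) (box_map G (rep G T) M (rep_map S \<phi>)) x \<otimes>\<^bsub>hom_group G (box G (rep G S) M) N\<^esub>
      precomp G (box G (rep G S) M) (box_map G (rep G T) M (rep_map S \<psi>)) x"
    proof (rule hom_group_eqI[OF precomp_in[OF B bm[OF S add] x] HA.m_closed[OF precomp_in[OF B bm[OF S \<phi>] x] precomp_in[OF B bm[OF S \<psi>] x]]])
      fix V t assume Vt: "gset G V" "t \<in> el (box G (rep G S) M) V"
      have "box_map G (rep G T) M (rep_map S (bz_add \<phi> \<psi>)) V t =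
          box_map G (rep G T) M (rep_map S \<phi>) V t \<otimes>\<^bsub>zobj (box G (rep G T) M) V\<^esub> box_map G (rep G T) M (rep_map S \<psi>) V t"
        by (rule box_map_functor(2)[OF zmodule_rep M zmodule_rep zmod_hom_rep_map[OF S \<phi>] Vt
              zmod_hom_rep_map[OF S \<psi>] zmod_hom_rep_map[OF S add]])
          (simp add: rep_map_def)
      then show "precomp G (box G (rep G S) M) (box_map G (rep G T) M (rep_map S (bz_add \<phi> \<psi>))) x V t =
        (precomp G (box G (rep G S) M) (box_map G (rep G T) M (rep_map S \<phi>)) x \<otimes>\<^bsub>hom_group G (box G (rep G S) M) N\<^esub>
         precomp G (box G (rep G S) M) (box_map G (rep G T) M (rep_map S \<psi>)) x) V t"
        unfolding hom_group_apply[OF Vt] precomp_apply[OF Vt]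
        using zmod_homD(3)[OF hom_group_hom[OF x] Vt(1) zmod_homD(2)[OF bm[OF S \<phi>] Vt] zmod_homD(2)[OF bm[OF S \<psi>] Vt]] by simp
    qed
  qed
qed

lemma ihom_map:
  assumes M: "zmodule G M" and M': "zmodule G M'" and N: "zmodule G N" and f: "zmod_hom G M M' f"
  shows "zmod_hom G (ihom G M' N) (ihom G M N) (ihom_map G M M' f)"
    and "\<eta> \<in> el (ihom G M' N) X \<Longrightarrow> gset G S \<Longrightarrow> x \<in> el (box G (rep G X) M) S \<Longrightarrow>
      ihom_map G M M' f X \<eta> S x = \<eta> S (box_map' G (rep G X) M' f S x)"
proof -
  note B = box_zmodule[OF zmodule_rep M] and B' = box_zmodule[OF zmodule_rep M']
  note bm' = box_map'(1)[OF zmodule_rep M M' f]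
  have bm: "zmod_hom G (box G (rep G X) L) (box G (rep G Y) L) (box_map G (rep G Y) L (rep_map X \<theta>))"
    if "zmodule G L" "gset G X" "\<theta> \<in> bz_hom G X Y" for X Y \<theta> and L :: "('a, 'z) zmod"
    by (rule box_map(1)[OF zmodule_rep zmodule_rep that(1) zmod_hom_rep_map[OF that(2,3)]])
  show "ihom_map G M M' f X \<eta> S x = \<eta> S (box_map' G (rep G X) M' f S x)"
    if "\<eta> \<in> el (ihom G M' N) X" "gset G S" "x \<in> el (box G (rep G X) M) S"
    using that by (simp add: ihom_map_def precomp_apply)
  show "zmod_hom G (ihom G M' N) (ihom G M N) (ihom_map G M M' f)"
    unfolding zmod_hom_def ihom_simps ihom_map_def
  proof (intro conjI allI impI ballI)
    fix S :: "'a gset" assume "gset G S"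
    show "precomp G (box G (rep G S) M) (box_map' G (rep G S) M' f) \<in> hom (hom_group G (box G (rep G S) M') N) (hom_group G (box G (rep G S) M) N)"
      by (rule precomp_hom[OF B B' N bm'])
  next
    fix S T \<phi> x assume S: "gset G S" and T: "gset G T" and \<phi>: "\<phi> \<in> bz_hom G S T"
      and x: "x \<in> carrier (hom_group G (box G (rep G T) M') N)"
    note bM = box_map(1)[OF zmodule_rep zmodule_rep M zmod_hom_rep_map[OF S \<phi>]]
      and bM' = box_map(1)[OF zmodule_rep zmodule_rep M' zmod_hom_rep_map[OF S \<phi>]]
    show "precomp G (box G (rep G S) M) (box_map' G (rep G S) M' f)
         (precomp G (box G (rep G S) M') (box_map G (rep G T) M' (rep_map S \<phi>)) x) =
       precomp G (box G (rep G S) M) (box_map G (rep G T) M (rep_map S \<phi>))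
         (precomp G (box G (rep G T) M) (box_map' G (rep G T) M' f) x)"
    proof (rule precomp_eq[OF B B' B bm' bM precomp_in[OF B' bM' x] precomp_in[OF B bm' x]])
      fix V t assume Vt: "gset G V" "t \<in> el (box G (rep G S) M) V"
      \<comment> \<open>The actions of maps on the two factors of a box product commute; on
        generators both orders give the same tuple.\<close>
      have "box_map G (rep G T) M' (rep_map S \<phi>) V (box_map' G (rep G S) M' f V t) =
          box_map' G (rep G T) M' f V (box_map G (rep G T) M (rep_map S \<phi>) V t)"
        by (rule zmod_hom_box_eq[OF zmodule_rep M B' zmod_hom_comp[OF bm' bM'] zmod_hom_comp[OF bM bm'] Vt])
          (simp add: box_map(2)[OF zmodule_rep zmodule_rep M zmod_hom_rep_map[OF S \<phi>] Vt(1)]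
            box_map(2)[OF zmodule_rep zmodule_rep M' zmod_hom_rep_map[OF S \<phi>] Vt(1)]
            box_map'(2)[OF zmodule_rep M M' f Vt(1)] zmod_homD(2)[OF f] zmod_homD(2)[OF zmod_hom_rep_map[OF S \<phi>], simplified])
      then show "precomp G (box G (rep G S) M') (box_map G (rep G T) M' (rep_map S \<phi>)) x V (box_map' G (rep G S) M' f V t) =
          precomp G (box G (rep G T) M) (box_map' G (rep G T) M' f) x V (box_map G (rep G T) M (rep_map S \<phi>) V t)"
        by (simp add: precomp_apply[OF Vt(1) zmod_homD(2)[OF bm' Vt]] precomp_apply[OF Vt(1) zmod_homD(2)[OF bM Vt]])
    qed
  qed
qed

lemma ihom_map_functor:
  assumes M: "zmodule G M" and M': "zmodule G M'" and N: "zmodule G N" and f: "zmod_hom G M M' f"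
    and X: "gset G X"
  shows "zmodule G M'' \<Longrightarrow> zmod_hom G M' M'' g1 \<Longrightarrow> \<eta>1 \<in> el (ihom G M'' N) X \<Longrightarrow>
      ihom_map G M M' f X (ihom_map G M' M'' g1 X \<eta>1) = ihom_map G M M'' (\<lambda>S x. g1 S (f S x)) X \<eta>1"
    and "zmod_hom G M M' g2 \<Longrightarrow> zmod_hom G M M' h2 \<Longrightarrow>
      (\<And>S x. gset G S \<Longrightarrow> x \<in> el M S \<Longrightarrow> h2 S x = f S x \<otimes>\<^bsub>zobj M' S\<^esub> g2 S x) \<Longrightarrow>
      \<eta>2 \<in> el (ihom G M' N) X \<Longrightarrow>
      ihom_map G M M' h2 X \<eta>2 = ihom_map G M M' f X \<eta>2 \<otimes>\<^bsub>zobj (ihom G M N) X\<^esub> ihom_map G M M' g2 X \<eta>2"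
    and "zmod_hom G M M h3 \<Longrightarrow> (\<And>S x. gset G S \<Longrightarrow> x \<in> el M S \<Longrightarrow> h3 S x = x) \<Longrightarrow>
      \<eta>3 \<in> el (ihom G M N) X \<Longrightarrow> ihom_map G M M h3 X \<eta>3 = \<eta>3"
    and "zmod_hom G M M' h4 \<Longrightarrow> (\<And>S x. gset G S \<Longrightarrow> x \<in> el M S \<Longrightarrow> h4 S x = f S x) \<Longrightarrow>
      \<eta>4 \<in> el (ihom G M' N) X \<Longrightarrow> ihom_map G M M' h4 X \<eta>4 = ihom_map G M M' f X \<eta>4"
proof -
  note B = box_zmodule[OF zmodule_rep]
  show "ihom_map G M M' f X (ihom_map G M' M'' g1 X \<eta>1) = ihom_map G M M'' (\<lambda>S x. g1 S (f S x)) X \<eta>1"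
    if M'': "zmodule G M''" and g: "zmod_hom G M' M'' g1" and \<eta>: "\<eta>1 \<in> el (ihom G M'' N) X"
  proof -
    note \<eta>' = \<eta>[unfolded ihom_simps] and gf = zmod_hom_comp[OF f g]
    show ?thesis
      unfolding ihom_map_def
    proof (rule precomp_eq[OF B[OF M] B[OF M'] B[OF M''] box_map'(1)[OF zmodule_rep M M' f]
          box_map'(1)[OF zmodule_rep M M'' gf] precomp_in[OF B[OF M'] box_map'(1)[OF zmodule_rep M' M'' g] \<eta>'] \<eta>'])
      fix V t assume Vt: "gset G V" "t \<in> el (box G (rep G X) M) V"
      show "precomp G (box G (rep G X) M') (box_map' G (rep G X) M'' g1) \<eta>1 V (box_map' G (rep G X) M' f V t) =
          \<eta>1 V (box_map' G (rep G X) M'' (\<lambda>S x. g1 S (f S x)) V t)"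
        unfolding precomp_apply[OF Vt(1) zmod_homD(2)[OF box_map'(1)[OF zmodule_rep M M' f] Vt]]
          box_map'_functor(1)[OF zmodule_rep M M' f Vt M'' g] ..
    qed
  qed
  show "ihom_map G M M' h2 X \<eta>2 = ihom_map G M M' f X \<eta>2 \<otimes>\<^bsub>zobj (ihom G M N) X\<^esub> ihom_map G M M' g2 X \<eta>2"
    if g: "zmod_hom G M M' g2" and h: "zmod_hom G M M' h2"
      and eq: "\<And>S x. gset G S \<Longrightarrow> x \<in> el M S \<Longrightarrow> h2 S x = f S x \<otimes>\<^bsub>zobj M' S\<^esub> g2 S x"
      and \<theta>: "\<eta>2 \<in> el (ihom G M' N) X"
  proof -
    interpret HA: comm_group "hom_group G (box G (rep G X) M) N" by (rule hom_group_comm_group[OF B[OF M] N])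
    note bm = box_map'(1)[OF zmodule_rep M M'] and \<theta>' = \<theta>[unfolded ihom_simps]
    note pf = precomp_in[OF B[OF M] bm[OF f] \<theta>'] and pg = precomp_in[OF B[OF M] bm[OF g] \<theta>']
      and ph = precomp_in[OF B[OF M] bm[OF h] \<theta>']
    show ?thesis
      unfolding ihom_map_def ihom_simps
    proof (rule hom_group_eqI[OF ph HA.m_closed[OF pf pg]])
      fix V t assume Vt: "gset G V" "t \<in> el (box G (rep G X) M) V"
      have bh: "box_map' G (rep G X) M' h2 V t =
          box_map' G (rep G X) M' f V t \<otimes>\<^bsub>zobj (box G (rep G X) M') V\<^esub> box_map' G (rep G X) M' g2 V t"
        by (rule box_map'_functor(2)[OF zmodule_rep M M' f Vt g h eq])
      show "precomp G (box G (rep G X) M) (box_map' G (rep G X) M' h2) \<eta>2 V t =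
        (precomp G (box G (rep G X) M) (box_map' G (rep G X) M' f) \<eta>2 \<otimes>\<^bsub>hom_group G (box G (rep G X) M) N\<^esub>
         precomp G (box G (rep G X) M) (box_map' G (rep G X) M' g2) \<eta>2) V t"
        unfolding hom_group_apply[OF Vt] precomp_apply[OF Vt] bh
        by (rule zmod_homD(3)[OF hom_group_hom[OF \<theta>'] Vt(1) zmod_homD(2)[OF bm[OF f] Vt] zmod_homD(2)[OF bm[OF g] Vt]])
    qed
  qed
  show "ihom_map G M M h3 X \<eta>3 = \<eta>3"
    if h: "zmod_hom G M M h3" and eq: "\<And>S x. gset G S \<Longrightarrow> x \<in> el M S \<Longrightarrow> h3 S x = x"
      and \<zeta>: "\<eta>3 \<in> el (ihom G M N) X"
    unfolding ihom_map_def
  proof (rule hom_group_eqI[OF precomp_in[OF B[OF M] box_map'(1)[OF zmodule_rep M M h] \<zeta>[unfolded ihom_simps]] \<zeta>[unfolded ihom_simps]])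
    fix V t assume Vt: "gset G V" "t \<in> el (box G (rep G X) M) V"
    have bh: "box_map' G (rep G X) M h3 V t = t"
      by (rule box_map'_functor(3)[OF zmodule_rep M M zmod_hom_id Vt h eq])
    show "precomp G (box G (rep G X) M) (box_map' G (rep G X) M h3) \<eta>3 V t = \<eta>3 V t"
      unfolding precomp_apply[OF Vt] bh ..
  qed
  show "ihom_map G M M' h4 X \<eta>4 = ihom_map G M M' f X \<eta>4"
    if h: "zmod_hom G M M' h4" and eq: "\<And>S x. gset G S \<Longrightarrow> x \<in> el M S \<Longrightarrow> h4 S x = f S x"
      and \<zeta>: "\<eta>4 \<in> el (ihom G M' N) X"
    unfolding ihom_map_def
  proof (rule precomp_eq[OF B[OF M] B[OF M'] B[OF M'] box_map'(1)[OF zmodule_rep M M' h] box_map'(1)[OF zmodule_rep M M' f]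
        \<zeta>[unfolded ihom_simps] \<zeta>[unfolded ihom_simps]])
    fix V t assume Vt: "gset G V" "t \<in> el (box G (rep G X) M) V"
    have bh: "box_map' G (rep G X) M' h4 V t = box_map' G (rep G X) M' f V t"
      by (rule box_map'_functor(4)[OF zmodule_rep M M' f Vt h eq])
    show "\<eta>4 V (box_map' G (rep G X) M' h4 V t) = \<eta>4 V (box_map' G (rep G X) M' f V t)"
      unfolding bh ..
  qed
qed

section \<open>Tor and Ext from an arbitrary free resolution\<close>

text \<open>A zero map satisfies f = f + f, and additivity of the box product carries this equation
  over to the induced map.\<close>

lemma box_map_zero:
  assumes M: "zmodule G M" and M': "zmodule G M'" and N: "zmodule G N" and f: "zmod_hom G M M' f"
    and S: "gset G S" and x: "x \<in> el (box G M N) S"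
    and eq: "\<And>S x. gset G S \<Longrightarrow> x \<in> el M S \<Longrightarrow> f S x = \<one>\<^bsub>zobj M' S\<^esub>"
  shows "box_map G M' N f S x = \<one>\<^bsub>zobj (box G M' N) S\<^esub>"
proof (rule group.idem_imp_one[OF zm_group[OF box_zmodule[OF M' N] S] zmod_homD(2)[OF box_map(1)[OF M M' N f] S x]])
  show "box_map G M' N f S x = box_map G M' N f S x \<otimes>\<^bsub>zobj (box G M' N) S\<^esub> box_map G M' N f S x"
  proof (rule box_map_functor(2)[OF M N M' f S x f f])
    fix S x assume Sx: "gset G S" "x \<in> el M S"
    show "f S x = f S x \<otimes>\<^bsub>zobj M' S\<^esub> f S x"
      using zm_group[OF M' Sx(1)] by (simp add: eq[OF Sx] group.is_monoid monoid.l_one monoid.one_closed)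
  qed
qed

lemma ihom_map_zero:
  assumes M: "zmodule G M" and M': "zmodule G M'" and N: "zmodule G N" and f: "zmod_hom G M M' f"
    and X: "gset G X" and \<eta>: "\<eta> \<in> el (ihom G M' N) X"
    and eq: "\<And>S x. gset G S \<Longrightarrow> x \<in> el M S \<Longrightarrow> f S x = \<one>\<^bsub>zobj M' S\<^esub>"
  shows "ihom_map G M M' f X \<eta> = \<one>\<^bsub>zobj (ihom G M N) X\<^esub>"
proof (rule group.idem_imp_one[OF zm_group[OF zmodule_ihom[OF M N] X] zmod_homD(2)[OF ihom_map(1)[OF M M' N f] X \<eta>]])
  show "ihom_map G M M' f X \<eta> = ihom_map G M M' f X \<eta> \<otimes>\<^bsub>zobj (ihom G M N) X\<^esub> ihom_map G M M' f X \<eta>"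
  proof (rule ihom_map_functor(2)[OF M M' N f X f f _ \<eta>])
    fix S x assume Sx: "gset G S" "x \<in> el M S"
    show "f S x = f S x \<otimes>\<^bsub>zobj M' S\<^esub> f S x"
      using zm_group[OF M' Sx(1)] by (simp add: eq[OF Sx] group.is_monoid monoid.l_one monoid.one_closed)
  qed
qed

lemma box_zseq:
  assumes A: "zmodule G A" and B: "zmodule G B" and C: "zmodule G C" and N: "zmodule G N"
    and f: "zmod_hom G A B f" and g: "zmod_hom G B C g"
    and gf: "\<And>S x. gset G S \<Longrightarrow> x \<in> el A S \<Longrightarrow> g S (f S x) = \<one>\<^bsub>zobj C S\<^esub>"
  shows "zseq G (box G A N) (box G B N) (box G C N) (box_map G B N f) (box_map G C N g)"
  unfolding zseq_def
proof (intro conjI allI impI ballI)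
  fix S x assume Sx: "gset G S" "x \<in> el (box G A N) S"
  show "box_map G C N g S (box_map G B N f S x) = \<one>\<^bsub>zobj (box G C N) S\<^esub>"
    unfolding box_map_functor(1)[OF A N B f Sx C g]
    by (rule box_map_zero[OF A C N zmod_hom_comp[OF f g] Sx gf])
qed (rule box_zmodule[OF A N] box_zmodule[OF B N] box_zmodule[OF C N] box_map(1)[OF A B N f] box_map(1)[OF B C N g])+

lemma ihom_zseq:
  assumes A: "zmodule G A" and B: "zmodule G B" and C: "zmodule G C" and N: "zmodule G N"
    and f: "zmod_hom G A B f" and g: "zmod_hom G B C g"
    and gf: "\<And>S x. gset G S \<Longrightarrow> x \<in> el A S \<Longrightarrow> g S (f S x) = \<one>\<^bsub>zobj C S\<^esub>"
  shows "zseq G (ihom G C N) (ihom G B N) (ihom G A N) (ihom_map G B C g) (ihom_map G A B f)"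
  unfolding zseq_def
proof (intro conjI allI impI ballI)
  fix S x assume Sx: "gset G S" "x \<in> el (ihom G C N) S"
  show "ihom_map G A B f S (ihom_map G B C g S x) = \<one>\<^bsub>zobj (ihom G A N) S\<^esub>"
    unfolding ihom_map_functor(1)[OF A B N f Sx(1) C g Sx(2)]
    by (rule ihom_map_zero[OF A C N zmod_hom_comp[OF f g] Sx gf])
qed (rule zmodule_ihom[OF A N] zmodule_ihom[OF B N] zmodule_ihom[OF C N] ihom_map(1)[OF A B N f] ihom_map(1)[OF B C N g])+

text \<open>The choice operator returns a resolution as soon as one exists; the explicit periodic
  resolutions will be the witnesses.\<close>

lemma the_resolution_ok:
  assumes "free_resolution G M r" shows "free_resolution G M (the_resolution G M)"
  unfolding the_resolution_def by (rule someI[of "free_resolution G M", OF assms])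

lemma free_resolution_diff:
  assumes R: "free_resolution G M (P, d, e)"
  shows "zmod_hom G (P (i + 1)) (P i) (d (i + 1))"
  using free_resolutionD(4)[OF R, of "i + 1"] by simp

lemma Tor_zseq:
  assumes R: "free_resolution G M (P, d, e)" and N: "zmodule G N"
  shows "zseq G (box G (P (i + 1)) N) (box G (P i) N) (box G (P (i - 1)) N)
       (box_map G (P i) N (d (i + 1))) (box_map G (P (i - 1)) N (d i))"
  by (rule box_zseq[of G "P (i + 1)" "P i" "P (i - 1)" N "d (i + 1)" "d i", OF free_resolutionD(2)[OF R] free_resolutionD(2)[OF R] free_resolutionD(2)[OF R] N
        free_resolution_diff[OF R] free_resolutionD(4)[OF R] free_resolution_dd[OF R]])

lemma Ext_zseq:
  assumes R: "free_resolution G M (P, d, e)" and N: "zmodule G N"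
  shows "zseq G (ihom G (P (i - 1)) N) (ihom G (P i) N) (ihom G (P (i + 1)) N)
       (ihom_map G (P i) (P (i - 1)) (d i)) (ihom_map G (P (i + 1)) (P i) (d (i + 1)))"
  by (rule ihom_zseq[of G "P (i + 1)" "P i" "P (i - 1)" N "d (i + 1)" "d i", OF free_resolutionD(2)[OF R] free_resolutionD(2)[OF R] free_resolutionD(2)[OF R] N
        free_resolution_diff[OF R] free_resolutionD(4)[OF R] free_resolution_dd[OF R]])

text \<open>Additive functors preserve chain homotopies: the formula id + (d s + s d) is expanded by
  the composition, sum and identity rules.\<close>

lemma box_homotopy:
  fixes i :: int
  assumes P: "\<And>i. zmodule G (P i)" and Q: "\<And>i. zmodule G (Q i)" and N: "zmodule G N"
    and H: "homotopy_retract G P Q d d' f g s"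
    and g: "\<And>i. zmod_hom G (Q i) (P i) (g i)" and d: "\<And>i. zmod_hom G (P i) (P (i - 1)) (d i)"
    and S: "gset G S" and x: "x \<in> el (box G (P i) N) S"
  shows "box_map G (P i) N (g i) S (box_map G (Q i) N (f i) S x) = x \<otimes>\<^bsub>zobj (box G (P i) N) S\<^esub>
    (box_map G (P i) N (d (i + 1)) S (box_map G (P (i + 1)) N (s i) S x) \<otimes>\<^bsub>zobj (box G (P i) N) S\<^esub>
     box_map G (P i) N (s (i - 1)) S (box_map G (P (i - 1)) N (d i) S x))"
proof -
  note f = homotopy_retractD(1)[OF H] and s = homotopy_retractD(2)[OF H] and eq = homotopy_retractD(4)[OF H]
  have d1: "zmod_hom G (P (i + 1)) (P i) (d (i + 1))" and s1: "zmod_hom G (P (i - 1)) (P i) (s (i - 1))"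
    using d[of "i + 1"] s[of "i - 1"] by simp_all
  note ds = zmod_hom_comp[OF s d1] and sd = zmod_hom_comp[OF d s1]
  note m = zmod_hom_mult[OF P P ds sd]
  show ?thesis
    unfolding box_map_functor(1)[OF P N Q f S x P g] box_map_functor(1)[OF P N P s S x P d1]
      box_map_functor(1)[OF P N P d S x P s1] box_map_functor(2)[OF P N P ds S x sd m refl, symmetric]
    using box_map_functor(2)[OF P N P zmod_hom_id S x m zmod_hom_comp[OF f g] eq]
    unfolding box_map_functor(3)[OF P N P zmod_hom_id S x zmod_hom_id refl] .
qed

lemma ihom_homotopy:
  fixes i :: int
  assumes P: "\<And>i. zmodule G (P i)" and Q: "\<And>i. zmodule G (Q i)" and N: "zmodule G N"
    and H: "homotopy_retract G P Q d d' f g s"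
    and g: "\<And>i. zmod_hom G (Q i) (P i) (g i)" and d: "\<And>i. zmod_hom G (P i) (P (i - 1)) (d i)"
    and S: "gset G S" and x: "x \<in> el (ihom G (P i) N) S"
  shows "ihom_map G (P i) (Q i) (f i) S (ihom_map G (Q i) (P i) (g i) S x) = x \<otimes>\<^bsub>zobj (ihom G (P i) N) S\<^esub>
    (ihom_map G (P i) (P (i - 1)) (d i) S (ihom_map G (P (i - 1)) (P i) (s (i - 1)) S x) \<otimes>\<^bsub>zobj (ihom G (P i) N) S\<^esub>
     ihom_map G (P i) (P (i + 1)) (s i) S (ihom_map G (P (i + 1)) (P i) (d (i + 1)) S x))"
proof -
  note f = homotopy_retractD(1)[OF H] and s = homotopy_retractD(2)[OF H] and eq = homotopy_retractD(4)[OF H]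
  have d1: "zmod_hom G (P (i + 1)) (P i) (d (i + 1))" and s1: "zmod_hom G (P (i - 1)) (P i) (s (i - 1))"
    using d[of "i + 1"] s[of "i - 1"] by simp_all
  note ds = zmod_hom_comp[OF s d1] and sd = zmod_hom_comp[OF d s1]
  note m = zmod_hom_mult[OF P P sd ds]
  \<comment> \<open>Under a contravariant functor the two homotopy terms exchange their roles, so
    they are put into the opposite order beforehand.\<close>
  have eq': "g i S (f i S x) = x \<otimes>\<^bsub>zobj (P i) S\<^esub> (s (i - 1) S (d i S x) \<otimes>\<^bsub>zobj (P i) S\<^esub> d (i + 1) S (s i S x))"
    if "gset G S" "x \<in> el (P i) S" for S x
    unfolding eq[OF that] comm_monoid.m_comm[OF comm_group.axioms(1)[OF zm_comm_group[OF P that(1)]] zmod_homD(2)[OF ds that] zmod_homD(2)[OF sd that]] ..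
  show ?thesis
    unfolding ihom_map_functor(1)[OF P Q N f S P g x] ihom_map_functor(1)[OF P P N s S P d1 x]
      ihom_map_functor(1)[OF P P N d S P s1 x] ihom_map_functor(2)[OF P P N sd S ds m refl x, symmetric]
    using ihom_map_functor(2)[OF P P N zmod_hom_id S m zmod_hom_comp[OF f g] eq' x]
    unfolding ihom_map_functor(3)[OF P P N zmod_hom_id S zmod_hom_id refl x] .
qed

section \<open>Independence of Tor and Ext from the resolution\<close>

lemma box_square:
  assumes A: "zmodule G A" and B: "zmodule G B" and C: "zmodule G C" and D: "zmodule G D" and N: "zmodule G N"
    and f: "zmod_hom G A B f" and g: "zmod_hom G B D g" and f': "zmod_hom G A C f'" and g': "zmod_hom G C D g'"
    and eq: "\<And>S x. gset G S \<Longrightarrow> x \<in> el A S \<Longrightarrow> g S (f S x) = g' S (f' S x)"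
    and S: "gset G S" and x: "x \<in> el (box G A N) S"
  shows "box_map G D N g S (box_map G B N f S x) = box_map G D N g' S (box_map G C N f' S x)"
  unfolding box_map_functor(1)[OF A N B f S x D g] box_map_functor(1)[OF A N C f' S x D g']
  by (rule box_map_functor(4)[OF A N D zmod_hom_comp[OF f' g'] S x zmod_hom_comp[OF f g] eq])

lemma ihom_square:
  assumes A: "zmodule G A" and B: "zmodule G B" and C: "zmodule G C" and D: "zmodule G D" and N: "zmodule G N"
    and f: "zmod_hom G A B f" and g: "zmod_hom G B D g" and f': "zmod_hom G A C f'" and g': "zmod_hom G C D g'"
    and eq: "\<And>S x. gset G S \<Longrightarrow> x \<in> el A S \<Longrightarrow> g S (f S x) = g' S (f' S x)"
    and S: "gset G S" and x: "x \<in> el (ihom G D N) S"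
  shows "ihom_map G A B f S (ihom_map G B D g S x) = ihom_map G A C f' S (ihom_map G C D g' S x)"
  unfolding ihom_map_functor(1)[OF A B N f S D g x] ihom_map_functor(1)[OF A C N f' S D g' x]
  by (rule ihom_map_functor(4)[OF A D N zmod_hom_comp[OF f' g'] S zmod_hom_comp[OF f g] eq x])

lemma Tor_resolution_indep:
  assumes R: "free_resolution G M (P, d, e)" and R': "free_resolution G M (Q, d', e')"
    and M: "zmodule G M" and N: "zmodule G N"
  shows "zmod_iso G
    (homology (box G (P (i + 1)) N) (box G (P i) N) (box G (P (i - 1)) N)
       (box_map G (P i) N (d (i + 1))) (box_map G (P (i - 1)) N (d i)))
    (homology (box G (Q (i + 1)) N) (box G (Q i) N) (box G (Q (i - 1)) N)
       (box_map G (Q i) N (d' (i + 1))) (box_map G (Q (i - 1)) N (d' i)))"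
proof -
  note P = free_resolutionD(2)[OF R] and Q = free_resolutionD(2)[OF R']
    and d = free_resolutionD(4)[OF R] and d' = free_resolutionD(4)[OF R']
    and d1 = free_resolution_diff[OF R] and d1' = free_resolution_diff[OF R']
  obtain f g s t where fgs: "homotopy_retract G P Q d d' f g s" and gft: "homotopy_retract G Q P d' d g f t"
    by (rule resolution_homotopy_equiv[OF R R' M])
  note f = homotopy_retractD(1)[OF fgs] and s = homotopy_retractD(2)[OF fgs] and df = homotopy_retractD(3)[OF fgs]
    and g = homotopy_retractD(1)[OF gft] and t = homotopy_retractD(2)[OF gft]
    and dg = homotopy_retractD(3)[OF gft]
  have df1: "f i S (d (i + 1) S x) = d' (i + 1) S (f (i + 1) S x)"
    if "gset G S" "x \<in> el (P (i + 1)) S" for S x using df[OF that] by simp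
  have dg1: "g i S (d' (i + 1) S x) = d (i + 1) S (g (i + 1) S x)"
    if "gset G S" "x \<in> el (Q (i + 1)) S" for S x using dg[OF that] by simp
  have s1: "zmod_hom G (P (i - 1)) (P i) (s (i - 1))" and t1: "zmod_hom G (Q (i - 1)) (Q i) (t (i - 1))"
    using s[of "i - 1"] t[of "i - 1"] by simp_all
  show ?thesis
    by (rule homology_homotopy_equiv[OF Tor_zseq[OF R N, of i] Tor_zseq[OF R' N, of i]
      box_map(1)[OF P Q N f] box_map(1)[OF P Q N f] box_map(1)[OF P Q N f]
      box_map(1)[OF Q P N g] box_map(1)[OF Q P N g] box_map(1)[OF Q P N g]])
      (rule box_square[where f="d (i + 1)" and g="f i" and f'="f (i + 1)" and g'="d' (i + 1)", OF P P Q Q N d1 f f d1' df1]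
      box_square[where f="f i" and g="d' i" and f'="d i" and g'="f (i - 1)", OF P Q P Q N f d' d f df]
      box_square[where f="d' (i + 1)" and g="g i" and f'="g (i + 1)" and g'="d (i + 1)", OF Q Q P P N d1' g g d1 dg1]
      box_square[where f="g i" and g="d i" and f'="d' i" and g'="g (i - 1)", OF Q P Q P N g d d' g dg]
      box_map(1)[OF P P N s] box_map(1)[OF P P N s1] box_map(1)[OF Q Q N t] box_map(1)[OF Q Q N t1]
      box_homotopy[OF P Q N fgs g d] box_homotopy[OF Q P N gft f d']; assumption)+
qed

lemma Ext_resolution_indep:
  assumes R: "free_resolution G M (P, d, e)" and R': "free_resolution G M (Q, d', e')"
    and M: "zmodule G M" and N: "zmodule G N"
  shows "zmod_iso G
    (homology (ihom G (P (i - 1)) N) (ihom G (P i) N) (ihom G (P (i + 1)) N)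
       (ihom_map G (P i) (P (i - 1)) (d i)) (ihom_map G (P (i + 1)) (P i) (d (i + 1))))
    (homology (ihom G (Q (i - 1)) N) (ihom G (Q i) N) (ihom G (Q (i + 1)) N)
       (ihom_map G (Q i) (Q (i - 1)) (d' i)) (ihom_map G (Q (i + 1)) (Q i) (d' (i + 1))))"
proof -
  note P = free_resolutionD(2)[OF R] and Q = free_resolutionD(2)[OF R']
    and d = free_resolutionD(4)[OF R] and d' = free_resolutionD(4)[OF R']
    and d1 = free_resolution_diff[OF R] and d1' = free_resolution_diff[OF R']
  obtain f g s t where fgs: "homotopy_retract G P Q d d' f g s" and gft: "homotopy_retract G Q P d' d g f t"
    by (rule resolution_homotopy_equiv[OF R R' M])
  note f = homotopy_retractD(1)[OF fgs] and s = homotopy_retractD(2)[OF fgs] and df = homotopy_retractD(3)[OF fgs]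
    and g = homotopy_retractD(1)[OF gft] and t = homotopy_retractD(2)[OF gft]
    and dg = homotopy_retractD(3)[OF gft]
  have df1: "f i S (d (i + 1) S x) = d' (i + 1) S (f (i + 1) S x)"
    if "gset G S" "x \<in> el (P (i + 1)) S" for S x using df[OF that] by simp
  have dg1: "g i S (d' (i + 1) S x) = d (i + 1) S (g (i + 1) S x)"
    if "gset G S" "x \<in> el (Q (i + 1)) S" for S x using dg[OF that] by simp
  have s1: "zmod_hom G (P (i - 1)) (P i) (s (i - 1))" and t1: "zmod_hom G (Q (i - 1)) (Q i) (t (i - 1))"
    using s[of "i - 1"] t[of "i - 1"] by simp_all
  show ?thesis
    \<comment> \<open>Hom reverses arrows: the map from the P-complex to the Q-complex is induced by
      g and the way back by f, while each homotopy stays with its own complex.\<close>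
    by (rule homology_homotopy_equiv[OF Ext_zseq[OF R N, of i] Ext_zseq[OF R' N, of i]
      ihom_map(1)[OF Q P N g] ihom_map(1)[OF Q P N g] ihom_map(1)[OF Q P N g]
      ihom_map(1)[OF P Q N f] ihom_map(1)[OF P Q N f] ihom_map(1)[OF P Q N f]])
      (rule ihom_square[where f="g i" and g="d i" and f'="d' i" and g'="g (i - 1)", OF Q P Q P N g d d' g dg]
      ihom_square[where f="d' (i + 1)" and g="g i" and f'="g (i + 1)" and g'="d (i + 1)", OF Q Q P P N d1' g g d1 dg1]
      ihom_square[where f="f i" and g="d' i" and f'="d i" and g'="f (i - 1)", OF P Q P Q N f d' d f df]
      ihom_square[where f="d (i + 1)" and g="f i" and f'="f (i + 1)" and g'="d' (i + 1)", OF P P Q Q N d1 f f d1' df1]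
      ihom_map(1)[OF P P N s1] ihom_map(1)[OF P P N s] ihom_map(1)[OF Q Q N t1] ihom_map(1)[OF Q Q N t]
      ihom_homotopy[OF P Q N fgs g d] ihom_homotopy[OF Q P N gft f d']; assumption)+
qed

lemma Tor_iso:
  assumes R: "free_resolution G M (P, d, e)" and M: "zmodule G M" and N: "zmodule G N"
  shows "zmod_iso G (Tor G i M N)
    (homology (box G (P (i + 1)) N) (box G (P i) N) (box G (P (i - 1)) N)
       (box_map G (P i) N (d (i + 1))) (box_map G (P (i - 1)) N (d i)))"
proof -
  obtain Q d' e' where r: "the_resolution G M = (Q, d', e')" by (cases "the_resolution G M")
  show ?thesis
    unfolding Tor_def r prod.case
    by (rule Tor_resolution_indep[OF the_resolution_ok[OF R, unfolded r] R M N])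
qed

lemma Ext_iso:
  assumes R: "free_resolution G M (P, d, e)" and M: "zmodule G M" and N: "zmodule G N"
  shows "zmod_iso G (Ext G i M N)
    (homology (ihom G (P (i - 1)) N) (ihom G (P i) N) (ihom G (P (i + 1)) N)
       (ihom_map G (P i) (P (i - 1)) (d i)) (ihom_map G (P (i + 1)) (P i) (d (i + 1))))"
proof -
  obtain Q d' e' where r: "the_resolution G M = (Q, d', e')" by (cases "the_resolution G M")
  show ?thesis
    unfolding Ext_def r prod.case
    by (rule Ext_resolution_indep[OF the_resolution_ok[OF R, unfolded r] R M N])
qed

subsection \<open>Right exactness of the box product\<close>

text \<open>Right exactness of the box product. An inverse modulo the image of d 1 is constructed on
  generators by lifting the first entry along the augmentation; its existence shows that the kernel
  of the induced map is no larger than that image.\<close>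

lemma Tor_0_iso_box:
  assumes R: "free_resolution G M (P, d, e)" and M: "zmodule G M" and N: "zmodule G N"
  shows "zmod_iso G (Tor G 0 M N) (box G M N)"
proof -
  note P = free_resolutionD(2)[OF R] and e = free_resolutionD(5)[OF R]
  have d1: "zmod_hom G (P 1) (P 0) (d 1)" using free_resolution_diff[OF R, of 0] by simp
  let ?BP = "box G (P 0) N" and ?BM = "box G M N" and ?I = "zimg (box G (P 1) N) (box_map G (P 0) N (d 1))"
  have zs: "zseq G (box G (P 1) N) ?BP (box G (P (- 1)) N) (box_map G (P 0) N (d 1)) (box_map G (P (- 1)) N (d 0))"
    using Tor_zseq[OF R N, of 0] by simp
  note B0 = box_zmodule[OF P[of 0] N] and B = box_zmodule[OF M N]
  note be = box_map(1)[OF P[of 0] M N e] and bd = box_map(1)[OF P[of 1] P[of 0] N d1]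
  have I: "submodule_family G ?BP ?I" by (rule submodule_family_zimg[OF box_zmodule[OF P[of 1] N] B0 bd])
  have d0: "d 0 S x = \<one>\<^bsub>zobj (P (- 1)) S\<^esub>" if "gset G S" "x \<in> el (P 0) S" for S x
    using free_resolutionD(3)[OF R _ that(1), of "- 1"] zmod_homD(2)[OF free_resolutionD(4)[OF R, of 0] that] by simp
  have d0_hom: "zmod_hom G (P 0) (P (- 1)) (d 0)" using free_resolutionD(4)[OF R, of 0] by simp
  have bd0: "box_map G (P (- 1)) N (d 0) S x = \<one>\<^bsub>zobj (box G (P (- 1)) N) S\<^esub>"
    if "gset G S" "x \<in> el ?BP S" for S x
    by (rule box_map_zero[OF P P N d0_hom that d0])
  have e_surj: "\<exists>p \<in> el (P 0) X. e X p = m" if "gset G X" "m \<in> el M X" for X m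
    using free_resolutionD(6)[OF R that(1)] that(2) unfolding zimg_def by force
  have cl_d: "box_cl G (P 0) N S (X, Y, \<phi>, d 1 X q, n) \<in> ?I S"
    if S: "gset G S" and g: "(X, Y, \<phi>, q, n) \<in> box_gens G (P 1) N S" for S X Y \<phi> q n
    unfolding zimg_def box_map(2)[OF P[of 1] P[of 0] N d1 S g, symmetric]
    by (rule imageI[OF box_cl_closed[OF P N S g]])
  have mem: "x \<in> ?I S" if S: "gset G S" and x: "x \<in> el ?BP S"
    and ex: "box_map G M N e S x = \<one>\<^bsub>zobj ?BM S\<^esub>" for S x
  proof -
    let ?L = "zobj ?BP S Mod ?I S" and ?\<pi> = "\<lambda>x. ?I S #>\<^bsub>zobj ?BP S\<^esub> x"
    interpret B0: comm_group "zobj ?BP S" by (rule zm_comm_group[OF B0 S])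
    have sub: "subgroup (?I S) (zobj ?BP S)" by (rule submodule_familyD(1)[OF I S])
    interpret L: comm_group ?L by (rule B0.abelian_FactGroup[OF sub])
    have \<pi>: "?\<pi> \<in> hom (zobj ?BP S) ?L" using normal.r_coset_hom_Mod B0.normal_iff_subgroup sub by blast
    let ?c = "\<lambda>X Y \<phi> p n. box_cl G (P 0) N S (X, Y, \<phi>, p, n)"
    note bal = box_balancedD[OF box_cl_balanced[OF P[of 0] N S]]
    \<comment> \<open>Two lifts of the same element differ by some d 1 q, and the generator with
      first entry d 1 q comes from P 1; hence the class modulo the image does not depend on the
      lift.\<close>
    have key: "?\<pi> (?c X Y \<phi> p n) = ?\<pi> (?c X Y \<phi> p' n)"
      if X: "gset G X" and Y: "gset G Y" and \<phi>: "\<phi> \<in> bz_hom G S (gset_prod G X Y)"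
        and p: "p \<in> el (P 0) X" and p': "p' \<in> el (P 0) X" and n: "n \<in> el N Y"
        and eq: "e X p = e X p'" for X Y \<phi> p p' n
    proof -
      interpret P0: comm_group "zobj (P 0) X" by (rule zm_comm_group[OF P X])
      interpret MX: comm_group "zobj M X" by (rule zm_comm_group[OF M X])
      let ?r = "p \<otimes>\<^bsub>zobj (P 0) X\<^esub> inv\<^bsub>zobj (P 0) X\<^esub> p'"
      have "e X ?r = \<one>\<^bsub>zobj M X\<^esub>"
        using p p' eq zmod_homD(2)[OF e X p'] by (simp add: zmod_homD(3)[OF e X] zmod_hom_inv[OF e P M X])
      then have "?r \<in> zimg (P 1) (d 1) X"
        unfolding free_resolutionD(7)[OF R X] zker_iff using p p' by simp
      then obtain q where q: "q \<in> el (P 1) X" "?r = d 1 X q" unfolding zimg_iff by blast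
      have pq: "p = d 1 X q \<otimes>\<^bsub>zobj (P 0) X\<^esub> p'" unfolding q(2)[symmetric] using p p' by (simp add: P0.m_assoc)
      have dq: "d 1 X q \<in> el (P 0) X" using zmod_homD(2)[OF d1 X q(1)] .
      have c: "?c X Y \<phi> p n = ?c X Y \<phi> (d 1 X q) n \<otimes>\<^bsub>zobj ?BP S\<^esub> ?c X Y \<phi> p' n"
        unfolding pq by (rule bal(3)[OF X Y \<phi> dq p' n])
      have in_I: "?c X Y \<phi> (d 1 X q) n \<in> ?I S" by (rule cl_d[OF S]) (simp add: X Y \<phi> q n)
      show ?thesis
        unfolding c using in_I bal(1)[OF X Y \<phi> p' n] subgroup.mem_carrier[OF sub in_I]
        by (metis B0.coset_mult_assoc B0.is_group sub subgroup.rcos_const subgroup.subset)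
    qed
    \<comment> \<open>An arbitrary section of the augmentation, neither additive nor natural. By
      \<open>key\<close> the resulting classes are both.\<close>
    define lift where "lift X m = (SOME p. p \<in> el (P 0) X \<and> e X p = m)" for X m
    have lift: "lift X m \<in> el (P 0) X" "e X (lift X m) = m"
      if "gset G X" "m \<in> el M X" for X m
      using someI_ex[of "\<lambda>p. p \<in> el (P 0) X \<and> e X p = m"] e_surj[OF that] unfolding lift_def by blast+
    define \<beta> where "\<beta> = (\<lambda>(X, Y, \<phi>, m, n). ?\<pi> (?c X Y \<phi> (lift X m) n))"
    have "box_balanced G M N S ?L \<beta>"
    proof (rule box_balancedI)
      fix X Y \<phi> m m' n
      assume *: "gset G X" "gset G Y" "\<phi> \<in> bz_hom G S (gset_prod G X Y)"
        "m \<in> el M X" "m' \<in> el M X" "n \<in> el N Y"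
      have "?\<pi> (?c X Y \<phi> (lift X (m \<otimes>\<^bsub>zobj M X\<^esub> m')) n) = ?\<pi> (?c X Y \<phi> (lift X m \<otimes>\<^bsub>zobj (P 0) X\<^esub> lift X m') n)"
        by (rule key) (use * in \<open>simp_all add: lift zm_m_closed[OF P] zm_m_closed[OF M] zmod_homD(3)[OF e]\<close>)
      then show "\<beta> (X, Y, \<phi>, m \<otimes>\<^bsub>zobj M X\<^esub> m', n) = \<beta> (X, Y, \<phi>, m, n) \<otimes>\<^bsub>?L\<^esub> \<beta> (X, Y, \<phi>, m', n)"
        unfolding \<beta>_def prod.case
        using * by (simp only: bal(3)[OF *(1-3) lift(1)[OF *(1,4)] lift(1)[OF *(1,5)] *(6)]
            hom_mult[OF \<pi> bal(1)[OF *(1-3) lift(1)[OF *(1,4)] *(6)] bal(1)[OF *(1-3) lift(1)[OF *(1,5)] *(6)]])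
    next
      fix X Y X' Y' f h \<phi> m n
      assume *: "gset G X" "gset G Y" "gset G X'" "gset G Y'"
        "f \<in> bz_hom G X X'" "h \<in> bz_hom G Y Y'" "\<phi> \<in> bz_hom G S (gset_prod G X Y)"
        "m \<in> el M X'" "n \<in> el N Y'"
      have "?\<pi> (?c X Y \<phi> (lift X (zmor M X X' f m)) (zmor N Y Y' h n)) = ?\<pi> (?c X Y \<phi> (zmor (P 0) X X' f (lift X' m)) (zmor N Y Y' h n))"
        by (rule key)
          (use * in \<open>simp_all add: lift zm_closed[OF M] zm_closed[OF P] zm_closed[OF N] zmod_homD(4)[OF e]\<close>)
      then show "\<beta> (X', Y', bz_comp (gset_prod G X Y) (bz_prod X Y X' Y' f h) \<phi>, m, n) = \<beta> (X, Y, \<phi>, zmor M X X' f m, zmor N Y Y' h n)"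
        unfolding \<beta>_def prod.case using bal(5)[OF *(1,2,7,3,4,5,6) lift(1)[OF *(3,8)] *(9)] by simp
    next
      fix X Y \<phi> m n
      assume *: "gset G X" "gset G Y" "\<phi> \<in> bz_hom G S (gset_prod G X Y)"
        "m \<in> el M X" "n \<in> el N Y"
      show "\<beta> (X, Y, \<phi>, m, n) \<in> carrier ?L"
        unfolding \<beta>_def prod.case by (rule hom_in_carrier[OF \<pi> bal(1)[OF *(1-3) lift(1)[OF *(1,4)] *(5)]])
    next
      fix X Y \<phi> \<psi> m n
      assume *: "gset G X" "gset G Y" "\<phi> \<in> bz_hom G S (gset_prod G X Y)" "\<psi> \<in> bz_hom G S (gset_prod G X Y)"
        "m \<in> el M X" "n \<in> el N Y"
      note l = lift(1)[OF *(1,5)]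
      show "\<beta> (X, Y, bz_add \<phi> \<psi>, m, n) = \<beta> (X, Y, \<phi>, m, n) \<otimes>\<^bsub>?L\<^esub> \<beta> (X, Y, \<psi>, m, n)"
        unfolding \<beta>_def prod.case bal(2)[OF *(1-3) *(4) l *(6)]
        by (rule hom_mult[OF \<pi> bal(1)[OF *(1-3) l *(6)] bal(1)[OF *(1,2,4) l *(6)]])
    next
      fix X Y \<phi> m n n'
      assume *: "gset G X" "gset G Y" "\<phi> \<in> bz_hom G S (gset_prod G X Y)"
        "m \<in> el M X" "n \<in> el N Y" "n' \<in> el N Y"
      note l = lift(1)[OF *(1,4)]
      show "\<beta> (X, Y, \<phi>, m, n \<otimes>\<^bsub>zobj N Y\<^esub> n') = \<beta> (X, Y, \<phi>, m, n) \<otimes>\<^bsub>?L\<^esub> \<beta> (X, Y, \<phi>, m, n')"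
        unfolding \<beta>_def prod.case bal(4)[OF *(1-3) l *(5,6)]
        by (rule hom_mult[OF \<pi> bal(1)[OF *(1-3) l *(5)] bal(1)[OF *(1-3) l *(6)]])
    qed
    then obtain k where k: "k \<in> hom (zobj ?BM S) ?L" "\<And>x. x \<in> box_gens G M N S \<Longrightarrow> k (box_cl G M N S x) = \<beta> x"
      using box_lift[OF M N S L.comm_group_axioms] by blast
    \<comment> \<open>So k is inverse to the induced map modulo the image: if the induced map kills
      x, then x has trivial class and lies in the image.\<close>
    have "k (box_map G M N e S x) = ?\<pi> x"
    proof (rule box_hom_eq[OF P[of 0] N S L.is_group _ \<pi> _ x])
      show "(\<lambda>x. k (box_map G M N e S x)) \<in> hom (zobj ?BP S) ?L"
        using hom_compose[OF zmod_homD(1)[OF be S] k(1)] by (simp add: comp_def)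
      fix y assume y: "y \<in> box_gens G (P 0) N S"
      obtain X Y \<phi> p n where y_eq: "y = (X, Y, \<phi>, p, n)" by (cases y)
      have *: "gset G X" "gset G Y" "\<phi> \<in> bz_hom G S (gset_prod G X Y)"
        "p \<in> el (P 0) X" "n \<in> el N Y" using y unfolding y_eq by simp_all
      have "k (box_map G M N e S (box_cl G (P 0) N S y)) = \<beta> (X, Y, \<phi>, e X p, n)"
        using * zmod_homD(2)[OF e *(1,4)] unfolding y_eq by (simp add: box_map(2)[OF P[of 0] M N e S] k(2))
      also have "\<dots> = ?\<pi> (box_cl G (P 0) N S y)"
        unfolding \<beta>_def prod.case y_eq
        by (rule key) (use * lift[OF *(1) zmod_homD(2)[OF e *(1,4)]] in simp_all)
      finally show "k (box_map G M N e S (box_cl G (P 0) N S y)) = ?\<pi> (box_cl G (P 0) N S y)" .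
    qed
    then have "?\<pi> x = ?I S"
      unfolding ex using hom_one[OF k(1) zm_group[OF B S] L.is_group] by simp
    then show ?thesis using B0.rcos_self[OF x sub] by simp
  qed
  have "zmod_iso G (homology (box G (P 1) N) ?BP (box G (P (- 1)) N) (box_map G (P 0) N (d 1)) (box_map G (P (- 1)) N (d 0))) ?BM"
    unfolding homology_def
  proof (rule quot_iso_target[OF zseqD(8)[OF zs] B zseqD(9)[OF zs], where \<eta>="box_map G M N e"])
    show "zmod_hom G (submod ?BP (zker ?BP (box G (P (- 1)) N) (box_map G (P (- 1)) N (d 0)))) ?BM (box_map G M N e)"
      by (rule zmod_homI) (simp_all add: zker_iff zmod_homD[OF be])
  next
    fix S x assume S: "gset G S"
      and "x \<in> el (submod ?BP (zker ?BP (box G (P (- 1)) N) (box_map G (P (- 1)) N (d 0)))) S"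
    then have x: "x \<in> el ?BP S" by (simp add: zker_iff)
    have "box_map G M N e S (box_map G (P 0) N (d 1) S z) = \<one>\<^bsub>zobj ?BM S\<^esub>" if z: "z \<in> el (box G (P 1) N) S" for z
    proof -
      have "e S (d 1 S x) = \<one>\<^bsub>zobj M S\<^esub>" if "gset G S" "x \<in> el (P 1) S" for S x
      proof -
        have "d 1 S x \<in> zker (P 0) M e S"
          unfolding free_resolutionD(7)[OF R that(1), symmetric] zimg_def by (rule imageI[OF that(2)])
        then show ?thesis by (simp add: zker_iff)
      qed
      then show ?thesis
        using zseqD(6)[OF box_zseq[OF P P M N d1 e] S z] by blast
    qed
    then show "box_map G M N e S x = \<one>\<^bsub>zobj ?BM S\<^esub> \<longleftrightarrow> x \<in> ?I S"
      using mem[OF S x] unfolding zimg_iff by blast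
  next
    fix S y assume S: "gset G S" and y: "y \<in> el ?BM S"
    let ?img = "zimg ?BP (box_map G M N e)"
    have fam: "submodule_family G ?BM ?img" by (rule submodule_family_zimg[OF B0 B be])
    let ?\<pi> = "\<lambda>x. ?img S #>\<^bsub>zobj ?BM S\<^esub> x"
    interpret BB: comm_group "zobj ?BM S" by (rule zm_comm_group[OF B S])
    have sub: "subgroup (?img S) (zobj ?BM S)" by (rule submodule_familyD(1)[OF fam S])
    interpret L: comm_group "zobj ?BM S Mod ?img S" by (rule BB.abelian_FactGroup[OF sub])
    have \<pi>: "?\<pi> \<in> hom (zobj ?BM S) (zobj ?BM S Mod ?img S)" using normal.r_coset_hom_Mod BB.normal_iff_subgroup sub by blast
    have one: "(\<lambda>x. \<one>\<^bsub>zobj ?BM S Mod ?img S\<^esub>) \<in> hom (zobj ?BM S) (zobj ?BM S Mod ?img S)"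
      by (rule homI) (rule L.one_closed, rule L.l_one[OF L.one_closed, symmetric])
    \<comment> \<open>Surjectivity, phrased as the vanishing of the projection onto the cokernel, so
      that checking generators suffices.\<close>
    have "?\<pi> y = \<one>\<^bsub>zobj ?BM S Mod ?img S\<^esub>"
    proof (rule box_hom_eq[OF M N S L.is_group \<pi> one _ y])
      fix x assume x: "x \<in> box_gens G M N S"
      obtain X Y \<phi> m n where x_eq: "x = (X, Y, \<phi>, m, n)" by (cases x)
      obtain p where p: "p \<in> el (P 0) X" "e X p = m" using e_surj[of X m] x unfolding x_eq by auto
      have g: "(X, Y, \<phi>, p, n) \<in> box_gens G (P 0) N S" using x p unfolding x_eq by simp
      have "box_cl G M N S x = box_map G M N e S (box_cl G (P 0) N S (X, Y, \<phi>, p, n))"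
        unfolding box_map(2)[OF P[of 0] M N e S g] p(2) x_eq ..
      then have "box_cl G M N S x \<in> ?img S" unfolding zimg_iff using box_cl_closed[OF P N S g] by blast
      then show "?\<pi> (box_cl G M N S x) = \<one>\<^bsub>zobj ?BM S Mod ?img S\<^esub>"
        using subgroup.rcos_const[OF sub BB.is_group] by simp
    qed
    then have "y \<in> ?img S" using BB.rcos_self[OF y sub] by simp
    then show "\<exists>x \<in> el (submod ?BP (zker ?BP (box G (P (- 1)) N) (box_map G (P (- 1)) N (d 0)))) S. y = box_map G M N e S x"
      unfolding zimg_iff using bd0[OF S] by (auto simp: zker_iff)
  qed
  then show ?thesis
    using zmod_iso_trans[OF Tor_iso[OF R M N, of 0]] by simp
qed

section \<open>Box product and internal hom with a representable module\<close>

text \<open>Surjectivity at A matches the boundaries, injectivity at C matches the cycles, and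
  bijectivity at B does the rest.\<close>

lemma homology_iso_bij:
  assumes s: "zseq G A B C \<alpha> \<beta>" and s': "zseq G A' B' C' \<alpha>' \<beta>'"
    and fA: "zmod_hom G A A' fA" and fB: "zmod_hom G B B' fB" and fC: "zmod_hom G C C' fC"
    and surjA: "\<And>S y. gset G S \<Longrightarrow> y \<in> el A' S \<Longrightarrow> \<exists>x \<in> el A S. fA S x = y"
    and surjB: "\<And>S y. gset G S \<Longrightarrow> y \<in> el B' S \<Longrightarrow> \<exists>x \<in> el B S. fB S x = y"
    and injB: "\<And>S. gset G S \<Longrightarrow> inj_on (fB S) (el B S)"
    and injC: "\<And>S. gset G S \<Longrightarrow> inj_on (fC S) (el C S)"
    and comm\<alpha>: "\<And>S x. gset G S \<Longrightarrow> x \<in> el A S \<Longrightarrow> fB S (\<alpha> S x) = \<alpha>' S (fA S x)"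
    and comm\<beta>: "\<And>S x. gset G S \<Longrightarrow> x \<in> el B S \<Longrightarrow> fC S (\<beta> S x) = \<beta>' S (fB S x)"
  shows "zmod_iso G (homology A B C \<alpha> \<beta>) (homology A' B' C' \<alpha>' \<beta>')"
  unfolding homology_def
proof (rule quot_iso[OF zseqD(8)[OF s] zseqD(8)[OF s'] zseqD(9)[OF s] zseqD(9)[OF s'], where \<eta>=fB])
  note D = zseqD[OF s] and D' = zseqD[OF s']
  have fC1: "fC S \<one>\<^bsub>zobj C S\<^esub> = \<one>\<^bsub>zobj C' S\<^esub>" if "gset G S" for S
    by (rule zmod_hom_one[OF fC D(3) D'(3) that])
  have ker: "\<beta>' S (fB S x) = \<one>\<^bsub>zobj C' S\<^esub> \<longleftrightarrow> \<beta> S x = \<one>\<^bsub>zobj C S\<^esub>"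
    if S: "gset G S" and x: "x \<in> el B S" for S x
  proof -
    have "\<beta> S x \<in> el C S" "\<one>\<^bsub>zobj C S\<^esub> \<in> el C S"
      using zmod_homD(2)[OF D(5) S x] zm_group[OF D(3) S] by (simp_all add: group.is_monoid monoid.one_closed)
    then show ?thesis
      unfolding comm\<beta>[OF S x, symmetric] fC1[OF S, symmetric] using injC[OF S] by (simp add: inj_on_eq_iff)
  qed
  show "zmod_hom G (submod B (zker B C \<beta>)) (submod B' (zker B' C' \<beta>')) fB"
    by (rule zmod_homI) (simp_all add: zker_iff zmod_homD[OF fB] ker)
  fix S x assume S: "gset G S"
  {
    assume "x \<in> el (submod B (zker B C \<beta>)) S"
    then have x: "x \<in> el B S" by (simp add: zker_iff)
    show "fB S x \<in> zimg A' \<alpha>' S \<longleftrightarrow> x \<in> zimg A \<alpha> S"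
    proof
      assume "fB S x \<in> zimg A' \<alpha>' S"
      then obtain y where y: "y \<in> el A' S" "fB S x = \<alpha>' S y" unfolding zimg_iff by blast
      obtain z where z: "z \<in> el A S" "fA S z = y" using surjA[OF S y(1)] by blast
      have "fB S x = fB S (\<alpha> S z)" unfolding comm\<alpha>[OF S z(1)] z(2) y(2) ..
      then have "x = \<alpha> S z" using injB[OF S] x zmod_homD(2)[OF D(4) S z(1)] by (simp add: inj_on_eq_iff)
      then show "x \<in> zimg A \<alpha> S" using z(1) unfolding zimg_iff by blast
    next
      assume "x \<in> zimg A \<alpha> S"
      then obtain z where z: "z \<in> el A S" "x = \<alpha> S z" unfolding zimg_iff by blast
      show "fB S x \<in> zimg A' \<alpha>' S"
        unfolding z(2) comm\<alpha>[OF S z(1)] zimg_def by (rule imageI[OF zmod_homD(2)[OF fA S z(1)]])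
    qed
  next
    assume "x \<in> el (submod B' (zker B' C' \<beta>')) S"
    then have x: "x \<in> el B' S" "\<beta>' S x = \<one>\<^bsub>zobj C' S\<^esub>" by (simp_all add: zker_iff)
    obtain z where z: "z \<in> el B S" "fB S z = x" using surjB[OF S x(1)] by blast
    have "z \<in> zker B C \<beta> S" using z x(2) ker[OF S z(1)] by (simp add: zker_iff)
    moreover have "\<one>\<^bsub>zobj B' S\<^esub> \<in> zimg A' \<alpha>' S"
      using subgroup.one_closed[OF submodule_familyD(1)[OF D'(9) S]] by simp
    moreover have "x = \<one>\<^bsub>zobj B' S\<^esub> \<otimes>\<^bsub>zobj B' S\<^esub> fB S z"
      unfolding z(2) using zm_group[OF D'(2) S] x(1) by (simp add: group.is_monoid monoid.l_one)
    ultimately show "\<exists>z \<in> el (submod B (zker B C \<beta>)) S. \<exists>k \<in> zimg A' \<alpha>' S.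
        x = k \<otimes>\<^bsub>zobj (submod B' (zker B' C' \<beta>')) S\<^esub> fB S z"
      by auto
  }
qed

subsection \<open>Shifted modules\<close>

definition shift :: "'g monoid \<Rightarrow> ('g, 'n) zmod \<Rightarrow> 'g gset \<Rightarrow> ('g, 'n) zmod" where
  "shift G N X = \<lparr>zobj = \<lambda>S. zobj N (gset_prod G X S),
     zmor = \<lambda>S T \<phi>. zmor N (gset_prod G X S) (gset_prod G X T) (bz_prod X S X T (bz_id X) \<phi>)\<rparr>"

definition shift_map :: "'g monoid \<Rightarrow> ('g, 'n) zmod \<Rightarrow> 'g gset \<Rightarrow> 'g gset \<Rightarrow> mat \<Rightarrow> ('g, 'n, 'n) zmap" where
  "shift_map G N X Y \<theta> = (\<lambda>S. zmor N (gset_prod G Y S) (gset_prod G X S) (bz_prod Y S X S \<theta> (bz_id S)))"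

lemma shift_simps [simp]:
  "zobj (shift G N X) S = zobj N (gset_prod G X S)"
  "zmor (shift G N X) S T \<phi> = zmor N (gset_prod G X S) (gset_prod G X T) (bz_prod X S X T (bz_id X) \<phi>)"
  by (simp_all add: shift_def)

lemma zmodule_shift:
  assumes N: "zmodule G N" and X: "gset G X" shows "zmodule G (shift G N X)"
proof -
  note XP = finite_gset_prod[OF X]
  have p: "bz_prod X S X T (bz_id X) \<phi> \<in> bz_hom G (gset_prod G X S) (gset_prod G X T)"
    if "gset G S" "gset G T" "\<phi> \<in> bz_hom G S T" for S T \<phi>
    by (rule bz_prod_in[OF X that(1) X that(2) bz_id_in[OF X] that(3)])
  show ?thesis
    unfolding zmodule_def shift_simps
  proof (intro conjI allI impI ballI)
    fix S x assume "gset G S" "x \<in> el N (gset_prod G X S)"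
    then show "zmor N (gset_prod G X S) (gset_prod G X S) (bz_prod X S X S (bz_id X) (bz_id S)) x = x"
      unfolding bz_prod_id[where G=G] by (intro zm_id[OF N XP])
  next
    fix S T U \<phi> \<psi> x assume *: "gset G S" "gset G T" "gset G U"
      "\<phi> \<in> bz_hom G S T" "\<psi> \<in> bz_hom G T U" "x \<in> el N (gset_prod G X U)"
    have "bz_prod X S X U (bz_id X) (bz_comp T \<psi> \<phi>) =
        bz_comp (gset_prod G X T) (bz_prod X T X U (bz_id X) \<psi>) (bz_prod X S X T (bz_id X) \<phi>)"
      unfolding bz_prod_comp[OF bz_id_in[OF X] bz_id_in[OF X] *(4,5)] bz_comp_id_left[OF X bz_id_in[OF X]] ..
    then show "zmor N (gset_prod G X S) (gset_prod G X U) (bz_prod X S X U (bz_id X) (bz_comp T \<psi> \<phi>)) x =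
        zmor N (gset_prod G X S) (gset_prod G X T) (bz_prod X S X T (bz_id X) \<phi>)
         (zmor N (gset_prod G X T) (gset_prod G X U) (bz_prod X T X U (bz_id X) \<psi>) x)"
      using zm_comp[OF N XP[OF *(1)] XP[OF *(2)] XP[OF *(3)] p[OF *(1,2,4)] p[OF *(2,3,5)] *(6)] by simp
  qed (simp_all add: zm_comm_group[OF N XP] zm_hom[OF N XP XP p] bz_prod_add zm_add[OF N XP XP p p])
qed

lemma zmod_hom_shift_map:
  assumes N: "zmodule G N" and X: "gset G X" and Y: "gset G Y" and \<theta>: "\<theta> \<in> bz_hom G Y X"
  shows "zmod_hom G (shift G N X) (shift G N Y) (shift_map G N X Y \<theta>)"
proof -
  note XP = finite_gset_prod[OF X] and YP = finite_gset_prod[OF Y]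
  have t: "bz_prod Y S X S \<theta> (bz_id S) \<in> bz_hom G (gset_prod G Y S) (gset_prod G X S)" if "gset G S" for S
    by (rule bz_prod_in[OF Y that X that \<theta> bz_id_in[OF that]])
  show ?thesis
    unfolding zmod_hom_def shift_map_def shift_simps
  proof (intro conjI allI impI ballI)
    fix S :: "'a gset" assume S: "gset G S"
    show "zmor N (gset_prod G Y S) (gset_prod G X S) (bz_prod Y S X S \<theta> (bz_id S)) \<in> hom (zobj N (gset_prod G X S)) (zobj N (gset_prod G Y S))"
      by (rule zm_hom[OF N YP[OF S] XP[OF S] t[OF S]])
  next
    fix S T \<phi> x assume S: "gset G S" and T: "gset G T" and \<phi>: "\<phi> \<in> bz_hom G S T"
      and x: "x \<in> el N (gset_prod G X T)"
    have pX: "bz_prod X S X T (bz_id X) \<phi> \<in> bz_hom G (gset_prod G X S) (gset_prod G X T)"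
      and pY: "bz_prod Y S Y T (bz_id Y) \<phi> \<in> bz_hom G (gset_prod G Y S) (gset_prod G Y T)"
      by (rule bz_prod_in[OF X S X T bz_id_in[OF X] \<phi>], rule bz_prod_in[OF Y S Y T bz_id_in[OF Y] \<phi>])
    have "bz_comp (gset_prod G X S) (bz_prod X S X T (bz_id X) \<phi>) (bz_prod Y S X S \<theta> (bz_id S)) =
        bz_comp (gset_prod G Y T) (bz_prod Y T X T \<theta> (bz_id T)) (bz_prod Y S Y T (bz_id Y) \<phi>)"
      unfolding bz_prod_comp[OF \<theta> bz_id_in[OF X] bz_id_in[OF S] \<phi>] bz_prod_comp[OF bz_id_in[OF Y] \<theta> \<phi> bz_id_in[OF T]]
        bz_comp_id_left[OF X \<theta>] bz_comp_id_right[OF Y \<theta>] bz_comp_id_left[OF T \<phi>] bz_comp_id_right[OF S \<phi>] ..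
    then show "zmor N (gset_prod G Y S) (gset_prod G X S) (bz_prod Y S X S \<theta> (bz_id S))
         (zmor N (gset_prod G X S) (gset_prod G X T) (bz_prod X S X T (bz_id X) \<phi>) x) =
        zmor N (gset_prod G Y S) (gset_prod G Y T) (bz_prod Y S Y T (bz_id Y) \<phi>)
         (zmor N (gset_prod G Y T) (gset_prod G X T) (bz_prod Y T X T \<theta> (bz_id T)) x)"
      unfolding zm_comp[OF N YP[OF S] XP[OF S] XP[OF T] t[OF S] pX x, symmetric]
        zm_comp[OF N YP[OF S] YP[OF T] XP[OF T] pY t[OF T] x, symmetric] by simp
  qed
qed

lemma shift_zseq:
  assumes N: "zmodule G N" and X: "gset G X" and Y: "gset G Y" and Z: "gset G Z"
    and \<theta>: "\<theta> \<in> bz_hom G Y X" and \<theta>': "\<theta>' \<in> bz_hom G Z Y" and zero: "bz_comp Y \<theta> \<theta>' = bz_zero"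
  shows "zseq G (shift G N X) (shift G N Y) (shift G N Z) (shift_map G N X Y \<theta>) (shift_map G N Y Z \<theta>')"
  unfolding zseq_def
proof (intro conjI allI impI ballI)
  fix S x assume S: "gset G S" and x: "x \<in> el (shift G N X) S"
  note id = bz_id_in[OF S]
  have "bz_comp (gset_prod G Y S) (bz_prod Y S X S \<theta> (bz_id S)) (bz_prod Z S Y S \<theta>' (bz_id S)) = bz_zero"
    unfolding bz_prod_comp[OF \<theta>' \<theta> id id] zero by (simp add: bz_prod_def bz_zero_def fun_eq_iff)
  then show "shift_map G N Y Z \<theta>' S (shift_map G N X Y \<theta> S x) = \<one>\<^bsub>zobj (shift G N Z) S\<^esub>"
    using zm_comp[OF N finite_gset_prod[OF Z S] finite_gset_prod[OF Y S] finite_gset_prod[OF X S]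
        bz_prod_in[OF Z S Y S \<theta>' id] bz_prod_in[OF Y S X S \<theta> id], of x]
      zm_zero[OF N finite_gset_prod[OF Z S] finite_gset_prod[OF X S], of x] x
    by (simp add: shift_map_def)
qed (rule zmodule_shift[OF N X] zmodule_shift[OF N Y] zmodule_shift[OF N Z]
    zmod_hom_shift_map[OF N X Y \<theta>] zmod_hom_shift_map[OF N Y Z \<theta>'])+

subsection \<open>Free modules on one generator\<close>

text \<open>Resolutions are made of \<open>free_mod\<close>s, so a representable module enters them
  as a direct sum over a one-element index set.\<close>

abbreviation free1 :: "'g monoid \<Rightarrow> 'j \<Rightarrow> 'g gset \<Rightarrow> ('g, 'j \<Rightarrow> mat) zmod" where
  "free1 G j X \<equiv> free_mod G {j} (\<lambda>_. X)"

definition single :: "'j \<Rightarrow> mat \<Rightarrow> 'j \<Rightarrow> mat" where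
  "single j \<mu> = (\<lambda>i. if i = j then \<mu> else bz_zero)"

definition free1_map :: "'j \<Rightarrow> 'g gset \<Rightarrow> mat \<Rightarrow> ('g, 'j \<Rightarrow> mat, 'j \<Rightarrow> mat) zmap" where
  "free1_map j X \<theta> = (\<lambda>S u. single j (bz_comp X \<theta> (u j)))"

lemma free1_carrier: "el (free1 G j X) S = single j ` bz_hom G S X"
proof (intro equalityI subsetI)
  fix u assume u: "u \<in> el (free1 G j X) S"
  then have "u = single j (u j)" by (auto simp: single_def)
  moreover have "u j \<in> bz_hom G S X" using u by simp
  ultimately show "u \<in> single j ` bz_hom G S X" by blast
next
  fix u assume "u \<in> single j ` bz_hom G S X"
  then obtain \<mu> where \<mu>: "\<mu> \<in> bz_hom G S X" "u = single j \<mu>" by blast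
  have "finite {i. u i \<noteq> bz_zero}" by (rule finite_subset[of _ "{j}"]) (auto simp: \<mu>(2) single_def)
  then show "u \<in> el (free1 G j X) S" using \<mu> by (simp add: single_def)
qed

lemma single_apply [simp]: "single j \<mu> j = \<mu>"
  by (simp add: single_def)

lemma single_in: "\<mu> \<in> bz_hom G S X \<Longrightarrow> single j \<mu> \<in> el (free1 G j X) S"
  unfolding free1_carrier by (rule imageI)

lemma free1_mult: "single j \<mu> \<otimes>\<^bsub>zobj (free1 G j X) S\<^esub> single j \<nu> = single j (bz_add \<mu> \<nu>)"
  by (auto simp: single_def)

lemma free1_mor: "zmor (free1 G j X) S T \<phi> (single j \<mu>) = single j (bz_comp T \<mu> \<phi>)"
  by (auto simp: single_def)

lemma free1_one: "\<one>\<^bsub>zobj (free1 G j X) S\<^esub> = single j bz_zero"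
  by (auto simp: single_def)

lemma single_eq_iff [simp]: "single j \<mu> = single j \<nu> \<longleftrightarrow> \<mu> = \<nu>"
  by (metis single_apply)

lemma free1_map_single: "free1_map j X \<theta> S (single j \<mu>) = single j (bz_comp X \<theta> \<mu>)"
  by (simp add: free1_map_def)

lemma zmod_hom_free1_map:
  assumes X: "gset G X" and \<theta>: "\<theta> \<in> bz_hom G X Y"
  shows "zmod_hom G (free1 G j X) (free1 G j Y) (free1_map j X \<theta>)"
proof (rule zmod_homI)
  fix S u v assume u: "u \<in> el (free1 G j X) S" and v: "v \<in> el (free1 G j X) S"
  then obtain \<mu> \<nu> where *: "\<mu> \<in> bz_hom G S X" "u = single j \<mu>" "\<nu> \<in> bz_hom G S X" "v = single j \<nu>"
    unfolding free1_carrier by blast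
  show "free1_map j X \<theta> S u \<in> el (free1 G j Y) S"
    unfolding *(2) free1_map_single by (rule single_in[OF bz_comp_in[OF X *(1) \<theta>]])
  show "free1_map j X \<theta> S (u \<otimes>\<^bsub>zobj (free1 G j X) S\<^esub> v) =
      free1_map j X \<theta> S u \<otimes>\<^bsub>zobj (free1 G j Y) S\<^esub> free1_map j X \<theta> S v"
    unfolding *(2,4) free1_mult free1_map_single by simp
next
  fix S T \<phi> u assume "u \<in> el (free1 G j X) T"
  then obtain \<mu> where *: "u = single j \<mu>" unfolding free1_carrier by blast
  show "free1_map j X \<theta> S (zmor (free1 G j X) S T \<phi> u) = zmor (free1 G j Y) S T \<phi> (free1_map j X \<theta> T u)"
    unfolding * free1_mor free1_map_single bz_comp_assoc ..
qed

subsection \<open>The isomorphism of \<open>F\<^sub>X \<box> N\<close> with \<open>N(X \<times> -)\<close>\<close>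

text \<open>
  Since \<open>\<int>\<langle>X\<rangle>\<close> is self-dual, a map \<open>\<int>\<langle>S\<rangle> \<rightarrow> \<int>\<langle>A \<times> B\<rangle>\<close> and a map \<open>\<int>\<langle>A\<rangle> \<rightarrow> \<int>\<langle>X\<rangle>\<close> give a map
  \<open>\<int>\<langle>X \<times> S\<rangle> \<rightarrow> \<int>\<langle>B\<rangle>\<close>.
\<close>

definition mate :: "'g gset \<Rightarrow> 'g gset \<Rightarrow> 'g gset \<Rightarrow> 'g gset \<Rightarrow> mat \<Rightarrow> mat \<Rightarrow> mat" where
  "mate X A S B \<phi> \<mu> = (\<lambda>p b. if p \<in> prod_encode ` (pts X \<times> pts S) \<and> b \<in> pts B
     then \<Sum>a \<in> pts A. \<phi> (snd (prod_decode p)) (prod_encode (a, b)) * \<mu> a (fst (prod_decode p)) else 0)"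

lemma mate_apply: "x \<in> pts X \<Longrightarrow> s \<in> pts S \<Longrightarrow> b \<in> pts B \<Longrightarrow>
    mate X A S B \<phi> \<mu> (prod_encode (x, s)) b = (\<Sum>a \<in> pts A. \<phi> s (prod_encode (a, b)) * \<mu> a x)"
  by (simp add: mate_def)

lemma bz_hom_prod_eqI:
  assumes "\<phi> \<in> bz_hom G (gset_prod G X S) B" "\<psi> \<in> bz_hom G (gset_prod G X S) B"
    and "\<And>x s b. x \<in> pts X \<Longrightarrow> s \<in> pts S \<Longrightarrow> b \<in> pts B \<Longrightarrow> \<phi> (prod_encode (x, s)) b = \<psi> (prod_encode (x, s)) b"
  shows "\<phi> = \<psi>"
  by (rule bz_hom_eqI[OF assms(1,2)]) (use assms(3) in force)

lemma mate_in:
  assumes A: "gset G A" and B: "gset G B" and X: "gset G X" and S: "gset G S"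
    and \<phi>: "\<phi> \<in> bz_hom G S (gset_prod G A B)" and \<mu>: "\<mu> \<in> bz_hom G A X"
  shows "mate X A S B \<phi> \<mu> \<in> bz_hom G (gset_prod G X S) B"
proof (rule bz_homI)
  fix g p b assume g: "g \<in> carrier G" and p: "p \<in> pts (gset_prod G X S)" and b: "b \<in> pts B"
  from p obtain x s where p_eq: "p = prod_encode (x, s)" and x: "x \<in> pts X" and s: "s \<in> pts S" by auto
  have eq: "\<phi> (act S g s) (prod_encode (act A g a, act B g b)) * \<mu> (act A g a) (act X g x) = \<phi> s (prod_encode (a, b)) * \<mu> a x"
    if a: "a \<in> pts A" for a
    using bz_hom_inv[OF \<phi> g s, of "prod_encode (a, b)"] bz_hom_inv[OF \<mu> g a x] a b by (simp add: act_gset_prod)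
  have "mate X A S B \<phi> \<mu> (act (gset_prod G X S) g p) (act B g b) =
      (\<Sum>a \<in> pts A. \<phi> (act S g s) (prod_encode (a, act B g b)) * \<mu> a (act X g x))"
    unfolding p_eq act_gset_prod[OF x s]
    by (rule mate_apply[OF act_closed[OF X g x] act_closed[OF S g s] act_closed[OF B g b]])
  also have "\<dots> = (\<Sum>a \<in> pts A. \<phi> (act S g s) (prod_encode (act A g a, act B g b)) * \<mu> (act A g a) (act X g x))"
    by (rule sum_act[OF A g, symmetric])
  also have "\<dots> = mate X A S B \<phi> \<mu> p b"
    unfolding p_eq mate_apply[OF x s b] by (rule sum.cong[OF refl eq])
  finally show "mate X A S B \<phi> \<mu> (act (gset_prod G X S) g p) (act B g b) = mate X A S B \<phi> \<mu> p b" .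
qed (auto simp: mate_def)

lemma mate_add:
  "mate X A S B (bz_add \<phi> \<phi>') \<mu> = bz_add (mate X A S B \<phi> \<mu>) (mate X A S B \<phi>' \<mu>)"
  "mate X A S B \<phi> (bz_add \<mu> \<mu>') = bz_add (mate X A S B \<phi> \<mu>) (mate X A S B \<phi> \<mu>')"
  by (intro ext; simp add: mate_def bz_add_def algebra_simps sum.distrib)+

text \<open>The coend relation after passage to mates: f is absorbed into \<mu>, and h is applied
  afterwards. The computation is a rearrangement of three finite sums.\<close>

lemma mate_comp:
  assumes A: "gset G A" and B: "gset G B" and A': "gset G A'" and B': "gset G B'"
    and X: "gset G X" and S: "gset G S"
    and \<phi>: "\<phi> \<in> bz_hom G S (gset_prod G A B)" and f: "f \<in> bz_hom G A A'" and h: "h \<in> bz_hom G B B'" and \<mu>: "\<mu> \<in> bz_hom G A' X"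
  shows "mate X A' S B' (bz_comp (gset_prod G A B) (bz_prod A B A' B' f h) \<phi>) \<mu> = bz_comp B h (mate X A S B \<phi> (bz_comp A' \<mu> f))"
proof (rule bz_hom_prod_eqI)
  show "mate X A' S B' (bz_comp (gset_prod G A B) (bz_prod A B A' B' f h) \<phi>) \<mu> \<in> bz_hom G (gset_prod G X S) B'"
    by (rule mate_in[OF A' B' X S bz_comp_in[OF finite_gset_prod[OF A B] \<phi> bz_prod_in[OF A B A' B' f h]] \<mu>])
  show "bz_comp B h (mate X A S B \<phi> (bz_comp A' \<mu> f)) \<in> bz_hom G (gset_prod G X S) B'"
    by (rule bz_comp_in[OF B mate_in[OF A B X S \<phi> bz_comp_in[OF A' f \<mu>]] h])
  fix x s b' assume *: "x \<in> pts X" "s \<in> pts S" "b' \<in> pts B'"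
  have "mate X A' S B' (bz_comp (gset_prod G A B) (bz_prod A B A' B' f h) \<phi>) \<mu> (prod_encode (x, s)) b' =
      (\<Sum>a' \<in> pts A'. (\<Sum>a \<in> pts A. \<Sum>b \<in> pts B. \<phi> s (prod_encode (a, b)) * (f a a' * h b b')) * \<mu> a' x)"
    unfolding mate_apply[OF *] using * by (simp add: bz_comp_def sum_prod_encode)
  also have "\<dots> = (\<Sum>a' \<in> pts A'. \<Sum>a \<in> pts A. \<Sum>b \<in> pts B. \<phi> s (prod_encode (a, b)) * f a a' * \<mu> a' x * h b b')"
    by (simp add: sum_distrib_left sum_distrib_right mult_ac)
  also have "\<dots> = (\<Sum>a' \<in> pts A'. \<Sum>b \<in> pts B. \<Sum>a \<in> pts A. \<phi> s (prod_encode (a, b)) * f a a' * \<mu> a' x * h b b')"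
    by (intro sum.cong refl sum.swap)
  also have "\<dots> = (\<Sum>b \<in> pts B. \<Sum>a' \<in> pts A'. \<Sum>a \<in> pts A. \<phi> s (prod_encode (a, b)) * f a a' * \<mu> a' x * h b b')"
    by (rule sum.swap)
  also have "\<dots> = (\<Sum>b \<in> pts B. \<Sum>a \<in> pts A. \<Sum>a' \<in> pts A'. \<phi> s (prod_encode (a, b)) * f a a' * \<mu> a' x * h b b')"
    by (intro sum.cong refl sum.swap)
  also have "\<dots> = bz_comp B h (mate X A S B \<phi> (bz_comp A' \<mu> f)) (prod_encode (x, s)) b'"
    using * by (simp add: bz_comp_def mate_apply sum_distrib_left sum_distrib_right mult_ac)
  finally show "mate X A' S B' (bz_comp (gset_prod G A B) (bz_prod A B A' B' f h) \<phi>) \<mu> (prod_encode (x, s)) b' =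
      bz_comp B h (mate X A S B \<phi> (bz_comp A' \<mu> f)) (prod_encode (x, s)) b'" .
qed

lemma bz_id_sum:
  assumes "gset G S" "s \<in> pts S"
  shows "(\<Sum>t \<in> pts S. bz_id S s t * F t) = F s" "(\<Sum>t \<in> pts S. bz_id S t s * F t) = F s"
    "(\<Sum>t \<in> pts S. F t * bz_id S t s) = F s"
proof -
  note fin = finite_gset_finite[OF assms(1)]
  have "(\<Sum>t \<in> pts S. bz_id S s t * F t) = (\<Sum>t \<in> pts S. if s = t then F t else 0)"
    by (rule sum.cong) (auto simp: bz_id_def assms(2))
  then show 1: "(\<Sum>t \<in> pts S. bz_id S s t * F t) = F s" using assms(2) fin by simp
  have "bz_id S t s = bz_id S s t" for t using assms(2) by (auto simp: bz_id_def)
  then show "(\<Sum>t \<in> pts S. bz_id S t s * F t) = F s" "(\<Sum>t \<in> pts S. F t * bz_id S t s) = F s" using 1 by (simp_all add: mult.commute)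
qed

lemma mate_natural:
  assumes A: "gset G A" and B: "gset G B" and X: "gset G X" and S: "gset G S" and S': "gset G S'"
    and \<phi>: "\<phi> \<in> bz_hom G S' (gset_prod G A B)" and \<theta>: "\<theta> \<in> bz_hom G S S'" and \<mu>: "\<mu> \<in> bz_hom G A X"
  shows "mate X A S B (bz_comp S' \<phi> \<theta>) \<mu> = bz_comp (gset_prod G X S') (mate X A S' B \<phi> \<mu>) (bz_prod X S X S' (bz_id X) \<theta>)"
proof (rule bz_hom_prod_eqI)
  show "mate X A S B (bz_comp S' \<phi> \<theta>) \<mu> \<in> bz_hom G (gset_prod G X S) B"
    by (rule mate_in[OF A B X S bz_comp_in[OF S' \<theta> \<phi>] \<mu>])
  show "bz_comp (gset_prod G X S') (mate X A S' B \<phi> \<mu>) (bz_prod X S X S' (bz_id X) \<theta>) \<in> bz_hom G (gset_prod G X S) B"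
    by (rule bz_comp_in[OF finite_gset_prod[OF X S'] bz_prod_in[OF X S X S' bz_id_in[OF X] \<theta>] mate_in[OF A B X S' \<phi> \<mu>]])
  fix x s b assume *: "x \<in> pts X" "s \<in> pts S" "b \<in> pts B"
  have "bz_comp (gset_prod G X S') (mate X A S' B \<phi> \<mu>) (bz_prod X S X S' (bz_id X) \<theta>) (prod_encode (x, s)) b =
     (\<Sum>x' \<in> pts X. bz_id X x x' * (\<Sum>s' \<in> pts S'. \<theta> s s' * (\<Sum>a \<in> pts A. \<phi> s' (prod_encode (a, b)) * \<mu> a x')))"
    using * by (simp add: bz_comp_def sum_prod_encode mate_apply sum_distrib_left mult.assoc)
  also have "\<dots> = (\<Sum>s' \<in> pts S'. \<Sum>a \<in> pts A. \<theta> s s' * \<phi> s' (prod_encode (a, b)) * \<mu> a x)"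
    unfolding bz_id_sum(1)[OF X *(1)] by (simp add: sum_distrib_left mult.assoc)
  also have "\<dots> = mate X A S B (bz_comp S' \<phi> \<theta>) \<mu> (prod_encode (x, s)) b"
    using * by (simp add: mate_apply bz_comp_def sum_distrib_right sum.swap[of _ "pts S'"])
  finally show "mate X A S B (bz_comp S' \<phi> \<theta>) \<mu> (prod_encode (x, s)) b =
    bz_comp (gset_prod G X S') (mate X A S' B \<phi> \<mu>) (bz_prod X S X S' (bz_id X) \<theta>) (prod_encode (x, s)) b" by simp
qed

text \<open>The mate moves X from the target to the source, so a map out of X has to act through its
  dual. This is the origin of the transposed matrices in the complexes computing Tor.\<close>

lemma mate_transpose:
  assumes A: "gset G A" and B: "gset G B" and X: "gset G X" and Y: "gset G Y" and S: "gset G S"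
    and \<phi>: "\<phi> \<in> bz_hom G S (gset_prod G A B)" and \<theta>: "\<theta> \<in> bz_hom G X Y" and \<mu>: "\<mu> \<in> bz_hom G A X"
  shows "mate Y A S B \<phi> (bz_comp X \<theta> \<mu>) = bz_comp (gset_prod G X S) (mate X A S B \<phi> \<mu>) (bz_prod Y S X S (bz_transpose \<theta>) (bz_id S))"
proof (rule bz_hom_prod_eqI)
  show "mate Y A S B \<phi> (bz_comp X \<theta> \<mu>) \<in> bz_hom G (gset_prod G Y S) B"
    by (rule mate_in[OF A B Y S \<phi> bz_comp_in[OF X \<mu> \<theta>]])
  show "bz_comp (gset_prod G X S) (mate X A S B \<phi> \<mu>) (bz_prod Y S X S (bz_transpose \<theta>) (bz_id S)) \<in> bz_hom G (gset_prod G Y S) B"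
    by (rule bz_comp_in[OF finite_gset_prod[OF X S] bz_prod_in[OF Y S X S bz_transpose_in[OF \<theta>] bz_id_in[OF S]] mate_in[OF A B X S \<phi> \<mu>]])
  fix y s b assume *: "y \<in> pts Y" "s \<in> pts S" "b \<in> pts B"
  have "bz_comp (gset_prod G X S) (mate X A S B \<phi> \<mu>) (bz_prod Y S X S (bz_transpose \<theta>) (bz_id S)) (prod_encode (y, s)) b =
     (\<Sum>x \<in> pts X. \<theta> x y * (\<Sum>s' \<in> pts S. bz_id S s s' * (\<Sum>a \<in> pts A. \<phi> s' (prod_encode (a, b)) * \<mu> a x)))"
    using * by (simp add: bz_comp_def sum_prod_encode mate_apply sum_distrib_left mult.assoc bz_transpose_def)
  also have "\<dots> = (\<Sum>x \<in> pts X. \<Sum>a \<in> pts A. \<phi> s (prod_encode (a, b)) * (\<mu> a x * \<theta> x y))"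
    unfolding bz_id_sum(1)[OF S *(2)] by (simp add: sum_distrib_left mult_ac)
  also have "\<dots> = mate Y A S B \<phi> (bz_comp X \<theta> \<mu>) (prod_encode (y, s)) b"
    using * by (simp add: mate_apply bz_comp_def sum_distrib_left sum.swap[of _ "pts X"])
  finally show "mate Y A S B \<phi> (bz_comp X \<theta> \<mu>) (prod_encode (y, s)) b =
    bz_comp (gset_prod G X S) (mate X A S B \<phi> \<mu>) (bz_prod Y S X S (bz_transpose \<theta>) (bz_id S)) (prod_encode (y, s)) b" by simp
qed

text \<open>The unit of the self-duality of the permutation module on X, tensored with S: s goes to
  the sum over x of (x, (x, s)).\<close>

definition codiag :: "'g monoid \<Rightarrow> 'g gset \<Rightarrow> 'g gset \<Rightarrow> mat" where
  "codiag G X S = (\<lambda>s q. if s \<in> pts S \<and> (\<exists>x \<in> pts X. q = prod_encode (x, prod_encode (x, s))) then 1 else 0)"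

lemma codiag_apply: "s \<in> pts S \<Longrightarrow> x \<in> pts X \<Longrightarrow> x' \<in> pts X \<Longrightarrow> s' \<in> pts S \<Longrightarrow>
    codiag G X S s (prod_encode (x, prod_encode (x', s'))) = bz_id X x x' * bz_id S s s'"
  by (auto simp: codiag_def bz_id_def prod_encode_eq)

lemma codiag_in:
  assumes X: "gset G X" and S: "gset G S"
  shows "codiag G X S \<in> bz_hom G S (gset_prod G X (gset_prod G X S))"
proof (rule bz_homI)
  fix g s q assume g: "g \<in> carrier G" and s: "s \<in> pts S" and q: "q \<in> pts (gset_prod G X (gset_prod G X S))"
  from q obtain x x' s' where q_eq: "q = prod_encode (x, prod_encode (x', s'))" and *: "x \<in> pts X" "x' \<in> pts X" "s' \<in> pts S"
    by auto
  show "codiag G X S (act S g s) (act (gset_prod G X (gset_prod G X S)) g q) = codiag G X S s q"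
    unfolding q_eq using * s g bz_hom_inv[OF bz_id_in[OF X] g] bz_hom_inv[OF bz_id_in[OF S] g]
    by (simp add: act_gset_prod codiag_apply act_closed[OF X] act_closed[OF S])
qed (auto simp: codiag_def)

lemma mate_codiag:
  assumes X: "gset G X" and S: "gset G S"
  shows "mate X X S (gset_prod G X S) (codiag G X S) (bz_id X) = bz_id (gset_prod G X S)"
proof (rule bz_hom_prod_eqI)
  note XS = finite_gset_prod[OF X S]
  show "mate X X S (gset_prod G X S) (codiag G X S) (bz_id X) \<in> bz_hom G (gset_prod G X S) (gset_prod G X S)"
    by (rule mate_in[OF X XS X S codiag_in[OF X S] bz_id_in[OF X]])
  show "bz_id (gset_prod G X S) \<in> bz_hom G (gset_prod G X S) (gset_prod G X S)" by (rule bz_id_in[OF XS])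
  fix x s b assume *: "x \<in> pts X" "s \<in> pts S" "b \<in> pts (gset_prod G X S)"
  then obtain x' s' where b: "b = prod_encode (x', s')" "x' \<in> pts X" "s' \<in> pts S" by auto
  have "mate X X S (gset_prod G X S) (codiag G X S) (bz_id X) (prod_encode (x, s)) b =
      (\<Sum>a \<in> pts X. codiag G X S s (prod_encode (a, b)) * bz_id X a x)"
    by (rule mate_apply[OF *])
  also have "\<dots> = codiag G X S s (prod_encode (x, b))" by (rule bz_id_sum(3)[OF X *(1)])
  also have "\<dots> = bz_id (gset_prod G X S) (prod_encode (x, s)) b"
    unfolding b(1) using * b(2,3) by (auto simp: codiag_apply bz_id_def prod_encode_eq)
  finally show "mate X X S (gset_prod G X S) (codiag G X S) (bz_id X) (prod_encode (x, s)) b = bz_id (gset_prod G X S) (prod_encode (x, s)) b" .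
qed

text \<open>A triangle identity of the duality. Combined with the coend relation it rewrites any
  generator as one based at X with the identity as its free coordinate.\<close>

lemma codiag_mate:
  assumes A: "gset G A" and B: "gset G B" and X: "gset G X" and S: "gset G S"
    and \<phi>: "\<phi> \<in> bz_hom G S (gset_prod G A B)" and \<mu>: "\<mu> \<in> bz_hom G A X"
  shows "bz_comp (gset_prod G X (gset_prod G X S)) (bz_prod X (gset_prod G X S) X B (bz_id X) (mate X A S B \<phi> \<mu>)) (codiag G X S) =
    bz_comp (gset_prod G A B) (bz_prod A B X B \<mu> (bz_id B)) \<phi>" (is "?l = ?r")
proof (rule bz_hom_eqI)
  note XS = finite_gset_prod[OF X S]
  show "?l \<in> bz_hom G S (gset_prod G X B)"
    by (rule bz_comp_in[OF finite_gset_prod[OF X XS] codiag_in[OF X S] bz_prod_in[OF X XS X B bz_id_in[OF X] mate_in[OF A B X S \<phi> \<mu>]]])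
  show "?r \<in> bz_hom G S (gset_prod G X B)"
    by (rule bz_comp_in[OF finite_gset_prod[OF A B] \<phi> bz_prod_in[OF A B X B \<mu> bz_id_in[OF B]]])
  fix s q assume s: "s \<in> pts S" and "q \<in> pts (gset_prod G X B)"
  then obtain x b where q: "q = prod_encode (x, b)" and x: "x \<in> pts X" and b: "b \<in> pts B" by auto
  have "?l s q = (\<Sum>x1 \<in> pts X. \<Sum>x2 \<in> pts X. \<Sum>s' \<in> pts S.
      bz_id X x1 x2 * bz_id S s s' * (bz_id X x1 x * mate X A S B \<phi> \<mu> (prod_encode (x2, s')) b))"
    unfolding q using s x b by (simp add: bz_comp_def sum_prod_encode codiag_apply)
  also have "\<dots> = (\<Sum>x1 \<in> pts X. bz_id X x1 x * (\<Sum>x2 \<in> pts X. bz_id X x1 x2 * (\<Sum>s' \<in> pts S. bz_id S s s' * mate X A S B \<phi> \<mu> (prod_encode (x2, s')) b)))"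
    by (simp add: sum_distrib_left mult_ac)
  also have "\<dots> = mate X A S B \<phi> \<mu> (prod_encode (x, s)) b"
    unfolding bz_id_sum(1)[OF S s] bz_id_sum(2)[OF X x] bz_id_sum(1)[OF X x] ..
  also have "\<dots> = (\<Sum>a \<in> pts A. \<phi> s (prod_encode (a, b)) * \<mu> a x)" by (rule mate_apply[OF x s b])
  also have "\<dots> = (\<Sum>a \<in> pts A. \<Sum>b' \<in> pts B. (\<phi> s (prod_encode (a, b')) * \<mu> a x) * bz_id B b' b)"
    unfolding bz_id_sum(3)[OF B b] ..
  also have "\<dots> = ?r s q"
    unfolding q using x b by (simp add: bz_comp_def sum_prod_encode mult.assoc)
  finally show "?l s q = ?r s q" .
qed

text \<open>The isomorphism is produced by an existence argument, so its behaviour on generators is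
  recorded here; naturality in X is derived from that formula alone.\<close>

definition box_free_equiv :: "'g monoid \<Rightarrow> 'j \<Rightarrow> 'g gset \<Rightarrow> ('g, 'n) zmod \<Rightarrow> ('g, (('g, 'j \<Rightarrow> mat, 'n) boxgen \<Rightarrow>\<^sub>0 int) set, 'n) zmap \<Rightarrow> bool" where
  "box_free_equiv G j X N \<Psi> \<longleftrightarrow> zmod_hom G (box G (free1 G j X) N) (shift G N X) \<Psi> \<and>
    (\<forall>S. gset G S \<longrightarrow> inj_on (\<Psi> S) (el (box G (free1 G j X) N) S) \<and>
      (\<forall>y \<in> el (shift G N X) S. \<exists>x \<in> el (box G (free1 G j X) N) S. \<Psi> S x = y)) \<and>
    (\<forall>S A B \<phi> \<mu> n. gset G S \<longrightarrow> gset G A \<longrightarrow> gset G B \<longrightarrow> \<phi> \<in> bz_hom G S (gset_prod G A B) \<longrightarrow>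
      \<mu> \<in> bz_hom G A X \<longrightarrow> n \<in> el N B \<longrightarrow>
      \<Psi> S (box_cl G (free1 G j X) N S (A, B, \<phi>, single j \<mu>, n)) = zmor N (gset_prod G X S) B (mate X A S B \<phi> \<mu>) n)"

lemma box_free_equiv_ex:
  assumes N: "zmodule G N" and X: "gset G X"
  shows "\<exists>\<Psi>. box_free_equiv G j X N \<Psi>"
proof -
  let ?F = "free1 G j X" and ?sh = "shift G N X"
  note F = zmodule_free_mod[of G "{j}" "\<lambda>_. X"] and XP = finite_gset_prod[OF X]
  define \<beta> where "\<beta> S = (\<lambda>(A, B, \<phi>, u, n). zmor N (gset_prod G X S) B (mate X A S B \<phi> (u j)) n)" for S
  have mem: "u \<in> el ?F A \<Longrightarrow> u j \<in> bz_hom G A X" for u A by simp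
  have bal: "box_balanced G ?F N S (zobj ?sh S) (\<beta> S)" if S: "gset G S" for S
  proof (rule box_balancedI)
    fix A B \<phi> u n assume *: "gset G A" "gset G B" "\<phi> \<in> bz_hom G S (gset_prod G A B)"
      "u \<in> el ?F A" "n \<in> el N B"
    note m = mate_in[OF *(1,2) X S _ mem[OF *(4)]]
    show "\<beta> S (A, B, \<phi>, u, n) \<in> el ?sh S"
      unfolding \<beta>_def prod.case shift_simps by (rule zm_closed[OF N XP[OF S] *(2) m[OF *(3)] *(5)])
    show "\<beta> S (A, B, \<phi>, u, n \<otimes>\<^bsub>zobj N B\<^esub> n') = \<beta> S (A, B, \<phi>, u, n) \<otimes>\<^bsub>zobj ?sh S\<^esub> \<beta> S (A, B, \<phi>, u, n')"
      if "n' \<in> el N B" for n'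
      unfolding \<beta>_def prod.case shift_simps by (rule zm_mult[OF N XP[OF S] *(2) m[OF *(3)] *(5) that])
    show "\<beta> S (A, B, bz_add \<phi> \<psi>, u, n) = \<beta> S (A, B, \<phi>, u, n) \<otimes>\<^bsub>zobj ?sh S\<^esub> \<beta> S (A, B, \<psi>, u, n)"
      if "\<psi> \<in> bz_hom G S (gset_prod G A B)" for \<psi>
      unfolding \<beta>_def prod.case shift_simps mate_add by (rule zm_add[OF N XP[OF S] *(2) m[OF *(3)] m[OF that] *(5)])
    show "\<beta> S (A, B, \<phi>, u \<otimes>\<^bsub>zobj ?F A\<^esub> v, n) = \<beta> S (A, B, \<phi>, u, n) \<otimes>\<^bsub>zobj ?sh S\<^esub> \<beta> S (A, B, \<phi>, v, n)"
      if "v \<in> el ?F A" for v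
      unfolding \<beta>_def prod.case shift_simps free_mod_simps mate_add
      by (rule zm_add[OF N XP[OF S] *(2) m[OF *(3)] mate_in[OF *(1,2) X S *(3) mem[OF that]] *(5)])
  next
    fix A B A' B' f h \<phi> u n assume *: "gset G A" "gset G B" "gset G A'" "gset G B'"
      "f \<in> bz_hom G A A'" "h \<in> bz_hom G B B'" "\<phi> \<in> bz_hom G S (gset_prod G A B)"
      "u \<in> el ?F A'" "n \<in> el N B'"
    show "\<beta> S (A', B', bz_comp (gset_prod G A B) (bz_prod A B A' B' f h) \<phi>, u, n) = \<beta> S (A, B, \<phi>, zmor ?F A A' f u, zmor N B B' h n)"
      unfolding \<beta>_def prod.case free_mod_simps mate_comp[OF *(1-4) X S *(7,5,6) mem[OF *(8)]]
      by (rule zm_comp[OF N XP[OF S] *(2,4) mate_in[OF *(1,2) X S *(7) bz_comp_in[OF *(3,5) mem[OF *(8)]]] *(6,9)])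
  qed
  have nat: "\<beta> S (A, B, bz_comp T \<phi> \<theta>, u, n) = zmor ?sh S T \<theta> (\<beta> T (A, B, \<phi>, u, n))"
    if S: "gset G S" and T: "gset G T" and \<theta>: "\<theta> \<in> bz_hom G S T"
      and A: "gset G A" and B: "gset G B" and \<phi>: "\<phi> \<in> bz_hom G T (gset_prod G A B)"
      and u: "u \<in> el ?F A" and n: "n \<in> el N B" for S T \<theta> A B \<phi> u n
    unfolding \<beta>_def prod.case shift_simps mate_natural[OF A B X S T \<phi> \<theta> mem[OF u]]
    by (rule zm_comp[OF N XP[OF S] XP[OF T] B bz_prod_in[OF X S X T bz_id_in[OF X] \<theta>] mate_in[OF A B X T \<phi> mem[OF u]] n])
  obtain \<Psi> where \<Psi>: "zmod_hom G (box G ?F N) ?sh \<Psi>"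
    and \<Psi>_cl: "\<And>S x. gset G S \<Longrightarrow> x \<in> box_gens G ?F N S \<Longrightarrow> \<Psi> S (box_cl G ?F N S x) = \<beta> S x"
    by (rule zmod_hom_from_box[OF F N zmodule_shift[OF N X], where \<beta>=\<beta>]) (use bal nat in \<open>blast+\<close>)
  have gen: "\<Psi> S (box_cl G ?F N S (A, B, \<phi>, single j \<mu>, n)) = zmor N (gset_prod G X S) B (mate X A S B \<phi> \<mu>) n"
    if "gset G S" "gset G A" "gset G B" "\<phi> \<in> bz_hom G S (gset_prod G A B)"
      "\<mu> \<in> bz_hom G A X" "n \<in> el N B" for S A B \<phi> \<mu> n
    using \<Psi>_cl[OF that(1), of "(A, B, \<phi>, single j \<mu>, n)"] that single_in[OF that(5), of j] by (simp add: \<beta>_def)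
  \<comment> \<open>The inverse inserts n beside the universal element of the free module, along the
    unit of the duality.\<close>
  define \<kappa> where "\<kappa> S n = box_cl G ?F N S (X, gset_prod G X S, codiag G X S, single j (bz_id X), n)" for S n
  note id = bz_id_in[OF X]
  have \<kappa>: "\<kappa> S n \<in> el (box G ?F N) S" "\<Psi> S (\<kappa> S n) = n"
    if S: "gset G S" and n: "n \<in> el N (gset_prod G X S)" for S n
  proof -
    show "\<kappa> S n \<in> el (box G ?F N) S"
      unfolding \<kappa>_def
      by (rule box_balancedD(1)[OF box_cl_balanced[OF F N S] X XP[OF S] codiag_in[OF X S] single_in[OF id] n])
    show "\<Psi> S (\<kappa> S n) = n"
      unfolding \<kappa>_def gen[OF S X XP[OF S] codiag_in[OF X S] id n] mate_codiag[OF X S] by (rule zm_id[OF N XP[OF S] n])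
  qed
  have inv: "\<kappa> S (\<Psi> S x) = x" if S: "gset G S" and x: "x \<in> el (box G ?F N) S" for S x
  proof -
    note bal = box_balancedD[OF box_cl_balanced[OF F N S]]
    have \<kappa>_hom: "\<kappa> S \<in> hom (zobj ?sh S) (zobj (box G ?F N) S)"
      by (rule homI) (simp_all add: \<kappa>(1)[OF S], simp add: \<kappa>_def bal(4)[OF X XP[OF S] codiag_in[OF X S] single_in[OF id]])
    show ?thesis
    proof (rule box_hom_eq[OF F N S zm_group[OF box_zmodule[OF F N] S] _ _ _ x, where k="\<lambda>x. x"])
      show "(\<lambda>x. \<kappa> S (\<Psi> S x)) \<in> hom (zobj (box G ?F N) S) (zobj (box G ?F N) S)"
        using hom_compose[OF zmod_homD(1)[OF \<Psi> S] \<kappa>_hom] by (simp add: comp_def)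
      show "(\<lambda>x. x) \<in> hom (zobj (box G ?F N) S) (zobj (box G ?F N) S)" by (simp add: hom_def)
      fix y assume y: "y \<in> box_gens G ?F N S"
      obtain A B \<phi> u n where y_eq: "y = (A, B, \<phi>, u, n)" by (cases y)
      have *: "gset G A" "gset G B" "\<phi> \<in> bz_hom G S (gset_prod G A B)" "u \<in> el ?F A" "n \<in> el N B"
        using y unfolding y_eq box_gens_iff by blast+
      from *(4) obtain \<mu> where \<mu>: "\<mu> \<in> bz_hom G A X" "u = single j \<mu>" unfolding free1_carrier by blast
      note m = mate_in[OF *(1,2) X S *(3) \<mu>(1)]
      let ?\<psi> = "mate X A S B \<phi> \<mu>"
      \<comment> \<open>The coend relation applies only to entries displayed as pullbacks.
        \<open>e1\<close> prepares moving the mate from n into the matrix, \<open>e2\<close>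
        prepares moving \<mu> back out of it.\<close>
      have e1: "single j (bz_id X) = zmor ?F X X (bz_id X) (single j (bz_id X))"
        unfolding free1_mor bz_comp_id_left[OF X id] ..
      have e2: "u = zmor ?F A X \<mu> (single j (bz_id X))"
        unfolding free1_mor bz_comp_id_left[OF X \<mu>(1)] \<mu>(2) ..
      have "\<kappa> S (\<Psi> S (box_cl G ?F N S y)) = box_cl G ?F N S (X, gset_prod G X S, codiag G X S, single j (bz_id X), zmor N (gset_prod G X S) B ?\<psi> n)"
        unfolding \<kappa>_def y_eq \<mu>(2) gen[OF S *(1-3) \<mu>(1) *(5)] ..
      also have "\<dots> = box_cl G ?F N S (X, B, bz_comp (gset_prod G X (gset_prod G X S)) (bz_prod X (gset_prod G X S) X B (bz_id X) ?\<psi>) (codiag G X S), single j (bz_id X), n)"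
        by (subst (1) e1) (rule bal(5)[OF X XP[OF S] codiag_in[OF X S] X *(2) id m single_in[OF id] *(5), symmetric])
      also have "\<dots> = box_cl G ?F N S (X, B, bz_comp (gset_prod G A B) (bz_prod A B X B \<mu> (bz_id B)) \<phi>, single j (bz_id X), n)"
        unfolding codiag_mate[OF *(1,2) X S *(3) \<mu>(1)] ..
      also have "\<dots> = box_cl G ?F N S (A, B, \<phi>, zmor ?F A X \<mu> (single j (bz_id X)), zmor N B B (bz_id B) n)"
        by (rule bal(5)[OF *(1-3) X *(2) \<mu>(1) bz_id_in[OF *(2)] single_in[OF id] *(5)])
      also have "\<dots> = box_cl G ?F N S y"
        unfolding e2[symmetric] zm_id[OF N *(2,5)] y_eq ..
      finally show "\<kappa> S (\<Psi> S (box_cl G ?F N S y)) = box_cl G ?F N S y" .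
    qed
  qed
  have equiv: "box_free_equiv G j X N \<Psi>"
    unfolding box_free_equiv_def
  proof (intro conjI allI impI ballI)
    fix S :: "'a gset" assume S: "gset G S"
    show "inj_on (\<Psi> S) (el (box G ?F N) S)" by (rule inj_on_inverseI[where g="\<kappa> S"]) (rule inv[OF S])
    fix y assume "y \<in> el ?sh S"
    then have y: "y \<in> el N (gset_prod G X S)" by simp
    show "\<exists>x \<in> el (box G ?F N) S. \<Psi> S x = y"
      by (rule bexI[of _ "\<kappa> S y"], rule \<kappa>(2)[OF S y], rule \<kappa>(1)[OF S y])
  qed (rule \<Psi>, rule gen)
  show ?thesis by (rule exI[where x=\<Psi>]) (rule equiv)
qed

lemma box_free_natural:
  assumes N: "zmodule G N" and X: "gset G X" and Y: "gset G Y" and \<theta>: "\<theta> \<in> bz_hom G X Y"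
    and \<Psi>: "box_free_equiv G j X N \<Psi>" and \<Psi>': "box_free_equiv G j Y N \<Psi>'"
    and S: "gset G S" and x: "x \<in> el (box G (free1 G j X) N) S"
  shows "\<Psi>' S (box_map G (free1 G j Y) N (free1_map j X \<theta>) S x) = shift_map G N X Y (bz_transpose \<theta>) S (\<Psi> S x)"
proof -
  have h: "zmod_hom G (box G (free1 G j X) N) (shift G N X) \<Psi>" and h': "zmod_hom G (box G (free1 G j Y) N) (shift G N Y) \<Psi>'"
    using \<Psi> \<Psi>' unfolding box_free_equiv_def by simp_all
  have gen: "\<Psi> S (box_cl G (free1 G j X) N S (A, B, \<phi>, single j \<mu>, n)) = zmor N (gset_prod G X S) B (mate X A S B \<phi> \<mu>) n"
    if "gset G A" "gset G B" "\<phi> \<in> bz_hom G S (gset_prod G A B)" "\<mu> \<in> bz_hom G A X" "n \<in> el N B" for A B \<phi> \<mu> n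
    using \<Psi> S that unfolding box_free_equiv_def by simp
  have gen': "\<Psi>' S (box_cl G (free1 G j Y) N S (A, B, \<phi>, single j \<mu>, n)) = zmor N (gset_prod G Y S) B (mate Y A S B \<phi> \<mu>) n"
    if "gset G A" "gset G B" "\<phi> \<in> bz_hom G S (gset_prod G A B)" "\<mu> \<in> bz_hom G A Y" "n \<in> el N B" for A B \<phi> \<mu> n
    using \<Psi>' S that unfolding box_free_equiv_def by simp
  note fm = zmod_hom_free1_map[OF X \<theta>, of j] and t = bz_transpose_in[OF \<theta>]
  note bm = box_map(1)[OF zmodule_free_mod zmodule_free_mod N fm] and sm = zmod_hom_shift_map[OF N X Y t]
  show ?thesis
  proof (rule zmod_hom_box_eq[OF zmodule_free_mod N zmodule_shift[OF N Y] zmod_hom_comp[OF bm h'] zmod_hom_comp[OF h sm] S x])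
    fix A B \<phi> u n assume *: "gset G A" "gset G B" "\<phi> \<in> bz_hom G S (gset_prod G A B)"
      "u \<in> el (free1 G j X) A" "n \<in> el N B"
    from *(4) obtain \<mu> where \<mu>: "\<mu> \<in> bz_hom G A X" "u = single j \<mu>" unfolding free1_carrier by blast
    have g: "(A, B, \<phi>, single j \<mu>, n) \<in> box_gens G (free1 G j X) N S"
      unfolding box_gens_iff by (intro conjI * single_in[OF \<mu>(1)])
    show "\<Psi>' S (box_map G (free1 G j Y) N (free1_map j X \<theta>) S (box_cl G (free1 G j X) N S (A, B, \<phi>, u, n))) =
        shift_map G N X Y (bz_transpose \<theta>) S (\<Psi> S (box_cl G (free1 G j X) N S (A, B, \<phi>, u, n)))"
      unfolding \<mu>(2) box_map(2)[OF zmodule_free_mod zmodule_free_mod N fm S g] free1_map_single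
        gen'[OF *(1-3) bz_comp_in[OF X \<mu>(1) \<theta>] *(5)] gen[OF *(1-3) \<mu>(1) *(5)]
        mate_transpose[OF *(1,2) X Y S *(3) \<theta> \<mu>(1)] shift_map_def
      by (rule zm_comp[OF N finite_gset_prod[OF Y S] finite_gset_prod[OF X S] *(2)
            bz_prod_in[OF Y S X S t bz_id_in[OF S]] mate_in[OF *(1,2) X S *(3) \<mu>(1)] *(5)])
  qed
qed

subsection \<open>The isomorphism of the internal hom from \<open>F\<^sub>X\<close> to \<open>N\<close> with \<open>N(X \<times> -)\<close>\<close>

text \<open>The symmetry of the product. In the internal hom the representing factor for S stands
  first, whereas the shifted module has X first.\<close>

definition swap :: "'g gset \<Rightarrow> 'g gset \<Rightarrow> mat" where
  "swap S X = (\<lambda>p q. if \<exists>s \<in> pts S. \<exists>x \<in> pts X. p = prod_encode (s, x) \<and> q = prod_encode (x, s) then 1 else 0)"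

lemma swap_apply: "s \<in> pts S \<Longrightarrow> x \<in> pts X \<Longrightarrow> s' \<in> pts S \<Longrightarrow> x' \<in> pts X \<Longrightarrow>
    swap S X (prod_encode (s, x)) (prod_encode (x', s')) = bz_id S s s' * bz_id X x x'"
  by (auto simp: swap_def bz_id_def prod_encode_eq)

lemma swap_in:
  assumes S: "gset G S" and X: "gset G X"
  shows "swap S X \<in> bz_hom G (gset_prod G S X) (gset_prod G X S)"
proof (rule bz_homI)
  fix g p q assume g: "g \<in> carrier G" and p: "p \<in> pts (gset_prod G S X)" and q: "q \<in> pts (gset_prod G X S)"
  from p q obtain s x s' x' where pq: "p = prod_encode (s, x)" "q = prod_encode (x', s')"
    and *: "s \<in> pts S" "x \<in> pts X" "s' \<in> pts S" "x' \<in> pts X" by auto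
  show "swap S X (act (gset_prod G S X) g p) (act (gset_prod G X S) g q) = swap S X p q"
    unfolding pq using * g bz_hom_inv[OF bz_id_in[OF X] g] bz_hom_inv[OF bz_id_in[OF S] g]
    by (simp add: act_gset_prod swap_apply act_closed[OF X] act_closed[OF S])
qed (auto simp: swap_def)

lemma swap_comp_left:
  assumes S: "gset G S" and X: "gset G X" and "s \<in> pts S" "x \<in> pts X"
  shows "bz_comp (gset_prod G X S) \<phi> (swap S X) (prod_encode (s, x)) q = \<phi> (prod_encode (x, s)) q"
proof -
  have "bz_comp (gset_prod G X S) \<phi> (swap S X) (prod_encode (s, x)) q =
      (\<Sum>x' \<in> pts X. bz_id X x x' * (\<Sum>s' \<in> pts S. bz_id S s s' * \<phi> (prod_encode (x', s')) q))"
    using assms(3,4) by (simp add: bz_comp_def sum_prod_encode swap_apply sum_distrib_left mult_ac)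
  then show ?thesis unfolding bz_id_sum(1)[OF S assms(3)] bz_id_sum(1)[OF X assms(4)] .
qed

lemma swap_comp_right:
  assumes S: "gset G S" and X: "gset G X" and "s \<in> pts S" "x \<in> pts X"
  shows "bz_comp (gset_prod G S X) (swap S X) \<phi> p (prod_encode (x, s)) = \<phi> p (prod_encode (s, x))"
proof -
  have "bz_comp (gset_prod G S X) (swap S X) \<phi> p (prod_encode (x, s)) =
      (\<Sum>s' \<in> pts S. (\<Sum>x' \<in> pts X. \<phi> p (prod_encode (s', x')) * bz_id X x' x) * bz_id S s' s)"
    using assms(3,4) by (simp add: bz_comp_def sum_prod_encode swap_apply sum_distrib_left sum_distrib_right mult_ac)
  then show ?thesis unfolding bz_id_sum(3)[OF X assms(4)] bz_id_sum(3)[OF S assms(3)] .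
qed

lemma swap_swap:
  assumes S: "gset G S" and X: "gset G X"
  shows "bz_comp (gset_prod G X S) (swap X S) (swap S X) = bz_id (gset_prod G S X)"
proof (rule bz_hom_prod_eqI)
  note SX = finite_gset_prod[OF S X] and XS = finite_gset_prod[OF X S]
  show "bz_comp (gset_prod G X S) (swap X S) (swap S X) \<in> bz_hom G (gset_prod G S X) (gset_prod G S X)"
    by (rule bz_comp_in[OF XS swap_in[OF S X] swap_in[OF X S]])
  show "bz_id (gset_prod G S X) \<in> bz_hom G (gset_prod G S X) (gset_prod G S X)" by (rule bz_id_in[OF SX])
  fix s x b assume *: "s \<in> pts S" "x \<in> pts X" and b: "b \<in> pts (gset_prod G S X)"
  from b obtain s' x' where b_eq: "b = prod_encode (s', x')" "s' \<in> pts S" "x' \<in> pts X" by auto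
  show "bz_comp (gset_prod G X S) (swap X S) (swap S X) (prod_encode (s, x)) b = bz_id (gset_prod G S X) (prod_encode (s, x)) b"
    unfolding swap_comp_left[OF S X *] b_eq(1) using * b_eq(2,3) by (auto simp: swap_apply bz_id_def prod_encode_eq)
qed

lemma swap_natural:
  assumes S: "gset G S" and X: "gset G X" and S': "gset G S'" and X': "gset G X'"
    and f: "f \<in> bz_hom G S S'" and h: "h \<in> bz_hom G X X'"
  shows "bz_comp (gset_prod G S' X') (swap S' X') (bz_prod S X S' X' f h) =
    bz_comp (gset_prod G X S) (bz_prod X S X' S' h f) (swap S X)"
proof (rule bz_hom_prod_eqI)
  note fh = bz_prod_in[OF S X S' X' f h] and hf = bz_prod_in[OF X S X' S' h f]
  show "bz_comp (gset_prod G S' X') (swap S' X') (bz_prod S X S' X' f h) \<in> bz_hom G (gset_prod G S X) (gset_prod G X' S')"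
    by (rule bz_comp_in[OF finite_gset_prod[OF S' X'] fh swap_in[OF S' X']])
  show "bz_comp (gset_prod G X S) (bz_prod X S X' S' h f) (swap S X) \<in> bz_hom G (gset_prod G S X) (gset_prod G X' S')"
    by (rule bz_comp_in[OF finite_gset_prod[OF X S] swap_in[OF S X] hf])
  fix s x b assume *: "s \<in> pts S" "x \<in> pts X" and b: "b \<in> pts (gset_prod G X' S')"
  from b obtain s' x' where b_eq: "b = prod_encode (x', s')" "s' \<in> pts S'" "x' \<in> pts X'" by auto
  show "bz_comp (gset_prod G S' X') (swap S' X') (bz_prod S X S' X' f h) (prod_encode (s, x)) b =
      bz_comp (gset_prod G X S) (bz_prod X S X' S' h f) (swap S X) (prod_encode (s, x)) b"
    unfolding swap_comp_left[OF S X *] b_eq(1) swap_comp_right[OF S' X' b_eq(2,3)]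
    using * b_eq(2,3) by simp
qed

text \<open>The element of \<open>(F\<^sub>S \<box> F\<^sub>X)(X \<times> S)\<close> representing the functor \<open>Hom(F\<^sub>S \<box> F\<^sub>X, -)\<close>.\<close>

definition ihom_gen :: "'g monoid \<Rightarrow> 'j \<Rightarrow> 'g gset \<Rightarrow> 'g gset \<Rightarrow> (('g, mat, 'j \<Rightarrow> mat) boxgen \<Rightarrow>\<^sub>0 int) set" where
  "ihom_gen G j X S = box_cl G (rep G S) (free1 G j X) (gset_prod G X S)
     (S, X, swap X S, bz_id S, single j (bz_id X))"

text \<open>The Yoneda isomorphism: evaluation at the universal element.\<close>

definition ihom_eval :: "'g monoid \<Rightarrow> 'j \<Rightarrow> 'g gset \<Rightarrow> ('g, ('g, 'j \<Rightarrow> mat, 'n) ihom_el, 'n) zmap" where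
  "ihom_eval G j X = (\<lambda>S \<eta>. \<eta> (gset_prod G X S) (ihom_gen G j X S))"

lemma rep_id: "gset G S \<Longrightarrow> \<theta> \<in> bz_hom G A S \<Longrightarrow> zmor (rep G S) A S \<theta> (bz_id S) = \<theta>"
  by (simp add: bz_comp_id_left)

lemma free1_id: "gset G X \<Longrightarrow> \<theta> \<in> bz_hom G A X \<Longrightarrow> zmor (free1 G j X) A X \<theta> (single j (bz_id X)) = single j \<theta>"
  unfolding free1_mor by (simp add: bz_comp_id_left)

text \<open>The coend relation pushes both module entries into the matrix, leaving the two universal
  elements behind. So a class depends only on a single map from T to S \<times> X.\<close>

lemma rep_free1_cl:
  assumes S: "gset G S" and X: "gset G X" and A: "gset G A" and B: "gset G B" and T: "gset G T"
    and \<phi>: "\<phi> \<in> bz_hom G T (gset_prod G A B)" and m: "m \<in> bz_hom G A S" and \<mu>: "\<mu> \<in> bz_hom G B X"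
  shows "box_cl G (rep G S) (free1 G j X) T (A, B, \<phi>, m, single j \<mu>) =
      box_cl G (rep G S) (free1 G j X) T (S, X, bz_comp (gset_prod G A B) (bz_prod A B S X m \<mu>) \<phi>, bz_id S, single j (bz_id X))"
proof -
  have "bz_id S \<in> el (rep G S) S" using bz_id_in[OF S] by simp
  from box_balancedD(5)[OF box_cl_balanced[OF zmodule_rep zmodule_free_mod T] A B \<phi> S X m \<mu> this single_in[OF bz_id_in[OF X]]]
  show ?thesis unfolding rep_id[OF S m] free1_id[OF X \<mu>] ..
qed

text \<open>Every class in this normal form is a pullback of one universal element: the box product
  of the two representables is represented by the product.\<close>

lemma ihom_gen_pullback:
  assumes S: "gset G S" and X: "gset G X" and T: "gset G T" and \<phi>: "\<phi> \<in> bz_hom G T (gset_prod G S X)"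
  shows "box_cl G (rep G S) (free1 G j X) T (S, X, \<phi>, bz_id S, single j (bz_id X)) =
     zmor (box G (rep G S) (free1 G j X)) T (gset_prod G X S) (bz_comp (gset_prod G S X) (swap S X) \<phi>) (ihom_gen G j X S)"
proof -
  note SX = finite_gset_prod[OF S X] and XS = finite_gset_prod[OF X S]
  have g: "(S, X, swap X S, bz_id S, single j (bz_id X)) \<in> box_gens G (rep G S) (free1 G j X) (gset_prod G X S)"
    unfolding box_gens_iff rep_simps by (intro conjI S X swap_in[OF X S] bz_id_in[OF S] single_in[OF bz_id_in[OF X]])
  have "bz_comp (gset_prod G X S) (swap X S) (bz_comp (gset_prod G S X) (swap S X) \<phi>) = \<phi>"
    unfolding bz_comp_assoc swap_swap[OF S X] by (rule bz_comp_id_left[OF SX \<phi>])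
  then show ?thesis
    unfolding ihom_gen_def box_mor(2)[OF zmodule_rep zmodule_free_mod T XS bz_comp_in[OF SX \<phi> swap_in[OF S X]] g] by simp
qed

lemma ihom_gen_in:
  assumes S: "gset G S" and X: "gset G X"
  shows "ihom_gen G j X S \<in> el (box G (rep G S) (free1 G j X)) (gset_prod G X S)"
  unfolding ihom_gen_def
  by (rule box_balancedD(1)[OF box_cl_balanced[OF zmodule_rep zmodule_free_mod finite_gset_prod[OF X S]] S X swap_in[OF X S]])
    (simp_all only: rep_simps bz_id_in[OF S] single_in[OF bz_id_in[OF X]])

text \<open>Injective because the universal element determines a transformation through its
  pullbacks, surjective because any y extends by the formula that these pullbacks dictate.\<close>

lemma ihom_eval:
  assumes N: "zmodule G N" and X: "gset G X"
  shows "zmod_hom G (ihom G (free1 G j X) N) (shift G N X) (ihom_eval G j X)"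
    and "gset G S \<Longrightarrow> inj_on (ihom_eval G j X S) (el (ihom G (free1 G j X) N) S)"
    and "gset G S \<Longrightarrow> y \<in> el (shift G N X) S \<Longrightarrow>
      \<exists>\<eta> \<in> el (ihom G (free1 G j X) N) S. ihom_eval G j X S \<eta> = y"
proof -
  let ?F = "free1 G j X"
  note F = zmodule_free_mod[of G "{j}" "\<lambda>_. X"] and XP = finite_gset_prod[OF X]
  show "zmod_hom G (ihom G ?F N) (shift G N X) (ihom_eval G j X)"
  proof (rule zmod_homI)
    fix S \<eta> assume S: "gset G S" and \<eta>: "\<eta> \<in> el (ihom G ?F N) S"
    note \<eta>' = \<eta>[unfolded ihom_simps]
    show "ihom_eval G j X S \<eta> \<in> el (shift G N X) S"
      unfolding ihom_eval_def shift_simps by (rule zmod_homD(2)[OF hom_group_hom[OF \<eta>'] XP[OF S] ihom_gen_in[OF S X]])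
    show "ihom_eval G j X S (\<eta> \<otimes>\<^bsub>zobj (ihom G ?F N) S\<^esub> \<theta>) = ihom_eval G j X S \<eta> \<otimes>\<^bsub>zobj (shift G N X) S\<^esub> ihom_eval G j X S \<theta>" for \<theta>
      unfolding ihom_eval_def shift_simps ihom_simps by (rule hom_group_apply(1)[OF XP[OF S] ihom_gen_in[OF S X]])
  next
    fix S S' \<theta> \<eta> assume S: "gset G S" and S': "gset G S'" and \<theta>: "\<theta> \<in> bz_hom G S S'"
      and \<eta>: "\<eta> \<in> el (ihom G ?F N) S'"
    note \<eta>' = \<eta>[unfolded ihom_simps] and XS = XP[OF S] and XS' = XP[OF S']
    have g: "(S, X, swap X S, bz_id S, single j (bz_id X)) \<in> box_gens G (rep G S) ?F (gset_prod G X S)"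
      unfolding box_gens_iff rep_simps by (intro conjI S X swap_in[OF X S] bz_id_in[OF S] single_in[OF bz_id_in[OF X]])
    have idX: "bz_prod X S X S' (bz_id X) \<theta> \<in> bz_hom G (gset_prod G X S) (gset_prod G X S')"
      by (rule bz_prod_in[OF X S X S' bz_id_in[OF X] \<theta>])
    have t\<theta>: "bz_prod S X S' X \<theta> (bz_id X) \<in> bz_hom G (gset_prod G S X) (gset_prod G S' X)"
      by (rule bz_prod_in[OF S X S' X \<theta> bz_id_in[OF X]])
    have m: "bz_comp (gset_prod G S' X) (swap S' X) (bz_comp (gset_prod G S X) (bz_prod S X S' X \<theta> (bz_id X)) (swap X S)) = bz_prod X S X S' (bz_id X) \<theta>"
    proof -
      have "bz_comp (gset_prod G S' X) (swap S' X) (bz_comp (gset_prod G S X) (bz_prod S X S' X \<theta> (bz_id X)) (swap X S)) =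
          bz_comp (gset_prod G X S) (bz_prod X S X S' (bz_id X) \<theta>) (bz_comp (gset_prod G S X) (swap S X) (swap X S))"
        unfolding bz_comp_assoc swap_natural[OF S X S' X \<theta> bz_id_in[OF X]] ..
      then show ?thesis unfolding swap_swap[OF X S] bz_comp_id_right[OF XS idX] .
    qed
    have "box_map G (rep G S') ?F (rep_map S \<theta>) (gset_prod G X S) (ihom_gen G j X S) =
        box_cl G (rep G S') ?F (gset_prod G X S) (S, X, swap X S, bz_comp S \<theta> (bz_id S), single j (bz_id X))"
      unfolding ihom_gen_def box_map(2)[OF zmodule_rep zmodule_rep F zmod_hom_rep_map[OF S \<theta>] XS g]
      unfolding rep_map_def ..
    also have "\<dots> = box_cl G (rep G S') ?F (gset_prod G X S) (S, X, swap X S, \<theta>, single j (bz_id X))"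
      unfolding bz_comp_id_right[OF S \<theta>] ..
    also have "\<dots> = box_cl G (rep G S') ?F (gset_prod G X S) (S', X, bz_comp (gset_prod G S X) (bz_prod S X S' X \<theta> (bz_id X)) (swap X S), bz_id S', single j (bz_id X))"
      by (rule rep_free1_cl[OF S' X S X XS swap_in[OF X S] \<theta> bz_id_in[OF X]])
    also have "\<dots> = zmor (box G (rep G S') ?F) (gset_prod G X S) (gset_prod G X S') (bz_prod X S X S' (bz_id X) \<theta>) (ihom_gen G j X S')"
      unfolding ihom_gen_pullback[OF S' X XS bz_comp_in[OF finite_gset_prod[OF S X] swap_in[OF X S] t\<theta>]] m ..
    finally have key: "box_map G (rep G S') ?F (rep_map S \<theta>) (gset_prod G X S) (ihom_gen G j X S) =
        zmor (box G (rep G S') ?F) (gset_prod G X S) (gset_prod G X S') (bz_prod X S X S' (bz_id X) \<theta>) (ihom_gen G j X S')" .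
    show "ihom_eval G j X S (zmor (ihom G ?F N) S S' \<theta> \<eta>) = zmor (shift G N X) S S' \<theta> (ihom_eval G j X S' \<eta>)"
      unfolding ihom_eval_def ihom_simps precomp_apply[OF XS ihom_gen_in[OF S X]] key shift_simps
      by (rule zmod_homD(4)[OF hom_group_hom[OF \<eta>'] XS XS' idX ihom_gen_in[OF S' X]])
  qed
  assume S: "gset G S"
  note XS = XP[OF S] and SX = finite_gset_prod[OF S X]
  have pull: "\<eta> T (box_cl G (rep G S) ?F T (A, B, \<phi>, m, single j \<mu>)) =
      zmor N T (gset_prod G X S) (bz_comp (gset_prod G S X) (swap S X) (bz_comp (gset_prod G A B) (bz_prod A B S X m \<mu>) \<phi>)) (ihom_eval G j X S \<eta>)"
    if \<eta>: "zmod_hom G (box G (rep G S) ?F) N \<eta>" and *: "gset G A" "gset G B" "gset G T" "\<phi> \<in> bz_hom G T (gset_prod G A B)"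
      "m \<in> bz_hom G A S" "\<mu> \<in> bz_hom G B X" for \<eta> T A B \<phi> m \<mu>
  proof -
    have p: "bz_comp (gset_prod G A B) (bz_prod A B S X m \<mu>) \<phi> \<in> bz_hom G T (gset_prod G S X)"
      by (rule bz_comp_in[OF finite_gset_prod[OF *(1,2)] *(4) bz_prod_in[OF *(1,2) S X *(5,6)]])
    show ?thesis
      unfolding rep_free1_cl[OF S X *] ihom_gen_pullback[OF S X *(3) p] ihom_eval_def
      by (rule zmod_homD(4)[OF \<eta> *(3) XS bz_comp_in[OF SX p swap_in[OF S X]] ihom_gen_in[OF S X]])
  qed
  show "inj_on (ihom_eval G j X S) (el (ihom G ?F N) S)"
  proof (rule inj_onI)
    fix \<eta> \<theta> assume \<eta>: "\<eta> \<in> el (ihom G ?F N) S" and \<theta>: "\<theta> \<in> el (ihom G ?F N) S"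
      and eq: "ihom_eval G j X S \<eta> = ihom_eval G j X S \<theta>"
    note \<eta>' = \<eta>[unfolded ihom_simps] and \<theta>' = \<theta>[unfolded ihom_simps]
    show "\<eta> = \<theta>"
    proof (rule hom_group_eqI[OF \<eta>' \<theta>'])
      fix T x assume T: "gset G T" and x: "x \<in> el (box G (rep G S) ?F) T"
      show "\<eta> T x = \<theta> T x"
      proof (rule zmod_hom_box_eq[OF zmodule_rep F N hom_group_hom[OF \<eta>'] hom_group_hom[OF \<theta>'] T x])
        fix A B \<phi> m u assume *: "gset G A" "gset G B" "\<phi> \<in> bz_hom G T (gset_prod G A B)"
          "m \<in> el (rep G S) A" "u \<in> el ?F B"
        from *(5) obtain \<mu> where \<mu>: "\<mu> \<in> bz_hom G B X" "u = single j \<mu>" unfolding free1_carrier by blast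
        note m = *(4)[unfolded rep_simps]
        show "\<eta> T (box_cl G (rep G S) ?F T (A, B, \<phi>, m, u)) = \<theta> T (box_cl G (rep G S) ?F T (A, B, \<phi>, m, u))"
          unfolding \<mu>(2) pull[OF hom_group_hom[OF \<eta>'] *(1,2) T *(3) m \<mu>(1)] pull[OF hom_group_hom[OF \<theta>'] *(1,2) T *(3) m \<mu>(1)] eq ..
      qed
    qed
  qed
  assume "y \<in> el (shift G N X) S"
  then have y: "y \<in> el N (gset_prod G X S)" by simp
  \<comment> \<open>The map along which the generator is the pullback of the universal element, as
    read off from \<open>pull\<close>; a transformation with value y must send the generator to the
    pullback of y along it.\<close>
  define K where "K T = (\<lambda>(A, B, \<phi>, m, u :: 'c \<Rightarrow> mat). bz_comp (gset_prod G S X) (swap S X) (bz_comp (gset_prod G A B) (bz_prod A B S X m (u j)) \<phi>))" for T :: "'a gset"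
  define \<beta> where "\<beta> T g = zmor N T (gset_prod G X S) (K T g) y" for T g
  have K: "K T (A, B, \<phi>, m, u) \<in> bz_hom G T (gset_prod G X S)"
    if "gset G A" "gset G B" "\<phi> \<in> bz_hom G T (gset_prod G A B)" "m \<in> bz_hom G A S" "u \<in> el ?F B" for T A B \<phi> m u
  proof -
    have "u j \<in> bz_hom G B X" using that(5) by simp
    then show ?thesis unfolding K_def prod.case
      by (intro bz_comp_in[OF SX _ swap_in[OF S X]] bz_comp_in[OF finite_gset_prod[OF that(1,2)] that(3)] bz_prod_in[OF that(1,2) S X that(4)])
  qed
  have bal: "box_balanced G (rep G S) ?F T (zobj N T) (\<beta> T)" if T: "gset G T" for T
  proof (rule box_balancedI)
    fix A B \<phi> m u assume *: "gset G A" "gset G B" "\<phi> \<in> bz_hom G T (gset_prod G A B)"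
      "m \<in> el (rep G S) A" "u \<in> el ?F B"
    note m = *(4)[unfolded rep_simps] and k = K[OF *(1-3) *(4)[unfolded rep_simps] *(5)]
    show "\<beta> T (A, B, \<phi>, m, u) \<in> el N T"
      unfolding \<beta>_def by (rule zm_closed[OF N T XS k y])
    show "\<beta> T (A, B, bz_add \<phi> \<psi>, m, u) = \<beta> T (A, B, \<phi>, m, u) \<otimes>\<^bsub>zobj N T\<^esub> \<beta> T (A, B, \<psi>, m, u)"
      if "\<psi> \<in> bz_hom G T (gset_prod G A B)" for \<psi>
      unfolding \<beta>_def zm_add[OF N T XS k K[OF *(1,2) that m *(5)] y, symmetric] by (simp add: K_def)
    show "\<beta> T (A, B, \<phi>, m \<otimes>\<^bsub>zobj (rep G S) A\<^esub> m', u) = \<beta> T (A, B, \<phi>, m, u) \<otimes>\<^bsub>zobj N T\<^esub> \<beta> T (A, B, \<phi>, m', u)"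
      if "m' \<in> el (rep G S) A" for m'
      unfolding \<beta>_def zm_add[OF N T XS k K[OF *(1-3) that[unfolded rep_simps] *(5)] y, symmetric] by (simp add: K_def bz_prod_add)
    show "\<beta> T (A, B, \<phi>, m, u \<otimes>\<^bsub>zobj ?F B\<^esub> u') = \<beta> T (A, B, \<phi>, m, u) \<otimes>\<^bsub>zobj N T\<^esub> \<beta> T (A, B, \<phi>, m, u')"
      if "u' \<in> el ?F B" for u'
      unfolding \<beta>_def zm_add[OF N T XS k K[OF *(1-3) m that] y, symmetric] by (simp add: K_def bz_prod_add)
  next
    fix A B A' B' f h \<phi> m u assume *: "gset G A" "gset G B" "gset G A'" "gset G B'"
      "f \<in> bz_hom G A A'" "h \<in> bz_hom G B B'" "\<phi> \<in> bz_hom G T (gset_prod G A B)"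
      "m \<in> el (rep G S) A'" "u \<in> el ?F B'"
    have u: "u j \<in> bz_hom G B' X" using *(9) by simp
    show "\<beta> T (A', B', bz_comp (gset_prod G A B) (bz_prod A B A' B' f h) \<phi>, m, u) = \<beta> T (A, B, \<phi>, zmor (rep G S) A A' f m, zmor ?F B B' h u)"
      unfolding \<beta>_def K_def prod.case rep_simps free_mod_simps
        bz_prod_comp[OF *(5) *(8)[unfolded rep_simps] *(6) u, symmetric] bz_comp_assoc ..
  qed
  have nat: "\<beta> T (A, B, bz_comp T' \<phi> \<theta>, m, u) = zmor N T T' \<theta> (\<beta> T' (A, B, \<phi>, m, u))"
    if T: "gset G T" and T': "gset G T'" and \<theta>: "\<theta> \<in> bz_hom G T T'"
      and *: "gset G A" "gset G B" "\<phi> \<in> bz_hom G T' (gset_prod G A B)"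
        "m \<in> el (rep G S) A" "u \<in> el ?F B" for T T' \<theta> A B \<phi> m u
    unfolding \<beta>_def zm_comp[OF N T T' XS \<theta> K[OF *(1-3) *(4)[unfolded rep_simps] *(5)] y, symmetric]
    by (simp add: K_def bz_comp_assoc)
  obtain \<eta> where \<eta>: "zmod_hom G (box G (rep G S) ?F) N \<eta>"
    and \<eta>_cl: "\<And>T x. gset G T \<Longrightarrow> x \<in> box_gens G (rep G S) ?F T \<Longrightarrow> \<eta> T (box_cl G (rep G S) ?F T x) = \<beta> T x"
    by (rule zmod_hom_from_box[OF zmodule_rep F N, where \<beta>=\<beta>]) (use bal nat in \<open>blast+\<close>)
  let ?\<eta> = "zext G (box G (rep G S) ?F) \<eta>"
  have in_ihom: "?\<eta> \<in> el (ihom G ?F N) S"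
    unfolding ihom_simps by (rule zext_in[OF box_zmodule[OF zmodule_rep F] \<eta>])
  have g: "(S, X, swap X S, bz_id S, single j (bz_id X)) \<in> box_gens G (rep G S) ?F (gset_prod G X S)"
    unfolding box_gens_iff rep_simps by (intro conjI S X swap_in[OF X S] bz_id_in[OF S] single_in[OF bz_id_in[OF X]])
  have "ihom_eval G j X S ?\<eta> = \<eta> (gset_prod G X S) (ihom_gen G j X S)"
    unfolding ihom_eval_def by (rule zext_apply[OF XS ihom_gen_in[OF S X]])
  also have "\<dots> = \<beta> (gset_prod G X S) (S, X, swap X S, bz_id S, single j (bz_id X))"
    unfolding ihom_gen_def by (rule \<eta>_cl[OF XS g])
  also have "\<dots> = y"
  proof -
    have "K (gset_prod G X S) (S, X, swap X S, bz_id S, single j (bz_id X)) = bz_id (gset_prod G X S)"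
      unfolding K_def prod.case single_apply bz_prod_id[where G=G] bz_comp_id_left[OF SX swap_in[OF X S]] by (rule swap_swap[OF X S])
    then show ?thesis unfolding \<beta>_def using zm_id[OF N XS y] by simp
  qed
  finally show "\<exists>\<eta> \<in> el (ihom G ?F N) S. ihom_eval G j X S \<eta> = y"
    by (rule bexI[OF _ in_ihom])
qed

text \<open>Hom is contravariant in X already, so \<theta> itself appears here, in contrast to the
  box product, where its transpose does.\<close>

lemma ihom_free_natural:
  assumes N: "zmodule G N" and X: "gset G X" and Y: "gset G Y" and \<theta>: "\<theta> \<in> bz_hom G X Y"
    and S: "gset G S" and \<eta>: "\<eta> \<in> el (ihom G (free1 G j Y) N) S"
  shows "ihom_eval G j X S (ihom_map G (free1 G j X) (free1 G j Y) (free1_map j X \<theta>) S \<eta>) =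
    shift_map G N Y X \<theta> S (ihom_eval G j Y S \<eta>)"
proof -
  note FX = zmodule_free_mod[of G "{j}" "\<lambda>_. X"] and FY = zmodule_free_mod[of G "{j}" "\<lambda>_. Y"]
  note XS = finite_gset_prod[OF X S] and YS = finite_gset_prod[OF Y S] and SX = finite_gset_prod[OF S X] and SY = finite_gset_prod[OF S Y]
  note fm = zmod_hom_free1_map[OF X \<theta>, of j] and \<eta>' = \<eta>[unfolded ihom_simps]
  have g: "(S, X, swap X S, bz_id S, single j (bz_id X)) \<in> box_gens G (rep G S) (free1 G j X) (gset_prod G X S)"
    unfolding box_gens_iff rep_simps by (intro conjI S X swap_in[OF X S] bz_id_in[OF S] single_in[OF bz_id_in[OF X]])
  have t: "bz_prod X S Y S \<theta> (bz_id S) \<in> bz_hom G (gset_prod G X S) (gset_prod G Y S)"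
    by (rule bz_prod_in[OF X S Y S \<theta> bz_id_in[OF S]])
  have t': "bz_prod S X S Y (bz_id S) \<theta> \<in> bz_hom G (gset_prod G S X) (gset_prod G S Y)"
    by (rule bz_prod_in[OF S X S Y bz_id_in[OF S] \<theta>])
  have m: "bz_comp (gset_prod G S Y) (swap S Y) (bz_comp (gset_prod G S X) (bz_prod S X S Y (bz_id S) \<theta>) (swap X S)) = bz_prod X S Y S \<theta> (bz_id S)"
  proof -
    have "bz_comp (gset_prod G S Y) (swap S Y) (bz_comp (gset_prod G S X) (bz_prod S X S Y (bz_id S) \<theta>) (swap X S)) =
        bz_comp (gset_prod G X S) (bz_prod X S Y S \<theta> (bz_id S)) (bz_comp (gset_prod G S X) (swap S X) (swap X S))"
      unfolding bz_comp_assoc swap_natural[OF S X S Y bz_id_in[OF S] \<theta>] ..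
    then show ?thesis unfolding swap_swap[OF X S] bz_comp_id_right[OF XS t] .
  qed
  have "box_map' G (rep G S) (free1 G j Y) (free1_map j X \<theta>) (gset_prod G X S) (ihom_gen G j X S) =
      box_cl G (rep G S) (free1 G j Y) (gset_prod G X S) (S, X, swap X S, bz_id S, single j \<theta>)"
    unfolding ihom_gen_def box_map'(2)[OF zmodule_rep FX FY fm XS g] free1_map_single bz_comp_id_right[OF X \<theta>] ..
  also have "\<dots> = zmor (box G (rep G S) (free1 G j Y)) (gset_prod G X S) (gset_prod G Y S) (bz_prod X S Y S \<theta> (bz_id S)) (ihom_gen G j Y S)"
    unfolding rep_free1_cl[OF S Y S X XS swap_in[OF X S] bz_id_in[OF S] \<theta>]
      ihom_gen_pullback[OF S Y XS bz_comp_in[OF SX swap_in[OF X S] t']] m ..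
  finally have key: "box_map' G (rep G S) (free1 G j Y) (free1_map j X \<theta>) (gset_prod G X S) (ihom_gen G j X S) =
      zmor (box G (rep G S) (free1 G j Y)) (gset_prod G X S) (gset_prod G Y S) (bz_prod X S Y S \<theta> (bz_id S)) (ihom_gen G j Y S)" .
  have "ihom_eval G j X S (ihom_map G (free1 G j X) (free1 G j Y) (free1_map j X \<theta>) S \<eta>) =
      \<eta> (gset_prod G X S) (box_map' G (rep G S) (free1 G j Y) (free1_map j X \<theta>) (gset_prod G X S) (ihom_gen G j X S))"
    unfolding ihom_eval_def by (rule ihom_map(2)[OF FX FY N fm \<eta> XS ihom_gen_in[OF S X]])
  also have "\<dots> = zmor N (gset_prod G X S) (gset_prod G Y S) (bz_prod X S Y S \<theta> (bz_id S)) (\<eta> (gset_prod G Y S) (ihom_gen G j Y S))"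
    unfolding key by (rule zmod_homD(4)[OF hom_group_hom[OF \<eta>'] XS YS t ihom_gen_in[OF S Y]])
  finally show ?thesis unfolding ihom_eval_def shift_map_def .
qed

subsection \<open>Tor and Ext from a resolution by representable modules\<close>

lemma Tor_rep_iso:
  assumes R: "free_resolution G M (\<lambda>i. free1 G j (X i), \<lambda>i. free1_map j (X i) (\<theta> i), e)"
    and M: "zmodule G M" and N: "zmodule G N"
    and X: "\<And>i. gset G (X i)" and \<theta>: "\<And>i. \<theta> i \<in> bz_hom G (X i) (X (i - 1))"
    and zero: "\<And>i. bz_comp (X i) (\<theta> i) (\<theta> (i + 1)) = bz_zero"
  shows "zmod_iso G (Tor G i M N)
    (homology (shift G N (X (i + 1))) (shift G N (X i)) (shift G N (X (i - 1)))
      (shift_map G N (X (i + 1)) (X i) (bz_transpose (\<theta> (i + 1)))) (shift_map G N (X i) (X (i - 1)) (bz_transpose (\<theta> i))))"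
proof -
  \<comment> \<open>Dualizing reverses the order of composition, so consecutive transposes again
    compose to zero and the shifted modules form a complex.\<close>
  have \<theta>1: "\<theta> (i + 1) \<in> bz_hom G (X (i + 1)) (X i)" using \<theta>[of "i + 1"] by simp
  have zero': "bz_comp (X i) (bz_transpose (\<theta> (i + 1))) (bz_transpose (\<theta> i)) = bz_zero"
    using zero[of i] by (simp add: bz_comp_def bz_transpose_def bz_zero_def fun_eq_iff mult.commute)
  obtain \<Psi>1 where \<Psi>1: "box_free_equiv G j (X (i + 1)) N \<Psi>1" using box_free_equiv_ex[OF N X] by (rule exE)
  obtain \<Psi> where \<Psi>: "box_free_equiv G j (X i) N \<Psi>" using box_free_equiv_ex[OF N X] by (rule exE)
  obtain \<Psi>2 where \<Psi>2: "box_free_equiv G j (X (i - 1)) N \<Psi>2" using box_free_equiv_ex[OF N X] by (rule exE)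
  note E = \<Psi>[unfolded box_free_equiv_def] and E1 = \<Psi>1[unfolded box_free_equiv_def] and E2 = \<Psi>2[unfolded box_free_equiv_def]
  have "zmod_iso G
    (homology (box G (free1 G j (X (i + 1))) N) (box G (free1 G j (X i)) N) (box G (free1 G j (X (i - 1))) N)
       (box_map G (free1 G j (X i)) N (free1_map j (X (i + 1)) (\<theta> (i + 1)))) (box_map G (free1 G j (X (i - 1))) N (free1_map j (X i) (\<theta> i))))
    (homology (shift G N (X (i + 1))) (shift G N (X i)) (shift G N (X (i - 1)))
      (shift_map G N (X (i + 1)) (X i) (bz_transpose (\<theta> (i + 1)))) (shift_map G N (X i) (X (i - 1)) (bz_transpose (\<theta> i))))"
  proof (rule homology_iso_bij[where fA=\<Psi>1 and fB=\<Psi> and fC=\<Psi>2, OF Tor_zseq[OF R N]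
        shift_zseq[OF N X X X bz_transpose_in[OF \<theta>1] bz_transpose_in[OF \<theta>] zero']
        E1[THEN conjunct1] E[THEN conjunct1] E2[THEN conjunct1]])
    fix S x assume S: "gset G S"
    show "\<exists>x \<in> el (box G (free1 G j (X (i + 1))) N) S. \<Psi>1 S x = y" if "y \<in> el (shift G N (X (i + 1))) S" for y
      by (rule E1[THEN conjunct2, THEN conjunct1, THEN spec, THEN mp, OF S, THEN conjunct2, THEN bspec, OF that])
    show "\<exists>x \<in> el (box G (free1 G j (X i)) N) S. \<Psi> S x = y" if "y \<in> el (shift G N (X i)) S" for y
      by (rule E[THEN conjunct2, THEN conjunct1, THEN spec, THEN mp, OF S, THEN conjunct2, THEN bspec, OF that])
    show "inj_on (\<Psi> S) (el (box G (free1 G j (X i)) N) S)"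
      by (rule E[THEN conjunct2, THEN conjunct1, THEN spec, THEN mp, OF S, THEN conjunct1])
    show "inj_on (\<Psi>2 S) (el (box G (free1 G j (X (i - 1))) N) S)"
      by (rule E2[THEN conjunct2, THEN conjunct1, THEN spec, THEN mp, OF S, THEN conjunct1])
    show "\<Psi> S (box_map G (free1 G j (X i)) N (free1_map j (X (i + 1)) (\<theta> (i + 1))) S x) =
        shift_map G N (X (i + 1)) (X i) (bz_transpose (\<theta> (i + 1))) S (\<Psi>1 S x)"
      if "x \<in> el (box G (free1 G j (X (i + 1))) N) S"
      by (rule box_free_natural[OF N X X \<theta>1 \<Psi>1 \<Psi> S that])
    show "\<Psi>2 S (box_map G (free1 G j (X (i - 1))) N (free1_map j (X i) (\<theta> i)) S x) =
        shift_map G N (X i) (X (i - 1)) (bz_transpose (\<theta> i)) S (\<Psi> S x)"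
      if "x \<in> el (box G (free1 G j (X i)) N) S"
      by (rule box_free_natural[OF N X X \<theta> \<Psi> \<Psi>2 S that])
  qed
  then show ?thesis by (rule zmod_iso_trans[OF Tor_iso[OF R M N]])
qed

lemma Ext_rep_iso:
  assumes R: "free_resolution G M (\<lambda>i. free1 G j (X i), \<lambda>i. free1_map j (X i) (\<theta> i), e)"
    and M: "zmodule G M" and N: "zmodule G N"
    and X: "\<And>i. gset G (X i)" and \<theta>: "\<And>i. \<theta> i \<in> bz_hom G (X i) (X (i - 1))"
    and zero: "\<And>i. bz_comp (X i) (\<theta> i) (\<theta> (i + 1)) = bz_zero"
  shows "zmod_iso G (Ext G i M N)
    (homology (shift G N (X (i - 1))) (shift G N (X i)) (shift G N (X (i + 1)))
      (shift_map G N (X (i - 1)) (X i) (\<theta> i)) (shift_map G N (X i) (X (i + 1)) (\<theta> (i + 1))))"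
proof -
  have \<theta>1: "\<theta> (i + 1) \<in> bz_hom G (X (i + 1)) (X i)" using \<theta>[of "i + 1"] by simp
  have "zmod_iso G
    (homology (ihom G (free1 G j (X (i - 1))) N) (ihom G (free1 G j (X i)) N) (ihom G (free1 G j (X (i + 1))) N)
       (ihom_map G (free1 G j (X i)) (free1 G j (X (i - 1))) (free1_map j (X i) (\<theta> i)))
       (ihom_map G (free1 G j (X (i + 1))) (free1 G j (X i)) (free1_map j (X (i + 1)) (\<theta> (i + 1)))))
    (homology (shift G N (X (i - 1))) (shift G N (X i)) (shift G N (X (i + 1)))
      (shift_map G N (X (i - 1)) (X i) (\<theta> i)) (shift_map G N (X i) (X (i + 1)) (\<theta> (i + 1))))"
    by (rule homology_iso_bij[where fA="ihom_eval G j (X (i - 1))" and fB="ihom_eval G j (X i)" and fC="ihom_eval G j (X (i + 1))",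
          OF Ext_zseq[OF R N] shift_zseq[OF N X X X \<theta> \<theta>1 zero] ihom_eval(1)[OF N X] ihom_eval(1)[OF N X] ihom_eval(1)[OF N X]
            ihom_eval(3)[OF N X] ihom_eval(3)[OF N X] ihom_eval(2)[OF N X] ihom_eval(2)[OF N X]
            ihom_free_natural[OF N X X \<theta>] ihom_free_natural[OF N X X \<theta>1]])
  then show ?thesis by (rule zmod_iso_trans[OF Ext_iso[OF R M N]])
qed

section \<open>Finite sets with an action of a cyclic group\<close>

text \<open>The group consists of the residues below n; extending the action to all integers lets
  orbit arithmetic take place in Z without reductions.\<close>

definition cact :: "nat \<Rightarrow> int gset \<Rightarrow> int \<Rightarrow> nat \<Rightarrow> nat" where
  "cact n S k s = act S (k mod int n) s"

text \<open>The orbit length of s, as the positive generator of its stabilizer in Z. A least period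
  exists because n is one.\<close>

definition per :: "nat \<Rightarrow> int gset \<Rightarrow> nat \<Rightarrow> nat" where
  "per n S s = (LEAST p. p > 0 \<and> cact n S (int p) s = s)"

locale cyclic_order =
  fixes n :: nat assumes n: "n > 0"
begin

abbreviation Cn :: "int monoid" where "Cn \<equiv> Cyc n"

lemma mod_carrier: "k mod int n \<in> carrier Cn"
  using n by (simp add: carrier_integer_mod_group)

lemma act_eq_cact: "g \<in> carrier Cn \<Longrightarrow> act S g s = cact n S g s"
  using n by (simp add: carrier_integer_mod_group cact_def)

context
  fixes S :: "int gset" assumes S: "gset Cn S"
begin

lemma cact_in: "s \<in> pts S \<Longrightarrow> cact n S k s \<in> pts S"
  unfolding cact_def by (rule act_closed[OF S mod_carrier])

lemma cact_0: "s \<in> pts S \<Longrightarrow> cact n S 0 s = s"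
  using act_one[OF S] by (simp add: cact_def)

lemma cact_add: "s \<in> pts S \<Longrightarrow> cact n S (k + l) s = cact n S k (cact n S l s)"
  using act_mult[OF S mod_carrier mod_carrier, of s k l] by (simp add: cact_def mod_add_eq)

lemma cact_n: "s \<in> pts S \<Longrightarrow> cact n S (int n) s = s"
  using cact_0 by (simp add: cact_def)

lemma cact_mult:
  assumes s: "s \<in> pts S" and p: "cact n S p s = s" shows "cact n S (p * m) s = s"
proof (induction m rule: int_induct[where k=0])
  case base then show ?case using cact_0[OF s] by simp
next
  case (step1 i)
  have "cact n S (p * (i + 1)) s = cact n S (p * i + p) s" by (simp add: distrib_left)
  then show ?case using step1 p cact_add[OF s] by simp
next
  case (step2 i)
  have "s = cact n S (p * (i - 1) + p) s" using step2 by (simp add: right_diff_distrib)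
  then show ?case using p cact_add[OF s, of "p * (i - 1)" p] by simp
qed

lemma per: assumes s: "s \<in> pts S" shows "per n S s > 0" "cact n S (int (per n S s)) s = s"
  using LeastI[of "\<lambda>p. p > 0 \<and> cact n S (int p) s = s" n] n cact_n[OF s] unfolding per_def by blast+

lemma cact_fix_iff: assumes s: "s \<in> pts S" shows "cact n S k s = s \<longleftrightarrow> int (per n S s) dvd k"
proof
  assume "int (per n S s) dvd k"
  then show "cact n S k s = s" using cact_mult[OF s per(2)[OF s]] by (auto elim: dvdE)
next
  assume k: "cact n S k s = s"
  define r where "r = k mod int (per n S s)"
  have "k = r + int (per n S s) * (k div int (per n S s))" by (simp add: r_def)
  then have "cact n S k s = cact n S r s"
    using cact_add[OF s, of r] cact_mult[OF s per(2)[OF s]] by metis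
  then have r: "cact n S (int (nat r)) s = s" using k per(1)[OF s] by (simp add: r_def)
  have "nat r < per n S s" using per(1)[OF s] by (simp add: r_def nat_less_iff)
  then have "\<not> (nat r > 0 \<and> cact n S (int (nat r)) s = s)" unfolding per_def by (rule not_less_Least)
  then have "\<not> nat r > 0" using r by metis
  moreover have "0 \<le> r" using per(1)[OF s] by (simp add: r_def)
  ultimately have "r = 0" by linarith
  then show "int (per n S s) dvd k" by (simp add: r_def dvd_eq_mod_eq_0)
qed

lemma cact_eq_iff: assumes s: "s \<in> pts S" shows "cact n S k s = cact n S l s \<longleftrightarrow> int (per n S s) dvd k - l"
proof -
  have "cact n S (k - l) s = s" if "cact n S k s = cact n S l s"
    using cact_add[OF s, of "- l" k] cact_add[OF s, of "- l" l] that cact_0[OF s] by simp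
  moreover have "cact n S k s = cact n S l s" if "cact n S (k - l) s = s"
    using cact_add[OF s, of l "k - l"] that by simp
  ultimately show ?thesis using cact_fix_iff[OF s] by blast
qed

lemma per_cact: assumes s: "s \<in> pts S" shows "per n S (cact n S k s) = per n S s"
proof -
  have "cact n S p (cact n S k s) = cact n S k s \<longleftrightarrow> cact n S p s = s" for p
    using cact_eq_iff[OF s, of "p + k" k] cact_fix_iff[OF s] cact_add[OF s, of p k] by simp
  then show ?thesis by (simp add: per_def)
qed

lemma per_eqI:
  assumes s: "s \<in> pts S" and m: "\<And>k. cact n S k s = s \<longleftrightarrow> int m dvd k"
  shows "per n S s = m"
proof -
  have "m dvd per n S s" using m[of "int (per n S s)"] per(2)[OF s] by simp
  moreover have "per n S s dvd m" using cact_fix_iff[OF s, of "int m"] m[of "int m"] by simp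
  ultimately show ?thesis by (simp add: dvd_antisym)
qed

end

lemma cact_prod:
  "s \<in> pts S \<Longrightarrow> t \<in> pts T \<Longrightarrow> cact n (gset_prod Cn S T) k (prod_encode (s, t)) = prod_encode (cact n S k s, cact n T k t)"
  by (simp add: cact_def act_gset_prod)

lemma per_prod:
  assumes S: "gset Cn S" and T: "gset Cn T" and "s \<in> pts S" "t \<in> pts T"
  shows "per n (gset_prod Cn S T) (prod_encode (s, t)) = lcm (per n S s) (per n T t)"
  by (rule per_eqI[OF finite_gset_prod[OF S T]])
    (use assms in \<open>simp_all add: cact_prod prod_encode_eq cact_fix_iff flip: lcm_int_int_eq\<close>)

subsection \<open>Sums over orbits\<close>

text \<open>Split T into orbits under multiples of p. The orbit of t, whose full orbit has length l,
  consists of lcm(p,l)/p points on which F is constant, so p times its share of the sum is lcm(p,l)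
  F(t), which d divides.\<close>

lemma orbit_sum_dvd:
  fixes F :: "nat \<Rightarrow> int"
  assumes T: "gset Cn T"
    and inv: "\<And>t. t \<in> pts T \<Longrightarrow> F (cact n T (int p) t) = F t"
    and d: "\<And>t. t \<in> pts T \<Longrightarrow> d dvd int (lcm p (per n T t)) * F t"
  shows "d dvd int p * (\<Sum>t \<in> pts T. F t)"
proof (cases "p = 0")
  case False
  define r where "r = {(t, t'). t \<in> pts T \<and> t' \<in> pts T \<and> (\<exists>m. t' = cact n T (int p * m) t)}"
  have equiv: "equiv (pts T) r"
  proof (rule equivI)
    show "refl_on (pts T) r"
      by (rule refl_onI) (auto simp: r_def intro!: exI[of _ 0] simp: cact_0[OF T])
    show "r \<subseteq> pts T \<times> pts T" by (auto simp: r_def)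
    show "sym r"
    proof (rule symI)
      fix t t' assume "(t, t') \<in> r"
      then obtain m where m: "t \<in> pts T" "t' \<in> pts T" "t' = cact n T (int p * m) t" by (auto simp: r_def)
      have "t = cact n T (int p * (- m)) t'"
        using cact_add[OF T m(1), of "int p * (- m)" "int p * m"] cact_0[OF T m(1)] m(3) by simp
      then show "(t', t) \<in> r" unfolding r_def using m(1,2) by blast
    qed
    show "trans r"
    proof (rule transI)
      fix t t' t'' assume "(t, t') \<in> r" "(t', t'') \<in> r"
      then obtain m m' where m: "t \<in> pts T" "t'' \<in> pts T" "t' = cact n T (int p * m) t" "t'' = cact n T (int p * m') t'"
        by (auto simp: r_def)
      have "t'' = cact n T (int p * (m' + m)) t" using cact_add[OF T m(1)] m(3,4) by (simp add: distrib_left)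
      then show "(t, t'') \<in> r" using m by (auto simp: r_def)
    qed
  qed
  note fin = finite_gset_finite[OF T]
  have cls: "d dvd int p * (\<Sum>t \<in> C. F t)" if C: "C \<in> pts T // r" for C
  proof -
    from C obtain t where t: "t \<in> pts T" "C = r `` {t}" by (auto elim: quotientE)
    let ?l = "per n T t"
    \<comment> \<open>The number of points in the class: a multiple p j fixes t iff l divides p j,
      that is, iff q divides j.\<close>
    define q where "q = lcm p ?l div p"
    have q: "p * q = lcm p ?l" by (simp add: q_def)
    have qpos: "q > 0" using q per(1)[OF T t(1)] False by (metis gr0I lcm_eq_0_iff mult_0_right not_gr0)
    have C_eq: "C = (\<lambda>j. cact n T (int p * int j) t) ` {..<q}"
    proof
      show "(\<lambda>j. cact n T (int p * int j) t) ` {..<q} \<subseteq> C"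
        using t cact_in[OF T t(1)] by (auto simp: r_def)
      show "C \<subseteq> (\<lambda>j. cact n T (int p * int j) t) ` {..<q}"
      proof
        fix t' assume "t' \<in> C"
        then obtain m where m: "t' = cact n T (int p * m) t" using t by (auto simp: r_def)
        have "int p * m - int p * int (nat (m mod int q)) = int (p * q) * (m div int q)"
          using qpos by (simp add: minus_mod_eq_mult_div right_diff_distrib[symmetric] mult.assoc)
        also have "int ?l dvd \<dots>" unfolding q by (simp add: dvd_mult2)
        finally have "t' = cact n T (int p * int (nat (m mod int q))) t"
          using cact_eq_iff[OF T t(1)] m by blast
        moreover have "nat (m mod int q) < q" using qpos by (simp add: nat_less_iff)
        ultimately show "t' \<in> (\<lambda>j. cact n T (int p * int j) t) ` {..<q}" by blast
      qed
    qed
    have inj: "inj_on (\<lambda>j. cact n T (int p * int j) t) {..<q}"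
    proof (rule inj_onI)
      fix i j assume ij: "i \<in> {..<q}" "j \<in> {..<q}" and "cact n T (int p * int i) t = cact n T (int p * int j) t"
      then have "int ?l dvd int p * (int i - int j)"
        using cact_eq_iff[OF T t(1)] by (simp add: right_diff_distrib)
      then have "int (lcm p ?l) dvd int p * (int i - int j)" by (simp flip: lcm_int_int_eq)
      then have "int q dvd int i - int j" unfolding q[symmetric] using False by simp
      then have "int i mod int q = int j mod int q" by (simp add: mod_eq_dvd_iff)
      then show "i = j" using ij by simp
    qed
    have const: "F (cact n T (int p * int j) t) = F t" for j
    proof (induction j)
      case 0 then show ?case using cact_0[OF T t(1)] by simp
    next
      case (Suc j)
      have "cact n T (int p * int (Suc j)) t = cact n T (int p) (cact n T (int p * int j) t)"
        using cact_add[OF T t(1), of "int p" "int p * int j"] by (simp add: distrib_left)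
      then show ?case using inv[OF cact_in[OF T t(1)]] Suc by simp
    qed
    have "(\<Sum>t \<in> C. F t) = int q * F t"
      unfolding C_eq sum.reindex[OF inj] comp_def const by simp
    then have "int p * (\<Sum>t \<in> C. F t) = int (lcm p ?l) * F t"
      unfolding q[symmetric] by simp
    then show ?thesis using d[OF t(1)] by simp
  qed
  have "(\<Sum>t \<in> pts T. F t) = (\<Sum>C \<in> pts T // r. \<Sum>t \<in> C. F t)"
  proof -
    have "(\<Sum>t \<in> \<Union> (pts T // r). F t) = (sum \<circ> sum) F (pts T // r)"
      by (rule sum.Union_disjoint)
        (use fin equiv in \<open>auto dest: quotient_disj in_quotient_imp_subset intro: finite_subset\<close>)
    then show ?thesis using Union_quotient[OF equiv] by simp
  qed
  then show ?thesis using cls by (simp add: sum_distrib_left dvd_sum)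
qed simp

subsection \<open>The orbits \<open>\<int>/a\<close>\<close>

definition rot :: "nat \<Rightarrow> int \<Rightarrow> nat \<Rightarrow> nat" where
  "rot a k x = nat ((int x + k) mod int a)"

text \<open>For a dividing n this is the orbit of length a. The value a = 0 gives the empty set,
  which serves as the zero term of the resolutions.\<close>

definition Zc :: "nat \<Rightarrow> int gset" where
  "Zc a = ({..<a}, \<lambda>g. \<lambda>x \<in> {..<a}. rot a g x)"

lemma pts_Zc [simp]: "pts (Zc a) = {..<a}"
  by (simp add: Zc_def)

lemma rot_less [simp]: "x < a \<Longrightarrow> rot a k x < a"
  by (simp add: rot_def nat_less_iff)

lemma int_rot: "x < a \<Longrightarrow> int (rot a k x) = (int x + k) mod int a"
  by (simp add: rot_def)

lemma rot_add: "x < a \<Longrightarrow> rot a k (rot a l x) = rot a (k + l) x"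
  by (simp add: rot_def mod_simps add_ac)

lemma rot_0 [simp]: "x < a \<Longrightarrow> rot a 0 x = x"
  by (simp add: rot_def)

lemma rot_dvd: "x < a \<Longrightarrow> int a dvd int (rot a k x) - (int x + k)"
  by (simp add: int_rot) (metis dvd_minus_mod dvd_diff_commute)

lemma rot_eq_iff: "x < a \<Longrightarrow> y < a \<Longrightarrow> rot a k x = y \<longleftrightarrow> int a dvd int x + k - int y"
proof -
  assume *: "x < a" "y < a"
  have "rot a k x = y \<longleftrightarrow> (int x + k) mod int a = int y mod int a"
    using * int_rot[OF *(1), of k] by (metis mod_pos_pos_trivial of_nat_0_le_iff of_nat_eq_iff of_nat_less_iff)
  then show ?thesis by (simp add: mod_eq_dvd_iff)
qed

lemma rot_mod: "a dvd n \<Longrightarrow> rot a (k mod int n) x = rot a k x"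
proof -
  assume "a dvd n"
  then have "(k mod int n) mod int a = k mod int a" by (simp add: mod_mod_cancel)
  then show ?thesis unfolding rot_def by (metis mod_add_right_eq)
qed

lemma finite_gset_Zc:
  assumes "a = 0 \<or> a dvd n" shows "gset Cn (Zc a)"
proof (rule finite_gsetI)
  fix g h x assume "x \<in> pts (Zc a)"
  then have x: "x < a" by simp
  then have a: "a dvd n" using assms by auto
  show "act (Zc a) (g \<otimes>\<^bsub>Cn\<^esub> h) x = act (Zc a) g (act (Zc a) h x)"
    using x by (simp add: Zc_def rot_mod[OF a] rot_add)
qed (simp_all add: Zc_def)

lemma cact_Zc: "a dvd n \<Longrightarrow> x < a \<Longrightarrow> cact n (Zc a) k x = rot a k x"
  by (simp add: cact_def Zc_def rot_mod)

lemma per_Zc: assumes a: "a dvd n" and x: "x < a" shows "per n (Zc a) x = a"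
  by (rule per_eqI[OF finite_gset_Zc]) (use assms in \<open>simp_all add: cact_Zc rot_eq_iff\<close>)

lemma per_Zc_prod:
  "gset Cn S \<Longrightarrow> a dvd n \<Longrightarrow> x < a \<Longrightarrow> s \<in> pts S \<Longrightarrow>
    per n (gset_prod Cn (Zc a) S) (prod_encode (x, s)) = lcm a (per n S s)"
  using per_prod[OF finite_gset_Zc, of a S x s] by (simp add: per_Zc)

lemma cact_Zc_prod:
  "a dvd n \<Longrightarrow> x < a \<Longrightarrow> s \<in> pts S \<Longrightarrow>
    cact n (gset_prod Cn (Zc a) S) k (prod_encode (x, s)) = prod_encode (rot a k x, cact n S k s)"
  by (simp add: cact_prod cact_Zc)

section \<open>The ideals as divisibility conditions\<close>

lemma Zconst_simps [simp]:
  "el (Zconst G) S = {u. (\<forall>s. s \<notin> pts S \<longrightarrow> u s = 0) \<and> (\<forall>g \<in> carrier G. \<forall>s \<in> pts S. u (act S g s) = u s)}"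
  "monoid.mult (zobj (Zconst G) S) = (\<lambda>u v s. u s + v s)"
  "one (zobj (Zconst G) S) = (\<lambda>s. 0)"
  "zmor (Zconst G) S T \<phi> u = (\<lambda>s. \<Sum>t \<in> pts T. \<phi> s t * u t)"
  by (simp_all add: Zconst_def)

lemma zmodule_Zconst: "zmodule G (Zconst G)"
  unfolding zmodule_def
proof (intro conjI allI impI ballI)
  fix S :: "'a gset" assume S: "gset G S"
  show "comm_group (zobj (Zconst G) S)"
  proof (rule group.group_comm_groupI[OF groupI])
    fix x assume "x \<in> el (Zconst G) S"
    then show "\<exists>y \<in> el (Zconst G) S. y \<otimes>\<^bsub>zobj (Zconst G) S\<^esub> x = \<one>\<^bsub>zobj (Zconst G) S\<^esub>"
      by (intro bexI[of _ "\<lambda>s. - x s"]) simp_all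
  qed (simp_all add: ac_simps)
next
  fix S T \<phi> assume S: "gset G S" and T: "gset G T" and \<phi>: "\<phi> \<in> bz_hom G S T"
  show "zmor (Zconst G) S T \<phi> \<in> hom (zobj (Zconst G) T) (zobj (Zconst G) S)"
  proof (rule homI)
    fix u assume u: "u \<in> el (Zconst G) T"
    have "(\<Sum>t \<in> pts T. \<phi> (act S g s) t * u t) = (\<Sum>t \<in> pts T. \<phi> s t * u t)" if g: "g \<in> carrier G" and s: "s \<in> pts S" for g s
    proof -
      have "(\<Sum>t \<in> pts T. \<phi> (act S g s) t * u t) = (\<Sum>t \<in> pts T. \<phi> (act S g s) (act T g t) * u (act T g t))"
        by (rule sum_act[OF T g, symmetric])
      also have "\<dots> = (\<Sum>t \<in> pts T. \<phi> s t * u t)"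
        by (rule sum.cong) (use u g s bz_hom_inv[OF \<phi>] in simp_all)
      finally show ?thesis .
    qed
    then show "zmor (Zconst G) S T \<phi> u \<in> el (Zconst G) S" by (simp add: bz_hom_out[OF \<phi>])
  qed (simp add: algebra_simps sum.distrib)
next
  fix S u assume S: "gset G S" and u: "u \<in> el (Zconst G) S"
  show "zmor (Zconst G) S S (bz_id S) u = u"
  proof
    fix s show "zmor (Zconst G) S S (bz_id S) u s = u s"
      using u bz_id_sum(1)[OF S, of s u] bz_hom_out(1)[OF bz_id_in[OF S], of s] by (cases "s \<in> pts S") simp_all
  qed
next
  fix S T U \<phi> \<psi> u
  show "zmor (Zconst G) S U (bz_comp T \<psi> \<phi>) u = zmor (Zconst G) S T \<phi> (zmor (Zconst G) T U \<psi> u)"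
    by (intro ext) (simp add: bz_comp_def sum_distrib_left sum_distrib_right mult.assoc, rule sum.swap)
qed (simp add: bz_add_def algebra_simps sum.distrib)

lemma Zconst_inv:
  assumes "gset G S" "u \<in> el (Zconst G) S"
  shows "inv\<^bsub>zobj (Zconst G) S\<^esub> u = (\<lambda>s. - u s)"
  by (rule group.inv_equality[OF zm_group[OF zmodule_Zconst assms(1)]]) (use assms(2) in simp_all)

lemma Zconst_Cyc_iff:
  "u \<in> el (Zconst Cn) S \<longleftrightarrow> (\<forall>s. s \<notin> pts S \<longrightarrow> u s = 0) \<and> (\<forall>k. \<forall>s \<in> pts S. u (cact n S k s) = u s)"
proof -
  have "(\<forall>g \<in> carrier Cn. \<forall>s \<in> pts S. u (act S g s) = u s) \<longleftrightarrow> (\<forall>k. \<forall>s \<in> pts S. u (cact n S k s) = u s)"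
  proof (intro iffI ballI allI)
    fix k s assume "\<forall>g \<in> carrier Cn. \<forall>s \<in> pts S. u (act S g s) = u s" and s: "s \<in> pts S"
    then show "u (cact n S k s) = u s" unfolding cact_def using mod_carrier by simp
  qed (simp add: act_eq_cact)
  then show ?thesis by simp
qed

text \<open>On a single orbit of length l these are the constants divisible by d / gcd(d,l).
  Multiplying by the orbit length avoids the quotient.\<close>

definition idl :: "nat \<Rightarrow> int gset \<Rightarrow> (nat \<Rightarrow> int) set" where
  "idl d S = {u \<in> el (Zconst Cn) S. \<forall>s \<in> pts S. int d dvd int (per n S s) * u s}"

lemma idlD:
  assumes "u \<in> idl d S"
  shows "u \<in> el (Zconst Cn) S" "s \<notin> pts S \<Longrightarrow> u s = 0"
    "s \<in> pts S \<Longrightarrow> u (cact n S k s) = u s" "s \<in> pts S \<Longrightarrow> int d dvd int (per n S s) * u s"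
  using assms Zconst_Cyc_iff[of u S] unfolding idl_def by blast+

lemma idlI:
  assumes "\<And>s. s \<notin> pts S \<Longrightarrow> u s = 0" "\<And>k s. s \<in> pts S \<Longrightarrow> u (cact n S k s) = u s"
    "\<And>s. s \<in> pts S \<Longrightarrow> int d dvd int (per n S s) * u s"
  shows "u \<in> idl d S"
  unfolding idl_def using assms Zconst_Cyc_iff[of u S] by blast

lemma submodule_family_idl: "submodule_family Cn (Zconst Cn) (idl d)"
  unfolding submodule_family_def
proof (intro conjI allI impI ballI)
  fix S assume S: "gset Cn S"
  interpret group "zobj (Zconst Cn) S" by (rule zm_group[OF zmodule_Zconst S])
  show "subgroup (idl d S) (zobj (Zconst Cn) S)"
  proof (rule subgroupI)
    show "idl d S \<subseteq> el (Zconst Cn) S" using idlD(1) by blast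
    have "(\<lambda>s. 0) \<in> idl d S" by (rule idlI) simp_all
    then show "idl d S \<noteq> {}" by blast
    show "inv\<^bsub>zobj (Zconst Cn) S\<^esub> u \<in> idl d S" if u: "u \<in> idl d S" for u
      unfolding Zconst_inv[OF S idlD(1)[OF u]] by (rule idlI) (simp_all add: idlD[OF u])
    show "u \<otimes>\<^bsub>zobj (Zconst Cn) S\<^esub> v \<in> idl d S" if u: "u \<in> idl d S" and v: "v \<in> idl d S" for u v
      by (rule idlI) (simp_all add: idlD[OF u] idlD[OF v] distrib_left)
  qed
next
  fix S T \<phi> u assume S: "gset Cn S" and T: "gset Cn T" and \<phi>: "\<phi> \<in> bz_hom Cn S T" and u: "u \<in> idl d T"
  have \<phi>_cact: "\<phi> (cact n S k s) (cact n T k t) = \<phi> s t" if "s \<in> pts S" "t \<in> pts T" for k s t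
    unfolding cact_def by (rule bz_hom_inv[OF \<phi> mod_carrier that])
  have "zmor (Zconst Cn) S T \<phi> u \<in> el (Zconst Cn) S"
    by (rule zm_closed[OF zmodule_Zconst S T \<phi> idlD(1)[OF u]])
  moreover have "int d dvd int (per n S s) * zmor (Zconst Cn) S T \<phi> u s" if s: "s \<in> pts S" for s
    unfolding Zconst_simps
  \<comment> \<open>For fixed s, the summand is invariant only under the stabilizer of s, which is
    generated by the orbit length; hence p is \<open>per n S s\<close>.\<close>
  proof (rule orbit_sum_dvd[OF T])
    fix t assume t: "t \<in> pts T"
    show "\<phi> s (cact n T (int (per n S s)) t) * u (cact n T (int (per n S s)) t) = \<phi> s t * u t"
      using \<phi>_cact[OF s t, of "int (per n S s)"] idlD(3)[OF u t] per(2)[OF S s] by simp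
    have "int d dvd int (per n T t) * u t" by (rule idlD(4)[OF u t])
    moreover have "int (per n T t) * u t dvd int (lcm (per n S s) (per n T t)) * (\<phi> s t * u t)"
      by (rule mult_dvd_mono) (simp_all flip: lcm_int_int_eq)
    ultimately show "int d dvd int (lcm (per n S s) (per n T t)) * (\<phi> s t * u t)" by (rule dvd_trans)
  qed
  ultimately show "zmor (Zconst Cn) S T \<phi> u \<in> idl d S" unfolding idl_def by blast
qed

subsection \<open>Invariant functions on \<open>\<int>/a \<times> S\<close>\<close>

abbreviation ZcP :: "nat \<Rightarrow> int gset \<Rightarrow> int gset" where
  "ZcP a S \<equiv> gset_prod Cn (Zc a) S"

lemma idl_Zc_D:
  assumes w: "w \<in> idl b (ZcP a S)" and S: "gset Cn S" and a: "a dvd n" and x: "x < a" and s: "s \<in> pts S"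
  shows "w (prod_encode (rot a k x, cact n S k s)) = w (prod_encode (x, s))"
    and "int b dvd int (lcm a (per n S s)) * w (prod_encode (x, s))"
  using idlD(3,4)[OF w, of "prod_encode (x, s)"] x s by (simp_all add: cact_Zc_prod[OF a] per_Zc_prod[OF S a])

lemma idl_Zc_I:
  assumes S: "gset Cn S" and a: "a dvd n" and "\<And>p. p \<notin> pts (ZcP a S) \<Longrightarrow> w p = 0"
    and "\<And>x s k. x < a \<Longrightarrow> s \<in> pts S \<Longrightarrow> w (prod_encode (rot a k x, cact n S k s)) = w (prod_encode (x, s))"
    and "\<And>x s. x < a \<Longrightarrow> s \<in> pts S \<Longrightarrow> int b dvd int (lcm a (per n S s)) * w (prod_encode (x, s))"
  shows "w \<in> idl b (ZcP a S)"
  by (rule idlI) (use assms in \<open>auto simp: cact_Zc_prod[OF a] per_Zc_prod[OF S a]\<close>)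

text \<open>Acting by multiples of the orbit length l of s fixes s and moves x by multiples of l
  modulo a, so w depends on x only modulo gcd(a,l).\<close>

lemma idl_Zc_periodic:
  assumes w: "w \<in> idl b (ZcP a S)" and S: "gset Cn S" and a: "a dvd n" and x: "x < a" and y: "y < a" and s: "s \<in> pts S"
    and dvd: "int (gcd a (per n S s)) dvd int x - int y"
  shows "w (prod_encode (x, s)) = w (prod_encode (y, s))"
proof -
  have g: "gcd (int a) (int (per n S s)) dvd int y - int x" using dvd by (simp add: dvd_diff_commute)
  then obtain m where m: "int y - int x = gcd (int a) (int (per n S s)) * m" by (auto elim: dvdE)
  obtain p q where pq: "p * int a + q * int (per n S s) = gcd (int a) (int (per n S s))"
    using bezout_int by blast
  \<comment> \<open>By Bezout a multiple of the orbit length that is congruent to y - x modulo a: it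
    fixes s and carries x to y.\<close>
  let ?k = "int (per n S s) * (q * m)"
  have "int x + ?k - int y = int a * (- (p * m))"
    using m unfolding pq[symmetric] by (simp add: algebra_simps)
  then have "rot a ?k x = y" using rot_eq_iff[OF x y] by simp
  moreover have "cact n S ?k s = s" using cact_fix_iff[OF S s] by simp
  ultimately show ?thesis using idl_Zc_D(1)[OF w S a x s, of ?k] by simp
qed

text \<open>
  Functions on \<open>\<int>/a \<times> S\<close> are built orbit by orbit: a family \<open>f\<close> of functions on \<open>\<int>\<close>, one for each
  chosen representative \<open>r\<close> of an orbit, extends equivariantly if \<open>f r\<close> has period \<open>gcd a (per r)\<close>.
\<close>

definition orep :: "int gset \<Rightarrow> nat \<Rightarrow> nat" where
  "orep S s = Min (range (\<lambda>k. cact n S k s))"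

lemma orep:
  assumes S: "gset Cn S" and s: "s \<in> pts S"
  shows "orep S s \<in> pts S" "\<exists>k. cact n S k (orep S s) = s" "orep S (cact n S k s) = orep S s"
    "per n S (orep S s) = per n S s"
proof -
  have sub: "range (\<lambda>k. cact n S k s) \<subseteq> pts S" using cact_in[OF S s] by blast
  then have "finite (range (\<lambda>k. cact n S k s))" using finite_gset_finite[OF S] finite_subset by blast
  then have "orep S s \<in> range (\<lambda>k. cact n S k s)" unfolding orep_def by (rule Min_in) simp
  then obtain k0 where k0: "orep S s = cact n S k0 s" by blast
  show "orep S s \<in> pts S" unfolding k0 by (rule cact_in[OF S s])
  show "\<exists>k. cact n S k (orep S s) = s"
    unfolding k0 using cact_add[OF S s, of "- k0" k0] cact_0[OF S s] by (intro exI[of _ "- k0"]) simp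
  show "per n S (orep S s) = per n S s" unfolding k0 by (rule per_cact[OF S s])
  have "range (\<lambda>l. cact n S l (cact n S k s)) = range (\<lambda>l. cact n S l s)"
  proof (intro equalityI subsetI)
    fix t assume "t \<in> range (\<lambda>l. cact n S l (cact n S k s))"
    then show "t \<in> range (\<lambda>l. cact n S l s)" using cact_add[OF S s] by (metis (mono_tags) imageE rangeI)
  next
    fix t assume "t \<in> range (\<lambda>l. cact n S l s)"
    then obtain l where "t = cact n S l s" by blast
    then have "t = cact n S (l - k) (cact n S k s)" using cact_add[OF S s, of "l - k" k] by simp
    then show "t \<in> range (\<lambda>l. cact n S l (cact n S k s))" by blast
  qed
  then show "orep S (cact n S k s) = orep S s" by (simp add: orep_def)
qed

lemma orbit_function:
  assumes S: "gset Cn S" and a: "a dvd n"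
    and per_f: "\<And>r y y'. r \<in> pts S \<Longrightarrow> int (gcd a (per n S r)) dvd y - y' \<Longrightarrow> f r y = f r y'"
    and b_f: "\<And>r y. r \<in> pts S \<Longrightarrow> int b dvd int (lcm a (per n S r)) * f r y"
  shows "\<exists>w \<in> idl b (ZcP a S). \<forall>s \<in> pts S. \<exists>k. cact n S k (orep S s) = s \<and>
    (\<forall>x < a. w (prod_encode (x, s)) = f (orep S s) (int x - k))"
proof -
  \<comment> \<open>A position of s on its orbit, determined only up to the orbit length; the
    periodicity of f makes the choice immaterial.\<close>
  define pos where "pos s = (SOME k. cact n S k (orep S s) = s)" for s
  have pos: "cact n S (pos s) (orep S s) = s" if "s \<in> pts S" for s
    unfolding pos_def by (rule someI_ex[OF orep(2)[OF S that]])
  define w where "w p = (if p \<in> pts (ZcP a S) then f (orep S (snd (prod_decode p))) (int (fst (prod_decode p)) - pos (snd (prod_decode p))) else 0)" for p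
  have w: "w (prod_encode (x, s)) = f (orep S s) (int x - pos s)" if "x < a" "s \<in> pts S" for x s
    using that by (simp add: w_def)
  have "w \<in> idl b (ZcP a S)"
  proof (rule idl_Zc_I[OF S a])
    fix x s k assume x: "x < a" and s: "s \<in> pts S"
    let ?r = "orep S s"
    note r = orep(1)[OF S s]
    have "cact n S (pos (cact n S k s)) ?r = cact n S (k + pos s) ?r"
      using pos[OF cact_in[OF S s], of k] pos[OF s] orep(3)[OF S s] cact_add[OF S r] by simp
    then have 1: "int (per n S ?r) dvd pos (cact n S k s) - (k + pos s)" using cact_eq_iff[OF S r] by simp
    have 2: "int a dvd int (rot a k x) - (int x + k)" by (rule rot_dvd[OF x])
    \<comment> \<open>The first bracket is a multiple of a, from reduction in Z/a, and the second a
      multiple of the orbit length, from the choice of \<open>pos\<close>. Both are periods of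
      f.\<close>
    have "int (gcd a (per n S ?r)) dvd (int (rot a k x) - (int x + k)) - (pos (cact n S k s) - (k + pos s))"
      by (rule dvd_diff[OF dvd_trans[OF _ 2] dvd_trans[OF _ 1]]) simp_all
    then have "f ?r (int (rot a k x) - pos (cact n S k s)) = f ?r (int x - pos s)"
      by (intro per_f[OF r]) (simp add: algebra_simps)
    then show "w (prod_encode (rot a k x, cact n S k s)) = w (prod_encode (x, s))"
      using x s by (simp add: w cact_in[OF S] orep(3)[OF S])
    show "int b dvd int (lcm a (per n S s)) * w (prod_encode (x, s))"
      unfolding w[OF x s] using b_f[OF r] by (simp add: orep(4)[OF S s])
  qed (simp add: w_def)
  then show ?thesis using pos w by blast
qed

section \<open>The trace along Z/a: image and kernel\<close>

lemma card_residue_class: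
  assumes "g dvd a" "g > 0"
  shows "card {x \<in> {..<a}. int g dvd int x - k} = a div g"
proof -
  define k0 where "k0 = nat (k mod int g)"
  have k0: "k0 < g" "int k0 = k mod int g" using assms(2) by (simp_all add: k0_def nat_less_iff)
  have iff: "int g dvd int x - k \<longleftrightarrow> x mod g = k0" for x
  proof -
    have "int g dvd int x - k \<longleftrightarrow> int x mod int g = int k0" by (simp add: mod_eq_dvd_iff k0(2))
    also have "\<dots> \<longleftrightarrow> x mod g = k0" by (simp flip: of_nat_mod)
    finally show ?thesis .
  qed
  have "{x \<in> {..<a}. int g dvd int x - k} = (\<lambda>j. k0 + g * j) ` {..<a div g}"
  proof (intro equalityI subsetI)
    fix x assume "x \<in> {x \<in> {..<a}. int g dvd int x - k}"
    then have x: "x < a" "x mod g = k0" using iff by auto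
    have "x = k0 + g * (x div g)" using x(2) by (metis mod_mult_div_eq)
    moreover have "x div g < a div g" using x(1) assms by (metis dvd_mult_div_cancel less_mult_imp_div_less mult.commute)
    ultimately show "x \<in> (\<lambda>j. k0 + g * j) ` {..<a div g}" by blast
  next
    fix x assume "x \<in> (\<lambda>j. k0 + g * j) ` {..<a div g}"
    then obtain j where j: "j < a div g" "x = k0 + g * j" by blast
    have "g * Suc j \<le> g * (a div g)" using j(1) by (intro mult_le_mono2) simp
    then have "x < a" using j(2) k0(1) assms(1) by simp
    moreover have "x mod g = k0" using j(2) k0(1) by simp
    ultimately show "x \<in> {x \<in> {..<a}. int g dvd int x - k}" using iff by simp
  qed
  moreover have "inj_on (\<lambda>j. k0 + g * j) {..<a div g}" using assms(2) by (simp add: inj_on_def)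
  ultimately show ?thesis by (simp add: card_image)
qed

text \<open>Over an orbit of length l put a constant c on one residue class modulo gcd(a,l) and 0
  elsewhere. The class has a/gcd(a,l) points in Z/a, which dictates c, and the two divisibilities in
  \<open>idl (lcm a b)\<close> play separate parts: that by a makes c an integer, that by b puts w
  into \<open>idl b\<close>.\<close>

lemma trace_surj:
  assumes S: "gset Cn S" and a: "a dvd n" and u: "u \<in> idl (lcm a b) S"
  shows "\<exists>w \<in> idl b (ZcP a S). \<forall>s \<in> pts S. u s = (\<Sum>x<a. w (prod_encode (x, s)))"
proof -
  have a0: "a > 0" using a n by (auto intro: dvd_pos_nat)
  \<comment> \<open>Solved from (a / gcd(a,l)) c = u by means of a l = gcd(a,l) lcm(a,l).\<close>
  define c where "c r = (int (per n S r) * u r) div int (lcm a (per n S r))" for r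
  define f where "f r y = (if int (gcd a (per n S r)) dvd y then c r else 0)" for r y
  have ab: "int a dvd int (per n S r) * u r" "int b dvd int (per n S r) * u r" if "r \<in> pts S" for r
    using idlD(4)[OF u that] by (simp_all flip: lcm_int_int_eq)
  have c: "int (lcm a (per n S r)) * c r = int (per n S r) * u r" if r: "r \<in> pts S" for r
    unfolding c_def using ab(1)[OF r] by (intro dvd_mult_div_cancel) (simp flip: lcm_int_int_eq)
  have "\<exists>w \<in> idl b (ZcP a S). \<forall>s \<in> pts S. \<exists>k. cact n S k (orep S s) = s \<and>
    (\<forall>x < a. w (prod_encode (x, s)) = f (orep S s) (int x - k))"
  proof (rule orbit_function[OF S a])
    fix r y y' assume "int (gcd a (per n S r)) dvd y - y'"
    then have "int (gcd a (per n S r)) dvd y \<longleftrightarrow> int (gcd a (per n S r)) dvd y'"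
      by (metis dvd_diff_right_iff dvd_diff_commute dvd_add_right_iff diff_add_cancel)
    then show "f r y = f r y'" by (simp add: f_def)
  qed (use ab(2) c in \<open>simp add: f_def\<close>)
  then obtain w where w: "w \<in> idl b (ZcP a S)"
    "\<And>s. s \<in> pts S \<Longrightarrow> \<exists>k. cact n S k (orep S s) = s \<and> (\<forall>x < a. w (prod_encode (x, s)) = f (orep S s) (int x - k))"
    by blast
  have "u s = (\<Sum>x<a. w (prod_encode (x, s)))" if s: "s \<in> pts S" for s
  proof -
    let ?r = "orep S s" and ?l = "per n S s" and ?g = "gcd a (per n S s)"
    obtain k where k: "cact n S k ?r = s" "\<And>x. x < a \<Longrightarrow> w (prod_encode (x, s)) = f ?r (int x - k)" using w(2)[OF s] by blast
    note r = orep(1)[OF S s]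
    have ur: "u ?r = u s" using idlD(3)[OF u r, of k] k(1) by simp
    have l0: "?l > 0" by (rule per(1)[OF S s])
    have "(\<Sum>x<a. w (prod_encode (x, s))) = (\<Sum>x<a. if int ?g dvd int x - k then c ?r else 0)"
      by (rule sum.cong) (simp_all add: k(2) f_def orep(4)[OF S s])
    also have "\<dots> = (\<Sum>x \<in> {x \<in> {..<a}. int ?g dvd int x - k}. c ?r)"
      by (rule sum.inter_filter[symmetric]) simp
    also have "\<dots> = int (a div ?g) * c ?r" using card_residue_class[of ?g a k] a0 by simp
    finally have 1: "(\<Sum>x<a. w (prod_encode (x, s))) = int (a div ?g) * c ?r" .
    have "?l * (a div ?g) = lcm a ?l"
      by (simp add: lcm_nat_def div_mult_swap mult.commute)
    then have "int ?l * (int (a div ?g) * c ?r) = int (lcm a (per n S ?r)) * c ?r"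
      unfolding orep(4)[OF S s] by (metis mult.assoc of_nat_mult)
    also have "\<dots> = int ?l * u s" using c[OF r] unfolding ur orep(4)[OF S s] .
    finally show ?thesis unfolding 1 using l0 by simp
  qed
  then show ?thesis using w(1) by blast
qed

text \<open>Apply \<open>orbit_sum_dvd\<close> to Z/a with p the orbit length l of s. Divisibility
  by b is inherited from w, and divisibility by a holds for free because each term carries the
  factor lcm(a,l).\<close>

lemma trace_in:
  assumes S: "gset Cn S" and a: "a dvd n" and w: "w \<in> idl b (ZcP a S)"
    and u: "\<And>s. s \<in> pts S \<Longrightarrow> u s = (\<Sum>x<a. w (prod_encode (x, s)))" "\<And>s. s \<notin> pts S \<Longrightarrow> u s = 0"
  shows "u \<in> idl (lcm a b) S"
proof (rule idlI)
  note Z = finite_gset_Zc[of a, OF disjI2[OF a]]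
  fix s assume s: "s \<in> pts S"
  show "u (cact n S k s) = u s" for k
  proof -
    have "u (cact n S k s) = (\<Sum>x \<in> pts (Zc a). w (prod_encode (act (Zc a) (k mod int n) x, cact n S k s)))"
      using u(1)[OF cact_in[OF S s]] sum_act[OF Z mod_carrier, of "\<lambda>x. w (prod_encode (x, cact n S k s))" k] by simp
    also have "\<dots> = (\<Sum>x \<in> pts (Zc a). w (prod_encode (x, s)))"
    proof (rule sum.cong[OF refl])
      fix x assume "x \<in> pts (Zc a)"
      then have x: "x < a" by simp
      show "w (prod_encode (act (Zc a) (k mod int n) x, cact n S k s)) = w (prod_encode (x, s))"
        using idl_Zc_D(1)[OF w S a x s, of k] cact_Zc[OF a x, of k] by (simp add: cact_def)
    qed
    finally show ?thesis using u(1)[OF s] by simp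
  qed
  have "int (lcm a b) dvd int (per n S s) * (\<Sum>x \<in> pts (Zc a). w (prod_encode (x, s)))"
  proof (rule orbit_sum_dvd[OF Z])
    fix x assume "x \<in> pts (Zc a)"
    then have x: "x < a" by simp
    show "w (prod_encode (cact n (Zc a) (int (per n S s)) x, s)) = w (prod_encode (x, s))"
      using idl_Zc_D(1)[OF w S a x s, of "int (per n S s)"] per(2)[OF S s] by (simp add: cact_Zc[OF a x])
    have "int a dvd int (lcm a (per n S s)) * w (prod_encode (x, s))" by (simp add: dvd_mult2 flip: lcm_int_int_eq)
    with idl_Zc_D(2)[OF w S a x s] show "int (lcm a b) dvd int (lcm (per n S s) (per n (Zc a) x)) * w (prod_encode (x, s))"
      unfolding per_Zc[OF a x] by (simp add: lcm.commute flip: lcm_int_int_eq)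
  qed
  then show "int (lcm a b) dvd int (per n S s) * u s" by (simp add: u(1)[OF s])
qed (rule u(2))

lemma sum_periodic:
  fixes F :: "nat \<Rightarrow> int"
  shows "(\<Sum>x<m * g. F (x mod g)) = int m * (\<Sum>t<g. F t)"
proof (cases "g = 0")
  case False
  have "(\<Sum>x<m * g. F (x mod g)) = (\<Sum>i<m. \<Sum>x \<in> {i * g..<i * g + g}. F (x mod g))"
    by (rule sum.nat_group[symmetric])
  also have "\<dots> = (\<Sum>i<m. \<Sum>t<g. F t)"
  proof (rule sum.cong[OF refl])
    fix i
    have "(\<Sum>x \<in> {i * g..<i * g + g}. F (x mod g)) = (\<Sum>t \<in> {0..<g}. F ((t + i * g) mod g))"
      using sum.shift_bounds_nat_ivl[of "\<lambda>x. F (x mod g)" 0 "i * g" g] by (simp add: add.commute)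
    then show "(\<Sum>x \<in> {i * g..<i * g + g}. F (x mod g)) = (\<Sum>t<g. F t)" by (simp add: atLeast0LessThan)
  qed
  finally show ?thesis by simp
qed simp

text \<open>Over an orbit representative w has period g = gcd(a,l), and its sum over one period
  vanishes as well, being a fraction of the full trace. So partial sums are again g-periodic and
  form an equivariant primitive, which inherits the divisibility of its summands.\<close>

lemma trace_zero_diff:
  assumes S: "gset Cn S" and a: "a dvd n" and w: "w \<in> idl b (ZcP a S)" and e: "e = 1 \<or> e = - 1"
    and zero: "\<And>s. s \<in> pts S \<Longrightarrow> (\<Sum>x<a. w (prod_encode (x, s))) = 0"
  shows "\<exists>v \<in> idl b (ZcP a S). \<forall>x < a. \<forall>s \<in> pts S.
    w (prod_encode (x, s)) = v (prod_encode (x, s)) - v (prod_encode (rot a e x, s))"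
proof -
  have a0: "a > 0" using a n by (auto intro: dvd_pos_nat)
  define g where "g r = gcd a (per n S r)" for r
  have g: "g r > 0" "g r dvd a" "g r \<le> a" for r using a0 by (simp_all add: g_def gcd_le1_nat)
  define F where "F r y = (\<Sum>t<nat (y mod int (g r)). w (prod_encode (t, r)))" for r y
  \<comment> \<open>Sign and shift are fixed by w(y) = F(y + 1) - F(y): for e = 1 the required
    difference is f(y) - f(y + 1), for e = - 1 it is f(y) - f(y - 1).\<close>
  define f where "f r y = (if e = 1 then - F r y else F r (y + 1))" for r y
  have tot: "(\<Sum>t<g r. w (prod_encode (t, r))) = 0" if r: "r \<in> pts S" for r
  proof -
    have "(\<Sum>x<a. w (prod_encode (x, r))) = (\<Sum>x<(a div g r) * g r. w (prod_encode (x mod g r, r)))"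
    proof (rule sum.cong)
      fix x assume "x \<in> {..<a div g r * g r}"
      then have x: "x < a" using g(2) by simp
      show "w (prod_encode (x, r)) = w (prod_encode (x mod g r, r))"
      proof (rule idl_Zc_periodic[OF w S a x _ r])
        show "x mod g r < a" using g[of r] by (metis mod_less_divisor order_less_le_trans)
        show "int (gcd a (per n S r)) dvd int x - int (x mod g r)"
          unfolding g_def[symmetric] by (simp add: of_nat_mod dvd_minus_mod)
      qed
    qed (use g(2) in simp)
    then have "int (a div g r) * (\<Sum>t<g r. w (prod_encode (t, r))) = 0" using zero[OF r] sum_periodic[where F = "\<lambda>x. w (prod_encode (x, r))" and m = "a div g r" and g = "g r"] by (simp del: mult_eq_0_iff)
    moreover have "a div g r \<noteq> 0" using g(1,3)[of r] by (simp add: div_greater_zero_iff)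
    ultimately show ?thesis by (metis mult_eq_0_iff of_nat_eq_0_iff)
  qed
  have step: "F r (y + 1) - F r y = w (prod_encode (nat (y mod int (g r)), r))" if r: "r \<in> pts S" for r y
  proof -
    let ?m = "nat (y mod int (g r))"
    have m: "?m < g r" "int ?m = y mod int (g r)" using g(1)[of r] by (simp_all add: nat_less_iff)
    show ?thesis
    proof (cases "Suc ?m < g r")
      case True
      have "(y + 1) mod int (g r) = (int ?m + 1) mod int (g r)" unfolding m(2) by (simp add: mod_simps)
      also have "\<dots> = int (Suc ?m)" using True by simp
      finally have "nat ((y + 1) mod int (g r)) = Suc ?m" by (simp only: nat_int)
      then show ?thesis unfolding F_def by simp
    next
      case False
      \<comment> \<open>The wrap-around at the end of a period: the partial sum restarts at 0, which
        agrees with adding one more term because the total over a period is 0.\<close>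
      then have eq: "Suc ?m = g r" using m(1) by simp
      have "(y + 1) mod int (g r) = (int ?m + 1) mod int (g r)" unfolding m(2) by (simp add: mod_simps)
      also have "int ?m + 1 = int (g r)" by (metis eq of_nat_Suc add.commute)
      finally have "F r (y + 1) = 0" unfolding F_def by simp
      moreover have "(\<Sum>t<Suc ?m. w (prod_encode (t, r))) = 0" unfolding eq by (rule tot[OF r])
      then have "F r y + w (prod_encode (?m, r)) = 0" by (simp add: F_def)
      ultimately show ?thesis by simp
    qed
  qed
  have F_per: "F r y = F r y'" if "int (g r) dvd y - y'" for r y y'
    using that by (simp add: F_def mod_eq_dvd_iff[symmetric])
  have F_b: "int b dvd int (lcm a (per n S r)) * F r y" if r: "r \<in> pts S" for r y
    unfolding F_def sum_distrib_left
  proof (rule dvd_sum)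
    fix t assume "t \<in> {..<nat (y mod int (g r))}"
    then have "t < g r" using g(1)[of r] by (simp add: nat_less_iff zless_nat_eq_int_zless) (meson less_trans of_nat_less_iff pos_mod_bound of_nat_0_less_iff)
    then show "int b dvd int (lcm a (per n S r)) * w (prod_encode (t, r))"
      by (intro idl_Zc_D(2)[OF w S a _ r] order_less_le_trans[OF _ g(3)])
  qed
  have "\<exists>v \<in> idl b (ZcP a S). \<forall>s \<in> pts S. \<exists>k. cact n S k (orep S s) = s \<and>
    (\<forall>x < a. v (prod_encode (x, s)) = f (orep S s) (int x - k))"
  proof (rule orbit_function[OF S a])
    fix r y y' assume "int (gcd a (per n S r)) dvd y - y'"
    then have "int (g r) dvd y - y'" "int (g r) dvd (y + 1) - (y' + 1)" by (simp_all add: g_def)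
    then show "f r y = f r y'" unfolding f_def using F_per by metis
  qed (use F_b in \<open>simp add: f_def\<close>)
  then obtain v where v: "v \<in> idl b (ZcP a S)"
    "\<And>s. s \<in> pts S \<Longrightarrow> \<exists>k. cact n S k (orep S s) = s \<and> (\<forall>x < a. v (prod_encode (x, s)) = f (orep S s) (int x - k))"
    by blast
  have "w (prod_encode (x, s)) = v (prod_encode (x, s)) - v (prod_encode (rot a e x, s))" if x: "x < a" and s: "s \<in> pts S" for x s
  proof -
    let ?r = "orep S s"
    obtain k where k: "cact n S k ?r = s" "\<And>x. x < a \<Longrightarrow> v (prod_encode (x, s)) = f ?r (int x - k)" using v(2)[OF s] by blast
    note r = orep(1)[OF S s]
    let ?x' = "rot a (- k) x" and ?m = "nat ((int x - k) mod int (g ?r))"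
    have m: "?m < g ?r" "int ?m = (int x - k) mod int (g ?r)" using g(1)[of ?r] by (simp_all add: nat_less_iff)
    have "rot a k ?x' = x" using x by (simp add: rot_add)
    then have "w (prod_encode (x, s)) = w (prod_encode (?x', ?r))"
      using idl_Zc_D(1)[OF w S a rot_less[OF x] r, of k "- k"] k(1) by simp
    also have "\<dots> = w (prod_encode (?m, ?r))"
    proof (rule idl_Zc_periodic[OF w S a rot_less[OF x] order_less_le_trans[OF m(1) g(3)] r])
      have "int (g ?r) dvd int ?x' - (int x + - k)" by (rule dvd_trans[OF _ rot_dvd[OF x]]) (simp add: g(2))
      moreover have "int (g ?r) dvd (int x - k) - int ?m" unfolding m(2) by (rule dvd_minus_mod)
      ultimately have "int (g ?r) dvd (int ?x' - (int x + - k)) + ((int x - k) - int ?m)" by (rule dvd_add)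
      then show "int (gcd a (per n S ?r)) dvd int ?x' - int ?m" by (simp add: g_def)
    qed
    also have "\<dots> = F ?r (int x - k + 1) - F ?r (int x - k)" by (rule step[OF r, symmetric])
    finally have w_eq: "w (prod_encode (x, s)) = F ?r (int x - k + 1) - F ?r (int x - k)" .
    have gr: "int (g ?r) dvd int (rot a e x) - (int x + e)" by (rule dvd_trans[OF _ rot_dvd[OF x]]) (simp add: g(2))
    show ?thesis
    proof (cases "e = 1")
      case True
      have "F ?r (int (rot a e x) - k) = F ?r (int x - k + 1)"
        by (rule F_per) (use gr True in \<open>simp add: algebra_simps\<close>)
      then show ?thesis using True x by (simp add: w_eq k(2) f_def)
    next
      case False
      then have e1: "e = - 1" using e by simp
      have "F ?r (int (rot a e x) - k + 1) = F ?r (int x - k)"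
        by (rule F_per) (use gr e1 in \<open>simp add: algebra_simps\<close>)
      then show ?thesis using e1 x by (simp add: w_eq k(2) f_def)
    qed
  qed
  then show ?thesis using v(1) by blast
qed

subsection \<open>The generated ideals\<close>

text \<open>The subgroup of index d and order n/d. It is the largest member of
  \<open>Fam n d\<close>, so its orbit alone generates the ideal.\<close>

definition Hsub :: "nat \<Rightarrow> int set" where
  "Hsub d = {k \<in> {0..<int n}. int d dvd k}"

lemma Hsub: assumes d: "d dvd n" shows "subgroup (Hsub d) Cn" "card (Hsub d) = n div d"
proof -
  have d0: "d > 0" using d n by (auto intro: dvd_pos_nat)
  have dn: "int d dvd int n" using d by simp
  show "subgroup (Hsub d) Cn"
  proof (rule group.subgroupI[OF group_integer_mod_group])
    show "Hsub d \<subseteq> carrier Cn" using n by (auto simp: Hsub_def carrier_integer_mod_group)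
    have "0 \<in> Hsub d" using n by (simp add: Hsub_def)
    then show "Hsub d \<noteq> {}" by blast
    show "inv\<^bsub>Cn\<^esub> k \<in> Hsub d" if "k \<in> Hsub d" for k
      using that n dn by (simp add: Hsub_def carrier_integer_mod_group dvd_mod)
    show "k \<otimes>\<^bsub>Cn\<^esub> l \<in> Hsub d" if "k \<in> Hsub d" "l \<in> Hsub d" for k l
      using that n dn by (simp add: Hsub_def dvd_mod)
  qed
  have "Hsub d = int ` {x \<in> {..<n}. int d dvd int x - 0}"
  proof (intro equalityI subsetI)
    fix k assume "k \<in> Hsub d"
    then show "k \<in> int ` {x \<in> {..<n}. int d dvd int x - 0}" by (intro image_eqI[of _ _ "nat k"]) (auto simp: Hsub_def simp flip: int_dvd_int_iff)
  qed (auto simp: Hsub_def)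
  then show "card (Hsub d) = n div d" using card_residue_class[OF d d0, of 0] by (simp add: card_image)
qed

text \<open>Cosets are residue classes modulo d. An arbitrary offset c is allowed because the
  formula is used for the subgroup itself and for its cosets.\<close>

lemma Hsub_coset:
  assumes d: "d dvd n"
  shows "g <#\<^bsub>Cn\<^esub> {y \<in> {0..<int n}. int d dvd y - c} = {y \<in> {0..<int n}. int d dvd y - (g + c)}"
proof -
  have dn: "int d dvd int n" using d by simp
  have md: "int d dvd z mod int n - z" for z
    using dvd_trans[OF dn, of "z mod int n - z"] by (simp add: dvd_diff_commute[of "int n" "z mod int n"] dvd_minus_mod)
  show ?thesis
  proof (intro equalityI subsetI)
    fix y assume "y \<in> g <#\<^bsub>Cn\<^esub> {y \<in> {0..<int n}. int d dvd y - c}"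
    then obtain z where z: "int d dvd z - c" "y = (g + z) mod int n" by (auto simp: l_coset_def)
    have "int d dvd (y - (g + z)) + (z - c)" using md[of "g + z"] z by (intro dvd_add) simp_all
    then show "y \<in> {y \<in> {0..<int n}. int d dvd y - (g + c)}" using n z(2) by (simp add: algebra_simps)
  next
    fix y assume y: "y \<in> {y \<in> {0..<int n}. int d dvd y - (g + c)}"
    let ?z = "(y - g) mod int n"
    have "int d dvd (?z - (y - g)) + (y - (g + c))" using md y by (intro dvd_add) simp_all
    then have "?z \<in> {y \<in> {0..<int n}. int d dvd y - c}" using n by (simp add: algebra_simps)
    moreover have "y = (g + ?z) mod int n" using y by (simp add: mod_add_right_eq)
    ultimately show "y \<in> g <#\<^bsub>Cn\<^esub> {y \<in> {0..<int n}. int d dvd y - c}" by (auto simp: l_coset_def)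
  qed
qed

lemma is_orbit_Zc: assumes d: "d dvd n" shows "is_orbit Cn (Hsub d) (Zc d)"
  unfolding is_orbit_def
proof (intro conjI exI ballI)
  have d0: "d > 0" using d n by (auto intro: dvd_pos_nat)
  have dn: "d \<le> n" using d n by (simp add: dvd_imp_le)
  let ?f = "\<lambda>x. {y \<in> {0..<int n}. int d dvd y - int x}"
  show "gset Cn (Zc d)" by (rule finite_gset_Zc) (simp add: d)
  have H: "Hsub d = {y \<in> {0..<int n}. int d dvd y - 0}" by (simp add: Hsub_def)
  have cos: "g <#\<^bsub>Cn\<^esub> Hsub d = {y \<in> {0..<int n}. int d dvd y - g}" for g
    unfolding H Hsub_coset[OF d] by simp
  have cong: "{y \<in> {0..<int n}. int d dvd y - c} = {y \<in> {0..<int n}. int d dvd y - c'}" if "int d dvd c - c'" for c c'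
  proof -
    have "int d dvd y - c \<longleftrightarrow> int d dvd y - c'" for y
      using dvd_add_left_iff[OF that, of "y - c"] by simp
    then show ?thesis by simp
  qed
  show "bij_betw ?f (pts (Zc d)) (lcosets\<^bsub>Cn\<^esub> Hsub d)"
    unfolding bij_betw_def
  proof
    show "inj_on ?f (pts (Zc d))"
    proof (rule inj_onI)
      fix x y assume xy: "x \<in> pts (Zc d)" "y \<in> pts (Zc d)" and eq: "?f x = ?f y"
      have "int x \<in> ?f x" using xy dn by simp
      then have "int d dvd int x - int y" unfolding eq by simp
      then have "int x mod int d = int y mod int d" by (simp add: mod_eq_dvd_iff)
      then show "x = y" using xy by simp
    qed
    show "?f ` pts (Zc d) = lcosets\<^bsub>Cn\<^esub> Hsub d"
    proof (intro equalityI subsetI)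
      fix C assume "C \<in> ?f ` pts (Zc d)"
      then obtain x where x: "x < d" "C = ?f x" by auto
      have "int x \<in> carrier Cn" using x(1) dn n by (simp add: carrier_integer_mod_group)
      then show "C \<in> lcosets\<^bsub>Cn\<^esub> Hsub d" unfolding LCOSETS_def cos x(2) by blast
    next
      fix C assume "C \<in> lcosets\<^bsub>Cn\<^esub> Hsub d"
      then obtain g where g: "C = {y \<in> {0..<int n}. int d dvd y - g}" unfolding LCOSETS_def cos by blast
      have "C = ?f (nat (g mod int d))"
        unfolding g using d0 by (intro cong) (simp add: dvd_minus_mod)
      moreover have "nat (g mod int d) \<in> pts (Zc d)" using d0 by (simp add: nat_less_iff)
      ultimately show "C \<in> ?f ` pts (Zc d)" by blast
    qed
  qed
  fix g x assume g: "g \<in> carrier Cn" and "x \<in> pts (Zc d)"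
  then have x: "x < d" by simp
  have "int d dvd int (rot d g x) - (g + int x)" using rot_dvd[OF x, of g] by (simp add: add.commute)
  then have "?f (rot d g x) = {y \<in> {0..<int n}. int d dvd y - (g + int x)}" by (rule cong)
  moreover have "act (Zc d) g x = rot d g x" using x by (simp add: Zc_def)
  ultimately show "?f (act (Zc d) g x) = g <#\<^bsub>Cn\<^esub> ?f x" by (simp only: Hsub_coset[OF d])
qed

text \<open>One inclusion holds because \<open>idl d\<close> is a submodule family containing the
  generators: orbits with stabilizer of order dividing n/d have length divisible by d. For the
  other, every element of \<open>idl d\<close> is a trace from Z/d, hence a transfer-like image of
  the generator on that single orbit.\<close>

lemma ideal_fam_eq:
  assumes d: "d dvd n" and S: "gset Cn S"
  shows "ideal_fam n d S = idl d S"
proof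
  have d0: "d > 0" using d n by (auto intro: dvd_pos_nat)
  have gen: "Zgen T \<in> idl d T" if H: "H \<in> Fam n d" and T: "is_orbit Cn H T" for H T
  proof (rule idlI)
    have T': "gset Cn T" using T unfolding is_orbit_def by (rule conjunct1)
    have H': "subgroup H Cn" "card H dvd n div d" using H by (simp_all add: Fam_def)
    have "\<exists>f. bij_betw f (pts T) (lcosets\<^bsub>Cn\<^esub> H) \<and> (\<forall>g \<in> carrier Cn. \<forall>t \<in> pts T. f (act T g t) = g <#\<^bsub>Cn\<^esub> f t)"
      using T unfolding is_orbit_def by (rule conjunct2)
    then obtain f where "bij_betw f (pts T) (lcosets\<^bsub>Cn\<^esub> H) \<and> (\<forall>g \<in> carrier Cn. \<forall>t \<in> pts T. f (act T g t) = g <#\<^bsub>Cn\<^esub> f t)"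
      by (rule exE)
    then have f: "f ` pts T = lcosets\<^bsub>Cn\<^esub> H" "f (act T g t) = g <#\<^bsub>Cn\<^esub> f t" if "g \<in> carrier Cn" "t \<in> pts T" for g t
      using that by (simp_all add: bij_betw_def)
    fix t assume t: "t \<in> pts T"
    show "Zgen T (cact n T k t) = Zgen T t" for k using t cact_in[OF T' t] by (simp add: Zgen_def)
    interpret C: comm_group Cn by simp
    interpret H: subgroup H Cn by (rule H'(1))
    let ?l = "int (per n T t) mod int n"
    obtain c where c: "c \<in> carrier Cn" "f t = c <#\<^bsub>Cn\<^esub> H" using f(1)[OF mod_carrier t] t unfolding LCOSETS_def by blast
    \<comment> \<open>The orbit length fixes t and therefore its coset; in an abelian group this
      puts it into H.\<close>
    have "act T ?l t = t" using per(2)[OF T' t] by (simp add: cact_def)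
    then have "c <#\<^bsub>Cn\<^esub> H = ?l <#\<^bsub>Cn\<^esub> (c <#\<^bsub>Cn\<^esub> H)" using f(2)[OF mod_carrier t, of "int (per n T t)"] c(2) by simp
    also have "\<dots> = (?l \<otimes>\<^bsub>Cn\<^esub> c) <#\<^bsub>Cn\<^esub> H" by (rule C.lcos_m_assoc[OF H.subset mod_carrier c(1)])
    also have "?l \<otimes>\<^bsub>Cn\<^esub> c = c \<otimes>\<^bsub>Cn\<^esub> ?l" by (rule C.m_comm[OF mod_carrier c(1)])
    finally have "c \<otimes>\<^bsub>Cn\<^esub> ?l \<in> c <#\<^bsub>Cn\<^esub> H"
      using C.lcos_self[OF C.m_closed[OF c(1) mod_carrier] H'(1)] by simp
    then have "inv\<^bsub>Cn\<^esub> c \<otimes>\<^bsub>Cn\<^esub> (c \<otimes>\<^bsub>Cn\<^esub> ?l) \<in> H" by (rule H.lcos_module_imp[OF C.is_group c(1)])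
    then have lH: "?l \<in> H" by (simp only: C.m_assoc[OF C.inv_closed[OF c(1)] c(1) mod_carrier, symmetric] C.l_inv[OF c(1)] C.l_one[OF mod_carrier])
    interpret K: comm_group "Cn\<lparr>carrier := H\<rparr>"
      by (rule group.group_comm_groupI[OF H.subgroup_is_group[OF C.is_group]]) (simp add: add.commute)
    have finH: "finite H" by (rule finite_subset[OF H.subset]) (simp add: carrier_integer_mod_group n)
    \<comment> \<open>Lagrange in H: n divides |H| times the orbit length, hence also (n/d) times
      it, and cancelling n/d leaves divisibility by d.\<close>
    have "?l [^]\<^bsub>Cn\<lparr>carrier := H\<rparr>\<^esub> card H = 0"
      using K.power_order_eq_one[of ?l] finH lH by simp
    then have "?l [^]\<^bsub>Cn\<^esub> card H = 0" using C.nat_pow_consistent by metis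
    then have "(int (card H) * ?l) mod int n = 0" by simp
    then have "int n dvd int (card H) * int (per n T t)" by (simp add: dvd_eq_mod_eq_0 mod_mult_right_eq)
    moreover have "int (card H) * int (per n T t) dvd int (n div d) * int (per n T t)"
      using H'(2) by (intro mult_dvd_mono) simp_all
    ultimately have "int n dvd int (n div d) * int (per n T t)" by (rule dvd_trans)
    moreover have "int n = int (n div d) * int d" using d by (metis dvd_div_mult_self of_nat_mult)
    moreover have "n div d > 0" using d n by (simp add: d0 div_greater_zero_iff dvd_imp_le)
    ultimately have "int d dvd int (per n T t)" by simp
    then show "int d dvd int (per n T t) * Zgen T t" using t by (simp add: Zgen_def)
  qed (simp add: Zgen_def)
  show "ideal_fam n d S \<subseteq> idl d S"
    unfolding ideal_fam_def
    by (intro Inter_lower CollectI exI[of _ "idl d"] conjI refl submodule_family_idl ballI allI impI gen)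
  show "idl d S \<subseteq> ideal_fam n d S"
    unfolding ideal_fam_def
  proof (intro subsetI InterI)
    fix u A assume u: "u \<in> idl d S"
      and A: "A \<in> {J S |J. submodule_family Cn (Zconst Cn) J \<and> (\<forall>H \<in> Fam n d. \<forall>T. is_orbit Cn H T \<longrightarrow> Zgen T \<in> J T)}"
    from A have "\<exists>J. A = J S \<and> submodule_family Cn (Zconst Cn) J \<and> (\<forall>H \<in> Fam n d. \<forall>T. is_orbit Cn H T \<longrightarrow> Zgen T \<in> J T)"
      by (rule CollectD)
    then obtain J where J': "A = J S \<and> submodule_family Cn (Zconst Cn) J \<and> (\<forall>H \<in> Fam n d. \<forall>T. is_orbit Cn H T \<longrightarrow> Zgen T \<in> J T)"
      by (rule exE)
    then have J: "submodule_family Cn (Zconst Cn) J" "A = J S" by simp_all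
    note Z = finite_gset_Zc[of d, OF disjI2[OF d]]
    have "Hsub d \<in> Fam n d" using Hsub[OF d] by (simp add: Fam_def)
    then have gen: "Zgen (Zc d) \<in> J (Zc d)" by (rule J'[THEN conjunct2, THEN conjunct2, THEN bspec, THEN spec, THEN mp, OF _ is_orbit_Zc[OF d]])
    \<comment> \<open>With second parameter 1 the function w is merely integral and invariant, which
      is to say a matrix from S to Z/d; it sends the generator to its row sums, and these are the
      values of u.\<close>
    obtain w where w: "w \<in> idl 1 (ZcP d S)" "\<And>s. s \<in> pts S \<Longrightarrow> u s = (\<Sum>x<d. w (prod_encode (x, s)))"
      using trace_surj[OF S d, of u 1] u by auto
    define \<phi> where "\<phi> s x = (if s \<in> pts S \<and> x < d then w (prod_encode (x, s)) else 0)" for s x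
    have \<phi>: "\<phi> \<in> bz_hom Cn S (Zc d)"
    proof (rule bz_homI)
      fix g s x assume g: "g \<in> carrier Cn" and s: "s \<in> pts S" and "x \<in> pts (Zc d)"
      then have x: "x < d" by simp
      show "\<phi> (act S g s) (act (Zc d) g x) = \<phi> s x"
        using idl_Zc_D(1)[OF w(1) S d x s, of g] x s cact_in[OF S s, of g]
        by (simp add: act_eq_cact[OF g] cact_Zc[OF d x] \<phi>_def)
    qed (auto simp: \<phi>_def)
    have "u = zmor (Zconst Cn) S (Zc d) \<phi> (Zgen (Zc d))"
    proof
      fix s show "u s = zmor (Zconst Cn) S (Zc d) \<phi> (Zgen (Zc d)) s"
        using w(2)[of s] idlD(2)[OF u, of s] by (cases "s \<in> pts S") (simp_all add: \<phi>_def Zgen_def)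
    qed
    then show "u \<in> A" unfolding J(2) using submodule_familyD(2)[OF J(1) S Z \<phi> gen] by simp
  qed
qed

end

section \<open>Arithmetic of two congruence conditions\<close>

text \<open>Pointwise form of I_a + I_b = I_(a,b). Write a = a' gcd(a,l) and b = b' gcd(b,l): the
  two conditions become a' | v and b' | u - v, solvable iff k = gcd(a',b') divides u. This follows
  since k divides l1 l2 u and is coprime to the cofactors l1 = l/gcd(a,l) and l2 =
  l/gcd(b,l).\<close>

lemma split_dvd:
  fixes a b l u :: int
  assumes "a \<noteq> 0" "b \<noteq> 0" and g: "gcd a b dvd l * u"
  shows "\<exists>v. a dvd l * v \<and> b dvd l * (u - v)"
proof -
  let ?\<alpha> = "gcd a l" and ?\<beta> = "gcd b l"
  obtain a' l1 where A: "a = a' * ?\<alpha>" "l = l1 * ?\<alpha>" "coprime a' l1"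
    using gcd_coprime_exists[of a l] assms by auto
  obtain b' l2 where B: "b = b' * ?\<beta>" "l = l2 * ?\<beta>" "coprime b' l2"
    using gcd_coprime_exists[of b l] assms by auto
  define k where "k = gcd a' b'"
  obtain p q where pq: "p * ?\<alpha> + q * ?\<beta> = gcd ?\<alpha> ?\<beta>" using bezout_int by blast
  \<comment> \<open>Both l1 \<alpha> and l2 \<beta> equal l, so l divides l1 l2
    gcd(\<alpha>,\<beta>); this carries the hypothesis on l u over to l1 l2 u.\<close>
  have "l1 * l2 * gcd ?\<alpha> ?\<beta> = l2 * p * (l1 * ?\<alpha>) + l1 * q * (l2 * ?\<beta>)"
    unfolding pq[symmetric] by (simp add: algebra_simps)
  also have "\<dots> = (l2 * p + l1 * q) * l" unfolding A(2)[symmetric] B(2)[symmetric] by (simp add: algebra_simps)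
  finally have "l * u dvd l1 * l2 * gcd ?\<alpha> ?\<beta> * u" by simp
  moreover have "k * gcd ?\<alpha> ?\<beta> dvd a' * ?\<alpha>" "k * gcd ?\<alpha> ?\<beta> dvd b' * ?\<beta>"
    unfolding k_def by (intro mult_dvd_mono gcd_dvd1 gcd_dvd2)+
  then have "k * gcd ?\<alpha> ?\<beta> dvd gcd a b" using A(1) B(1) by simp
  ultimately have "k * gcd ?\<alpha> ?\<beta> dvd (l1 * l2 * u) * gcd ?\<alpha> ?\<beta>"
    using g by (metis dvd_trans mult.assoc mult.commute)
  then have "k dvd l1 * (l2 * u)" using assms by (simp add: mult.assoc)
  moreover have "coprime k l1" "coprime k l2"
    using A(3) B(3) coprime_divisors[of k a' l1 l1] coprime_divisors[of k b' l2 l2] by (simp_all add: k_def)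
  ultimately have "k dvd u" by (simp add: coprime_dvd_mult_right_iff)
  then obtain c where c: "u = k * c" by (auto elim: dvdE)
  obtain x y where xy: "x * a' + y * b' = k" unfolding k_def using bezout_int by blast
  \<comment> \<open>The witness is v = a' x c, the first summand when u = k c is expanded by the
    Bezout identity for k.\<close>
  have "l * (a' * x * c) = a * (l1 * x * c)" by (subst A(2), subst (2) A(1)) (simp add: algebra_simps)
  moreover have "u - a' * x * c = b' * y * c" unfolding c xy[symmetric] by (simp add: algebra_simps)
  moreover have "l * (b' * y * c) = b * (l2 * y * c)" by (subst B(2), subst (2) B(1)) (simp add: algebra_simps)
  ultimately show ?thesis by (metis dvd_triv_left)
qed

text \<open>With m = b/gcd(a,b) and b1 = b/gcd(b,l) the goal is b1 | w - m u, solvable iff k =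
  gcd(m,b1) divides w. As lcm(a,l) divides a1 l1 lcm(gcd(a,b), gcd(b,l)), and k times that last lcm
  divides b, the hypothesis gives k | a1 l1 w; k is coprime to a1 = a/gcd(a,b) and l1 =
  l/gcd(b,l).\<close>

lemma split_lcm:
  fixes a b l w :: int
  assumes "b \<noteq> 0" and w: "b dvd lcm a l * w"
  shows "\<exists>u. b dvd l * (w - b div gcd a b * u)"
proof -
  let ?g = "gcd a b" and ?h = "gcd b l"
  obtain a1 m where A: "a = a1 * ?g" "b = m * ?g" "coprime a1 m"
    using gcd_coprime_exists[of a b] assms by auto
  obtain b1 l1 where B: "b = b1 * ?h" "l = l1 * ?h" "coprime b1 l1"
    using gcd_coprime_exists[of b l] assms by auto
  have m: "b div ?g = m" using A(2) assms(1) by (metis nonzero_mult_div_cancel_right mult_zero_right)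
  define k where "k = gcd m b1"
  have "a1 * ?g dvd (a1 * l1) * lcm ?g ?h" "l1 * ?h dvd (a1 * l1) * lcm ?g ?h"
    by (intro mult_dvd_mono; simp)+
  then have "lcm a l dvd (a1 * l1) * lcm ?g ?h" using A(1) B(2) by simp
  then have "b dvd (a1 * l1) * lcm ?g ?h * w" using w by (meson dvd_refl dvd_trans mult_dvd_mono)
  moreover have "k * lcm ?g ?h dvd b"
  proof -
    obtain c where c: "b = k * c"
      using A(2) by (metis dvdE dvd_mult2 gcd_dvd1 k_def)
    have k0: "k \<noteq> 0" using c assms(1) by auto
    have "k * ?g dvd m * ?g" "k * ?h dvd b1 * ?h" by (simp_all add: k_def)
    then have "k * ?g dvd k * c" "k * ?h dvd k * c" using A(2) B(1) c by metis+
    then show ?thesis using k0 by (subst c) simp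
  qed
  ultimately have "k * lcm ?g ?h dvd (a1 * (l1 * w)) * lcm ?g ?h"
    by (metis dvd_trans mult.assoc mult.commute)
  moreover have "lcm ?g ?h \<noteq> 0" using assms(1) by (simp add: lcm_eq_0_iff)
  ultimately have "k dvd a1 * (l1 * w)" using dvd_mult_cancel_right by blast
  moreover have "coprime k a1" "coprime k l1"
    using A(3) B(3) coprime_divisors[of k m a1 a1] coprime_divisors[of k b1 l1 l1]
    by (simp_all add: k_def coprime_commute)
  ultimately have "k dvd w" by (simp add: coprime_dvd_mult_right_iff)
  then obtain c where c: "w = k * c" by (auto elim: dvdE)
  obtain x y where xy: "x * m + y * b1 = k" unfolding k_def using bezout_int by blast
  have "w - m * (x * c) = b1 * y * c" unfolding c xy[symmetric] by (simp add: algebra_simps)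
  moreover have "l * (b1 * y * c) = b * (l1 * y * c)" by (subst B(2), subst (2) B(1)) (simp add: algebra_simps)
  ultimately show ?thesis unfolding m by (metis dvd_triv_left)
qed

section \<open>Periodic resolutions\<close>

context cyclic_order
begin

text \<open>For c = 1 this is the augmentation, for a = 1 the norm; the two are dual to each
  other.\<close>

definition ones :: "nat \<Rightarrow> nat \<Rightarrow> mat" where
  "ones a c = (\<lambda>x y. if x < a \<and> y < c then 1 else 0)"

text \<open>The endomorphism 1 - \<sigma>^e for the rotation \<sigma> by one step. The exponent is a
  parameter because the dual has the same form with - e.\<close>

definition dif :: "nat \<Rightarrow> int \<Rightarrow> mat" where
  "dif a e = (\<lambda>x y. if x < a \<and> y < a then (if x = y then 1 else 0) - (if y = rot a e x then 1 else 0) else 0)"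

lemma act_Zc: "g \<in> carrier Cn \<Longrightarrow> x < a \<Longrightarrow> act (Zc a) g x = rot a g x"
  by (simp add: Zc_def)

lemma rot_cancel: "x < a \<Longrightarrow> rot a (- k) (rot a k x) = x"
  using rot_add[of x a "- k" k] by simp

lemma rot_inj: assumes "x < a" "y < a" shows "rot a k x = rot a k y \<longleftrightarrow> x = y"
proof
  assume "rot a k x = rot a k y"
  from arg_cong[OF this, of "rot a (- k)"] show "x = y" by (simp only: rot_cancel assms)
qed simp

lemma ones_in [simp]: "ones a c \<in> bz_hom Cn (Zc a) (Zc c)"
  by (rule bz_homI) (auto simp: ones_def act_Zc)

lemma dif_in [simp]: "dif a e \<in> bz_hom Cn (Zc a) (Zc a)"
proof (rule bz_homI)
  fix g x y assume g: "g \<in> carrier Cn" and "x \<in> pts (Zc a)" "y \<in> pts (Zc a)"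
  then have xy: "x < a" "y < a" by simp_all
  have "rot a e (rot a g x) = rot a g (rot a e x)" using xy by (simp add: rot_add add.commute)
  then show "dif a e (act (Zc a) g x) (act (Zc a) g y) = dif a e x y"
    using xy by (simp add: act_Zc[OF g] dif_def rot_inj)
qed (auto simp: dif_def)

lemma transpose_ones [simp]: "bz_transpose (ones a c) = ones c a"
  by (auto simp: bz_transpose_def ones_def fun_eq_iff)

lemma rot_swap: assumes "x < a" "y < a" shows "y = rot a e x \<longleftrightarrow> x = rot a (- e) y"
proof
  assume "y = rot a e x"
  then show "x = rot a (- e) y" using rot_cancel[OF assms(1), of e] by (simp only:)
next
  assume "x = rot a (- e) y"
  then show "y = rot a e x" using rot_cancel[OF assms(2), of "- e"] by (simp only: minus_minus)
qed

lemma transpose_dif [simp]: "bz_transpose (dif a e) = dif a (- e)"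
proof (intro ext)
  fix x y
  have "(if y = x then 1 else 0) - (if x = rot a e y then 1 else 0) = (if x = y then 1 else 0) - (if y = rot a (- e) x then 1 else (0 :: int))"
    if "x < a" "y < a"
    using rot_swap[OF that(2,1), of e] by (simp only: eq_commute[of y x])
  then show "bz_transpose (dif a e) x y = dif a (- e) x y" by (simp add: bz_transpose_def dif_def)
qed

lemma transpose_zero [simp]: "bz_transpose bz_zero = bz_zero"
  by (simp add: bz_transpose_def bz_zero_def)

lemma sum_dif_left:
  fixes w :: "nat \<Rightarrow> int"
  assumes "x < a" shows "(\<Sum>y<a. dif a e x y * w y) = w x - w (rot a e x)"
proof -
  have "(\<Sum>y<a. dif a e x y * w y) = (\<Sum>y<a. (if x = y then w y else 0) - (if y = rot a e x then w y else 0))"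
    by (rule sum.cong) (use assms in \<open>simp_all add: dif_def\<close>)
  then show ?thesis using assms by (simp add: sum_subtractf)
qed

lemma sum_dif_right:
  fixes w :: "nat \<Rightarrow> int"
  assumes "x < a" shows "(\<Sum>y<a. w y * dif a e y x) = w x - w (rot a (- e) x)"
  using sum_dif_left[OF assms, of "- e" w] unfolding transpose_dif[symmetric]
  by (simp add: bz_transpose_def mult.commute)

lemma sum_rot: "(\<Sum>x<a. F (rot a e x)) = (\<Sum>x<a. F x)"
  by (rule sum.reindex_bij_witness[of _ "rot a (- e)" "rot a e"]) (auto simp: rot_add)

lemma ones_dif [simp]: "bz_comp (Zc a) (ones a c) (dif a e) = bz_zero"
proof (intro ext)
  fix x y
  show "bz_comp (Zc a) (ones a c) (dif a e) x y = bz_zero x y"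
    using sum_dif_left[of x a e "\<lambda>_. 1"]
    by (cases "x < a \<and> y < c") (auto simp: bz_comp_def bz_zero_def ones_def dif_def)
qed

lemma dif_ones [simp]: "bz_comp (Zc a) (dif a e) (ones c a) = bz_zero"
proof (intro ext)
  fix x y
  show "bz_comp (Zc a) (dif a e) (ones c a) x y = bz_zero x y"
    using sum_dif_right[of y a "\<lambda>_. 1" e]
    by (cases "y < a \<and> x < c") (auto simp: bz_comp_def bz_zero_def ones_def dif_def)
qed

lemma bz_hom_Zc_0: "\<mu> \<in> bz_hom Cn S (Zc 0) \<longleftrightarrow> \<mu> = bz_zero" "\<mu> \<in> bz_hom Cn (Zc 0) S \<longleftrightarrow> \<mu> = bz_zero"
  by (auto simp: bz_hom_def bz_zero_def fun_eq_iff)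

lemma bz_comp_Zc_0 [simp]: "bz_comp (Zc 0) \<phi> \<psi> = bz_zero"
  by (simp add: bz_comp_def bz_zero_def)

lemma rot_invariant:
  assumes e: "e = 1 \<or> e = - 1" and F: "\<And>x. x < a \<Longrightarrow> F (rot a e x) = F x" and x: "x < a"
  shows "F x = F 0"
  using x
proof (induction x)
  case (Suc x)
  then have "rot a 1 x = Suc x" "rot a (- 1) (Suc x) = x" by (simp_all add: rot_eq_iff)
  then have "F (Suc x) = F x" using e F[of x] F[of "Suc x"] Suc.prems by auto
  then show ?case using Suc by simp
qed simp

text \<open>Maps into \<open>\<int>\<langle>\<int>/a\<rangle>\<close> are invariant functions on \<open>\<int>/a \<times> S\<close>.\<close>

lemma bz_hom_flat:
  assumes S: "gset Cn S" and a: "a dvd n" and \<mu>: "\<mu> \<in> bz_hom Cn S (Zc a)"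
  shows "\<exists>w \<in> idl 1 (ZcP a S). \<forall>x < a. \<forall>s \<in> pts S. w (prod_encode (x, s)) = \<mu> s x"
proof
  let ?w = "\<lambda>p. if p \<in> pts (ZcP a S) then \<mu> (snd (prod_decode p)) (fst (prod_decode p)) else 0"
  show "?w \<in> idl 1 (ZcP a S)"
  proof (rule idl_Zc_I[OF S a])
    fix x s k assume x: "x < a" and s: "s \<in> pts S"
    then show "?w (prod_encode (rot a k x, cact n S k s)) = ?w (prod_encode (x, s))"
      using bz_hom_inv[OF \<mu> mod_carrier s, of x k] cact_Zc[OF a x, of k] cact_in[OF S s]
      by (simp add: cact_def)
  qed simp_all
qed simp

lemma bz_hom_unflat:
  assumes S: "gset Cn S" and a: "a dvd n" and w: "w \<in> idl b (ZcP a S)"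
  shows "\<exists>\<mu> \<in> bz_hom Cn S (Zc a). \<forall>x < a. \<forall>s \<in> pts S. \<mu> s x = w (prod_encode (x, s))"
proof
  let ?\<mu> = "\<lambda>s x. if s \<in> pts S \<and> x < a then w (prod_encode (x, s)) else 0"
  show "?\<mu> \<in> bz_hom Cn S (Zc a)"
  proof (rule bz_homI)
    fix g s x assume g: "g \<in> carrier Cn" and s: "s \<in> pts S" and "x \<in> pts (Zc a)"
    then show "?\<mu> (act S g s) (act (Zc a) g x) = ?\<mu> s x"
      using idl_Zc_D(1)[OF w S a _ s, of x g] cact_in[OF S s, of g]
      by (simp add: act_eq_cact[OF g] cact_Zc[OF a])
  qed auto
qed simp

lemma bz_trace_surj:
  assumes S: "gset Cn S" and a: "a dvd n" and u: "u \<in> idl a S"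
  shows "\<exists>\<mu> \<in> bz_hom Cn S (Zc a). \<forall>s \<in> pts S. u s = (\<Sum>x<a. \<mu> s x)"
proof -
  obtain w where w: "w \<in> idl 1 (ZcP a S)" "\<forall>s \<in> pts S. u s = (\<Sum>x<a. w (prod_encode (x, s)))"
    using trace_surj[OF S a, of u 1] u by auto
  obtain \<mu> where "\<mu> \<in> bz_hom Cn S (Zc a)" "\<forall>x < a. \<forall>s \<in> pts S. \<mu> s x = w (prod_encode (x, s))"
    using bz_hom_unflat[OF S a w(1)] by blast
  then show ?thesis using w(2) by (intro bexI[of _ \<mu>]) simp_all
qed

lemma bz_trace_in:
  assumes S: "gset Cn S" and a: "a dvd n" and \<mu>: "\<mu> \<in> bz_hom Cn S (Zc a)"
  shows "(\<lambda>s. \<Sum>x<a. \<mu> s x) \<in> idl a S"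
proof -
  obtain w where w: "w \<in> idl 1 (ZcP a S)" "\<forall>x < a. \<forall>s \<in> pts S. w (prod_encode (x, s)) = \<mu> s x"
    using bz_hom_flat[OF S a \<mu>] by blast
  have "(\<lambda>s. \<Sum>x<a. \<mu> s x) \<in> idl (lcm a 1) S"
    by (rule trace_in[OF S a w(1)]) (use w(2) in \<open>simp_all add: bz_hom_out(1)[OF \<mu>]\<close>)
  then show ?thesis by simp
qed

section \<open>Exactness of the periodic complexes on representables\<close>

lemma bz_exact_dif:
  assumes S: "gset Cn S" and a: "a dvd n" and \<mu>: "\<mu> \<in> bz_hom Cn S (Zc a)"
    and zero: "\<And>s. s \<in> pts S \<Longrightarrow> (\<Sum>x<a. \<mu> s x) = 0"
  shows "\<exists>\<nu> \<in> bz_hom Cn S (Zc a). \<mu> = bz_comp (Zc a) (dif a 1) \<nu>"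
proof -
  obtain w where w: "w \<in> idl 1 (ZcP a S)" "\<And>x s. x < a \<Longrightarrow> s \<in> pts S \<Longrightarrow> w (prod_encode (x, s)) = \<mu> s x"
    using bz_hom_flat[OF S a \<mu>] by blast
  have "(\<Sum>x<a. w (prod_encode (x, s))) = 0" if "s \<in> pts S" for s using zero[OF that] w(2)[OF _ that] by simp
  \<comment> \<open>Composition with \<open>dif a 1\<close> acts on coefficient functions through
    the transpose, so the primitive is taken for rotation by - 1.\<close>
  then obtain v where v: "v \<in> idl 1 (ZcP a S)"
    "\<And>x s. x < a \<Longrightarrow> s \<in> pts S \<Longrightarrow> w (prod_encode (x, s)) = v (prod_encode (x, s)) - v (prod_encode (rot a (- 1) x, s))"
    using trace_zero_diff[OF S a w(1), of "- 1"] by blast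
  obtain \<nu> where \<nu>: "\<nu> \<in> bz_hom Cn S (Zc a)" "\<And>x s. x < a \<Longrightarrow> s \<in> pts S \<Longrightarrow> \<nu> s x = v (prod_encode (x, s))"
    using bz_hom_unflat[OF S a v(1)] by blast
  have "\<mu> = bz_comp (Zc a) (dif a 1) \<nu>"
  proof (rule bz_hom_eqI[OF \<mu> bz_comp_in[OF finite_gset_Zc[OF disjI2[OF a]] \<nu>(1) dif_in]])
    fix s x assume "s \<in> pts S" "x \<in> pts (Zc a)"
    then show "\<mu> s x = bz_comp (Zc a) (dif a 1) \<nu> s x"
      using w(2)[of x s] v(2)[of x s] by (simp add: bz_comp_def sum_dif_right \<nu>(2))
  qed
  then show ?thesis using \<nu>(1) by blast
qed

lemma bz_exact_ones:
  assumes S: "gset Cn S" and a: "a dvd n" and \<mu>: "\<mu> \<in> bz_hom Cn S (Zc a)"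
    and zero: "bz_comp (Zc a) (dif a 1) \<mu> = bz_zero"
  shows "\<exists>\<nu> \<in> bz_hom Cn S (Zc 1). \<mu> = bz_comp (Zc 1) (ones 1 a) \<nu>"
proof -
  have a0: "0 < a" using a n by (auto intro: dvd_pos_nat)
  \<comment> \<open>Rows killed by 1 - \<sigma> are constant along Z/a. The common value, read off
    at 0, is a matrix into the one-point set, and the norm reproduces the row.\<close>
  have "\<mu> s (rot a (- 1) x) = \<mu> s x" if x: "x < a" for s x
    using sum_dif_right[OF x, of "\<mu> s" 1] fun_cong[OF fun_cong[OF zero, of s], of x] by (simp add: bz_comp_def bz_zero_def)
  then have const: "\<mu> s x = \<mu> s 0" if "x < a" for s x using rot_invariant[of "- 1" a "\<mu> s" x] that by simp
  define \<nu> where "\<nu> s x = (if x = (0 :: nat) then \<mu> s 0 else 0)" for s x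
  have \<nu>: "\<nu> \<in> bz_hom Cn S (Zc 1)"
  proof (rule bz_homI)
    fix g s x assume g: "g \<in> carrier Cn" and s: "s \<in> pts S" and "x \<in> pts (Zc 1)"
    then have x: "x = 0" by simp
    have "\<mu> (act S g s) 0 = \<mu> (act S g s) (act (Zc a) g 0)"
      using const[of "rot a g 0" "act S g s"] a0 by (simp add: act_Zc[OF g])
    also have "\<dots> = \<mu> s 0" by (rule bz_hom_inv[OF \<mu> g s]) (simp add: a0)
    finally show "\<nu> (act S g s) (act (Zc 1) g x) = \<nu> s x" unfolding x by (simp add: \<nu>_def act_Zc[OF g] rot_def)
  qed (auto simp: \<nu>_def bz_hom_out(1)[OF \<mu>])
  have "\<mu> = bz_comp (Zc 1) (ones 1 a) \<nu>"
  proof (rule bz_hom_eqI[OF \<mu> bz_comp_in[OF finite_gset_Zc \<nu> ones_in]])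
    fix s x assume "s \<in> pts S" "x \<in> pts (Zc a)"
    then show "\<mu> s x = bz_comp (Zc 1) (ones 1 a) \<nu> s x" using const[of x s] by (simp add: bz_comp_def ones_def \<nu>_def)
  qed simp
  then show ?thesis using \<nu> by blast
qed

lemma bz_inj_ones:
  assumes a: "a dvd n" and \<mu>: "\<mu> \<in> bz_hom Cn S (Zc 1)" and zero: "bz_comp (Zc 1) (ones 1 a) \<mu> = bz_zero"
  shows "\<mu> = bz_zero"
proof (rule bz_hom_eqI[OF \<mu> bz_zero_in])
  have a0: "0 < a" using a n by (auto intro: dvd_pos_nat)
  fix s x assume "s \<in> pts S" "x \<in> pts (Zc 1)"
  then show "\<mu> s x = bz_zero s x"
    using fun_cong[OF fun_cong[OF zero, of s], of 0] a0 by (simp add: bz_comp_def ones_def bz_zero_def)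
qed

end

text \<open>By Yoneda a complex of representables is a complex of matrices, so exactness is reduced
  to solving matrix equations at each S. Negative degrees are handled by requiring that only the
  zero matrix maps there.\<close>

lemma free1_resolution:
  assumes X: "\<And>i. gset G (X i)" and \<theta>: "\<And>i. \<theta> i \<in> bz_hom G (X i) (X (i - 1))"
    and zero: "\<And>i. bz_comp (X i) (\<theta> i) (\<theta> (i + 1)) = bz_zero"
    and neg: "\<And>i S \<mu>. i < 0 \<Longrightarrow> \<mu> \<in> bz_hom G S (X i) \<Longrightarrow> \<mu> = bz_zero"
    and e: "zmod_hom G (free1 G j (X 0)) M e"
    and surj: "\<And>S y. gset G S \<Longrightarrow> y \<in> el M S \<Longrightarrow> \<exists>\<mu> \<in> bz_hom G S (X 0). y = e S (single j \<mu>)"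
    and e_zero: "\<And>S \<nu>. gset G S \<Longrightarrow> \<nu> \<in> bz_hom G S (X 1) \<Longrightarrow> e S (single j (bz_comp (X 1) (\<theta> 1) \<nu>)) = \<one>\<^bsub>zobj M S\<^esub>"
    and exact0: "\<And>S \<mu>. gset G S \<Longrightarrow> \<mu> \<in> bz_hom G S (X 0) \<Longrightarrow> e S (single j \<mu>) = \<one>\<^bsub>zobj M S\<^esub>
      \<Longrightarrow> \<exists>\<nu> \<in> bz_hom G S (X 1). \<mu> = bz_comp (X 1) (\<theta> 1) \<nu>"
    and exact: "\<And>i S \<mu>. i \<ge> 1 \<Longrightarrow> gset G S \<Longrightarrow> \<mu> \<in> bz_hom G S (X i) \<Longrightarrow> bz_comp (X i) (\<theta> i) \<mu> = bz_zero
      \<Longrightarrow> \<exists>\<nu> \<in> bz_hom G S (X (i + 1)). \<mu> = bz_comp (X (i + 1)) (\<theta> (i + 1)) \<nu>"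
  shows "free_resolution G M (\<lambda>i. free1 G j (X i), \<lambda>i. free1_map j (X i) (\<theta> i), e)"
  unfolding free_resolution_def prod.case
proof (intro conjI allI impI)
  fix i show "\<exists>J Y. (\<forall>j \<in> J. gset G (Y j)) \<and> free1 G j (X i) = free_mod G J Y"
    by (rule exI[of _ "{j}"], rule exI[of _ "\<lambda>_. X i"]) (simp add: X)
next
  fix i :: int and S assume i: "i < 0" and S: "gset G S"
  have "bz_hom G S (X i) = {bz_zero}" using neg[OF i, of _ S] bz_zero_in by blast
  then have "el (free1 G j (X i)) S = {\<one>\<^bsub>zobj (free1 G j (X i)) S\<^esub>}" unfolding free1_carrier free1_one by simp
  moreover have "group (zobj (free1 G j (X i)) S)" by (rule zm_group[OF zmodule_free_mod S])
  ultimately show "trivial_group (zobj (free1 G j (X i)) S)" by (simp add: trivial_group_def)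
next
  fix i show "zmod_hom G (free1 G j (X i)) (free1 G j (X (i - 1))) (free1_map j (X i) (\<theta> i))"
    by (rule zmod_hom_free1_map[OF X \<theta>])
next
  show "zmod_hom G (free1 G j (X 0)) M e" by (rule e)
next
  fix S assume S: "gset G S"
  have "zimg (free1 G j (X 0)) e S = (\<lambda>\<mu>. e S (single j \<mu>)) ` bz_hom G S (X 0)"
    unfolding zimg_def free1_carrier by (simp add: image_image)
  also have "\<dots> = el M S"
    using surj[OF S] zmod_homD(2)[OF e S single_in] by blast
  finally show "zimg (free1 G j (X 0)) e S = el M S" .
  have "\<theta> 1 \<in> bz_hom G (X 1) (X 0)" using \<theta>[of 1] by simp
  note \<theta>1 = bz_comp_in[OF X _ this]
  show "zimg (free1 G j (X 1)) (free1_map j (X 1) (\<theta> 1)) S = zker (free1 G j (X 0)) M e S"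
  proof (intro equalityI subsetI)
    fix u assume "u \<in> zimg (free1 G j (X 1)) (free1_map j (X 1) (\<theta> 1)) S"
    then obtain \<nu> where \<nu>: "\<nu> \<in> bz_hom G S (X 1)" "u = single j (bz_comp (X 1) (\<theta> 1) \<nu>)"
      unfolding zimg_def free1_carrier by (auto simp: free1_map_single)
    show "u \<in> zker (free1 G j (X 0)) M e S"
      unfolding zker_iff \<nu>(2) by (rule conjI[OF single_in[OF \<theta>1[OF \<nu>(1)]] e_zero[OF S \<nu>(1)]])
  next
    fix u assume "u \<in> zker (free1 G j (X 0)) M e S"
    then obtain \<mu> where \<mu>: "\<mu> \<in> bz_hom G S (X 0)" "u = single j \<mu>" "e S (single j \<mu>) = \<one>\<^bsub>zobj M S\<^esub>"
      unfolding zker_iff free1_carrier by blast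
    then obtain \<nu> where "\<nu> \<in> bz_hom G S (X 1)" "u = single j (bz_comp (X 1) (\<theta> 1) \<nu>)" using exact0[OF S] by blast
    then show "u \<in> zimg (free1 G j (X 1)) (free1_map j (X 1) (\<theta> 1)) S"
      unfolding zimg_iff by (intro bexI[of _ "single j \<nu>"] single_in) (simp_all add: free1_map_single)
  qed
  fix i :: int assume i: "i \<ge> 1"
  have "\<theta> (i + 1) \<in> bz_hom G (X (i + 1)) (X i)" using \<theta>[of "i + 1"] by simp
  note \<theta>i = bz_comp_in[OF X _ this]
  show "zimg (free1 G j (X (i + 1))) (free1_map j (X (i + 1)) (\<theta> (i + 1))) S
      = zker (free1 G j (X i)) (free1 G j (X (i - 1))) (free1_map j (X i) (\<theta> i)) S"
  proof (intro equalityI subsetI)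
    fix u assume "u \<in> zimg (free1 G j (X (i + 1))) (free1_map j (X (i + 1)) (\<theta> (i + 1))) S"
    then obtain \<nu> where \<nu>: "\<nu> \<in> bz_hom G S (X (i + 1))" "u = single j (bz_comp (X (i + 1)) (\<theta> (i + 1)) \<nu>)"
      unfolding zimg_def free1_carrier by (auto simp: free1_map_single)
    have z: "bz_comp (X i) (\<theta> i) (bz_comp (X (i + 1)) (\<theta> (i + 1)) \<nu>) = bz_zero" by (simp add: bz_comp_assoc zero)
    show "u \<in> zker (free1 G j (X i)) (free1 G j (X (i - 1))) (free1_map j (X i) (\<theta> i)) S"
      unfolding zker_iff free1_one \<nu>(2) free1_map_single z by (rule conjI[OF single_in[OF \<theta>i[OF \<nu>(1)]] refl])
  next
    fix u assume "u \<in> zker (free1 G j (X i)) (free1 G j (X (i - 1))) (free1_map j (X i) (\<theta> i)) S"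
    then obtain \<mu> where \<mu>: "\<mu> \<in> bz_hom G S (X i)" "u = single j \<mu>" "bz_comp (X i) (\<theta> i) \<mu> = bz_zero"
      unfolding zker_iff free1_carrier free1_one by (auto simp: free1_map_single)
    then obtain \<nu> where "\<nu> \<in> bz_hom G S (X (i + 1))" "u = single j (bz_comp (X (i + 1)) (\<theta> (i + 1)) \<nu>)"
      using exact[OF i S] by blast
    then show "u \<in> zimg (free1 G j (X (i + 1))) (free1_map j (X (i + 1)) (\<theta> (i + 1))) S"
      unfolding zimg_iff by (intro bexI[of _ "single j \<nu>"] single_in) (simp_all add: free1_map_single)
  qed
qed

lemma zmod_hom_proj:
  assumes M: "zmodule G M" and J: "submodule_family G M J"
  shows "zmod_hom G M (quot M J) (\<lambda>S x. J S #>\<^bsub>zobj M S\<^esub> x)"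
  by (rule zmod_homI) (simp_all add: carrier_quot quot_mult[OF M J] quot_mor[OF M J])

lemma proj_one_iff:
  assumes M: "zmodule G M" and J: "submodule_family G M J" and S: "gset G S" and x: "x \<in> el M S"
  shows "J S #>\<^bsub>zobj M S\<^esub> x = \<one>\<^bsub>zobj (quot M J) S\<^esub> \<longleftrightarrow> x \<in> J S"
proof -
  interpret group "zobj M S" by (rule zm_group[OF M S])
  show ?thesis using coset_join1[OF _ x submodule_familyD(1)[OF J S]] coset_join2[OF x submodule_familyD(1)[OF J S]] by auto
qed

context cyclic_order
begin

section \<open>The explicit resolutions\<close>

lemma submodule_family_ideal:
  assumes d: "d dvd n" shows "submodule_family Cn (Zconst Cn) (ideal_fam n d)"
  unfolding submodule_family_def
proof (intro conjI allI impI ballI)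
  fix S assume S: "gset Cn S"
  show "subgroup (ideal_fam n d S) (zobj (Zconst Cn) S)"
    unfolding ideal_fam_eq[OF d S] by (rule submodule_familyD(1)[OF submodule_family_idl S])
  fix T \<phi> u assume T: "gset Cn T" and "\<phi> \<in> bz_hom Cn S T" "u \<in> ideal_fam n d T"
  then show "zmor (Zconst Cn) S T \<phi> u \<in> ideal_fam n d S"
    unfolding ideal_fam_eq[OF d S] ideal_fam_eq[OF d T] by (intro submodule_familyD(2)[OF submodule_family_idl S])
qed

lemma zmodule_Imod: "d dvd n \<Longrightarrow> zmodule Cn (Imod n d)"
  unfolding Imod_def by (rule zmodule_submod[OF zmodule_Zconst submodule_family_ideal])

lemma carrier_Imod: "d dvd n \<Longrightarrow> gset Cn S \<Longrightarrow> el (Imod n d) S = idl d S"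
  by (simp add: Imod_def ideal_fam_eq)

lemma Imod_simps [simp]:
  "monoid.mult (zobj (Imod n d) S) = (\<lambda>u v s. u s + v s)"
  "one (zobj (Imod n d) S) = (\<lambda>s. 0)"
  "zmor (Imod n d) = zmor (Zconst Cn)"
  by (simp_all add: Imod_def)

lemma zmodule_ZmodI: "d dvd n \<Longrightarrow> zmodule Cn (ZmodI n d)"
  unfolding ZmodI_def by (rule zmodule_quot[OF zmodule_Zconst submodule_family_ideal])

lemma idl_1: "idl 1 S = el (Zconst Cn) S"
  by (simp add: idl_def)

lemma bz_eqI_sum:
  assumes "\<mu> \<in> bz_hom Cn S (Zc 1)" "\<nu> \<in> bz_hom Cn S (Zc a)" and a: "a dvd n"
    and "\<And>s. s \<in> pts S \<Longrightarrow> \<mu> s 0 = (\<Sum>x<a. \<nu> s x)"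
  shows "\<mu> = bz_comp (Zc a) (ones a 1) \<nu>"
proof (rule bz_hom_eqI[OF assms(1) bz_comp_in[OF finite_gset_Zc[OF disjI2[OF a]] assms(2) ones_in]])
  fix s x assume "s \<in> pts S" "x \<in> pts (Zc 1)"
  then show "\<mu> s x = bz_comp (Zc a) (ones a 1) \<nu> s x" using assms(4)[of s] by (simp add: bz_comp_def ones_def)
qed

text \<open>Row sums, that is, the trace along Z/a on coefficient functions. For a = 1 it identifies
  the free module on one point with the constant module.\<close>

definition aug :: "'j \<Rightarrow> nat \<Rightarrow> (int, 'j \<Rightarrow> mat, nat \<Rightarrow> int) zmap" where
  "aug j a = (\<lambda>S u s. \<Sum>x<a. u j s x)"

lemma aug_single [simp]: "aug j a S (single j \<mu>) = (\<lambda>s. \<Sum>x<a. \<mu> s x)"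
  by (simp add: aug_def)

lemma zmod_hom_aug:
  assumes a: "a dvd n" and d: "d dvd a" shows "zmod_hom Cn (free1 Cn j (Zc a)) (Imod n d) (aug j a)"
proof (rule zmod_homI)
  note dn = dvd_trans[OF d a]
  fix S u assume S: "gset Cn S" and "u \<in> el (free1 Cn j (Zc a)) S"
  then obtain \<mu> where \<mu>: "\<mu> \<in> bz_hom Cn S (Zc a)" "u = single j \<mu>" unfolding free1_carrier by blast
  have "(\<lambda>s. \<Sum>x<a. \<mu> s x) \<in> idl a S" by (rule bz_trace_in[OF S a \<mu>(1)])
  then have "(\<lambda>s. \<Sum>x<a. \<mu> s x) \<in> idl d S" using d by (simp add: idl_def) (meson dvd_trans int_dvd_int_iff)
  then show "aug j a S u \<in> el (Imod n d) S" unfolding carrier_Imod[OF dn S] \<mu>(2) by simp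
next
  fix S T :: "int gset" and \<phi> :: mat and u
  have "(\<Sum>x<a. \<Sum>t \<in> pts T. \<phi> s t * u j t x) = (\<Sum>t \<in> pts T. \<Sum>x<a. \<phi> s t * u j t x)" for s by (rule sum.swap)
  then show "aug j a S (zmor (free1 Cn j (Zc a)) S T \<phi> u) = zmor (Imod n d) S T \<phi> (aug j a T u)"
    by (simp add: aug_def bz_comp_def sum_distrib_left)
qed (simp add: aug_def bz_add_def sum.distrib)

text \<open>
  With \<open>X = \<int>/a\<close> the resolutions are \<open>0 \<rightarrow> F\<^sub>1 \<rightarrow> F\<^sub>X \<rightarrow> F\<^sub>X \<rightarrow> F\<^sub>1 \<rightarrow> \<int>/I\<^sub>a \<rightarrow> 0\<close> and its truncation, which resolves \<open>I\<^sub>a\<close>;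
  the point is \<open>Zc 1\<close>, the empty set is \<open>Zc 0\<close>.
\<close>

definition XA :: "nat \<Rightarrow> int \<Rightarrow> int gset" where
  "XA a i = (if i = 0 \<or> i = 3 then Zc 1 else if i = 1 \<or> i = 2 then Zc a else Zc 0)"

definition TA :: "nat \<Rightarrow> int \<Rightarrow> mat" where
  "TA a i = (if i = 1 then ones a 1 else if i = 2 then dif a 1 else if i = 3 then ones 1 a else bz_zero)"

definition XB :: "nat \<Rightarrow> int \<Rightarrow> int gset" where
  "XB a i = (if i = 0 \<or> i = 1 then Zc a else if i = 2 then Zc 1 else Zc 0)"

definition TB :: "nat \<Rightarrow> int \<Rightarrow> mat" where
  "TB a i = (if i = 1 then dif a 1 else if i = 2 then ones 1 a else bz_zero)"

context
  fixes a :: nat assumes a: "a dvd n"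
begin

lemma finite_XA: "gset Cn (XA a i)" and finite_XB: "gset Cn (XB a i)"
  using a by (simp_all add: XA_def XB_def finite_gset_Zc)

lemma TA_in: "TA a i \<in> bz_hom Cn (XA a i) (XA a (i - 1))"
  by (cases "i = 1"; cases "i = 2"; cases "i = 3") (simp_all add: XA_def TA_def del: One_nat_def)

lemma TB_in: "TB a i \<in> bz_hom Cn (XB a i) (XB a (i - 1))"
  by (cases "i = 1"; cases "i = 2") (simp_all add: XB_def TB_def del: One_nat_def)

lemma TA_zero: "bz_comp (XA a i) (TA a i) (TA a (i + 1)) = bz_zero"
  by (cases "i = 1"; cases "i = 2") (simp_all add: XA_def TA_def del: One_nat_def)

lemma TB_zero: "bz_comp (XB a i) (TB a i) (TB a (i + 1)) = bz_zero"
  by (cases "i = 1") (simp_all add: XB_def TB_def del: One_nat_def)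

text \<open>Traces of integral invariant functions are exactly \<open>idl a\<close>, so the
  augmentation is onto. Rows with vanishing trace are differences, rows with vanishing difference
  come from the norm, and the norm is injective.\<close>

lemma resolution_Imod:
  "free_resolution Cn (Imod n a) (\<lambda>i. free1 Cn j (XB a i), \<lambda>i. free1_map j (XB a i) (TB a i), aug j a)"
proof (rule free1_resolution[where X = "XB a" and \<theta> = "TB a", OF finite_XB TB_in TB_zero])
  have X: "XB a 0 = Zc a" "XB a 1 = Zc a" and T: "TB a 1 = dif a 1" by (simp_all add: XB_def TB_def)
  show "zmod_hom Cn (free1 Cn j (XB a 0)) (Imod n a) (aug j a)"
    unfolding X by (rule zmod_hom_aug[OF a dvd_refl])
  fix S assume S: "gset Cn S"
  show "\<exists>\<mu> \<in> bz_hom Cn S (XB a 0). y = aug j a S (single j \<mu>)" if y: "y \<in> el (Imod n a) S" for y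
  proof -
    have y': "y \<in> idl a S" using y unfolding carrier_Imod[OF a S] .
    obtain \<mu> where \<mu>: "\<mu> \<in> bz_hom Cn S (Zc a)" "\<forall>s \<in> pts S. y s = (\<Sum>x<a. \<mu> s x)" using bz_trace_surj[OF S a y'] by blast
    have "y s = (\<Sum>x<a. \<mu> s x)" for s
      using \<mu>(2) idlD(2)[OF y', of s] bz_hom_out(1)[OF \<mu>(1), of s] by (cases "s \<in> pts S") simp_all
    then show ?thesis unfolding X using \<mu>(1) by (intro bexI[of _ \<mu>]) (simp_all add: fun_eq_iff)
  qed
  show "aug j a S (single j (bz_comp (XB a 1) (TB a 1) \<nu>)) = \<one>\<^bsub>zobj (Imod n a) S\<^esub>" for \<nu>
    unfolding X T by (simp add: bz_comp_def sum_dif_right sum_subtractf sum_rot)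
  show "\<exists>\<nu> \<in> bz_hom Cn S (XB a 1). \<mu> = bz_comp (XB a 1) (TB a 1) \<nu>"
    if "\<mu> \<in> bz_hom Cn S (XB a 0)" "aug j a S (single j \<mu>) = \<one>\<^bsub>zobj (Imod n a) S\<^esub>" for \<mu>
    unfolding X T by (rule bz_exact_dif[OF S a that(1)[unfolded X]]) (use that(2) in \<open>simp add: fun_eq_iff\<close>)
  fix i :: int and \<mu> assume i: "1 \<le> i" and \<mu>: "\<mu> \<in> bz_hom Cn S (XB a i)" "bz_comp (XB a i) (TB a i) \<mu> = bz_zero"
  consider "i = 1" | "i = 2" | "3 \<le> i" using i by linarith
  then show "\<exists>\<nu> \<in> bz_hom Cn S (XB a (i + 1)). \<mu> = bz_comp (XB a (i + 1)) (TB a (i + 1)) \<nu>"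
  proof cases
    case 1
    then show ?thesis using bz_exact_ones[OF S a, of \<mu>] \<mu> by (simp add: XB_def TB_def del: One_nat_def)
  next
    case 2
    then have "\<mu> = bz_zero" using bz_inj_ones[OF a, of \<mu> S] \<mu> by (simp add: XB_def TB_def del: One_nat_def)
    then show ?thesis by (intro bexI[of _ bz_zero]) simp_all
  next
    case 3
    then have "\<mu> = bz_zero" using \<mu>(1) by (simp add: XB_def bz_hom_Zc_0)
    then show ?thesis by (intro bexI[of _ bz_zero]) simp_all
  qed
qed (simp add: XB_def bz_hom_Zc_0)

text \<open>One more free module is spliced in: the free module on a point is the constant module,
  and the augmentation from Z/a maps onto the ideal that is divided out.\<close>

lemma resolution_ZmodI:
  "free_resolution Cn (ZmodI n a) (\<lambda>i. free1 Cn j (XA a i), \<lambda>i. free1_map j (XA a i) (TA a i),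
    \<lambda>S u. ideal_fam n a S #>\<^bsub>zobj (Zconst Cn) S\<^esub> aug j 1 S u)"
proof (rule free1_resolution[where X = "XA a" and \<theta> = "TA a", OF finite_XA TA_in TA_zero])
  have X: "XA a 0 = Zc 1" "XA a 1 = Zc a" and T: "TA a 1 = ones a 1" by (simp_all add: XA_def TA_def)
  have I1: "el (Imod n 1) S = el (Zconst Cn) S" if "gset Cn S" for S
    using carrier_Imod[OF one_dvd that] by (simp only: idl_1)
  have aug: "zmod_hom Cn (free1 Cn j (Zc 1)) (Zconst Cn) (aug j 1)"
  proof (rule zmod_homI)
    note * = zmod_homD[OF zmod_hom_aug[OF one_dvd dvd_refl, of j]]
    fix S u assume S: "gset Cn S" and u: "u \<in> el (free1 Cn j (Zc 1)) S"
    show "aug j 1 S u \<in> el (Zconst Cn) S" using *(2)[OF S u] unfolding I1[OF S] .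
    show "aug j 1 S (u \<otimes>\<^bsub>zobj (free1 Cn j (Zc 1)) S\<^esub> v) = aug j 1 S u \<otimes>\<^bsub>zobj (Zconst Cn) S\<^esub> aug j 1 S v"
      if "v \<in> el (free1 Cn j (Zc 1)) S" for v
      using *(3)[OF S u that] by simp
  next
    fix S T \<phi> z assume "gset Cn S" "gset Cn T" "\<phi> \<in> bz_hom Cn S T" "z \<in> el (free1 Cn j (Zc 1)) T"
    from zmod_homD(4)[OF zmod_hom_aug[OF one_dvd dvd_refl, of j] this]
    show "aug j 1 S (zmor (free1 Cn j (Zc 1)) S T \<phi> z) = zmor (Zconst Cn) S T \<phi> (aug j 1 T z)" by (simp only: Imod_simps)
  qed
  note sub = submodule_family_ideal[OF a]
  show "zmod_hom Cn (free1 Cn j (XA a 0)) (ZmodI n a) (\<lambda>S u. ideal_fam n a S #>\<^bsub>zobj (Zconst Cn) S\<^esub> aug j 1 S u)"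
    unfolding X ZmodI_def by (rule zmod_hom_comp[OF aug zmod_hom_proj[OF zmodule_Zconst sub]])
  fix S assume S: "gset Cn S"
  \<comment> \<open>A matrix into the one-point set is a single column; it dies in the quotient iff
    that column lies in the ideal, which makes exactness in degree 0 a statement about
    traces.\<close>
  have one_iff: "ideal_fam n a S #>\<^bsub>zobj (Zconst Cn) S\<^esub> aug j 1 S (single j \<mu>) = \<one>\<^bsub>zobj (ZmodI n a) S\<^esub>
      \<longleftrightarrow> (\<lambda>s. \<mu> s 0) \<in> idl a S" if "\<mu> \<in> bz_hom Cn S (Zc 1)" for \<mu>
    using proj_one_iff[OF zmodule_Zconst sub S zmod_homD(2)[OF aug S single_in[OF that]]]
    by (simp add: ZmodI_def ideal_fam_eq[OF a S])
  show "\<exists>\<mu> \<in> bz_hom Cn S (XA a 0). y = ideal_fam n a S #>\<^bsub>zobj (Zconst Cn) S\<^esub> aug j 1 S (single j \<mu>)"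
    if y: "y \<in> el (ZmodI n a) S" for y
  proof -
    obtain u where u: "u \<in> el (Zconst Cn) S" "y = ideal_fam n a S #>\<^bsub>zobj (Zconst Cn) S\<^esub> u"
      using y unfolding ZmodI_def carrier_quot by blast
    have u1: "u \<in> idl 1 S" using u(1) unfolding idl_1 .
    obtain \<mu> where \<mu>: "\<mu> \<in> bz_hom Cn S (Zc 1)" "\<forall>s \<in> pts S. u s = (\<Sum>x<1. \<mu> s x)" using bz_trace_surj[OF S one_dvd u1] by blast
    have "u s = (\<Sum>x<1. \<mu> s x)" for s
      using \<mu>(2) idlD(2)[OF u1, of s] bz_hom_out(1)[OF \<mu>(1), of s] by (cases "s \<in> pts S") simp_all
    then have "u = aug j 1 S (single j \<mu>)" by (simp add: fun_eq_iff)
    then show ?thesis unfolding X using \<mu>(1) u(2) by blast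
  qed
  show "ideal_fam n a S #>\<^bsub>zobj (Zconst Cn) S\<^esub> aug j 1 S (single j (bz_comp (XA a 1) (TA a 1) \<nu>)) = \<one>\<^bsub>zobj (ZmodI n a) S\<^esub>"
    if \<nu>: "\<nu> \<in> bz_hom Cn S (XA a 1)" for \<nu>
  proof -
    note \<nu>' = \<nu>[unfolded X]
    have "bz_comp (Zc a) (ones a 1) \<nu> s 0 = (\<Sum>x<a. \<nu> s x)" for s by (simp add: bz_comp_def ones_def)
    then show ?thesis
      unfolding X T one_iff[OF bz_comp_in[OF finite_gset_Zc[OF disjI2[OF a]] \<nu>' ones_in]]
      using bz_trace_in[OF S a \<nu>'] by simp
  qed
  show "\<exists>\<nu> \<in> bz_hom Cn S (XA a 1). \<mu> = bz_comp (XA a 1) (TA a 1) \<nu>"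
    if \<mu>: "\<mu> \<in> bz_hom Cn S (XA a 0)" and eq: "ideal_fam n a S #>\<^bsub>zobj (Zconst Cn) S\<^esub> aug j 1 S (single j \<mu>) = \<one>\<^bsub>zobj (ZmodI n a) S\<^esub>" for \<mu>
  proof -
    note \<mu>' = \<mu>[unfolded X]
    have "(\<lambda>s. \<mu> s 0) \<in> idl a S" using eq one_iff[OF \<mu>'] by simp
    then obtain \<nu> where \<nu>: "\<nu> \<in> bz_hom Cn S (Zc a)" "\<forall>s \<in> pts S. \<mu> s 0 = (\<Sum>x<a. \<nu> s x)" using bz_trace_surj[OF S a] by blast
    show ?thesis unfolding X T using bz_eqI_sum[OF \<mu>' \<nu>(1) a] \<nu> by blast
  qed
  fix i :: int and \<mu> assume i: "1 \<le> i" and \<mu>: "\<mu> \<in> bz_hom Cn S (XA a i)" "bz_comp (XA a i) (TA a i) \<mu> = bz_zero"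
  consider "i = 1" | "i = 2" | "i = 3" | "4 \<le> i" using i by linarith
  then show "\<exists>\<nu> \<in> bz_hom Cn S (XA a (i + 1)). \<mu> = bz_comp (XA a (i + 1)) (TA a (i + 1)) \<nu>"
  proof cases
    case 1
    then have \<mu>': "\<mu> \<in> bz_hom Cn S (Zc a)" "bz_comp (Zc a) (ones a 1) \<mu> = bz_zero" using \<mu> by (simp_all add: X T)
    have "(\<Sum>x<a. \<mu> s x) = 0" for s
      using fun_cong[OF fun_cong[OF \<mu>'(2), of s], of 0] by (simp add: bz_comp_def ones_def bz_zero_def)
    then have "\<exists>\<nu> \<in> bz_hom Cn S (Zc a). \<mu> = bz_comp (Zc a) (dif a 1) \<nu>" by (intro bz_exact_dif[OF S a \<mu>'(1)])
    then show ?thesis using 1 by (simp add: XA_def TA_def)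
  next
    case 2
    then show ?thesis using bz_exact_ones[OF S a, of \<mu>] \<mu> by (simp add: XA_def TA_def del: One_nat_def)
  next
    case 3
    then have "\<mu> = bz_zero" using bz_inj_ones[OF a, of \<mu> S] \<mu> by (simp add: XA_def TA_def del: One_nat_def)
    then show ?thesis by (intro bexI[of _ bz_zero]) simp_all
  next
    case 4
    then have "\<mu> = bz_zero" using \<mu>(1) by (simp add: XA_def bz_hom_Zc_0)
    then show ?thesis by (intro bexI[of _ bz_zero]) simp_all
  qed
qed (simp add: XA_def bz_hom_Zc_0)

end

end

section \<open>Homology of the periodic complexes\<close>

context cyclic_order
begin

lemma idl_mono: "d dvd e \<Longrightarrow> u \<in> idl e S \<Longrightarrow> u \<in> idl d S"
  by (simp add: idl_def) (meson dvd_trans int_dvd_int_iff)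

lemma idl_lcm: "u \<in> idl (lcm d e) S \<longleftrightarrow> u \<in> idl d S \<and> u \<in> idl e S"
  unfolding idl_def by (auto simp flip: lcm_int_int_eq)

text \<open>I_(a,b) = I_a + I_b on every G-set, from the arithmetic at single points.\<close>

lemma idl_split:
  assumes S: "gset Cn S" and d: "d > 0" "e > 0" and y: "y \<in> idl (gcd d e) S"
  shows "\<exists>v \<in> idl d S. (\<lambda>s. y s - v s) \<in> idl e S"
proof -
  \<comment> \<open>The solution is chosen as a function of orbit length and value. Both are
    constant along orbits, so the summand built from it is automatically invariant.\<close>
  have "\<forall>l z. \<exists>v. int (gcd d e) dvd int l * z \<longrightarrow> int d dvd int l * v \<and> int e dvd int l * (z - v)"
    using split_dvd[of "int d" "int e"] d by fastforce
  then obtain F where F: "\<And>l z. int (gcd d e) dvd int l * z \<Longrightarrow> int d dvd int l * F l z \<and> int e dvd int l * (z - F l z)"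
    by metis
  define v where "v s = (if s \<in> pts S then F (per n S s) (y s) else 0)" for s
  have 1: "v s = 0" if "s \<notin> pts S" for s using that by (simp add: v_def)
  have 2: "v (cact n S k s) = v s" if "s \<in> pts S" for k s
    using that by (simp add: v_def cact_in[OF S] per_cact[OF S] idlD(3)[OF y])
  have 3: "int d dvd int (per n S s) * v s \<and> int e dvd int (per n S s) * (y s - v s)" if "s \<in> pts S" for s
    using F[OF idlD(4)[OF y that]] that by (simp add: v_def)
  have "v \<in> idl d S" by (rule idlI) (simp_all add: 1 2 3)
  moreover have "(\<lambda>s. y s - v s) \<in> idl e S" by (rule idlI) (simp_all add: 1 2 3 idlD(2,3)[OF y])
  ultimately show ?thesis by blast
qed

lemma ZcP_eqI:
  assumes "u \<in> idl d (ZcP c S)" "v \<in> idl e (ZcP c S)"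
    and "\<And>x s. x < c \<Longrightarrow> s \<in> pts S \<Longrightarrow> u (prod_encode (x, s)) = v (prod_encode (x, s))"
  shows "u = v"
proof
  fix p show "u p = v p"
  proof (cases "p \<in> pts (ZcP c S)")
    case True
    then obtain x s where "p = prod_encode (x, s)" "x < c" "s \<in> pts S" by auto
    then show ?thesis using assms(3) by simp
  next
    case False
    from idlD(2)[OF assms(1) this] idlD(2)[OF assms(2) this] show ?thesis by simp
  qed
qed

section \<open>Trace and pullback along the projection Z/c \<times> S \<rightarrow> S\<close>

definition tr :: "nat \<Rightarrow> int gset \<Rightarrow> (nat \<Rightarrow> int) \<Rightarrow> nat \<Rightarrow> int" where
  "tr c S w = (\<lambda>s. if s \<in> pts S then \<Sum>x<c. w (prod_encode (x, s)) else 0)"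

text \<open>Pullback along the projection followed by multiplication by m. The factor 1 produces
  boundaries, the factor b/(a,b) all cycles up to boundaries.\<close>

definition pb :: "int \<Rightarrow> nat \<Rightarrow> int gset \<Rightarrow> (nat \<Rightarrow> int) \<Rightarrow> nat \<Rightarrow> int" where
  "pb m c S u = (\<lambda>p. if p \<in> pts (ZcP c S) then m * u (snd (prod_decode p)) else 0)"

lemma pb_apply [simp]: "x < c \<Longrightarrow> s \<in> pts S \<Longrightarrow> pb m c S u (prod_encode (x, s)) = m * u s"
  by (simp add: pb_def)

lemma tr_in:
  assumes "gset Cn S" "c dvd n" "w \<in> idl d (ZcP c S)" shows "tr c S w \<in> idl (lcm c d) S"
  by (rule trace_in[OF assms]) (simp_all add: tr_def)

lemma tr_surj:
  assumes S: "gset Cn S" and c: "c dvd n" and u: "u \<in> idl (lcm c d) S"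
  shows "\<exists>w \<in> idl d (ZcP c S). u = tr c S w"
proof -
  obtain w where w: "w \<in> idl d (ZcP c S)" "\<And>s. s \<in> pts S \<Longrightarrow> u s = (\<Sum>x<c. w (prod_encode (x, s)))"
    using trace_surj[OF S c u] by blast
  then have "u = tr c S w" using idlD(2)[OF u] by (auto simp: tr_def)
  then show ?thesis using w(1) by blast
qed

lemma tr_1_inj:
  assumes "x \<in> idl d (ZcP 1 S)" "y \<in> idl d (ZcP 1 S)" and eq: "tr 1 S x = tr 1 S y" shows "x = y"
proof (rule ZcP_eqI[OF assms(1,2)])
  fix z s assume "z < (1 :: nat)" "s \<in> pts S"
  then show "x (prod_encode (z, s)) = y (prod_encode (z, s))" using fun_cong[OF eq, of s] by (simp add: tr_def)
qed

lemma pb_in: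
  assumes S: "gset Cn S" and c: "c dvd n" and u: "u \<in> idl 1 S"
    and d: "\<And>s. s \<in> pts S \<Longrightarrow> int d dvd int (lcm c (per n S s)) * (m * u s)"
  shows "pb m c S u \<in> idl d (ZcP c S)"
  by (rule idl_Zc_I[OF S c]) (use d in \<open>simp_all add: cact_in[OF S] idlD(3)[OF u]\<close>, simp add: pb_def)

section \<open>Homology of the complexes of shifted copies of I_b\<close>

context
  fixes a b :: nat assumes a: "a dvd n" and b: "b dvd n"
begin

abbreviation sh :: "nat \<Rightarrow> (int, nat \<Rightarrow> int) zmod" where
  "sh c \<equiv> shift Cn (Imod n b) (Zc c)"

abbreviation sm :: "nat \<Rightarrow> nat \<Rightarrow> mat \<Rightarrow> (int, nat \<Rightarrow> int, nat \<Rightarrow> int) zmap" where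
  "sm c c' \<equiv> shift_map Cn (Imod n b) (Zc c) (Zc c')"

lemma positive: "a > 0" "b > 0"
  using a b n by (auto intro: dvd_pos_nat)

lemma Zc_fin [simp]: "gset Cn (Zc 0)" "gset Cn (Zc 1)" "gset Cn (Zc a)"
  by (simp_all add: finite_gset_Zc a)

lemma gcd_lcm_n: "gcd a b dvd n" "lcm a b dvd n"
  using a b by (auto intro: dvd_trans[OF gcd_dvd1])

lemma zmodule_sh: "gset Cn (Zc c) \<Longrightarrow> zmodule Cn (sh c)"
  by (rule zmodule_shift[OF zmodule_Imod[OF b]])

lemma carrier_sh:
  assumes "gset Cn (Zc c)" "gset Cn S"
  shows "el (sh c) S = idl b (ZcP c S)"
  unfolding shift_simps by (rule carrier_Imod[OF b finite_gset_prod[OF assms]])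

lemma sm_eval:
  assumes S: "gset Cn S" and s: "s \<in> pts S" and y: "y < c'"
  shows "sm c c' \<theta> S w (prod_encode (y, s)) = (\<Sum>x<c. \<theta> y x * w (prod_encode (x, s)))"
proof -
  have "sm c c' \<theta> S w (prod_encode (y, s)) =
      (\<Sum>x<c. \<Sum>t \<in> pts S. bz_id S s t * (\<theta> y x * w (prod_encode (x, t))))"
    unfolding shift_map_def Imod_simps Zconst_simps pts_gset_prod sum_prod_encode pts_Zc
    by (intro sum.cong refl) (use s y in simp)
  then show ?thesis by (simp only: bz_id_sum(1)[OF S s])
qed

lemma sh_mor_eval:
  assumes c: "gset Cn (Zc c)" and s: "s \<in> pts S" and x: "x < c"
  shows "zmor (sh c) S T \<phi> w (prod_encode (x, s)) = (\<Sum>t \<in> pts T. \<phi> s t * w (prod_encode (x, t)))"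
proof -
  have "zmor (sh c) S T \<phi> w (prod_encode (x, s)) =
      (\<Sum>y \<in> pts (Zc c). bz_id (Zc c) x y * (\<Sum>t \<in> pts T. \<phi> s t * w (prod_encode (y, t))))"
    unfolding shift_simps Imod_simps Zconst_simps pts_gset_prod sum_prod_encode sum_distrib_left
    by (intro sum.cong refl) (use s x in simp)
  also have "\<dots> = (\<Sum>t \<in> pts T. \<phi> s t * w (prod_encode (x, t)))"
    by (rule bz_id_sum(1)[OF c]) (simp add: x)
  finally show ?thesis .
qed

lemma sm_in:
  assumes "gset Cn (Zc c)" "gset Cn (Zc c')" "\<theta> \<in> bz_hom Cn (Zc c') (Zc c)"
    and S: "gset Cn S" and "w \<in> idl b (ZcP c S)"
  shows "sm c c' \<theta> S w \<in> idl b (ZcP c' S)"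
  using zmod_homD(2)[OF zmod_hom_shift_map[OF zmodule_Imod[OF b] assms(1-3)] S, of w] assms(5)
  unfolding carrier_sh[OF assms(1) S] carrier_sh[OF assms(2) S] .

lemma sh_zseq:
  assumes "gset Cn (Zc c)" "gset Cn (Zc c')" "gset Cn (Zc c'')"
    "\<theta> \<in> bz_hom Cn (Zc c') (Zc c)" "\<theta>' \<in> bz_hom Cn (Zc c'') (Zc c')" "bz_comp (Zc c') \<theta> \<theta>' = bz_zero"
  shows "zseq Cn (sh c) (sh c') (sh c'') (sm c c' \<theta>) (sm c' c'' \<theta>')"
  by (rule shift_zseq[OF zmodule_Imod[OF b] assms])

lemma zero_sh: "(\<lambda>p. 0) \<in> idl b S"
  by (rule idlI) simp_all

lemma idl_empty: "u \<in> idl b (ZcP 0 S) \<Longrightarrow> u = (\<lambda>p. 0)"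
  by (rule ext) (auto dest: idlD(2))

lemma zker_sh_0:
  assumes "gset Cn (Zc c)" "gset Cn S"
  shows "zker (sh c) (sh 0) (sm c 0 bz_zero) S = idl b (ZcP c S)"
  using idl_empty[OF sm_in[OF assms(1) Zc_fin(1) bz_zero_in assms(2)]]
  unfolding set_eq_iff zker_iff carrier_sh[OF assms] by auto

lemma sm_dif: "gset Cn S \<Longrightarrow> s \<in> pts S \<Longrightarrow> x < a \<Longrightarrow>
    sm a a (dif a e) S w (prod_encode (x, s)) = w (prod_encode (x, s)) - w (prod_encode (rot a e x, s))"
  by (simp only: sm_eval sum_dif_left)

lemma sm_ones: "gset Cn S \<Longrightarrow> s \<in> pts S \<Longrightarrow> x < a \<Longrightarrow>
    sm 1 a (ones a 1) S w (prod_encode (x, s)) = w (prod_encode (0, s))"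
  by (simp add: sm_eval ones_def)

lemma tr_sm_ones: "gset Cn S \<Longrightarrow> tr 1 S (sm a 1 (ones 1 a) S w) = tr a S w"
  by (simp add: tr_def sm_eval ones_def fun_eq_iff)

lemma tr_sm_dif: "gset Cn S \<Longrightarrow> tr a S (sm a a (dif a e) S w) = (\<lambda>s. 0)"
  by (simp add: tr_def sm_dif sum_subtractf sum_rot[of "\<lambda>x. w (prod_encode (x, _))"] fun_eq_iff)

text \<open>Formulated on a submodule K because it is applied to modules of cycles; naturality is an
  interchange of two finite sums.\<close>

lemma zmod_hom_tr:
  assumes c: "gset Cn (Zc c)" and d: "d dvd n"
    and K: "\<And>S w. gset Cn S \<Longrightarrow> w \<in> K S \<Longrightarrow> tr c S w \<in> idl d S"
  shows "zmod_hom Cn (submod (sh c) K) (Imod n d) (tr c)"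
proof (rule zmod_homI)
  fix S x assume "gset Cn S" "x \<in> el (submod (sh c) K) S"
  then show "tr c S x \<in> el (Imod n d) S" using K by (simp add: carrier_Imod[OF d])
next
  fix S T \<phi> z assume \<phi>: "\<phi> \<in> bz_hom Cn S T"
  show "tr c S (zmor (submod (sh c) K) S T \<phi> z) = zmor (Imod n d) S T \<phi> (tr c T z)"
  proof
    fix s
    have "(\<Sum>x<c. \<Sum>t \<in> pts T. \<phi> s t * z (prod_encode (x, t))) = (\<Sum>t \<in> pts T. \<Sum>x<c. \<phi> s t * z (prod_encode (x, t)))"
      by (rule sum.swap)
    then show "tr c S (zmor (submod (sh c) K) S T \<phi> z) s = zmor (Imod n d) S T \<phi> (tr c T z) s"
      by (cases "s \<in> pts S")
        (simp_all add: tr_def sh_mor_eval[OF c] sum_distrib_left bz_hom_out(1)[OF \<phi>] del: shift_simps)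
  qed
qed (simp add: tr_def sum.distrib fun_eq_iff)

lemma zmod_hom_pb:
  assumes c: "gset Cn (Zc c)"
    and K: "\<And>S u. gset Cn S \<Longrightarrow> u \<in> idl 1 S \<Longrightarrow> pb m c S u \<in> K S"
    and K': "\<And>S u. gset Cn S \<Longrightarrow> u \<in> K S \<Longrightarrow> u \<in> idl b (ZcP c S)"
  shows "zmod_hom Cn (Zconst Cn) (submod (sh c) K) (pb m c)"
proof (rule zmod_homI)
  fix S x assume "gset Cn S" "x \<in> el (Zconst Cn) S"
  then show "pb m c S x \<in> el (submod (sh c) K) S" using K unfolding idl_1 by simp
next
  fix S T \<phi> z assume S: "gset Cn S" and T: "gset Cn T" and \<phi>: "\<phi> \<in> bz_hom Cn S T"
    and z: "z \<in> el (Zconst Cn) T"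
  have 1: "pb m c S (zmor (Zconst Cn) S T \<phi> z) \<in> idl b (ZcP c S)"
    using K'[OF S K[OF S]] zm_closed[OF zmodule_Zconst S T \<phi> z] unfolding idl_1 by blast
  have "pb m c T z \<in> idl b (ZcP c T)" using K'[OF T K[OF T]] z unfolding idl_1 by blast
  then have 2: "zmor (sh c) S T \<phi> (pb m c T z) \<in> idl b (ZcP c S)"
    using zm_closed[OF zmodule_sh[OF c] S T \<phi>, of "pb m c T z"] unfolding carrier_sh[OF c S] carrier_sh[OF c T] by blast
  have "pb m c S (zmor (Zconst Cn) S T \<phi> z) = zmor (sh c) S T \<phi> (pb m c T z)"
    by (rule ZcP_eqI[OF 1 2]) (simp add: sh_mor_eval[OF c] sum_distrib_left mult.left_commute del: shift_simps)
  then show "pb m c S (zmor (Zconst Cn) S T \<phi> z) = zmor (submod (sh c) K) S T \<phi> (pb m c T z)"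
    by (simp only: submod_simps)
qed (simp add: pb_def distrib_left fun_eq_iff)

text \<open>The second isomorphism theorem: \<open>tr 1\<close> identifies the shift by a point with
  I_b, the image of the trace is I_[a,b], the intersection of I_a and I_b, and I_b modulo this is
  (I_a + I_b)/I_a.\<close>

lemma homology_trace_cokernel:
  "zmod_iso Cn (homology (sh a) (sh 1) (sh 0) (sm a 1 (ones 1 a)) (sm 1 0 bz_zero)) (ImodI n (gcd a b) a)"
  unfolding homology_def ImodI_def
proof (rule quot_iso)
  have zs: "zseq Cn (sh a) (sh 1) (sh 0) (sm a 1 (ones 1 a)) (sm 1 0 bz_zero)" by (rule sh_zseq) (simp_all del: One_nat_def)
  note ker = zker_sh_0[OF Zc_fin(2)]
  show "zmodule Cn (submod (sh 1) (zker (sh 1) (sh 0) (sm 1 0 bz_zero)))"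
    "submodule_family Cn (submod (sh 1) (zker (sh 1) (sh 0) (sm 1 0 bz_zero))) (zimg (sh a) (sm a 1 (ones 1 a)))"
    by (rule zseqD(8,9)[OF zs])+
  show "zmodule Cn (Imod n (gcd a b))" by (rule zmodule_Imod[OF gcd_lcm_n(1)])
  show "submodule_family Cn (Imod n (gcd a b)) (ideal_fam n a)"
    unfolding Imod_def
  proof (rule subgroup_submod[OF submodule_family_ideal[OF gcd_lcm_n(1)] submodule_family_ideal[OF a] _ zmodule_Zconst])
    fix S x assume S: "gset Cn S" and x: "x \<in> ideal_fam n a S"
    show "x \<in> ideal_fam n (gcd a b) S"
      using x unfolding ideal_fam_eq[OF a S] ideal_fam_eq[OF gcd_lcm_n(1) S] by (rule idl_mono[OF gcd_dvd1])
  qed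
  have tr_b: "tr 1 S x \<in> idl b S" if "gset Cn S" "x \<in> idl b (ZcP 1 S)" for S x
    using tr_in[OF that(1) one_dvd that(2)] by simp
  show "zmod_hom Cn (submod (sh 1) (zker (sh 1) (sh 0) (sm 1 0 bz_zero))) (Imod n (gcd a b)) (tr 1)"
    by (rule zmod_hom_tr[OF Zc_fin(2) gcd_lcm_n(1)]) (simp only: ker, rule idl_mono[OF gcd_dvd2 tr_b])
  fix S assume S: "gset Cn S"
  note o = ones_in[of 1 a]
  show "tr 1 S x \<in> ideal_fam n a S \<longleftrightarrow> x \<in> zimg (sh a) (sm a 1 (ones 1 a)) S"
    if "x \<in> el (submod (sh 1) (zker (sh 1) (sh 0) (sm 1 0 bz_zero))) S" for x
    unfolding ideal_fam_eq[OF a S] zimg_iff carrier_sh[OF Zc_fin(3) S]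
  proof
    have x: "x \<in> idl b (ZcP 1 S)" using that unfolding submod_simps ker[OF S] .
    assume "tr 1 S x \<in> idl a S"
    then obtain w where w: "w \<in> idl b (ZcP a S)" "tr 1 S x = tr a S w"
      using tr_surj[OF S a, of "tr 1 S x" b] tr_b[OF S x] idl_lcm[of _ a b S] by blast
    have "x = sm a 1 (ones 1 a) S w"
      by (rule tr_1_inj[OF x sm_in[OF Zc_fin(3,2) o S w(1)]]) (simp only: tr_sm_ones[OF S] w(2))
    then show "\<exists>w \<in> idl b (ZcP a S). x = sm a 1 (ones 1 a) S w" using w(1) by blast
  next
    assume "\<exists>w \<in> idl b (ZcP a S). x = sm a 1 (ones 1 a) S w"
    then obtain w where w: "w \<in> idl b (ZcP a S)" "tr 1 S x = tr a S w" using tr_sm_ones[OF S] by metis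
    then show "tr 1 S x \<in> idl a S" using tr_in[OF S a w(1)] idl_lcm[of _ a b S] by simp
  qed
  fix y assume "y \<in> el (Imod n (gcd a b)) S"
  then have "y \<in> idl (gcd a b) S" unfolding carrier_Imod[OF gcd_lcm_n(1) S] .
  \<comment> \<open>The part v vanishes in the quotient, and the rest is a value of
    \<open>tr 1\<close>; so the map is onto modulo I_a.\<close>
  then obtain v where v: "v \<in> idl a S" "(\<lambda>s. y s - v s) \<in> idl b S" using idl_split[OF S positive] by blast
  then obtain x where "x \<in> idl b (ZcP 1 S)" "(\<lambda>s. y s - v s) = tr 1 S x"
    using tr_surj[OF S one_dvd, of _ b] by auto
  then show "\<exists>x \<in> el (submod (sh 1) (zker (sh 1) (sh 0) (sm 1 0 bz_zero))) S. \<exists>k \<in> ideal_fam n a S.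
      y = k \<otimes>\<^bsub>zobj (Imod n (gcd a b)) S\<^esub> tr 1 S x"
    unfolding submod_simps ker[OF S] ideal_fam_eq[OF a S] Imod_simps
    using v(1) by (intro bexI[of _ x] bexI[of _ v]) (simp_all add: fun_eq_iff algebra_simps)
qed

lemma tr_zero:
  assumes e: "e = 1 \<or> e = - 1" and S: "gset Cn S" and w: "w \<in> idl b (ZcP a S)" and zero: "tr a S w = (\<lambda>s. 0)"
  shows "\<exists>v \<in> idl b (ZcP a S). w = sm a a (dif a e) S v"
proof -
  have "(\<Sum>x<a. w (prod_encode (x, s))) = 0" if "s \<in> pts S" for s
    using fun_cong[OF zero, of s] that by (simp add: tr_def)
  then obtain v where v: "v \<in> idl b (ZcP a S)"
    "\<And>x s. x < a \<Longrightarrow> s \<in> pts S \<Longrightarrow> w (prod_encode (x, s)) = v (prod_encode (x, s)) - v (prod_encode (rot a e x, s))"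
    using trace_zero_diff[OF S a w e] by blast
  have "w = sm a a (dif a e) S v"
    by (rule ZcP_eqI[OF w sm_in[OF Zc_fin(3,3) dif_in S v(1)]]) (simp only: sm_dif[OF S] v(2))
  then show ?thesis using v(1) by blast
qed

lemma homology_trace_kernel:
  assumes e: "e = 1 \<or> e = - 1"
  shows "zmod_iso Cn (homology (sh a) (sh a) (sh 1) (sm a a (dif a e)) (sm a 1 (ones 1 a))) zmod_zero"
proof (rule homology_zero)
  show "zseq Cn (sh a) (sh a) (sh 1) (sm a a (dif a e)) (sm a 1 (ones 1 a))" by (rule sh_zseq) (simp_all del: One_nat_def)
  fix S w assume S: "gset Cn S" and w': "w \<in> el (sh a) S"
    and zero: "sm a 1 (ones 1 a) S w = \<one>\<^bsub>zobj (sh 1) S\<^esub>"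
  note w = w'[unfolded carrier_sh[OF Zc_fin(3) S]]
  have "tr a S w = (\<lambda>s. 0)" unfolding tr_sm_ones[OF S, symmetric] zero by (simp add: tr_def fun_eq_iff)
  from tr_zero[OF e S w this] show "\<exists>z \<in> el (sh a) S. w = sm a a (dif a e) S z"
    unfolding carrier_sh[OF Zc_fin(3) S] .
qed

text \<open>The trace factors through the cokernel of the difference, is injective there because
  trace-zero elements are differences, and has image I_[a,b].\<close>

lemma homology_dif_cokernel:
  assumes e: "e = 1 \<or> e = - 1"
  shows "zmod_iso Cn (homology (sh a) (sh a) (sh 0) (sm a a (dif a e)) (sm a 0 bz_zero)) (Imod n (lcm a b))"
  unfolding homology_def
proof (rule quot_iso_target)
  have zs: "zseq Cn (sh a) (sh a) (sh 0) (sm a a (dif a e)) (sm a 0 bz_zero)" by (rule sh_zseq) (simp_all del: One_nat_def)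
  note ker = zker_sh_0[OF Zc_fin(3)]
  show "zmodule Cn (submod (sh a) (zker (sh a) (sh 0) (sm a 0 bz_zero)))"
    "submodule_family Cn (submod (sh a) (zker (sh a) (sh 0) (sm a 0 bz_zero))) (zimg (sh a) (sm a a (dif a e)))"
    by (rule zseqD(8,9)[OF zs])+
  show "zmodule Cn (Imod n (lcm a b))" by (rule zmodule_Imod[OF gcd_lcm_n(2)])
  show "zmod_hom Cn (submod (sh a) (zker (sh a) (sh 0) (sm a 0 bz_zero))) (Imod n (lcm a b)) (tr a)"
    by (rule zmod_hom_tr[OF Zc_fin(3) gcd_lcm_n(2)]) (simp only: ker, rule tr_in[OF _ a])
  fix S assume S: "gset Cn S"
  show "tr a S w = \<one>\<^bsub>zobj (Imod n (lcm a b)) S\<^esub> \<longleftrightarrow> w \<in> zimg (sh a) (sm a a (dif a e)) S"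
    if "w \<in> el (submod (sh a) (zker (sh a) (sh 0) (sm a 0 bz_zero))) S" for w
    unfolding zimg_iff carrier_sh[OF Zc_fin(3) S] Imod_simps
  proof
    assume "tr a S w = (\<lambda>s. 0)"
    then show "\<exists>v \<in> idl b (ZcP a S). w = sm a a (dif a e) S v"
      using that unfolding submod_simps ker[OF S] by (intro tr_zero[OF e S])
  qed (use tr_sm_dif[OF S] in blast)
  show "\<exists>w \<in> el (submod (sh a) (zker (sh a) (sh 0) (sm a 0 bz_zero))) S. y = tr a S w"
    if "y \<in> el (Imod n (lcm a b)) S" for y
    using tr_surj[OF S a, of y b] that unfolding submod_simps ker[OF S] carrier_Imod[OF gcd_lcm_n(2) S] by blast
qed

text \<open>Cycles are the functions in I_b on Z/a \<times> S that do not depend on the first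
  coordinate, and boundaries are those pulled back from I_b on S. Multiplying by m = b/(a,b) sends
  every integral function to a cycle; it becomes a boundary exactly when (a,b) | l u, and by
  \<open>split_lcm\<close> every cycle is reached up to a boundary.\<close>

lemma homology_invariants:
  assumes e: "e = 1 \<or> e = - 1"
  shows "zmod_iso Cn (homology (sh 1) (sh a) (sh a) (sm 1 a (ones a 1)) (sm a a (dif a e))) (ZmodI n (gcd a b))"
proof -
  have zs: "zseq Cn (sh 1) (sh a) (sh a) (sm 1 a (ones a 1)) (sm a a (dif a e))" by (rule sh_zseq) (simp_all del: One_nat_def)
  let ?K = "zker (sh a) (sh a) (sm a a (dif a e))"
  define m where "m = int b div gcd (int a) (int b)"
  have m: "int b = m * int (gcd a b)" by (simp add: m_def)
  then have m0: "m \<noteq> 0" using positive(2) by auto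
  have K: "w \<in> ?K S \<longleftrightarrow> w \<in> idl b (ZcP a S) \<and> (\<forall>x < a. \<forall>s \<in> pts S. w (prod_encode (x, s)) = w (prod_encode (0, s)))"
    if S: "gset Cn S" for S w
  proof
    assume "w \<in> ?K S"
    then have w: "w \<in> idl b (ZcP a S)" and zero: "sm a a (dif a e) S w = (\<lambda>p. 0)"
      unfolding zker_iff carrier_sh[OF Zc_fin(3) S] by simp_all
    have "w (prod_encode (rot a e x, s)) = w (prod_encode (x, s))" if "x < a" "s \<in> pts S" for x s
      using sm_dif[OF S that(2,1), of e w] unfolding zero by simp
    then have "w (prod_encode (x, s)) = w (prod_encode (0, s))" if "x < a" "s \<in> pts S" for x s
      using rot_invariant[OF e, of a "\<lambda>x. w (prod_encode (x, s))"] that by blast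
    then show "w \<in> idl b (ZcP a S) \<and> (\<forall>x < a. \<forall>s \<in> pts S. w (prod_encode (x, s)) = w (prod_encode (0, s)))"
      using w by blast
  next
    assume *: "w \<in> idl b (ZcP a S) \<and> (\<forall>x < a. \<forall>s \<in> pts S. w (prod_encode (x, s)) = w (prod_encode (0, s)))"
    then have w: "w \<in> idl b (ZcP a S)" by blast
    have "sm a a (dif a e) S w = (\<lambda>p. 0)"
    proof (rule ZcP_eqI[OF sm_in[OF Zc_fin(3,3) dif_in S w] zero_sh])
      fix x s assume x: "x < a" and s: "s \<in> pts S"
      have "w (prod_encode (x, s)) = w (prod_encode (0, s))" "w (prod_encode (rot a e x, s)) = w (prod_encode (0, s))"
        using * x s rot_less[OF x] by blast+
      then show "sm a a (dif a e) S w (prod_encode (x, s)) = 0" unfolding sm_dif[OF S s x] by linarith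
    qed
    then show "w \<in> ?K S" unfolding zker_iff carrier_sh[OF Zc_fin(3) S] using w by simp
  qed
  have pb_K: "pb m a S u \<in> ?K S" if S: "gset Cn S" and u: "u \<in> idl 1 S" for S u
  proof -
    \<comment> \<open>Here b = m gcd(a,b), and gcd(a,b) divides a, hence lcm(a,l) for every orbit
      length l.\<close>
    have "int b dvd int (lcm a (per n S s)) * (m * u s)" for s
    proof -
      have "int (gcd a b) dvd int (lcm a (per n S s))"
        unfolding int_dvd_int_iff by (rule dvd_trans[OF gcd_dvd1 dvd_lcm1])
      then have "m * int (gcd a b) dvd (m * u s) * int (lcm a (per n S s))" by (intro mult_dvd_mono) simp_all
      then show ?thesis unfolding m by (simp only: mult.commute)
    qed
    then have "pb m a S u \<in> idl b (ZcP a S)" by (intro pb_in[OF S a u])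
    then show ?thesis unfolding K[OF S] using positive(1) by simp
  qed
  have "zmod_iso Cn (quot (Zconst Cn) (ideal_fam n (gcd a b))) (quot (submod (sh a) ?K) (zimg (sh 1) (sm 1 a (ones a 1))))"
  proof (rule quot_iso[OF zmodule_Zconst zseqD(8)[OF zs] submodule_family_ideal[OF gcd_lcm_n(1)] zseqD(9)[OF zs]])
    show "zmod_hom Cn (Zconst Cn) (submod (sh a) ?K) (pb m a)"
      by (rule zmod_hom_pb[OF Zc_fin(3) pb_K]) (simp_all add: K)
    fix S assume S: "gset Cn S"
    have img: "w \<in> zimg (sh 1) (sm 1 a (ones a 1)) S \<longleftrightarrow> (\<exists>v \<in> idl b (ZcP 1 S). w = sm 1 a (ones a 1) S v)" for w
      unfolding zimg_iff carrier_sh[OF Zc_fin(2) S] ..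
    have pb_img: "pb k a S v \<in> zimg (sh 1) (sm 1 a (ones a 1)) S"
      if v: "v \<in> idl 1 S" and "\<And>s. s \<in> pts S \<Longrightarrow> int b dvd int (per n S s) * (k * v s)"
        and w: "pb k a S v \<in> idl b (ZcP a S)" for k v
      unfolding img
    proof
      show *: "pb k 1 S v \<in> idl b (ZcP 1 S)" by (rule pb_in[OF S one_dvd v]) (use that(2) in simp)
      show "pb k a S v = sm 1 a (ones a 1) S (pb k 1 S v)"
        by (rule ZcP_eqI[OF w sm_in[OF Zc_fin(2,3) ones_in S *]]) (simp add: sm_ones[OF S] del: One_nat_def)
    qed
    show "pb m a S u \<in> zimg (sh 1) (sm 1 a (ones a 1)) S \<longleftrightarrow> u \<in> ideal_fam n (gcd a b) S"
      if "u \<in> el (Zconst Cn) S" for u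
      unfolding ideal_fam_eq[OF gcd_lcm_n(1) S]
    proof
      have u: "u \<in> idl 1 S" using that unfolding idl_1 .
      assume "pb m a S u \<in> zimg (sh 1) (sm 1 a (ones a 1)) S"
      then obtain v where v: "v \<in> idl b (ZcP 1 S)" "pb m a S u = sm 1 a (ones a 1) S v" unfolding img by blast
      show "u \<in> idl (gcd a b) S"
      proof (rule idlI)
        fix s assume s: "s \<in> pts S"
        have mu: "m * u s = v (prod_encode (0, s))"
          using fun_cong[OF v(2), of "prod_encode (0, s)"] sm_ones[OF S s positive(1)] s positive(1) by simp
        have "int b dvd int (per n S s) * (m * u s)"
          using idl_Zc_D(2)[OF v(1) S one_dvd _ s, of 0] unfolding mu by simp
        \<comment> \<open>With b written as m gcd(a,b), cancelling the nonzero m leaves the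
          condition for I_(a,b).\<close>
        then have "m * int (gcd a b) dvd m * (int (per n S s) * u s)"
          unfolding m mult.left_commute[of "int (per n S s)" m] .
        then show "int (gcd a b) dvd int (per n S s) * u s" using m0 by simp
      qed (use idlD(2,3)[OF u] in simp_all)
    next
      assume u: "u \<in> idl (gcd a b) S"
      then have u1: "u \<in> idl 1 S" by (rule idl_mono[OF one_dvd])
      show "pb m a S u \<in> zimg (sh 1) (sm 1 a (ones a 1)) S"
      proof (rule pb_img[OF u1])
        fix s assume "s \<in> pts S"
        then have "m * int (gcd a b) dvd m * (int (per n S s) * u s)" by (intro mult_dvd_mono idlD(4)[OF u] dvd_refl)
        then show "int b dvd int (per n S s) * (m * u s)" unfolding m by (simp only: mult.left_commute)
      qed (use pb_K[OF S u1] in \<open>simp add: K[OF S]\<close>)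
    qed
    fix y assume "y \<in> el (submod (sh a) ?K) S"
    then have y: "y \<in> idl b (ZcP a S)" and const: "\<And>x s. x < a \<Longrightarrow> s \<in> pts S \<Longrightarrow> y (prod_encode (x, s)) = y (prod_encode (0, s))"
      unfolding submod_simps K[OF S] by blast+
    define w where "w s = (if s \<in> pts S then y (prod_encode (0, s)) else 0)" for s
    have w_cact: "w (cact n S k s) = w s" if s: "s \<in> pts S" for k s
    proof -
      have "y (prod_encode (0, cact n S k s)) = y (prod_encode (rot a k 0, cact n S k s))"
        using const[OF rot_less[OF positive(1)] cact_in[OF S s]] by simp
      also have "\<dots> = y (prod_encode (0, s))" by (rule idl_Zc_D(1)[OF y S a positive(1) s])
      finally show ?thesis using s cact_in[OF S s] by (simp add: w_def)
    qed
    \<comment> \<open>Once more the solution is chosen as a function of orbit length and value,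
      which makes u invariant.\<close>
    have "\<forall>l z. \<exists>u. int b dvd int (lcm a l) * z \<longrightarrow> int b dvd int l * (z - m * u)"
      using split_lcm[of "int b" "int a"] positive(2) unfolding m_def by fastforce
    then obtain F where F: "\<And>l z. int b dvd int (lcm a l) * z \<Longrightarrow> int b dvd int l * (z - m * F l z)" by metis
    define u where "u s = (if s \<in> pts S then F (per n S s) (w s) else 0)" for s
    have u: "u \<in> idl 1 S" by (rule idlI) (simp_all add: u_def cact_in[OF S] per_cact[OF S] w_cact)
    \<comment> \<open>The remainder lies in I_b on S itself, without the help of the factor Z/a, so
      its pullback is a boundary.\<close>
    define v where "v s = w s - m * u s" for s
    have v: "v \<in> idl b S"
    proof (rule idlI)
      fix s assume s: "s \<in> pts S"
      show "v (cact n S k s) = v s" for k using s by (simp add: v_def w_cact idlD(3)[OF u])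
      have "int b dvd int (lcm a (per n S s)) * w s" using idl_Zc_D(2)[OF y S a positive(1) s] s by (simp add: w_def)
      from F[OF this] show "int b dvd int (per n S s) * v s" using s by (simp add: v_def u_def)
    qed (simp add: v_def w_def u_def)
    have v_pb: "pb 1 a S v \<in> idl b (ZcP a S)"
    proof (rule pb_in[OF S a idl_mono[OF one_dvd v]])
      fix s assume "s \<in> pts S"
      then have "int b dvd int (per n S s) * v s" by (rule idlD(4)[OF v])
      moreover have "int (per n S s) * v s dvd int (lcm a (per n S s)) * (1 * v s)" by (intro mult_dvd_mono) simp_all
      ultimately show "int b dvd int (lcm a (per n S s)) * (1 * v s)" by (rule dvd_trans)
    qed
    have "y p = pb 1 a S v p + pb m a S u p" for p
    proof (cases "p \<in> pts (ZcP a S)")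
      case True
      then obtain x s where "p = prod_encode (x, s)" "x < a" "s \<in> pts S" by auto
      then show ?thesis using const[of x s] by (simp add: v_def w_def)
    qed (simp add: idlD(2)[OF y] pb_def)
    then have "y = pb 1 a S v \<otimes>\<^bsub>zobj (submod (sh a) ?K) S\<^esub> pb m a S u" by (simp add: fun_eq_iff)
    moreover have "pb 1 a S v \<in> zimg (sh 1) (sm 1 a (ones a 1)) S"
      by (rule pb_img[OF idl_mono[OF one_dvd v] _ v_pb]) (simp add: idlD(4)[OF v])
    ultimately show "\<exists>x \<in> el (Zconst Cn) S. \<exists>k \<in> zimg (sh 1) (sm 1 a (ones a 1)) S.
        y = k \<otimes>\<^bsub>zobj (submod (sh a) ?K) S\<^esub> pb m a S x"
      using u unfolding idl_1 by blast
  qed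
  then show ?thesis unfolding homology_def ZmodI_def by (rule zmod_iso_sym)
qed

lemma homology_ones_kernel:
  "zmod_iso Cn (homology (sh 0) (sh 1) (sh a) (sm 0 1 bz_zero) (sm 1 a (ones a 1))) zmod_zero"
proof (rule homology_zero)
  show zs: "zseq Cn (sh 0) (sh 1) (sh a) (sm 0 1 bz_zero) (sm 1 a (ones a 1))" by (rule sh_zseq) (simp_all del: One_nat_def)
  fix S w assume S: "gset Cn S" and "w \<in> el (sh 1) S"
    and zero: "sm 1 a (ones a 1) S w = \<one>\<^bsub>zobj (sh a) S\<^esub>"
  then have w: "w \<in> idl b (ZcP 1 S)" unfolding carrier_sh[OF Zc_fin(2) S] by blast
  have "w = sm 0 1 bz_zero S (\<lambda>p. 0)"
  proof (rule ZcP_eqI[OF w sm_in[OF Zc_fin(1,2) bz_zero_in S zero_sh]])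
    fix x s assume "x < (1 :: nat)" and s: "s \<in> pts S"
    then show "w (prod_encode (x, s)) = sm 0 1 bz_zero S (\<lambda>p. 0) (prod_encode (x, s))"
      using sm_ones[OF S s positive(1), of w] unfolding zero by (simp add: sm_eval[OF S s])
  qed
  then show "\<exists>z \<in> el (sh 0) S. w = sm 0 1 bz_zero S z"
    unfolding carrier_sh[OF Zc_fin(1) S] using zero_sh by blast
qed

text \<open>Covers the degrees outside the resolution: the middle term is I_b evaluated on the empty
  set.\<close>

lemma homology_sh_0:
  assumes X: "gset Cn X" and Y: "gset Cn Y"
    and \<theta>: "\<theta> \<in> bz_hom Cn (Zc 0) X" and \<theta>': "\<theta>' \<in> bz_hom Cn Y (Zc 0)"
  shows "zmod_iso Cn (homology (shift Cn (Imod n b) X) (sh 0) (shift Cn (Imod n b) Y)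
    (shift_map Cn (Imod n b) X (Zc 0) \<theta>) (shift_map Cn (Imod n b) (Zc 0) Y \<theta>')) zmod_zero"
proof (rule homology_zero)
  let ?A = "shift Cn (Imod n b) X"
  show "zseq Cn ?A (sh 0) (shift Cn (Imod n b) Y) (shift_map Cn (Imod n b) X (Zc 0) \<theta>) (shift_map Cn (Imod n b) (Zc 0) Y \<theta>')"
    by (rule shift_zseq[OF zmodule_Imod[OF b] X Zc_fin(1) Y \<theta> \<theta>' bz_comp_Zc_0])
  fix S w assume S: "gset Cn S" and "w \<in> el (sh 0) S"
  then have w: "w \<in> idl b (ZcP 0 S)" unfolding carrier_sh[OF Zc_fin(1) S] by blast
  note A = zmodule_shift[OF zmodule_Imod[OF b] X]
  have "shift_map Cn (Imod n b) X (Zc 0) \<theta> S \<one>\<^bsub>zobj ?A S\<^esub> = \<one>\<^bsub>zobj (sh 0) S\<^esub>"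
    by (rule zmod_hom_one[OF zmod_hom_shift_map[OF zmodule_Imod[OF b] X Zc_fin(1) \<theta>] A zmodule_sh[OF Zc_fin(1)] S])
  then have "w = shift_map Cn (Imod n b) X (Zc 0) \<theta> S \<one>\<^bsub>zobj ?A S\<^esub>" using idl_empty[OF w] by simp
  then show "\<exists>z \<in> el ?A S. w = shift_map Cn (Imod n b) X (Zc 0) \<theta> S z"
    using monoid.one_closed[OF group.is_monoid[OF zm_group[OF A S]]] by blast
qed

section \<open>Tor and Ext\<close>

text \<open>Tor uses transposed matrices: augmentation and norm change places, and the difference
  acquires exponent - 1. Hence the trace cokernel sits in degree 0 and the invariants in degree
  2.\<close>

lemma Tor_ZmodI:
  "zmod_iso Cn (Tor Cn 0 (ZmodI n a) (Imod n b)) (ImodI n (gcd a b) a)"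
  "zmod_iso Cn (Tor Cn 1 (ZmodI n a) (Imod n b)) zmod_zero"
  "zmod_iso Cn (Tor Cn 2 (ZmodI n a) (Imod n b)) (ZmodI n (gcd a b))"
  "zmod_iso Cn (Tor Cn 3 (ZmodI n a) (Imod n b)) zmod_zero"
  "i < 0 \<or> i > 3 \<Longrightarrow> zmod_iso Cn (Tor Cn i (ZmodI n a) (Imod n b)) zmod_zero"
proof -
  note T = Tor_rep_iso[OF resolution_ZmodI[OF a] zmodule_ZmodI[OF a] zmodule_Imod[OF b] finite_XA[OF a] TA_in[OF a] TA_zero[OF a]]
  note simps = XA_def TA_def
  show "zmod_iso Cn (Tor Cn 0 (ZmodI n a) (Imod n b)) (ImodI n (gcd a b) a)"
    by (rule zmod_iso_trans[OF T]) (use homology_trace_cokernel in \<open>simp add: simps del: One_nat_def\<close>)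
  show "zmod_iso Cn (Tor Cn 1 (ZmodI n a) (Imod n b)) zmod_zero"
    by (rule zmod_iso_trans[OF T]) (use homology_trace_kernel[of "- 1"] in \<open>simp add: simps del: One_nat_def\<close>)
  show "zmod_iso Cn (Tor Cn 2 (ZmodI n a) (Imod n b)) (ZmodI n (gcd a b))"
    by (rule zmod_iso_trans[OF T]) (use homology_invariants[of "- 1"] in \<open>simp add: simps del: One_nat_def\<close>)
  show "zmod_iso Cn (Tor Cn 3 (ZmodI n a) (Imod n b)) zmod_zero"
    by (rule zmod_iso_trans[OF T]) (use homology_ones_kernel in \<open>simp add: simps del: One_nat_def\<close>)
  show "zmod_iso Cn (Tor Cn i (ZmodI n a) (Imod n b)) zmod_zero" if "i < 0 \<or> i > 3"
  proof -
    have X: "XA a i = Zc 0" using that by (auto simp: XA_def)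
    show ?thesis
      using zmod_iso_trans[OF T[of i, unfolded X] homology_sh_0[OF finite_XA[OF a] finite_XA[OF a]
        bz_transpose_in[OF TA_in[OF a, of "i + 1", simplified, unfolded X]] bz_transpose_in[OF TA_in[OF a, of i, unfolded X]]]] .
  qed
qed

text \<open>Without transposition the complex runs in the other direction with exponent 1. The
  homology lemmas hold for both exponents, so degree 3 - i here gives the module of Tor in degree
  i.\<close>

lemma Ext_ZmodI:
  "zmod_iso Cn (Ext Cn 3 (ZmodI n a) (Imod n b)) (ImodI n (gcd a b) a)"
  "zmod_iso Cn (Ext Cn 2 (ZmodI n a) (Imod n b)) zmod_zero"
  "zmod_iso Cn (Ext Cn 1 (ZmodI n a) (Imod n b)) (ZmodI n (gcd a b))"
  "zmod_iso Cn (Ext Cn 0 (ZmodI n a) (Imod n b)) zmod_zero"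
  "i < 0 \<or> i > 3 \<Longrightarrow> zmod_iso Cn (Ext Cn i (ZmodI n a) (Imod n b)) zmod_zero"
proof -
  note T = Ext_rep_iso[OF resolution_ZmodI[OF a] zmodule_ZmodI[OF a] zmodule_Imod[OF b] finite_XA[OF a] TA_in[OF a] TA_zero[OF a]]
  note simps = XA_def TA_def
  show "zmod_iso Cn (Ext Cn 3 (ZmodI n a) (Imod n b)) (ImodI n (gcd a b) a)"
    by (rule zmod_iso_trans[OF T]) (use homology_trace_cokernel in \<open>simp add: simps del: One_nat_def\<close>)
  show "zmod_iso Cn (Ext Cn 2 (ZmodI n a) (Imod n b)) zmod_zero"
    by (rule zmod_iso_trans[OF T]) (use homology_trace_kernel[of 1] in \<open>simp add: simps del: One_nat_def\<close>)
  show "zmod_iso Cn (Ext Cn 1 (ZmodI n a) (Imod n b)) (ZmodI n (gcd a b))"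
    by (rule zmod_iso_trans[OF T]) (use homology_invariants[of 1] in \<open>simp add: simps del: One_nat_def\<close>)
  show "zmod_iso Cn (Ext Cn 0 (ZmodI n a) (Imod n b)) zmod_zero"
    by (rule zmod_iso_trans[OF T]) (use homology_ones_kernel in \<open>simp add: simps del: One_nat_def\<close>)
  show "zmod_iso Cn (Ext Cn i (ZmodI n a) (Imod n b)) zmod_zero" if "i < 0 \<or> i > 3"
  proof -
    have X: "XA a i = Zc 0" using that by (auto simp: XA_def)
    show ?thesis
      using zmod_iso_trans[OF T[of i, unfolded X] homology_sh_0[OF finite_XA[OF a] finite_XA[OF a]
        TA_in[OF a, of i, unfolded X] TA_in[OF a, of "i + 1", simplified, unfolded X]]] .
  qed
qed

text \<open>Truncating the resolution lowers degrees by one, so degree 1 repeats the invariants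
  found in degree 2 for the quotient. Only degree 0, the cokernel of the difference, is a new
  computation.\<close>

lemma Tor_Imod:
  "zmod_iso Cn (Tor Cn 0 (Imod n a) (Imod n b)) (Imod n (lcm a b))"
  "zmod_iso Cn (Tor Cn 1 (Imod n a) (Imod n b)) (ZmodI n (gcd a b))"
  "i \<noteq> 0 \<Longrightarrow> i \<noteq> 1 \<Longrightarrow> zmod_iso Cn (Tor Cn i (Imod n a) (Imod n b)) zmod_zero"
proof -
  note T = Tor_rep_iso[OF resolution_Imod[OF a] zmodule_Imod[OF a] zmodule_Imod[OF b] finite_XB[OF a] TB_in[OF a] TB_zero[OF a]]
  note simps = XB_def TB_def
  show "zmod_iso Cn (Tor Cn 0 (Imod n a) (Imod n b)) (Imod n (lcm a b))"
    by (rule zmod_iso_trans[OF T]) (use homology_dif_cokernel[of "- 1"] in \<open>simp add: simps del: One_nat_def\<close>)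
  show "zmod_iso Cn (Tor Cn 1 (Imod n a) (Imod n b)) (ZmodI n (gcd a b))"
    by (rule zmod_iso_trans[OF T]) (use homology_invariants[of "- 1"] in \<open>simp add: simps del: One_nat_def\<close>)
  assume i: "i \<noteq> 0" "i \<noteq> 1"
  show "zmod_iso Cn (Tor Cn i (Imod n a) (Imod n b)) zmod_zero"
  proof (cases "i = 2")
    case True
    show ?thesis unfolding True
      by (rule zmod_iso_trans[OF T]) (use homology_ones_kernel in \<open>simp add: simps del: One_nat_def\<close>)
  next
    case False
    then have X: "XB a i = Zc 0" using i by (simp add: XB_def)
    show ?thesis
      using zmod_iso_trans[OF T[of i, unfolded X] homology_sh_0[OF finite_XB[OF a] finite_XB[OF a]
        bz_transpose_in[OF TB_in[OF a, of "i + 1", simplified, unfolded X]] bz_transpose_in[OF TB_in[OF a, of i, unfolded X]]]] .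
  qed
qed

lemma box_ZmodI: "zmod_iso Cn (box Cn (ZmodI n a) (Imod n b)) (ImodI n (gcd a b) a)"
  using zmod_iso_trans[OF zmod_iso_sym[OF Tor_0_iso_box[OF resolution_ZmodI[OF a] zmodule_ZmodI[OF a] zmodule_Imod[OF b]]] Tor_ZmodI(1)] .

lemma box_Imod: "zmod_iso Cn (box Cn (Imod n a) (Imod n b)) (Imod n (lcm a b))"
  using zmod_iso_trans[OF zmod_iso_sym[OF Tor_0_iso_box[OF resolution_Imod[OF a] zmodule_Imod[OF a] zmodule_Imod[OF b]]] Tor_Imod(1)] .

text \<open>Both sides are matched degree by degree with the same explicit module.\<close>

lemma Ext_Tor_ZmodI: "zmod_iso Cn (Ext Cn (3 - i) (ZmodI n a) (Imod n b)) (Tor Cn i (ZmodI n a) (Imod n b))"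
proof -
  consider "i = 0" | "i = 1" | "i = 2" | "i = 3" | "i < 0 \<or> i > 3" by linarith
  then show ?thesis
  proof cases
    case 1 then show ?thesis using zmod_iso_trans[OF Ext_ZmodI(1) zmod_iso_sym[OF Tor_ZmodI(1)]] by simp
  next
    case 2 then show ?thesis using zmod_iso_trans[OF Ext_ZmodI(2) zmod_iso_sym[OF Tor_ZmodI(2)]] by simp
  next
    case 3 then show ?thesis using zmod_iso_trans[OF Ext_ZmodI(3) zmod_iso_sym[OF Tor_ZmodI(3)]] by simp
  next
    case 4 then show ?thesis using zmod_iso_trans[OF Ext_ZmodI(4) zmod_iso_sym[OF Tor_ZmodI(4)]] by simp
  next
    case 5
    then have "3 - i < 0 \<or> 3 - i > 3" by linarith
    from zmod_iso_trans[OF Ext_ZmodI(5)[OF this] zmod_iso_sym[OF Tor_ZmodI(5)[OF 5]]] show ?thesis .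
  qed
qed

end

end

theorem proposition4p26:
  fixes n a b :: nat
  assumes "n \<ge> 1" and "a dvd n" and "b dvd n"
  shows
    "(\<forall>i::int.
        zmod_iso (Cyc n) (Ext (Cyc n) (3 - i) (ZmodI n a) (Imod n b))
                         (Tor (Cyc n) i (ZmodI n a) (Imod n b)) \<and>
        zmod_iso (Cyc n) (Tor (Cyc n) i (ZmodI n a) (Imod n b))
          (if i = 2 then ZmodI n (gcd a b)
           else if i = 0 then ImodI n (gcd a b) a
           else zmod_zero)) \<and>
     zmod_iso (Cyc n) (Tor (Cyc n) 1 (Imod n a) (Imod n b)) (ZmodI n (gcd a b)) \<and>
     zmod_iso (Cyc n) (Tor (Cyc n) 0 (Imod n a) (Imod n b)) (Imod n (lcm a b)) \<and>
     (\<forall>i::int. i \<noteq> 0 \<and> i \<noteq> 1 \<longrightarrow>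
        zmod_iso (Cyc n) (Tor (Cyc n) i (Imod n a) (Imod n b))
          (zmod_zero :: (int, nat \<Rightarrow> int) zmod)) \<and>
     zmod_iso (Cyc n) (box (Cyc n) (ZmodI n a) (Imod n b)) (ImodI n (gcd a b) a) \<and>
     zmod_iso (Cyc n) (box (Cyc n) (Imod n a) (Imod n b)) (Imod n (lcm a b))"
proof -
  interpret cyclic_order n using assms(1) by unfold_locales simp
  note ab = assms(2,3)
  have "zmod_iso (Cyc n) (Tor (Cyc n) i (ZmodI n a) (Imod n b))
      (if i = 2 then ZmodI n (gcd a b) else if i = 0 then ImodI n (gcd a b) a else zmod_zero)" for i
  proof -
    consider "i = 0" | "i = 1" | "i = 2" | "i = 3" | "i < 0 \<or> i > 3" by linarith
    then show ?thesis
    proof cases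
      case 5
      then have "i \<noteq> 2" "i \<noteq> 0" by auto
      then show ?thesis using Tor_ZmodI(5)[OF ab 5] by simp
    qed (simp_all add: Tor_ZmodI(1-4)[OF ab])
  qed
  moreover have "zmod_iso (Cyc n) (Tor (Cyc n) i (Imod n a) (Imod n b)) (zmod_zero :: (int, nat \<Rightarrow> int) zmod)"
    if "i \<noteq> 0" "i \<noteq> 1" for i using that by (rule Tor_Imod(3)[OF ab])
  ultimately show ?thesis
    using Ext_Tor_ZmodI[OF ab] Tor_Imod(1,2)[OF ab] box_ZmodI[OF ab] box_Imod[OF ab] by simp
qed

end
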